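(* Let $\mathcal{O}$ be the ring of integers of a number field and let $L$ be a solvable $\mathcal{O}$-Lie algebra of dimension at most $4$. Then: (1) for each $*\in\{\leq,\triangleleft\}$, $\zeta_L^{*}(s)$ is $\mathbb{F}_q$-finitely uniform; (2) if $L$ is nilpotent, then for each $*\in\{\leq,\triangleleft\}$, $\zeta_L^{*}(s)$ is $\mathbb{F}_q$-uniform; (3) $\zeta_L^{\leq}(s)$ is $\mathbb{F}_q$-uniform if and only if $\zeta_L^{\triangleleft}(s)$ is $\mathbb{F}_q$-uniform, and $\zeta_L^{\leq}(s)$ is $\mathbb{F}_q$-finitely uniform if and only if $\zeta_L^{\triangleleft}(s)$ is $\mathbb{F}_q$-finitely uniform.
   Context: An $\mathcal{O}$-Lie algebra is always assumed to be free and finitely generated as an $\mathcal{O}$-module; its dimension is its rank. For a nonzero prime ideal $\mathfrak{p}$ of $\mathcal{O}$ put $q=|\mathcal{O}/\mathfrak{p}|$ and $L(\mathcal{O}/\mathfrak{p})=L\otimes_{\mathcal{O}}\mathcal{O}/\mathfrak{p}$, a finite-dimensional Lie algebra over $\mathbb{F}_q$. For $*\in\{\leq,\triangleleft\}$ let $\zeta^{*}_{L(\mathcal{O}/\mathfrak{p})}(s)=\sum_{i\ge 0}a^{*}_{q^i}(L(\mathcal{O}/\mathfrak{p}))\,q^{-is}$, where $a^{\leq}_{q^i}$ (respectively $a^{\triangleleft}_{q^i}$) is the number of Lie subalgebras (respectively ideals) of codimension $i$ over $\mathbb{F}_q$. $\zeta_L^{*}(s)$ is called $\mathbb{F}_q$-finitely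 uniform if there exist finitely many polynomials $P_1,\dots,P_k\in\mathbb{Q}[X,Y]$ such that for every nonzero prime ideal $\mathfrak{p}$ of $\mathcal{O}$ one has $\zeta^{*}_{L(\mathcal{O}/\mathfrak{p})}(s)=P_i(q,q^{-s})$ for some $i\in\{1,\dots,k\}$, where $q=|\mathcal{O}/\mathfrak{p}|$. It is called $\mathbb{F}_q$-uniform if there is a single polynomial $P\in\mathbb{Q}[X,Y]$ with $\zeta^{*}_{L(\mathcal{O}/\mathfrak{p})}(s)=P(q,q^{-s})$ for all but finitely many nonzero prime ideals $\mathfrak{p}$. *)

theory Defs
  imports "HOL-Analysis.Complex_Transcendental" "HOL-Algebra.Algebra"
    "HOL-Computational_Algebra.Polynomial"
begin

section \<open>Number fields and their rings of integers\<close>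

definition number_field :: "'k::field_char_0 itself \<Rightarrow> bool" where
  "number_field _ \<longleftrightarrow>
     (\<exists>B :: 'k set. finite B \<and> Modules.module.span (\<lambda>(r::rat) x. of_rat r * x) B = UNIV)"

definition ring_of_integers :: "'k::field_char_0 ring" where
  "ring_of_integers =
     \<lparr>carrier = {x. algebraic_int x}, monoid.mult = (*), one = 1, ring.zero = 0, add = (+)\<rparr>"

definition nonzero_primes :: "('r, 'm) ring_scheme \<Rightarrow> 'r set set" where
  "nonzero_primes R = {I. primeideal I R \<and> I \<noteq> {\<zero>\<^bsub>R\<^esub>}}"

section \<open>Lie algebras over a commutative ring\<close>

text \<open>The library's module records extend ring records.  As for the library's modules, the
  inherited multiplication and unit fields carry no meaning here.\<close>

record ('r, 'a) lie_module = "('r, 'a) module" +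
  lie :: "'a \<Rightarrow> 'a \<Rightarrow> 'a"

locale lie_algebra = module R L
  for R :: "('r, 'm) ring_scheme" (structure) and L :: "('r, 'a, 'n) lie_module_scheme" (structure) +
  assumes lie_closed: "\<lbrakk>x \<in> carrier L; y \<in> carrier L\<rbrakk> \<Longrightarrow> lie L x y \<in> carrier L"
    and lie_add_left: "\<lbrakk>x \<in> carrier L; y \<in> carrier L; z \<in> carrier L\<rbrakk> \<Longrightarrow>
      lie L (x \<oplus>\<^bsub>L\<^esub> y) z = lie L x z \<oplus>\<^bsub>L\<^esub> lie L y z"
    and lie_add_right: "\<lbrakk>x \<in> carrier L; y \<in> carrier L; z \<in> carrier L\<rbrakk> \<Longrightarrow>
      lie L x (y \<oplus>\<^bsub>L\<^esub> z) = lie L x y \<oplus>\<^bsub>L\<^esub> lie L x z"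
    and lie_smult_left: "\<lbrakk>r \<in> carrier R; x \<in> carrier L; y \<in> carrier L\<rbrakk> \<Longrightarrow>
      lie L (r \<odot>\<^bsub>L\<^esub> x) y = r \<odot>\<^bsub>L\<^esub> lie L x y"
    and lie_smult_right: "\<lbrakk>r \<in> carrier R; x \<in> carrier L; y \<in> carrier L\<rbrakk> \<Longrightarrow>
      lie L x (r \<odot>\<^bsub>L\<^esub> y) = r \<odot>\<^bsub>L\<^esub> lie L x y"
    and lie_self: "x \<in> carrier L \<Longrightarrow> lie L x x = \<zero>\<^bsub>L\<^esub>"
    and jacobi: "\<lbrakk>x \<in> carrier L; y \<in> carrier L; z \<in> carrier L\<rbrakk> \<Longrightarrow>
      lie L x (lie L y z) \<oplus>\<^bsub>L\<^esub> lie L y (lie L z x) \<oplus>\<^bsub>L\<^esub> lie L z (lie L x y) = \<zero>\<^bsub>L\<^esub>"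

definition free_of_rank :: "('r, 'm) ring_scheme \<Rightarrow> ('r, 'a, 'n) module_scheme \<Rightarrow> nat \<Rightarrow> bool" where
  "free_of_rank R M n \<longleftrightarrow>
     (\<exists>b. b \<in> {..<n} \<rightarrow> carrier M \<and>
        (\<forall>x \<in> carrier M. \<exists>!c. c \<in> {..<n} \<rightarrow>\<^sub>E carrier R \<and>
           x = (\<Oplus>\<^bsub>M\<^esub> i \<in> {..<n}. c i \<odot>\<^bsub>M\<^esub> b i)))"

definition lie_subalgebra ::
  "('r, 'm) ring_scheme \<Rightarrow> ('r, 'a, 'n) lie_module_scheme \<Rightarrow> 'a set \<Rightarrow> bool" where
  "lie_subalgebra R L U \<longleftrightarrow> submodule U R L \<and> (\<forall>x \<in> U. \<forall>y \<in> U. lie L x y \<in> U)"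

definition lie_ideal ::
  "('r, 'm) ring_scheme \<Rightarrow> ('r, 'a, 'n) lie_module_scheme \<Rightarrow> 'a set \<Rightarrow> bool" where
  "lie_ideal R L U \<longleftrightarrow> submodule U R L \<and> (\<forall>x \<in> carrier L. \<forall>y \<in> U. lie L x y \<in> U)"

text \<open>\<open>lie_span R L A B\<close> is the submodule \<open>[A, B]\<close> generated by all brackets.\<close>

definition lie_span ::
  "('r, 'm) ring_scheme \<Rightarrow> ('r, 'a, 'n) lie_module_scheme \<Rightarrow> 'a set \<Rightarrow> 'a set \<Rightarrow> 'a set" where
  "lie_span R L A B = \<Inter>{U. submodule U R L \<and> (\<forall>x \<in> A. \<forall>y \<in> B. lie L x y \<in> U)}"

primrec derived_series ::
  "('r, 'm) ring_scheme \<Rightarrow> ('r, 'a, 'n) lie_module_scheme \<Rightarrow> nat \<Rightarrow> 'a set" where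
  "derived_series R L 0 = carrier L"
| "derived_series R L (Suc n) = lie_span R L (derived_series R L n) (derived_series R L n)"

primrec lower_central_series ::
  "('r, 'm) ring_scheme \<Rightarrow> ('r, 'a, 'n) lie_module_scheme \<Rightarrow> nat \<Rightarrow> 'a set" where
  "lower_central_series R L 0 = carrier L"
| "lower_central_series R L (Suc n) = lie_span R L (carrier L) (lower_central_series R L n)"

definition solvable_lie ::
  "('r, 'm) ring_scheme \<Rightarrow> ('r, 'a, 'n) lie_module_scheme \<Rightarrow> bool" where
  "solvable_lie R L \<longleftrightarrow> (\<exists>n. derived_series R L n = {\<zero>\<^bsub>L\<^esub>})"

definition nilpotent_lie ::
  "('r, 'm) ring_scheme \<Rightarrow> ('r, 'a, 'n) lie_module_scheme \<Rightarrow> bool" where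
  "nilpotent_lie R L \<longleftrightarrow> (\<exists>n. lower_central_series R L n = {\<zero>\<^bsub>L\<^esub>})"

section \<open>Extension of scalars\<close>

text \<open>For a ring homomorphism \<open>h\<close> from \<open>R\<close> to \<open>S\<close>, the tensor product of \<open>L\<close> and \<open>S\<close> over \<open>R\<close> is
  the free abelian group on the pairs \<open>(x, a)\<close>, standing for \<open>x \<otimes> a\<close>, modulo the subgroup
  \<open>tensor_kernel R S h L\<close> generated by the usual relations.\<close>

definition tensor_free ::
  "('s, 'm) ring_scheme \<Rightarrow> ('r, 'a, 'n) module_scheme \<Rightarrow> ('a \<times> 's \<Rightarrow>\<^sub>0 int) monoid" where
  "tensor_free S L = free_Abelian_group (carrier L \<times> carrier S)"

definition tensor_kernel ::
  "('r, 'l) ring_scheme \<Rightarrow> ('s, 'm) ring_scheme \<Rightarrow> ('r \<Rightarrow> 's) \<Rightarrow> ('r, 'a, 'n) module_scheme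
     \<Rightarrow> ('a \<times> 's \<Rightarrow>\<^sub>0 int) set" where
  "tensor_kernel R S h L = generate (tensor_free S L)
     ({frag_of (x \<oplus>\<^bsub>L\<^esub> y, a) - frag_of (x, a) - frag_of (y, a) | x y a.
         x \<in> carrier L \<and> y \<in> carrier L \<and> a \<in> carrier S}
    \<union> {frag_of (x, a \<oplus>\<^bsub>S\<^esub> b) - frag_of (x, a) - frag_of (x, b) | x a b.
         x \<in> carrier L \<and> a \<in> carrier S \<and> b \<in> carrier S}
    \<union> {frag_of (r \<odot>\<^bsub>L\<^esub> x, a) - frag_of (x, h r \<otimes>\<^bsub>S\<^esub> a) | r x a.
         r \<in> carrier R \<and> x \<in> carrier L \<and> a \<in> carrier S})"

text \<open>The \<open>S\<close>-action is \<open>s (x \<otimes> a) = x \<otimes> s a\<close> and the bracket is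
  \<open>[x \<otimes> a, y \<otimes> b] = [x, y] \<otimes> a b\<close>, both extended additively to formal sums and then to cosets
  (a union of cosets that all coincide, as in \<^const>\<open>rcoset_mult\<close>).\<close>

definition base_change ::
  "('r, 'l) ring_scheme \<Rightarrow> ('s, 'm) ring_scheme \<Rightarrow> ('r \<Rightarrow> 's) \<Rightarrow> ('r, 'a, 'n) lie_module_scheme
     \<Rightarrow> ('s, ('a \<times> 's \<Rightarrow>\<^sub>0 int) set) lie_module" where
  "base_change R S h L = (let F = tensor_free S L; N = tensor_kernel R S h L in
     \<lparr>carrier = carrier (F Mod N), monoid.mult = undefined, one = undefined,
      ring.zero = \<one>\<^bsub>F Mod N\<^esub>, add = monoid.mult (F Mod N),
      module.smult = (\<lambda>s C. \<Union>f \<in> C. N #>\<^bsub>F\<^esub> frag_extend (\<lambda>(x, a). frag_of (x, s \<otimes>\<^bsub>S\<^esub> a)) f),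
      lie = (\<lambda>C D. \<Union>f \<in> C. \<Union>g \<in> D. N #>\<^bsub>F\<^esub>
        frag_extend (\<lambda>(x, a). frag_extend (\<lambda>(y, b). frag_of (lie L x y, a \<otimes>\<^bsub>S\<^esub> b)) g) f)\<rparr>)"

definition reduction ::
  "('r, 'l) ring_scheme \<Rightarrow> 'r set \<Rightarrow> ('r, 'a, 'n) lie_module_scheme
     \<Rightarrow> ('r set, ('a \<times> 'r set \<Rightarrow>\<^sub>0 int) set) lie_module" where
  "reduction R I L = base_change R (R Quot I) (\<lambda>r. I +>\<^bsub>R\<^esub> r) L"

section \<open>Zeta functions and uniformity\<close>

datatype zeta_type = Subalgebras | Ideals

fun counted ::
  "zeta_type \<Rightarrow> ('r, 'm) ring_scheme \<Rightarrow> ('r, 'a, 'n) lie_module_scheme \<Rightarrow> 'a set \<Rightarrow> bool" where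
  "counted Subalgebras R L U = lie_subalgebra R L U"
| "counted Ideals R L U = lie_ideal R L U"

definition has_codim ::
  "('r, 'm) ring_scheme \<Rightarrow> ('r, 'a, 'n) lie_module_scheme \<Rightarrow> 'a set \<Rightarrow> nat \<Rightarrow> bool" where
  "has_codim F M U i \<longleftrightarrow>
     (\<exists>d. free_of_rank F (M\<lparr>carrier := U\<rparr>) d \<and> free_of_rank F M (d + i))"

definition num_codim ::
  "zeta_type \<Rightarrow> ('r, 'm) ring_scheme \<Rightarrow> ('r, 'a, 'n) lie_module_scheme \<Rightarrow> nat \<Rightarrow> nat" where
  "num_codim t F M i = card {U. counted t F M U \<and> has_codim F M U i}"

definition finite_zeta ::
  "zeta_type \<Rightarrow> ('r, 'm) ring_scheme \<Rightarrow> ('r, 'a, 'n) lie_module_scheme \<Rightarrow> complex \<Rightarrow> complex" where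
  "finite_zeta t F M s =
     suminf (\<lambda>i. of_nat (num_codim t F M i) *
       (of_nat (card (carrier F)) :: complex) powr (- (of_nat i * s)))"

text \<open>\<open>\<rat>[X, Y]\<close> is represented as \<open>\<rat>[X][Y]\<close>; \<open>eval2 P x y\<close> puts \<open>X = x\<close> and \<open>Y = y\<close>.\<close>

definition eval2 :: "rat poly poly \<Rightarrow> complex \<Rightarrow> complex \<Rightarrow> complex" where
  "eval2 P x y = poly (map_poly (\<lambda>c. poly (map_poly of_rat c) x) P) y"

definition zeta_given_by ::
  "zeta_type \<Rightarrow> ('r, 'm) ring_scheme \<Rightarrow> ('r, 'a, 'n) lie_module_scheme \<Rightarrow> 'r set
     \<Rightarrow> rat poly poly \<Rightarrow> bool" where
  "zeta_given_by t R L I P \<longleftrightarrow>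
     (let q = (of_nat (card (carrier (R Quot I))) :: complex)
      in \<forall>s::complex. finite_zeta t (R Quot I) (reduction R I L) s = eval2 P q (q powr (- s)))"

definition finitely_uniform ::
  "zeta_type \<Rightarrow> ('r, 'm) ring_scheme \<Rightarrow> ('r, 'a, 'n) lie_module_scheme \<Rightarrow> bool" where
  "finitely_uniform t R L \<longleftrightarrow>
     (\<exists>Ps. finite Ps \<and> (\<forall>I \<in> nonzero_primes R. \<exists>P \<in> Ps. zeta_given_by t R L I P))"

definition uniform ::
  "zeta_type \<Rightarrow> ('r, 'm) ring_scheme \<Rightarrow> ('r, 'a, 'n) lie_module_scheme \<Rightarrow> bool" where
  "uniform t R L \<longleftrightarrow>
     (\<exists>P. finite {I \<in> nonzero_primes R. \<not> zeta_given_by t R L I P})"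

end

theory Submission
  imports Defs "HOL-Library.Function_Algebras"
begin

text \<open>Outside finitely many primes \<open>I\<close> with residue field of size \<open>q\<close>, a subalgebra of the reduction is a
  lattice between \<open>I \<Lambda>\<close> and \<open>\<Lambda>\<close>, where \<open>\<Lambda>\<close> is spanned over the local ring at \<open>I\<close> by any fixed basis of
  \<open>K\<^sup>n\<close> over the number field \<open>K\<close>. Over \<open>K\<close>, a nonzero solvable Lie algebra of dimension at most four
  has an abelian ideal of codimension one, or its derived algebra is a Heisenberg algebra, or it is
  spanned by a plane \<open>V\<close>, an element acting on \<open>V\<close> as the identity and an element commuting with the
  latter. Sorting subalgebras \<open>H\<close> by their intersection with a suitable ideal of codimension one
  shows in each case that every count is an affine function of a single number \<open>\<iota>\<close>, the number of
  hyperplanes fixed by one linear map, with coefficients polynomial in \<open>q\<close>. Counting eigenvalues by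
  the dimensions of their eigenspaces leaves only finitely many polynomials in \<open>q\<close> as values of \<open>\<iota>\<close>,
  which gives finite uniformity; a nilpotent map has 0 as its only eigenvalue, so then \<open>\<iota>\<close> is one
  polynomial. Finally, either \<open>\<iota>\<close> is eventually a polynomial in \<open>q\<close>, or it occurs with nonzero slope in
  both zeta functions; since only finitely many primes have bounded norm, uniformity of either zeta
  function is then equivalent to \<open>\<iota>\<close> being eventually a polynomial in \<open>q\<close>.\<close>

section \<open>Cosets and indices of additive subgroups\<close>

text \<open>The reductions at different primes are kept in one place: all are quotients of lattices
  in the same space K^n with the same bracket, so a basis and its relations found once over K serve
  at every prime whose local ring contains the finitely many coefficients involved. Dimensions over
  the varying residue fields become indices, which are powers of q. The bound on the dimension
  enters because a proper nonzero subspace of a space of dimension at most 3 is a hyperplane or a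
  line, and a linear map T fixes as many lines as hyperplanes: T - r has kernel and cokernel of the
  same dimension for every residue r. So one number \<iota> records all invariant subspaces. The
  obstacle is that \<iota> depends on how a characteristic polynomial splits modulo the prime and
  need not be a polynomial in q; the equivalence of the two uniformities is therefore derived from
  the nonzero slopes and not from explicit zeta functions. The finitely many exceptional primes cost
  nothing: uniformity ignores them, and finite uniformity gives each of them its own polynomial,
  constant in X.\<close>

definition addgrp :: "'v::ab_group_add set => bool" where
  "addgrp N \<longleftrightarrow> 0 \<in> N \<and> (\<forall>u\<in>N. \<forall>v\<in>N. u - v \<in> N)"

definition cosets :: "'v::ab_group_add set => 'v set => 'v set set" where
  "cosets U N = (\<lambda>u. (+) u ` N) ` U"

text \<open>A cardinality, hence 0 when there are infinitely many cosets; finiteness is carried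
  separately by \<open>quot\<close>.\<close>

definition idx :: "'v::ab_group_add set => 'v set => nat" where
  "idx U N = card (cosets U N)"

lemma addgrp_minus: "addgrp N ==> u \<in> N ==> - u \<in> N"
  unfolding addgrp_def by (metis diff_0)

lemma addgrp_add: "addgrp N ==> u \<in> N ==> v \<in> N ==> u + v \<in> N"
  using addgrp_minus[of N v] unfolding addgrp_def by (metis diff_minus_eq_add)

lemma coset_eq_iff:
  assumes "addgrp N" shows "(+) u ` N = (+) v ` N \<longleftrightarrow> u - v \<in> N"
proof
  assume eq: "(+) u ` N = (+) v ` N"
  have "0 \<in> N" using assms by (simp add: addgrp_def)
  hence "u \<in> (+) v ` N" using eq by (metis add.right_neutral image_eqI)
  thus "u - v \<in> N" by auto
next
  assume d: "u - v \<in> N"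
  have "w \<in> (+) a ` N" if w: "w \<in> (+) b ` N" "b - a \<in> N" for w a b
  proof -
    obtain n where n: "n \<in> N" "w = b + n" using w by auto
    have "w = a + ((b - a) + n)" using n by simp
    moreover have "(b - a) + n \<in> N" using addgrp_add[OF assms w(2) n(1)] .
    ultimately show ?thesis by blast
  qed
  moreover have "v - u \<in> N" using addgrp_minus[OF assms d] by simp
  ultimately show "(+) u ` N = (+) v ` N" using d by blast
qed

text \<open>Sending f u to g u is well defined and injective because the two maps identify the same
  pairs. Indices are computed later by mapping U to something familiar whose fibres are the
  cosets.\<close>

lemma image_same_kernel:
  assumes "\<And>u v. u \<in> U ==> v \<in> U ==> f u = f v \<longleftrightarrow> g u = g v"
  shows "\<exists>h. bij_betw h (f ` U) (g ` U)"
proof -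
  define h where "h = (\<lambda>y. g (inv_into U f y))"
  have hf: "h (f u) = g u" if "u \<in> U" for u
  proof -
    have "inv_into U f (f u) \<in> U" "f (inv_into U f (f u)) = f u"
      using that by (auto intro: inv_into_into f_inv_into_f)
    thus ?thesis using assms that by (auto simp: h_def)
  qed
  have "bij_betw h (f ` U) (g ` U)"
    unfolding bij_betw_def inj_on_def image_image
    using hf assms by (auto simp: image_def)
  thus ?thesis by blast
qed

lemma
  assumes "\<And>u v. u \<in> U ==> v \<in> U ==> f u = f v \<longleftrightarrow> g u = g v"
  shows card_image_same_kernel: "card (f ` U) = card (g ` U)"
    and finite_image_same_kernel: "finite (f ` U) \<longleftrightarrow> finite (g ` U)"
  using image_same_kernel[of U f g, OF assms] bij_betw_same_card bij_betw_finite by blast+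

lemma
  assumes "addgrp N" "\<And>u v. u \<in> U ==> v \<in> U ==> f u = f v \<longleftrightarrow> u - v \<in> N"
  shows idx_eq_card_image: "idx U N = card (f ` U)"
    and finite_cosets_iff_image: "finite (cosets U N) \<longleftrightarrow> finite (f ` U)"
  unfolding idx_def cosets_def using assms coset_eq_iff[OF assms(1)]
  by (intro card_image_same_kernel finite_image_same_kernel; simp)+

text \<open>A representative \<open>rep u\<close> is chosen in each coset of W. The coset u + W
  together with the coset of u - \<open>rep u\<close> modulo N determines u modulo N, and all pairs
  occur.\<close>

lemma idx_tower:
  assumes "addgrp N" "addgrp W" "addgrp U" "N \<subseteq> W" "W \<subseteq> U"
  shows "idx U N = idx U W * idx W N"
proof -
  define rep where "rep u = (SOME r. r \<in> U \<and> u - r \<in> W)" for u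
  have rep: "rep u \<in> U" "u - rep u \<in> W" if "u \<in> U" for u
  proof -
    have "u - u \<in> W" using assms(2) by (simp add: addgrp_def)
    hence "\<exists>r. r \<in> U \<and> u - r \<in> W" using that by blast
    from someI_ex[OF this] show "rep u \<in> U" "u - rep u \<in> W" by (auto simp: rep_def)
  qed
  have repeq: "rep u = rep v" if "u - v \<in> W" for u v
  proof -
    \<comment> \<open>The choice operator is applied to the same predicate for u and for v, so it
      returns the same element.\<close>
    have "u - r \<in> W \<longleftrightarrow> v - r \<in> W" for r
    proof -
      have "u - r = (u - v) + (v - r)" "v - r = (u - r) - (u - v)" by simp_all
      thus ?thesis using addgrp_add[OF assms(2) that] assms(2) that unfolding addgrp_def by metis
    qed
    thus ?thesis by (simp add: rep_def)
  qed
  define f where "f u = ((+) u ` W, (+) (u - rep u) ` N)" for u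
  have "f u = f v \<longleftrightarrow> u - v \<in> N" if "u \<in> U" "v \<in> U" for u v
  proof
    assume "f u = f v"
    hence "u - v \<in> W" "(u - rep u) - (v - rep v) \<in> N"
      using coset_eq_iff[OF assms(1)] coset_eq_iff[OF assms(2)] by (auto simp: f_def)
    thus "u - v \<in> N" using repeq[of u v] by simp
  next
    assume d: "u - v \<in> N"
    hence "u - v \<in> W" using assms by auto
    thus "f u = f v" using coset_eq_iff[OF assms(1)] coset_eq_iff[OF assms(2)] d repeq[of u v]
      by (simp add: f_def)
  qed
  hence "idx U N = card (f ` U)" by (rule idx_eq_card_image[OF assms(1)])
  also have "f ` U = cosets U W \<times> cosets W N"
  proof (intro equalityI subsetI)
    fix y assume "y \<in> f ` U"
    thus "y \<in> cosets U W \<times> cosets W N" using rep by (auto simp: f_def cosets_def)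
  next
    fix y assume "y \<in> cosets U W \<times> cosets W N"
    then obtain u w where y: "u \<in> U" "w \<in> W" "y = ((+) u ` W, (+) w ` N)" by (auto simp: cosets_def)
    define u' where "u' = rep u + w"
    have "w \<in> U" using y assms by auto
    hence u': "u' \<in> U" using rep[OF y(1)] assms(3) by (simp add: u'_def addgrp_add)
    have "rep u - u \<in> W" using addgrp_minus[OF assms(2) rep(2)[OF y(1)]] by simp
    hence uu: "u' - u \<in> W" using addgrp_add[OF assms(2) _ y(2), of "rep u - u"] by (simp add: u'_def algebra_simps)
    hence "rep u' = rep u" by (rule repeq)
    hence "f u' = y" using coset_eq_iff[OF assms(2)] uu y by (simp add: f_def u'_def)
    thus "y \<in> f ` U" using u' by blast
  qed
  finally show ?thesis by (simp add: idx_def card_cartesian_product)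
qed

section \<open>Lattices over a local ring with finite residue field\<close>

text \<open>A local subring A of the field with maximal ideal M, given by subsets of the field
  rather than as rings of their own, so that modules over the local rings of all primes can be
  compared inside one vector space.\<close>

locale local_ring =
  fixes A M :: "'k::field set"
  assumes one_A: "1 \<in> A" and diff_A: "a \<in> A ==> b \<in> A ==> a - b \<in> A"
    and mult_A: "a \<in> A ==> b \<in> A ==> a * b \<in> A"
    and M_subset: "M \<subseteq> A" and addgrp_M: "addgrp M"
    and mult_M: "a \<in> A ==> m \<in> M ==> a * m \<in> M"
    and one_notin_M: "1 \<notin> M"
    and inverse_A: "a \<in> A ==> a \<notin> M ==> inverse a \<in> A"
    and finite_residues: "finite (cosets A M)"
begin

definition q :: nat where "q = idx A M"

lemma zero_A: "0 \<in> A" using diff_A[OF one_A one_A] by simp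
lemma uminus_A: "a \<in> A ==> - a \<in> A" using diff_A[OF zero_A, of a] by simp
lemma add_A: "a \<in> A ==> b \<in> A ==> a + b \<in> A" using diff_A[of a "-b"] uminus_A by simp
lemma zero_M: "0 \<in> M" using addgrp_M by (simp add: addgrp_def)
lemma uminus_M: "a \<in> M ==> - a \<in> M" using addgrp_minus[OF addgrp_M] .
lemma add_M: "a \<in> M ==> b \<in> M ==> a + b \<in> M" using addgrp_add[OF addgrp_M] .
lemma diff_M: "a \<in> M ==> b \<in> M ==> a - b \<in> M" using addgrp_M by (simp add: addgrp_def)

lemma q_ge_2: "q \<ge> 2"
proof -
  have "(+) 0 ` M \<noteq> (+) 1 ` M" using coset_eq_iff[OF addgrp_M, of 0 1] uminus_M[of "-1"] one_notin_M by auto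
  hence "card {(+) 0 ` M, (+) 1 ` M} = 2" by simp
  moreover have "{(+) 0 ` M, (+) 1 ` M} \<subseteq> cosets A M" using zero_A one_A unfolding cosets_def by blast
  ultimately show ?thesis using card_mono[OF finite_residues] by (metis q_def idx_def)
qed

end

locale lattice_space = local_ring A M + vector_space scale
  for A M :: "'k::field set" and scale :: "'k => 'v::ab_group_add => 'v" (infixr \<open>\<star>\<close> 75)
begin

text \<open>An A-submodule, without any finiteness or rank condition: those that are counted all lie
  between two fixed ones.\<close>

definition lat :: "'v set => bool" where
  "lat U \<longleftrightarrow> 0 \<in> U \<and> (\<forall>u\<in>U. \<forall>v\<in>U. u + v \<in> U) \<and> (\<forall>a\<in>A. \<forall>u\<in>U. a \<star> u \<in> U)"

text \<open>\<open>quot N U\<close> says that \<open>U / N\<close> is a finite-dimensional vector space over the residue field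
  \<open>A / M\<close>.\<close>

definition quot :: "'v set => 'v set => bool" where
  "quot N U \<longleftrightarrow> lat N \<and> lat U \<and> N \<subseteq> U \<and> (\<forall>m\<in>M. \<forall>u\<in>U. m \<star> u \<in> N) \<and> finite (cosets U N)"

text \<open>Under \<open>quot N U\<close> these are the subspaces of the residue space U / N;
  containing N replaces passing to the quotient.\<close>

definition betw :: "'v set => 'v set => 'v set set" where
  "betw N U = {W. lat W \<and> N \<subseteq> W \<and> W \<subseteq> U}"

definition adj :: "'v set => 'v => 'v set" where
  "adj W x = {w + a \<star> x | w a. w \<in> W \<and> a \<in> A}"

lemma lat_zero: "lat U ==> 0 \<in> U" by (simp add: lat_def)
lemma lat_add: "lat U ==> u \<in> U ==> v \<in> U ==> u + v \<in> U" by (simp add: lat_def)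
lemma lat_scale: "lat U ==> a \<in> A ==> u \<in> U ==> a \<star> u \<in> U" by (simp add: lat_def)
lemma lat_minus: "lat U ==> u \<in> U ==> - u \<in> U"
  using lat_scale[of U "-1" u] uminus_A[OF one_A] by simp
lemma lat_diff: "lat U ==> u \<in> U ==> v \<in> U ==> u - v \<in> U"
  using lat_add[of U u "-v"] lat_minus by simp
lemma lat_addgrp: "lat U ==> addgrp U" by (simp add: addgrp_def lat_zero lat_diff)
lemma lat_diff_iff: "lat U ==> v \<in> U ==> u - v \<in> U \<longleftrightarrow> u \<in> U"
  using lat_add[of U "u - v" v] lat_diff[of U u v] by auto
lemma lat_add_iff: "lat U ==> v \<in> U ==> u + v \<in> U \<longleftrightarrow> u \<in> U"
  using lat_diff[of U "u + v" v] lat_add[of U u v] by auto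
lemma lat_Int: "lat U ==> lat V ==> lat (U \<inter> V)" by (auto simp: lat_def)
lemma lat_sum: "lat U ==> (\<And>i. i \<in> S ==> f i \<in> U) ==> sum f S \<in> U"
  by (induction S rule: infinite_finite_induct) (auto simp: lat_zero lat_add)

lemma lat_unit_iff: "lat U ==> a \<in> A ==> a \<notin> M ==> a \<star> u \<in> U \<longleftrightarrow> u \<in> U"
proof
  assume a: "lat U" "a \<in> A" "a \<notin> M" "a \<star> u \<in> U"
  have "a \<noteq> 0" using a zero_M by auto
  hence "u = inverse a \<star> a \<star> u" by simp
  thus "u \<in> U" using lat_scale[OF a(1) inverse_A[OF a(2,3)] a(4)] by simp
qed (rule lat_scale)

lemma quotD:
  assumes "quot N U"
  shows "lat N" "lat U" "N \<subseteq> U" "\<And>m u. m \<in> M ==> u \<in> U ==> m \<star> u \<in> N" "finite (cosets U N)"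
  using assms by (auto simp: quot_def)

lemma cosets_mono: "W \<subseteq> U ==> cosets W N \<subseteq> cosets U N"
  by (auto simp: cosets_def)

lemma
  assumes "quot N U" "W \<in> betw N U"
  shows quot_lower: "quot N W" and quot_upper: "quot W U"
proof -
  have *: "lat N" "lat U" "lat W" "N \<subseteq> W" "W \<subseteq> U" "finite (cosets U N)"
    using assms by (auto simp: quot_def betw_def)
  show "quot N W" using assms * finite_subset[OF cosets_mono[OF *(5), of N]]
    by (auto simp: quot_def)
  \<comment> \<open>Each coset of N lies in one coset of W, recovered as the union of w + W over its
    members w; so the cosets of W are an image of the finitely many cosets of N.\<close>
  have "cosets U W = (\<lambda>c. \<Union>u\<in>c. (+) u ` W) ` cosets U N"
  proof -
    have "(\<Union>w\<in>(+) u ` N. (+) w ` W) = (+) u ` W" for u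
    proof -
      have "(+) w ` W = (+) u ` W" if w: "w \<in> (+) u ` N" for w
      proof -
        have "w - u \<in> W" using w *(4) by auto
        thus ?thesis using coset_eq_iff[OF lat_addgrp[OF *(3)]] by blast
      qed
      moreover have "u \<in> (+) u ` N" using lat_zero[OF *(1)] by (metis add.right_neutral image_eqI)
      ultimately show ?thesis by blast
    qed
    thus ?thesis by (simp add: cosets_def image_image)
  qed
  hence "finite (cosets U W)" using *(6) by simp
  thus "quot W U" using assms * by (auto simp: quot_def)
qed

lemma betwD: "W \<in> betw N U ==> lat W" "W \<in> betw N U ==> N \<subseteq> W" "W \<in> betw N U ==> W \<subseteq> U"
  by (simp_all add: betw_def)

lemma betw_trans: "W \<in> betw N U ==> V \<in> betw N W ==> V \<in> betw N U"
  by (auto simp: betw_def)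

lemma betw_ends: "quot N U ==> N \<in> betw N U" "quot N U ==> U \<in> betw N U"
  by (auto simp: betw_def quot_def)

text \<open>A lattice above N is the union of its cosets modulo N, so it is determined by a subset
  of the finite set \<open>cosets U N\<close>.\<close>

lemma finite_betw: assumes "quot N U" shows "finite (betw N U)"
proof (rule inj_on_finite[where f = "\<lambda>W. cosets W N" and B = "Pow (cosets U N)"])
  show "inj_on (\<lambda>W. cosets W N) (betw N U)"
  proof (rule inj_onI)
    fix W V assume *: "W \<in> betw N U" "V \<in> betw N U" "cosets W N = cosets V N"
    have "W = \<Union>(cosets W N)" if "W \<in> betw N U" for W
    proof -
      have l: "lat W" "N \<subseteq> W" "lat N" using that quotD[OF assms] by (auto simp: betw_def)
      show ?thesis
      proof (intro equalityI subsetI)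
        fix w assume "w \<in> W"
        moreover have "w = w + 0" by simp
        ultimately show "w \<in> \<Union>(cosets W N)" using lat_zero[OF l(3)] unfolding cosets_def by blast
      next
        fix w assume "w \<in> \<Union>(cosets W N)"
        thus "w \<in> W" using l by (auto simp: cosets_def intro!: lat_add)
      qed
    qed
    thus "W = V" using * by metis
  qed
  show "(\<lambda>W. cosets W N) ` betw N U \<subseteq> Pow (cosets U N)" using cosets_mono by (auto simp only: betw_def mem_Collect_eq Pow_iff image_subset_iff)
  show "finite (Pow (cosets U N))" using quotD[OF assms] by simp
qed

lemma idx_mult: "quot N U ==> W \<in> betw N U ==> idx U N = idx U W * idx W N"
  by (rule idx_tower) (auto simp: quot_def betw_def lat_addgrp)

lemma idx_pos: "quot N U ==> idx U N > 0"
  unfolding idx_def quot_def by (auto simp: card_gt_0_iff cosets_def lat_def)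

lemma idx_self: "lat N ==> idx N N = 1"
proof -
  assume l: "lat N"
  have "(+) u ` N = N" if "u \<in> N" for u
    using coset_eq_iff[OF lat_addgrp[OF l], of u 0] that by simp
  hence "cosets N N = {N}" using lat_zero[OF l] unfolding cosets_def by (metis (no_types, lifting) empty_iff image_constant image_cong)
  thus ?thesis by (simp add: idx_def)
qed

lemma idx_eq_1_iff: assumes "quot N U" shows "idx U N = 1 \<longleftrightarrow> U = N"
proof
  assume "idx U N = 1"
  then obtain c where c: "cosets U N = {c}" by (auto simp: idx_def card_1_singleton_iff)
  have "u \<in> N" if "u \<in> U" for u
  proof -
    have "(+) u ` N = (+) 0 ` N" using c that lat_zero[of U] quotD[OF assms] unfolding cosets_def by (metis image_eqI singletonD)
    thus ?thesis using coset_eq_iff[OF lat_addgrp, of N u 0] quotD[OF assms] by simp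
  qed
  thus "U = N" using quotD[OF assms] by auto
qed (use idx_self quotD[OF assms] in auto)

lemma adjI: "w \<in> W ==> a \<in> A ==> w + a \<star> x \<in> adj W x" by (auto simp: adj_def)

lemma
  assumes "lat W" shows lat_adj: "lat (adj W x)" and subset_adj: "W \<subseteq> adj W x" and mem_adj: "x \<in> adj W x"
proof -
  show s: "W \<subseteq> adj W x"
  proof
    fix w assume "w \<in> W"
    thus "w \<in> adj W x" using adjI[of w W 0 x] zero_A by simp
  qed
  show "x \<in> adj W x" using adjI[of 0 W 1 x] lat_zero[OF assms] one_A by simp
  show "lat (adj W x)" unfolding lat_def
  proof (intro conjI ballI)
    show "0 \<in> adj W x" using s lat_zero[OF assms] by auto
  next
    fix u v assume "u \<in> adj W x" "v \<in> adj W x"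
    then obtain w a w' a' where *: "w \<in> W" "a \<in> A" "w' \<in> W" "a' \<in> A" "u = w + a \<star> x" "v = w' + a' \<star> x"
      by (auto simp: adj_def)
    have "u + v = (w + w') + (a + a') \<star> x" using * by (simp add: algebra_simps)
    thus "u + v \<in> adj W x" using adjI[of "w + w'" W "a + a'" x] lat_add[OF assms] * add_A by metis
  next
    fix b u assume "b \<in> A" "u \<in> adj W x"
    then obtain w a where *: "b \<in> A" "w \<in> W" "a \<in> A" "u = w + a \<star> x" by (auto simp: adj_def)
    have "b \<star> u = b \<star> w + (b * a) \<star> x" using * by (simp add: algebra_simps)
    thus "b \<star> u \<in> adj W x" using adjI[of "b \<star> w" W "b * a" x] lat_scale[OF assms] * mult_A by metis
  qed
qed

lemma adj_subset: "lat U ==> W \<subseteq> U ==> x \<in> U ==> adj W x \<subseteq> U"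
  by (auto simp: adj_def intro!: lat_add lat_scale)

text \<open>The class of a x modulo W depends only on a modulo M, and faithfully so: if a unit
  multiple of x were in W, then x would be as well. Hence A / M parametrises the new cosets.\<close>

lemma
  assumes "lat W" "x \<notin> W" "\<And>m. m \<in> M ==> m \<star> x \<in> W"
  shows idx_adj: "idx (adj W x) W = q"
    and adj_coeff: "\<And>a. a \<in> A ==> a \<star> x \<in> W \<longleftrightarrow> a \<in> M"
proof -
  show c: "a \<star> x \<in> W \<longleftrightarrow> a \<in> M" if "a \<in> A" for a
    using lat_unit_iff[OF assms(1) that] assms by blast
  have 1: "((+) (a \<star> x) ` W = (+) (b \<star> x) ` W) \<longleftrightarrow> a - b \<in> M" if "a \<in> A" "b \<in> A" for a b
    using coset_eq_iff[OF lat_addgrp[OF assms(1)]] c[OF diff_A[OF that]] by (simp add: scale_left_diff_distrib)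
  have im: "(\<lambda>a. (+) (a \<star> x) ` W) ` A = cosets (adj W x) W"
  proof (intro equalityI subsetI)
    fix y assume "y \<in> (\<lambda>a. (+) (a \<star> x) ` W) ` A"
    then obtain a where "a \<in> A" "y = (+) (a \<star> x) ` W" by auto
    thus "y \<in> cosets (adj W x) W" using adjI[of 0 W a x] lat_zero[OF assms(1)] by (auto simp: cosets_def)
  next
    fix y assume "y \<in> cosets (adj W x) W"
    then obtain w a where *: "w \<in> W" "a \<in> A" "y = (+) (w + a \<star> x) ` W" by (auto simp: cosets_def adj_def)
    have "y = (+) (a \<star> x) ` W" using coset_eq_iff[OF lat_addgrp[OF assms(1)], of "w + a \<star> x" "a \<star> x"] * by simp
    thus "y \<in> (\<lambda>a. (+) (a \<star> x) ` W) ` A" using * by blast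
  qed
  show "idx (adj W x) W = q"
    using idx_eq_card_image[OF addgrp_M 1] im by (simp add: q_def idx_def)
qed

text \<open>Replacing N by N + A x for some x outside N divides the index by q, so induction on the
  index ends at 1.\<close>

lemma idx_power: "quot N U ==> \<exists>e. idx U N = q ^ e"
proof (induction "idx U N" arbitrary: N rule: less_induct)
  case less
  show ?case
  proof (cases "U = N")
    case True
    thus ?thesis using idx_eq_1_iff[OF less(2)] by (intro exI[of _ 0]) simp
  next
    case False
    then obtain x where x: "x \<in> U" "x \<notin> N" using quotD[OF less(2)] by auto
    have "adj N x \<in> betw N U" using x quotD[OF less(2)] adj_subset lat_adj subset_adj by (auto simp: betw_def)
    hence m: "idx U N = idx U (adj N x) * idx (adj N x) N" "quot (adj N x) U"
      using idx_mult less quot_upper by blast+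
    have i: "idx (adj N x) N = q" by (rule idx_adj) (use x quotD[OF less(2)] in auto)
    have "idx U (adj N x) < idx U N" using m i q_ge_2 idx_pos[OF m(2)] by simp
    then obtain e where "idx U (adj N x) = q ^ e" using less(1) m(2) by blast
    thus ?thesis using m i by (intro exI[of _ "Suc e"]) simp
  qed
qed

lemma q_power_eq_iff [simp]: "q ^ a = q ^ b \<longleftrightarrow> a = b"
  using q_ge_2 by simp

lemma betw_eq_if_idx:
  assumes "quot N U" "W \<in> betw N U" "V \<in> betw N W" "idx U W = idx U V" shows "V = W"
proof -
  have "V \<in> betw N U" using betw_trans[OF assms(2,3)] .
  hence "quot V U" "W \<in> betw V U" using quot_upper[OF assms(1)] assms(2,3) by (simp_all add: betw_def)
  hence "idx U V = idx U W * idx W V" "quot V W" "quot W U" using idx_mult quot_lower quot_upper by blast+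
  thus ?thesis using assms idx_eq_1_iff[of V W] idx_pos[of W U] by simp
qed

end

text \<open>Gaussian binomial coefficients: the number of subspaces of codimension i in a space of
  dimension e over a field with q elements. The recursion comes from sorting subspaces by whether
  they lie in a fixed hyperplane: if so, the codimension there is i - 1; if not, each subspace of
  codimension i in the hyperplane is the trace of q^i of them.\<close>

fun gb :: "nat => nat => nat => nat" where
  "gb q 0 i = (if i = 0 then 1 else 0)"
| "gb q (Suc e) i = (if i = 0 then 0 else gb q e (i - 1)) + q ^ i * gb q e i"

lemma gb_0 [simp]: "gb q e 0 = 1" by (induction e) auto
lemma gb_eq_0: "i > e ==> gb q e i = 0" by (induction e arbitrary: i) auto
lemma gb_self [simp]: "gb q e e = 1" by (induction e) (auto simp: gb_eq_0)
lemma gb_1: "gb q e 1 = (\<Sum>j<e. q ^ j)"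
  by (induction e) (simp_all add: sum.lessThan_Suc_shift sum_distrib_left del: sum.lessThan_Suc)
text \<open>Lines and hyperplanes are equally many: both sides are 1 + q + ... + q^e.\<close>

lemma gb_corank_1: "gb q (Suc e) e = gb q (Suc e) 1"
proof (induction e)
  case (Suc e)
  have "gb q (Suc (Suc e)) (Suc e) = gb q (Suc e) e + q ^ Suc e" by (simp only: gb.simps(2)[of q "Suc e" "Suc e"] gb_self) simp
  thus ?case using Suc gb_1[of q "Suc e"] gb_1[of q "Suc (Suc e)"] by (simp only: sum.lessThan_Suc)
qed simp

context local_ring
begin

text \<open>Representatives in A stand in for residue classes, so that eigenvalues modulo M are
  scalars that act on the lattice itself.\<close>

lemma residue_system:
  obtains R where "R \<subseteq> A" "finite R" "\<And>a. a \<in> A ==> \<exists>r\<in>R. a - r \<in> M"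
    "\<And>r s. r \<in> R ==> s \<in> R ==> r - s \<in> M ==> r = s"
proof -
  define rep where "rep c = (SOME a. a \<in> A \<and> (+) a ` M = c)" for c
  have rep: "rep c \<in> A" "(+) (rep c) ` M = c" if "c \<in> cosets A M" for c
    using someI_ex[of "\<lambda>a. a \<in> A \<and> (+) a ` M = c"] that by (auto simp: rep_def cosets_def)
  show ?thesis
  proof (rule that[of "rep ` cosets A M"])
    fix a assume a: "a \<in> A"
    hence c: "(+) a ` M \<in> cosets A M" by (auto simp: cosets_def)
    hence "a - rep ((+) a ` M) \<in> M" using rep(2) coset_eq_iff[OF addgrp_M] by metis
    thus "\<exists>r\<in>rep ` cosets A M. a - r \<in> M" using c by blast
  next
    fix r s assume "r \<in> rep ` cosets A M" "s \<in> rep ` cosets A M" "r - s \<in> M"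
    thus "r = s" using rep(2) coset_eq_iff[OF addgrp_M] by (metis imageE)
  qed (use rep finite_residues in auto)
qed

end

section \<open>Counting lattices by their intersection with a hyperplane\<close>

context lattice_space
begin

text \<open>V is maximal among the finitely many lattices above N that avoid x. For u outside V,
  maximality puts x into V + A u; the coefficient of u is a unit, since M u lies in N, so u can be
  solved for.\<close>

lemma hyperplane_exists:
  assumes "quot N U" "x \<in> U" "x \<notin> N"
  obtains V where "V \<in> betw N U" "x \<notin> V" "U = adj V x"
proof -
  have fin: "finite {V \<in> betw N U. x \<notin> V}" using finite_betw[OF assms(1)] by simp
  have "N \<in> {V \<in> betw N U. x \<notin> V}" using assms betw_ends by auto
  then obtain V where V: "V \<in> betw N U" "x \<notin> V" and mx: "\<And>W. W \<in> betw N U ==> x \<notin> W ==> V \<subseteq> W ==> W = V"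
    using finite_has_maximal2[OF fin] by (metis (mono_tags, lifting) mem_Collect_eq)
  have l: "lat V" "lat U" "N \<subseteq> V" "V \<subseteq> U" using V assms quotD by (auto simp: betw_def)
  have "u \<in> adj V x" if u: "u \<in> U" for u
  proof (cases "u \<in> V")
    case True thus ?thesis using subset_adj[OF l(1)] by auto
  next
    case False
    have "adj V u \<in> betw N U" using lat_adj[OF l(1), of u] subset_trans[OF l(3) subset_adj[OF l(1), of u]] adj_subset[OF l(2,4) u] by (simp add: betw_def)
    moreover have "adj V u \<noteq> V" using mem_adj[OF l(1), of u] False by blast
    ultimately have "x \<in> adj V u" using mx[of "adj V u"] subset_adj[OF l(1)] by blast
    then obtain v a where v: "v \<in> V" "a \<in> A" "x = v + a \<star> u" by (auto simp: adj_def)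
    have aM: "a \<notin> M" using v V quotD(4)[OF assms(1) _ u, of a] l lat_add[OF l(1)] by auto
    have "a \<star> u \<in> adj V x" using v lat_diff[OF lat_adj[OF l(1)], of x x v] mem_adj[OF l(1), of x] subset_adj[OF l(1), of x]
      by (simp add: subset_iff)
    thus ?thesis using lat_unit_iff[OF lat_adj[OF l(1)] v(2) aM] by simp
  qed
  moreover have "adj V x \<subseteq> U" using adj_subset[OF l(2,4) assms(2)] .
  ultimately show ?thesis using that V by blast
qed

context
  fixes N U V x
  assumes NU: "quot N U" and V: "V \<in> betw N U" and x: "x \<notin> V" and U: "U = adj V x"
begin

lemma complement_facts:
  shows "lat N" "lat V" "lat U" "N \<subseteq> V" "V \<subseteq> U" "x \<in> U" "quot N V" "idx U V = q"
    "\<And>m. m \<in> M ==> m \<star> x \<in> N"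
proof -
  show l: "lat N" "lat V" "lat U" "N \<subseteq> V" "V \<subseteq> U" using NU V by (auto simp: quot_def betw_def)
  show xU: "x \<in> U" using U mem_adj[OF l(2)] by simp
  show "quot N V" using quot_lower[OF NU V] .
  show m: "\<And>m. m \<in> M ==> m \<star> x \<in> N" using quotD(4)[OF NU _ xU] .
  show "idx U V = q" using idx_adj[OF l(2) x] m l U by auto
qed

text \<open>Since x + v is not in V, an element w + a (x + v) lies in V only for a in M, and then a
  (x + v) is already in N; so the trace on V is no larger than W. Comparing the towers through W and
  through V gives equal codimensions.\<close>

lemma complement_adj:
  assumes "W \<in> betw N V" "v \<in> V"
  shows "adj W (x + v) \<in> betw N U" "adj W (x + v) \<inter> V = W" "\<not> adj W (x + v) \<subseteq> V"
    "idx U (adj W (x + v)) = idx V W"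
proof -
  note f = complement_facts
  have W: "lat W" "N \<subseteq> W" "W \<subseteq> V" using assms by (auto simp: betw_def)
  have xv: "x + v \<in> U" using f assms by (auto intro: lat_add)
  show b: "adj W (x + v) \<in> betw N U"
    using lat_adj[OF W(1)] subset_adj[OF W(1), of "x + v"] adj_subset[OF f(3) _ xv, of W] W f by (auto simp: betw_def)
  have xvV: "x + v \<notin> V" using lat_add_iff[OF f(2) assms(2)] x by simp
  thus "\<not> adj W (x + v) \<subseteq> V" using mem_adj[OF W(1), of "x + v"] by blast
  have mx: "m \<star> (x + v) \<in> N" if "m \<in> M" for m using quotD(4)[OF NU that xv] .
  show "adj W (x + v) \<inter> V = W"
  proof (intro equalityI subsetI)
    fix h assume h: "h \<in> adj W (x + v) \<inter> V"
    then obtain w a where *: "w \<in> W" "a \<in> A" "h = w + a \<star> (x + v)" by (auto simp: adj_def)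
    have "a \<star> (x + v) \<in> V" using h * lat_add_iff[OF f(2), of w "a \<star> (x + v)"] W by (auto simp: add.commute)
    hence "a \<in> M" using adj_coeff[OF f(2) xvV _ *(2)] mx f by auto
    thus "h \<in> W" using * mx W by (auto intro!: lat_add)
  qed (use W subset_adj[OF W(1), of "x + v"] in auto)
  have "idx (adj W (x + v)) W = q" using idx_adj[OF W(1), of "x + v"] mx xvV W by auto
  hence "idx (adj W (x + v)) N = q * idx W N"
    using idx_mult[OF quot_lower[OF NU b], of W] W subset_adj[OF W(1), of "x + v"] by (auto simp: betw_def)
  hence "idx U (adj W (x + v)) * (q * idx W N) = q * (idx V W * idx W N)"
    using idx_mult[OF NU b] idx_mult[OF NU V] idx_mult[OF f(7) assms(1)] f(8) by (metis mult.commute)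
  thus "idx U (adj W (x + v)) = idx V W"
    using q_ge_2 idx_pos[OF quot_lower[OF f(7) assms(1)]] by simp
qed

text \<open>An element of H outside V has a coefficient of x outside M; dividing by that unit yields
  some x + v' in H, and every element of H differs from a multiple of it by an element of V.\<close>

lemma complement_adj_exhaust:
  assumes "H \<in> betw N U" "\<not> H \<subseteq> V"
  shows "\<exists>v\<in>V. H = adj (H \<inter> V) (x + v)" "H \<inter> V \<in> betw N V"
proof -
  note f = complement_facts
  have H: "lat H" "N \<subseteq> H" "H \<subseteq> U" using assms by (auto simp: betw_def)
  show b: "H \<inter> V \<in> betw N V" using H f by (auto simp: betw_def lat_Int)
  obtain h where h: "h \<in> H" "h \<notin> V" using assms by blast
  then obtain v a where *: "v \<in> V" "a \<in> A" "h = v + a \<star> x" using H U by (auto simp: adj_def)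
  have aM: "a \<notin> M" using h * f lat_add[OF f(2)] by blast
  have a0: "a \<noteq> 0" using aM zero_M by auto
  have ia: "inverse a \<in> A" using inverse_A * aM by auto
  define v' where "v' = inverse a \<star> v"
  have v': "v' \<in> V" using * ia f lat_scale by (auto simp: v'_def)
  have "inverse a \<star> h = x + v'" using * a0 by (simp add: v'_def algebra_simps)
  hence xv: "x + v' \<in> H" using lat_scale[OF H(1) ia h(1)] by simp
  have "H = adj (H \<inter> V) (x + v')"
  proof (intro equalityI subsetI)
    fix g assume g: "g \<in> H"
    then obtain w b where **: "w \<in> V" "b \<in> A" "g = w + b \<star> x" using H U by (auto simp: adj_def)
    have "g = (w - b \<star> v') + b \<star> (x + v')" using ** by (simp add: algebra_simps)
    moreover have "w - b \<star> v' \<in> V" using ** v' f by (auto intro!: lat_diff lat_scale)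
    moreover have "w - b \<star> v' \<in> H"
    proof -
      have "w - b \<star> v' = g - b \<star> (x + v')" using ** by (simp add: algebra_simps)
      thus ?thesis using lat_diff[OF H(1) g lat_scale[OF H(1) **(2) xv]] by simp
    qed
    ultimately show "g \<in> adj (H \<inter> V) (x + v')" using adjI ** by (metis IntI)
  next
    fix g assume "g \<in> adj (H \<inter> V) (x + v')"
    thus "g \<in> H" using adj_subset[OF H(1), of "H \<inter> V" "x + v'"] xv by auto
  qed
  thus "\<exists>v\<in>V. H = adj (H \<inter> V) (x + v)" using v' by blast
qed

text \<open>The difference of x + v and x + v' lies in V. Hence the lattices that are not inside V
  and have a given trace W on V are parametrised by V / W.\<close>

lemma complement_adj_eq_iff:
  assumes "W \<in> betw N V" "v \<in> V" "v' \<in> V"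
  shows "adj W (x + v) = adj W (x + v') \<longleftrightarrow> v - v' \<in> W"
proof
  have W: "lat W" "N \<subseteq> W" "W \<subseteq> V" using assms by (auto simp: betw_def)
  { assume "adj W (x + v) = adj W (x + v')"
    hence "(x + v) - (x + v') \<in> adj W (x + v')"
      using lat_diff[OF lat_adj[OF W(1)]] mem_adj[OF W(1)] by metis
    moreover have "(x + v) - (x + v') = v - v'" by simp
    moreover have "v - v' \<in> V" using assms complement_facts lat_diff by blast
    ultimately show "v - v' \<in> W" using complement_adj(2)[OF assms(1,3)] by auto }
  { have *: "adj W (x + a) \<subseteq> adj W (x + b)" if "a - b \<in> W" for a b
    proof (rule adj_subset[OF lat_adj[OF W(1)] subset_adj[OF W(1)]])
      have "x + a = (a - b) + 1 \<star> (x + b)" by simp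
      thus "x + a \<in> adj W (x + b)" using adjI[OF that one_A] by metis
    qed
    assume "v - v' \<in> W"
    moreover from this have "v' - v \<in> W" using lat_minus[OF W(1)] by fastforce
    ultimately show "adj W (x + v) = adj W (x + v')" using * by blast }
qed

text \<open>Lattices not inside V are fibred over their trace W. All v in one coset c of W give the
  same lattice, so the existential quantifier over c only expresses that P holds of that
  lattice.\<close>

lemma count_not_below:
  "card {H \<in> betw N U. idx U H = q ^ i \<and> \<not> H \<subseteq> V \<and> P H} =
     (\<Sum>W\<in>{W \<in> betw N V. idx V W = q ^ i}. card {c \<in> cosets V W. \<exists>v\<in>c. P (adj W (x + v))})"
    (is "card ?L = (\<Sum>W\<in>?S. ?f W)")
proof -
  note f = complement_facts
  have L: "?L = (\<Union>W\<in>?S. {H \<in> ?L. H \<inter> V = W})"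
  proof (intro equalityI subsetI)
    fix H assume H: "H \<in> ?L"
    then obtain v where v: "v \<in> V" "H = adj (H \<inter> V) (x + v)" "H \<inter> V \<in> betw N V"
      using complement_adj_exhaust[of H] by auto
    have "idx V (H \<inter> V) = idx U H" using complement_adj(4)[OF v(3,1)] v(2) by simp
    thus "H \<in> (\<Union>W\<in>?S. {H \<in> ?L. H \<inter> V = W})" using v H by auto
  qed auto
  have "card (\<Union>W\<in>?S. {H \<in> ?L. H \<inter> V = W}) = (\<Sum>W\<in>?S. card {H \<in> ?L. H \<inter> V = W})"
    by (rule card_UN_disjoint) (use finite_betw[OF f(7)] finite_betw[OF NU] in auto)
  also have "\<dots> = (\<Sum>W\<in>?S. ?f W)"
  proof (rule sum.cong[OF refl])
    fix W assume W: "W \<in> ?S"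
    hence Wb: "W \<in> betw N V" by simp
    have Wl: "lat W" "W \<subseteq> V" using Wb by (auto simp: betw_def)
    let ?X = "{v \<in> V. P (adj W (x + v))}"
    have "{H \<in> ?L. H \<inter> V = W} = (\<lambda>v. adj W (x + v)) ` ?X"
    proof (intro equalityI subsetI)
      fix H assume "H \<in> {H \<in> ?L. H \<inter> V = W}"
      thus "H \<in> (\<lambda>v. adj W (x + v)) ` ?X" using complement_adj_exhaust[of H] by auto
    next
      fix H assume "H \<in> (\<lambda>v. adj W (x + v)) ` ?X"
      then obtain v where v: "v \<in> V" "P (adj W (x + v))" "H = adj W (x + v)" by auto
      thus "H \<in> {H \<in> ?L. H \<inter> V = W}" using complement_adj[OF Wb v(1)] W by auto
    qed
    moreover have "{c \<in> cosets V W. \<exists>v\<in>c. P (adj W (x + v))} = (\<lambda>v. (+) v ` W) ` ?X"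
    proof (intro equalityI subsetI)
      fix c assume "c \<in> {c \<in> cosets V W. \<exists>v\<in>c. P (adj W (x + v))}"
      then obtain u v where uv: "u \<in> V" "c = (+) u ` W" "v \<in> c" "P (adj W (x + v))" by (auto simp: cosets_def)
      then obtain w where w: "w \<in> W" "v = u + w" by auto
      hence "v \<in> V" using uv Wl f lat_add by blast
      moreover have "(+) v ` W = c" using coset_eq_iff[OF lat_addgrp[OF Wl(1)]] w uv by simp
      ultimately show "c \<in> (\<lambda>v. (+) v ` W) ` ?X" using uv by blast
    next
      fix c assume "c \<in> (\<lambda>v. (+) v ` W) ` ?X"
      then obtain v where v: "v \<in> V" "P (adj W (x + v))" "c = (+) v ` W" by auto
      have "v \<in> c" using v lat_zero[OF Wl(1)] by (metis add.right_neutral image_eqI)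
      moreover have "c \<in> cosets V W" using v by (auto simp: cosets_def)
      ultimately show "c \<in> {c \<in> cosets V W. \<exists>v\<in>c. P (adj W (x + v))}" using v by blast
    qed
    moreover have "card ((\<lambda>v. adj W (x + v)) ` ?X) = card ((\<lambda>v. (+) v ` W) ` ?X)"
    proof (rule card_image_same_kernel)
      fix u v assume "u \<in> ?X" "v \<in> ?X"
      hence "u \<in> V" "v \<in> V" by simp_all
      thus "adj W (x + u) = adj W (x + v) \<longleftrightarrow> (+) u ` W = (+) v ` W"
        using complement_adj_eq_iff[OF Wb] coset_eq_iff[OF lat_addgrp[OF Wl(1)]] by metis
    qed
    ultimately show "card {H \<in> ?L. H \<inter> V = W} = ?f W" by simp
  qed
  finally show ?thesis using arg_cong[OF L, of card] by (rule trans[rotated])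
qed

lemma count_below:
  "card {H \<in> betw N U. idx U H = q ^ i \<and> H \<subseteq> V \<and> P H} =
     (if i = 0 then 0 else card {H \<in> betw N V. idx V H = q ^ (i - 1) \<and> P H})"
proof -
  note f = complement_facts
  have *: "idx U H = q * idx V H" if "H \<in> betw N V" for H
  proof -
    have "quot H U" "V \<in> betw H U" using that quot_upper[OF NU] betw_trans[OF V that] V by (auto simp: betw_def)
    thus ?thesis using idx_mult[of H U V] f by simp
  qed
  have eq: "{H \<in> betw N U. idx U H = q ^ i \<and> H \<subseteq> V \<and> P H} = {H \<in> betw N V. q * idx V H = q ^ i \<and> P H}"
  proof -
    have "H \<in> betw N U \<and> H \<subseteq> V \<longleftrightarrow> H \<in> betw N V" for H
      using V by (auto simp: betw_def)
    thus ?thesis using * by (intro Collect_cong) metis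
  qed
  show ?thesis
  proof (cases i)
    case 0
    have "q * n \<noteq> q ^ 0" for n using q_ge_2 by auto
    hence "{H \<in> betw N V. q * idx V H = q ^ 0 \<and> P H} = {}" by blast
    thus ?thesis using 0 eq by (simp only: card.empty if_True simp_thms)
  next
    case (Suc j)
    thus ?thesis using eq q_ge_2 by simp
  qed
qed

lemma count_split:
  "card {H \<in> betw N U. idx U H = q ^ i \<and> P H} =
     (if i = 0 then 0 else card {H \<in> betw N V. idx V H = q ^ (i - 1) \<and> P H}) +
     (\<Sum>W\<in>{W \<in> betw N V. idx V W = q ^ i}. card {c \<in> cosets V W. \<exists>v\<in>c. P (adj W (x + v))})"
proof -
  have 1: "{H \<in> betw N U. idx U H = q ^ i \<and> P H} = {H \<in> betw N U. idx U H = q ^ i \<and> H \<subseteq> V \<and> P H} \<union>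
    {H \<in> betw N U. idx U H = q ^ i \<and> \<not> H \<subseteq> V \<and> P H}" by auto
  have "card ({H \<in> betw N U. idx U H = q ^ i \<and> H \<subseteq> V \<and> P H} \<union>
    {H \<in> betw N U. idx U H = q ^ i \<and> \<not> H \<subseteq> V \<and> P H}) = card {H \<in> betw N U. idx U H = q ^ i \<and> H \<subseteq> V \<and> P H} +
    card {H \<in> betw N U. idx U H = q ^ i \<and> \<not> H \<subseteq> V \<and> P H}"
    by (rule card_Un_disjoint) (use finite_betw[OF NU] in auto)
  thus ?thesis unfolding 1 count_below count_not_below .
qed

text \<open>When P depends on the trace alone, each admissible W contributes its whole fibre V / W
  of q^i lattices. For the constantly true P this is the recursion of \<open>gb\<close>.\<close>

lemma count_split_const:
  assumes "\<And>W v. W \<in> betw N V ==> idx V W = q ^ i ==> v \<in> V ==> P (adj W (x + v)) \<longleftrightarrow> Q W"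
  shows "card {H \<in> betw N U. idx U H = q ^ i \<and> P H} =
     (if i = 0 then 0 else card {H \<in> betw N V. idx V H = q ^ (i - 1) \<and> P H}) +
     q ^ i * card {W \<in> betw N V. idx V W = q ^ i \<and> Q W}"
proof -
  note f = complement_facts
  have fin: "finite {W \<in> betw N V. idx V W = q ^ i}" using finite_betw[OF f(7)] by simp
  have "(\<Sum>W\<in>{W \<in> betw N V. idx V W = q ^ i}. card {c \<in> cosets V W. \<exists>v\<in>c. P (adj W (x + v))}) =
    (\<Sum>W\<in>{W \<in> betw N V. idx V W = q ^ i}. if Q W then q ^ i else 0)"
  proof (rule sum.cong[OF refl])
    fix W assume W: "W \<in> {W \<in> betw N V. idx V W = q ^ i}"
    have "c \<subseteq> V" "c \<noteq> {}" if "c \<in> cosets V W" for c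
      using that W lat_add[OF f(2)] lat_zero[of W] by (auto simp: cosets_def betw_def)
    hence "(\<exists>v\<in>c. P (adj W (x + v))) \<longleftrightarrow> Q W" if "c \<in> cosets V W" for c
      using assms[of W] W that by blast
    hence "{c \<in> cosets V W. \<exists>v\<in>c. P (adj W (x + v))} = (if Q W then cosets V W else {})" by auto
    thus "card {c \<in> cosets V W. \<exists>v\<in>c. P (adj W (x + v))} = (if Q W then q ^ i else 0)"
      using W by (simp add: idx_def)
  qed
  also have "\<dots> = q ^ i * card {W \<in> betw N V. idx V W = q ^ i \<and> Q W}"
    using fin by (simp add: sum.If_cases Int_def conj_assoc)
  finally show ?thesis using count_split[of i P] by simp
qed

end

lemma card_betw:
  assumes "quot N U" "idx U N = q ^ e"
  shows "card {H \<in> betw N U. idx U H = q ^ i} = gb q e i"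
  using assms
proof (induction e arbitrary: U i)
  case 0
  hence "U = N" using idx_eq_1_iff by simp
  hence "betw N U = {N}" "idx U N = 1" using quotD[OF 0(1)] idx_self by (auto simp: betw_def)
  moreover have "{H. H = N \<and> Suc 0 = q ^ i} = (if i = 0 then {N} else {})"
    using q_power_eq_iff[of 0 i] by auto
  ultimately show ?case using \<open>U = N\<close> by (simp cong: conj_cong)
next
  case (Suc e)
  have "U \<noteq> N" using idx_eq_1_iff[OF Suc(2)] Suc(3) q_ge_2 by auto
  then obtain x where x: "x \<in> U" "x \<notin> N" using quotD[OF Suc(2)] by auto
  obtain V where V: "V \<in> betw N U" "x \<notin> V" "U = adj V x" using hyperplane_exists[OF Suc(2) x] .
  note f = complement_facts[OF Suc(2) V]
  have "idx V N = q ^ e" using idx_mult[OF Suc(2) V(1)] f(8) Suc(3) q_ge_2 by simp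
  thus ?case using count_split_const[OF Suc(2) V, of i "\<lambda>_. True" "\<lambda>_. True"] Suc(1)[OF f(7)] by simp
qed

lemma idx_le_power:
  assumes "quot N U" "idx U N = q ^ e" "W \<in> betw N U"
  obtains i where "i \<le> e" "idx U W = q ^ i" "idx W N = q ^ (e - i)"
proof -
  obtain i j where ij: "idx U W = q ^ i" "idx W N = q ^ j"
    using idx_power[OF quot_upper[OF assms(1,3)]] idx_power[OF quot_lower[OF assms(1,3)]] by auto
  hence "e = i + j" using idx_mult[OF assms(1,3)] assms(2) by (simp flip: power_add)
  thus ?thesis using that[of i] ij by simp
qed

lemma idx_upper_iff:
  assumes "quot N U" "idx U N = q ^ e" "W \<in> betw N U" "i \<le> e"
  shows "idx U W = q ^ i \<longleftrightarrow> idx W N = q ^ (e - i)"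
proof -
  obtain j where "j \<le> e" "idx U W = q ^ j" "idx W N = q ^ (e - j)" using idx_le_power[OF assms(1-3)] .
  thus ?thesis using assms(4) by auto
qed

lemma card_lines:
  assumes "quot N U" "idx U N = q ^ e"
  shows "card {H \<in> betw N U. idx H N = q} = gb q e 1"
proof (cases e)
  case 0
  hence "idx H N \<noteq> q" if "H \<in> betw N U" for H
    using idx_mult[OF assms(1) that] assms(2) q_ge_2 by auto
  hence "{H \<in> betw N U. idx H N = q} = {}" by blast
  hence "card {H \<in> betw N U. idx H N = q} = 0" by (simp only: card.empty)
  thus ?thesis using 0 by simp
next
  case (Suc n)
  have "{H \<in> betw N U. idx H N = q} = {H \<in> betw N U. idx U H = q ^ n}"
    using idx_upper_iff[OF assms, of _ n] Suc by auto
  thus ?thesis using card_betw[OF assms, of n] gb_corank_1[of q n] Suc by simp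
qed

section \<open>Invariant subspaces of a single linear map\<close>

definition lin :: "('v => 'v) => bool" where
  "lin T \<longleftrightarrow> (\<forall>u v. T (u + v) = T u + T v) \<and> (\<forall>a u. T (a \<star> u) = a \<star> T u)"

lemma lin_zero: "lin T ==> T 0 = 0"
  unfolding lin_def by (metis scale_zero_left)

lemma lin_diff: "lin T ==> T (u - v) = T u - T v"
proof -
  assume l: "lin T"
  have "T u = T (u - v) + T v" using l unfolding lin_def by (metis diff_add_cancel)
  thus ?thesis by simp
qed

lemma lin_shift: "lin T ==> lin (\<lambda>v. T v - c \<star> v)"
  by (simp add: lin_def algebra_simps)

text \<open>Kernel and image of the map induced by T on V / N, pulled back to lattices above N; this
  is why N is added to the image in \<open>Img\<close>.\<close>

definition Ker :: "('v => 'v) => 'v set => 'v set => 'v set" where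
  "Ker T N V = {v \<in> V. T v \<in> N}"

definition Img :: "('v => 'v) => 'v set => 'v set => 'v set" where
  "Img T N V = {T v + n | v n. v \<in> V \<and> n \<in> N}"

text \<open>Rank and nullity: the map taking v to T v + N identifies V / \<open>Ker\<close> with
  \<open>Img\<close> / N, and comparing the two towers between N and V exchanges the roles. Thus the
  cokernel has the size of the kernel.\<close>

lemma
  assumes "quot N V" "lin T" "T ` V \<subseteq> V" "T ` N \<subseteq> N"
  shows Ker_betw: "Ker T N V \<in> betw N V" and Img_betw: "Img T N V \<in> betw N V"
    and idx_Img: "idx V (Img T N V) = idx (Ker T N V) N"
proof -
  note l = quotD[OF assms(1)]
  show K: "Ker T N V \<in> betw N V"
    using assms l by (auto simp: betw_def Ker_def lat_def lin_zero lin_def)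
  have "lat (Img T N V)" unfolding lat_def
  proof (intro conjI ballI)
    show "0 \<in> Img T N V" using lin_zero[OF assms(2)] lat_zero[OF l(1)] lat_zero[OF l(2)]
      unfolding Img_def by (metis (mono_tags, lifting) add.right_neutral mem_Collect_eq)
  next
    fix u v assume "u \<in> Img T N V" "v \<in> Img T N V"
    then obtain a n b m where *: "a \<in> V" "n \<in> N" "b \<in> V" "m \<in> N" "u = T a + n" "v = T b + m" by (auto simp: Img_def)
    have "u + v = T (a + b) + (n + m)" using * assms(2) by (simp add: lin_def algebra_simps)
    thus "u + v \<in> Img T N V" using * l lat_add unfolding Img_def by blast
  next
    fix c u assume "c \<in> A" "u \<in> Img T N V"
    then obtain a n where *: "c \<in> A" "a \<in> V" "n \<in> N" "u = T a + n" by (auto simp: Img_def)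
    have "c \<star> u = T (c \<star> a) + c \<star> n" using * assms(2) by (simp add: lin_def algebra_simps)
    thus "c \<star> u \<in> Img T N V" using * l lat_scale unfolding Img_def by blast
  qed
  moreover have "N \<subseteq> Img T N V"
  proof
    fix n assume "n \<in> N"
    moreover have "n = T 0 + n" using lin_zero[OF assms(2)] by simp
    ultimately show "n \<in> Img T N V" using lat_zero[OF l(2)] unfolding Img_def by blast
  qed
  moreover have "Img T N V \<subseteq> V" using assms(3) l by (auto simp: Img_def intro!: lat_add)
  ultimately show I: "Img T N V \<in> betw N V" by (simp add: betw_def)
  have "idx V (Ker T N V) = card ((\<lambda>v. (+) (T v) ` N) ` V)"
  proof (rule idx_eq_card_image)
    show "addgrp (Ker T N V)" using K by (auto simp: betw_def lat_addgrp)
    fix u v assume "u \<in> V" "v \<in> V"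
    thus "(+) (T u) ` N = (+) (T v) ` N \<longleftrightarrow> u - v \<in> Ker T N V"
      using coset_eq_iff[OF lat_addgrp[OF l(1)]] lin_diff[OF assms(2)] lat_diff[OF l(2)] by (simp add: Ker_def)
  qed
  also have "(\<lambda>v. (+) (T v) ` N) ` V = cosets (Img T N V) N"
  proof (intro equalityI subsetI)
    fix y assume "y \<in> (\<lambda>v. (+) (T v) ` N) ` V"
    then obtain v where v: "v \<in> V" "y = (+) (T v) ` N" by auto
    have "T v = T v + 0" by simp
    hence "T v \<in> Img T N V" using v lat_zero[OF l(1)] unfolding Img_def by blast
    thus "y \<in> cosets (Img T N V) N" using v by (auto simp: cosets_def)
  next
    fix y assume "y \<in> cosets (Img T N V) N"
    then obtain v n where *: "v \<in> V" "n \<in> N" "y = (+) (T v + n) ` N" by (auto simp: cosets_def Img_def)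
    have "y = (+) (T v) ` N" using coset_eq_iff[OF lat_addgrp[OF l(1)], of "T v + n" "T v"] * by simp
    thus "y \<in> (\<lambda>v. (+) (T v) ` N) ` V" using * by blast
  qed
  finally have "idx V (Ker T N V) = idx (Img T N V) N" by (simp add: idx_def)
  moreover have "idx V (Img T N V) * idx (Img T N V) N = idx V (Ker T N V) * idx (Ker T N V) N"
    using idx_mult[OF assms(1) I] idx_mult[OF assms(1) K] by simp
  ultimately show "idx V (Img T N V) = idx (Ker T N V) N"
    using idx_pos[OF quot_lower[OF assms(1) I]] by simp
qed

text \<open>Induction on the dimension by dividing out the line of one eigenvector v0 for r0. Every
  eigenvalue other than r0 survives in the quotient, because an eigenvector inside N + A v0 has the
  eigenvalue r0.\<close>

lemma eigenvalue_bound: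
  assumes "quot N V" "idx V N = q ^ d" "lin T" "T ` V \<subseteq> V" "T ` N \<subseteq> N"
    and R: "R \<subseteq> A" "finite R" "\<And>r s. r \<in> R ==> s \<in> R ==> r - s \<in> M ==> r = s"
  shows "card {r \<in> R. \<exists>v\<in>V. v \<notin> N \<and> T v - r \<star> v \<in> N} \<le> d"
  using assms(1,2,5)
proof (induction d arbitrary: N)
  case 0
  hence "V = N" using idx_eq_1_iff by simp
  thus ?case by simp
next
  case (Suc d)
  note l = quotD[OF Suc(2)]
  show ?case
  proof (cases "{r \<in> R. \<exists>v\<in>V. v \<notin> N \<and> T v - r \<star> v \<in> N} = {}")
    case False
    then obtain r0 v0 where 0: "r0 \<in> R" "v0 \<in> V" "v0 \<notin> N" "T v0 - r0 \<star> v0 \<in> N" by auto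
    define W where "W = adj N v0"
    have W: "W \<in> betw N V" using adj_subset[OF l(2,3) 0(2)] subset_adj[OF l(1)] lat_adj[OF l(1)] by (auto simp: betw_def W_def)
    have Wl: "lat W" using W by (simp add: betw_def)
    have "idx W N = q" using idx_adj[OF l(1) 0(3)] l(4)[OF _ 0(2)] by (simp add: W_def)
    hence i: "idx V W = q ^ d" using idx_mult[OF Suc(2) W] Suc(3) q_ge_2 by simp
    have "T w \<in> W" if w: "w \<in> W" for w
    proof -
      obtain n a where *: "n \<in> N" "a \<in> A" "w = n + a \<star> v0" using w by (auto simp: W_def adj_def)
      have "T w = (T n + a \<star> (T v0 - r0 \<star> v0)) + (a * r0) \<star> v0" using * assms(3) by (simp add: lin_def algebra_simps)
      moreover have "T n + a \<star> (T v0 - r0 \<star> v0) \<in> N" using * 0 Suc(4) l(1) by (auto intro!: lat_add lat_scale)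
      ultimately show ?thesis unfolding W_def using adjI[of _ N "a * r0" v0] mult_A * 0 R by auto
    qed
    hence IH: "card {r \<in> R. \<exists>v\<in>V. v \<notin> W \<and> T v - r \<star> v \<in> W} \<le> d"
      using Suc(1)[OF quot_upper[OF Suc(2) W] i] by blast
    have "{r \<in> R. \<exists>v\<in>V. v \<notin> N \<and> T v - r \<star> v \<in> N} \<subseteq> insert r0 {r \<in> R. \<exists>v\<in>V. v \<notin> W \<and> T v - r \<star> v \<in> W}"
    proof
      fix r assume "r \<in> {r \<in> R. \<exists>v\<in>V. v \<notin> N \<and> T v - r \<star> v \<in> N}"
      then obtain v where v: "r \<in> R" "v \<in> V" "v \<notin> N" "T v - r \<star> v \<in> N" by auto
      show "r \<in> insert r0 {r \<in> R. \<exists>v\<in>V. v \<notin> W \<and> T v - r \<star> v \<in> W}"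
      proof (cases "v \<in> W")
        case True
        then obtain n a where *: "n \<in> N" "a \<in> A" "v = n + a \<star> v0" by (auto simp: W_def adj_def)
        have aM: "a \<notin> M" using v * l(1) l(4)[OF _ 0(2), of a] lat_add[OF l(1)] by auto
        have rA: "r \<in> A" using v R by auto
        \<comment> \<open>Subtracting the eigenvector relations leaves a unit multiple of (r0 - r)
          v0 in N, which forces r0 - r into M.\<close>
        have "(a * (r0 - r)) \<star> v0 = (T v - r \<star> v) - (T n - r \<star> n) - a \<star> (T v0 - r0 \<star> v0)"
          using * assms(3) by (simp add: lin_def algebra_simps)
        moreover have "(T v - r \<star> v) - (T n - r \<star> n) - a \<star> (T v0 - r0 \<star> v0) \<in> N"
          using v * 0 Suc(4) l(1) rA by (auto intro!: lat_diff lat_scale)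
        ultimately have "a \<star> ((r0 - r) \<star> v0) \<in> N" unfolding scale_scale by simp
        hence "(r0 - r) \<star> v0 \<in> N" using lat_unit_iff[OF l(1) *(2) aM] by blast
        hence "r0 - r \<in> M" using adj_coeff[OF l(1) 0(3), of "r0 - r"] l(4)[OF _ 0(2)] diff_A 0 v R by auto
        thus ?thesis using R(3)[OF 0(1) v(1)] by simp
      next
        case False
        thus ?thesis using v W by (auto simp: betw_def)
      qed
    qed
    hence "card {r \<in> R. \<exists>v\<in>V. v \<notin> N \<and> T v - r \<star> v \<in> N} \<le> card (insert r0 {r \<in> R. \<exists>v\<in>V. v \<notin> W \<and> T v - r \<star> v \<in> W})"
      by (intro card_mono) (use R in auto)
    also have "\<dots> \<le> Suc d" using IH R(2) by (simp add: card_insert_if)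
    finally show ?thesis .
  qed (metis card.empty le0)
qed

end

text \<open>The candidates for the number of fixed hyperplanes: n j is the number of eigenvalues
  with an eigenspace of dimension j, and each of them contributes \<open>gb q j 1\<close>. The
  bounds on n do not refer to the map, so for fixed d only finitely many expressions in q
  arise.\<close>

definition eigen_counts :: "nat => nat => nat set" where
  "eigen_counts d q = (\<lambda>n. \<Sum>j\<in>{1..d}. n j * gb q j 1) ` ({1..d} \<rightarrow>\<^sub>E {..d})"

context lattice_space
begin

definition invs :: "('v => 'v) => 'v set => 'v set => nat => nat" where
  "invs T N V i = card {W \<in> betw N V. idx V W = q ^ i \<and> T ` W \<subseteq> W}"

lemma adj_eq_of_idx_q:
  assumes "quot N V" "W \<in> betw N V" "idx V W = q" "x \<in> V" "x \<notin> W"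
  shows "V = adj W x"
proof -
  have l: "lat W" "W \<subseteq> V" "lat V" using assms quotD by (auto simp: betw_def)
  have Q: "quot W V" using quot_upper assms by blast
  have b: "adj W x \<in> betw W V" using lat_adj[OF l(1)] subset_adj[OF l(1)] adj_subset[OF l(3,2) assms(4)] by (simp add: betw_def)
  have "idx (adj W x) W = q" by (rule idx_adj[OF l(1) assms(5)]) (use quotD(4)[OF Q _ assms(4)] in auto)
  hence "idx V (adj W x) = 1" using idx_mult[OF Q b] assms(3) q_ge_2 by simp
  thus ?thesis using idx_eq_1_iff[OF quot_upper[OF Q b]] by simp
qed

text \<open>T acts on the line V / W through a scalar, read off from T x, and any r congruent to it
  serves as well. This is applied to a hyperplane W of the whole space and, with N in the place of
  W, to an invariant line.\<close>

lemma eigenvalue_of_line: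
  assumes "quot N V" "lat W" "N \<subseteq> V" "\<And>v. v \<in> V ==> T v \<in> V" "T ` W \<subseteq> W" "lin T" "V = adj W x" "x \<in> V"
    "\<And>m. m \<in> M ==> m \<star> x \<in> W"
  shows "\<exists>a\<in>A. \<forall>r v. r \<in> A \<longrightarrow> a - r \<in> M \<longrightarrow> v \<in> V \<longrightarrow> T v - r \<star> v \<in> W"
proof -
  have "T x \<in> adj W x" using assms by auto
  then obtain w a where *: "w \<in> W" "a \<in> A" "T x = w + a \<star> x" by (auto simp: adj_def)
  show ?thesis
  proof (intro bexI[OF _ *(2)] allI impI)
    fix r v assume r: "r \<in> A" "a - r \<in> M" "v \<in> V"
    then obtain w' b where **: "w' \<in> W" "b \<in> A" "v = w' + b \<star> x" using assms(7) by (auto simp: adj_def)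
    have "T v = T w' + b \<star> T x" using ** assms(6) by (simp add: lin_def)
    hence "T v - r \<star> v = (T w' - r \<star> w') + b \<star> (w + (a - r) \<star> x)"
      using * ** by (simp add: algebra_simps)
    moreover have "T w' - r \<star> w' \<in> W" using ** r assms by (auto intro!: lat_diff lat_scale)
    moreover have "b \<star> (w + (a - r) \<star> x) \<in> W"
      by (rule lat_scale[OF assms(2) **(2) lat_add[OF assms(2) *(1) assms(9)[OF r(2)]]])
    ultimately show "T v - r \<star> v \<in> W" using lat_add[OF assms(2)] by metis
  qed
qed

text \<open>On the quotient by an invariant hyperplane W the map is a scalar r, so W contains the
  image of T - r; conversely every lattice containing that image is invariant. Dually, an invariant
  line lies in the kernel of T - r. Cokernel and kernel have the same dimension k r, so both counts
  are the same sum over the residues.\<close>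

lemma eigenspace_counts:
  assumes "quot N V" "idx V N = q ^ d" "lin T" "T ` V \<subseteq> V" "T ` N \<subseteq> N"
  obtains R k where "R \<subseteq> A" "finite R" "\<And>a. a \<in> A ==> \<exists>r\<in>R. a - r \<in> M"
    "\<And>r s. r \<in> R ==> s \<in> R ==> r - s \<in> M ==> r = s"
    "\<And>r. r \<in> R ==> idx (Ker (\<lambda>v. T v - r \<star> v) N V) N = q ^ k r"
    "\<And>r. r \<in> R ==> idx V (Img (\<lambda>v. T v - r \<star> v) N V) = q ^ k r"
    "invs T N V 1 = (\<Sum>r\<in>R. gb q (k r) 1)"
    "card {W \<in> betw N V. idx W N = q \<and> T ` W \<subseteq> W} = (\<Sum>r\<in>R. gb q (k r) 1)"
proof -
  note l = quotD[OF assms(1)]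
  obtain R where R: "R \<subseteq> A" "finite R" "\<And>a. a \<in> A ==> \<exists>r\<in>R. a - r \<in> M"
    "\<And>r s. r \<in> R ==> s \<in> R ==> r - s \<in> M ==> r = s" by (rule residue_system) (rule that)
  define S where "S r = (\<lambda>v. T v - r \<star> v)" for r
  have S: "lin (S r)" "S r ` V \<subseteq> V" "S r ` N \<subseteq> N" if "r \<in> R" for r
    using lin_shift[OF assms(3)] assms(4,5) l that R by (auto simp: S_def intro!: lat_diff lat_scale)
  have K: "Ker (S r) N V \<in> betw N V" "Img (S r) N V \<in> betw N V" "idx V (Img (S r) N V) = idx (Ker (S r) N V) N" if "r \<in> R" for r
    using Ker_betw Img_betw idx_Img assms(1) S[OF that] by blast+
  have "\<exists>e. idx (Ker (S r) N V) N = q ^ e" if "r \<in> R" for r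
    using idx_power[OF quot_lower[OF assms(1) K(1)[OF that]]] .
  then obtain k where k: "idx (Ker (S r) N V) N = q ^ k r" if "r \<in> R" for r by metis
  \<comment> \<open>Different residues make disjoint contributions: (T - r) v and (T - s) v differ
    by a unit multiple of v.\<close>
  have sep: "v \<in> W" if "r \<in> R" "s \<in> R" "r \<noteq> s" "lat W" "S r v \<in> W" "S s v \<in> W" for r s v W
  proof -
    have "s - r \<in> A" "s - r \<notin> M" using R that diff_A by blast+
    moreover have "(s - r) \<star> v = S r v - S s v" by (simp add: S_def algebra_simps)
    hence "(s - r) \<star> v \<in> W" using lat_diff[OF that(4)] that by simp
    ultimately show ?thesis using lat_unit_iff[OF that(4)] by blast
  qed
  have stab: "T ` W \<subseteq> W" if "r \<in> R" "lat W" "\<And>w. w \<in> W ==> S r w \<in> W" for r W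
  proof -
    have "T w \<in> W" if "w \<in> W" for w
    proof -
      have "T w = S r w + r \<star> w" by (simp add: S_def)
      thus ?thesis using \<open>lat W\<close> \<open>r \<in> R\<close> R that \<open>\<And>w. w \<in> W ==> S r w \<in> W\<close> lat_add lat_scale by (metis subsetD)
    qed
    thus ?thesis by blast
  qed
  have fin: "finite (betw N V)" using finite_betw[OF assms(1)] .
  have hyp: "{W \<in> betw N V. idx V W = q ^ 1 \<and> T ` W \<subseteq> W} = (\<Union>r\<in>R. {W \<in> betw (Img (S r) N V) V. idx V W = q ^ 1})"
  proof (intro equalityI subsetI)
    fix W assume W: "W \<in> {W \<in> betw N V. idx V W = q ^ 1 \<and> T ` W \<subseteq> W}"
    hence Wl: "lat W" "N \<subseteq> W" "W \<subseteq> V" by (auto simp: betw_def)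
    have "idx V W \<noteq> 1" using W q_ge_2 by auto
    hence "W \<noteq> V" using idx_self l by blast
    then obtain x where x: "x \<in> V" "x \<notin> W" using Wl by auto
    have V: "V = adj W x" using adj_eq_of_idx_q[OF assms(1) _ _ x] W by simp
    have mx: "m \<star> x \<in> W" if "m \<in> M" for m using l(4)[OF that x(1)] Wl by auto
    have tV: "\<And>v. v \<in> V ==> T v \<in> V" "T ` W \<subseteq> W" using assms(4) W by auto
    obtain a where a: "a \<in> A" "\<And>r v. r \<in> A ==> a - r \<in> M ==> v \<in> V ==> T v - r \<star> v \<in> W"
      using eigenvalue_of_line[OF assms(1) Wl(1) l(3) tV assms(3) V x(1) mx] by blast
    obtain r where r: "r \<in> R" "a - r \<in> M" using R a by blast
    have "T v - r \<star> v \<in> W" if "v \<in> V" for v using a(2) r R that by blast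
    hence "Img (S r) N V \<subseteq> W" using Wl by (auto simp: Img_def S_def intro!: lat_add)
    thus "W \<in> (\<Union>r\<in>R. {W \<in> betw (Img (S r) N V) V. idx V W = q ^ 1})" using r W Wl by (auto simp: betw_def)
  next
    fix W assume "W \<in> (\<Union>r\<in>R. {W \<in> betw (Img (S r) N V) V. idx V W = q ^ 1})"
    then obtain r where r: "r \<in> R" "lat W" "Img (S r) N V \<subseteq> W" "W \<subseteq> V" "idx V W = q ^ 1" by (auto simp: betw_def)
    have "N \<subseteq> W" using K(2)[OF r(1)] r by (auto simp: betw_def)
    moreover have "S r w \<in> W" if "w \<in> V" for w
    proof -
      have "S r w + 0 \<in> Img (S r) N V" using that lat_zero[OF l(1)] unfolding Img_def by blast
      thus ?thesis using r by auto
    qed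
    ultimately show "W \<in> {W \<in> betw N V. idx V W = q ^ 1 \<and> T ` W \<subseteq> W}"
      using stab[OF r(1,2)] r by (auto simp: betw_def)
  qed
  have "invs T N V 1 = (\<Sum>r\<in>R. card {W \<in> betw (Img (S r) N V) V. idx V W = q ^ 1})"
    unfolding invs_def hyp
  proof (rule card_UN_disjoint[OF R(2)], safe)
    fix r assume "r \<in> R"
    thus "finite {W \<in> betw (Img (S r) N V) V. idx V W = q ^ 1}"
      using finite_betw[OF quot_upper[OF assms(1) K(2)]] by simp
  next
    fix r s W assume rs: "r \<in> R" "s \<in> R" "r \<noteq> s" and W: "W \<in> betw (Img (S r) N V) V" "idx V W = q ^ 1" "W \<in> betw (Img (S s) N V) V"
    have *: "S t v \<in> Img (S t) N V" if "v \<in> V" for t v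
    proof -
      have "S t v = S t v + 0" by simp
      thus ?thesis using lat_zero[OF l(1)] that unfolding Img_def by blast
    qed
    have "v \<in> W" if "v \<in> V" for v
      by (rule sep[OF rs]) (use W *[OF that] in \<open>auto simp: betw_def\<close>)
    hence "W = V" using W by (auto simp: betw_def)
    thus "W \<in> {}" using W(2) idx_self[OF l(2)] q_ge_2 by simp
  qed
  also have "\<dots> = (\<Sum>r\<in>R. gb q (k r) 1)"
    by (rule sum.cong[OF refl], rule card_betw[OF quot_upper[OF assms(1) K(2)]]) (use K(3) k in auto)
  finally have c1: "invs T N V 1 = (\<Sum>r\<in>R. gb q (k r) 1)" .
  have lin: "{W \<in> betw N V. idx W N = q \<and> T ` W \<subseteq> W} = (\<Union>r\<in>R. {W \<in> betw N (Ker (S r) N V). idx W N = q})"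
  proof (intro equalityI subsetI)
    fix W assume W: "W \<in> {W \<in> betw N V. idx W N = q \<and> T ` W \<subseteq> W}"
    hence Wl: "lat W" "N \<subseteq> W" "W \<subseteq> V" by (auto simp: betw_def)
    have Q: "quot N W" using quot_lower[OF assms(1)] W by auto
    have "idx W N \<noteq> 1" using W q_ge_2 by auto
    hence "W \<noteq> N" using idx_self l by blast
    then obtain x where x: "x \<in> W" "x \<notin> N" using Wl by auto
    have V: "W = adj N x" using adj_eq_of_idx_q[OF Q betw_ends(1)[OF Q] _ x] W by simp
    have mx: "m \<star> x \<in> N" if "m \<in> M" for m using l(4)[OF that] x Wl by auto
    have tW: "\<And>v. v \<in> W ==> T v \<in> W" using W by auto
    obtain a where a: "a \<in> A" "\<And>r v. r \<in> A ==> a - r \<in> M ==> v \<in> W ==> T v - r \<star> v \<in> N"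
      using eigenvalue_of_line[OF Q l(1) Wl(2) tW assms(5,3) V x(1) mx] by blast
    obtain r where r: "r \<in> R" "a - r \<in> M" using R a by blast
    have "W \<subseteq> Ker (S r) N V" using a(2)[of r] r R Wl by (auto simp: Ker_def S_def)
    thus "W \<in> (\<Union>r\<in>R. {W \<in> betw N (Ker (S r) N V). idx W N = q})" using r W Wl by (auto simp: betw_def)
  next
    fix W assume "W \<in> (\<Union>r\<in>R. {W \<in> betw N (Ker (S r) N V). idx W N = q})"
    then obtain r where r: "r \<in> R" "lat W" "N \<subseteq> W" "W \<subseteq> Ker (S r) N V" "idx W N = q" by (auto simp: betw_def)
    thus "W \<in> {W \<in> betw N V. idx W N = q \<and> T ` W \<subseteq> W}"
      using stab[OF r(1,2)] by (auto simp: betw_def Ker_def)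
  qed
  have "card {W \<in> betw N V. idx W N = q \<and> T ` W \<subseteq> W} = (\<Sum>r\<in>R. card {W \<in> betw N (Ker (S r) N V). idx W N = q})"
    unfolding lin
  proof (rule card_UN_disjoint[OF R(2)]; intro ballI impI)
    fix r assume "r \<in> R"
    thus "finite {W \<in> betw N (Ker (S r) N V). idx W N = q}"
      using finite_betw[OF quot_lower[OF assms(1) K(1)]] by simp
  next
    fix r s assume rs: "r \<in> R" "s \<in> R" "r \<noteq> s"
    have False if W: "W \<in> betw N (Ker (S r) N V)" "idx W N = q" "W \<in> betw N (Ker (S s) N V)" for W
    proof -
      have "v \<in> N" if "v \<in> W" for v
        by (rule sep[OF rs l(1)]) (use W that in \<open>auto simp: betw_def Ker_def\<close>)
      hence "W = N" using W by (auto simp: betw_def)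
      thus False using W(2) idx_self[OF l(1)] q_ge_2 by simp
    qed
    thus "{W \<in> betw N (Ker (S r) N V). idx W N = q} \<inter> {W \<in> betw N (Ker (S s) N V). idx W N = q} = {}"
      by blast
  qed
  also have "\<dots> = (\<Sum>r\<in>R. gb q (k r) 1)"
    by (rule sum.cong[OF refl], rule card_lines[OF quot_lower[OF assms(1) K(1)]]) (use k in auto)
  finally have c2: "card {W \<in> betw N V. idx W N = q \<and> T ` W \<subseteq> W} = (\<Sum>r\<in>R. gb q (k r) 1)" .
  show ?thesis by (rule that[OF R _ _ c1 c2]) (use k K(3) in \<open>auto simp: S_def\<close>)
qed

text \<open>Grouping residues by the dimension of the eigenspace turns the sum into a member of
  \<open>eigen_counts\<close>. A nilpotent map has no eigenvalue except 0, and there the eigenspace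
  has the dimension e of the cokernel of T.\<close>

lemma
  assumes "quot N V" "idx V N = q ^ d" "lin T" "T ` V \<subseteq> V" "T ` N \<subseteq> N"
  shows invs_lines: "card {W \<in> betw N V. idx W N = q \<and> T ` W \<subseteq> W} = invs T N V 1"
    and invs_eigen_counts: "invs T N V 1 \<in> eigen_counts d q"
    and invs_nilpotent: "(\<And>v. v \<in> V ==> (T ^^ m) v \<in> N) ==> idx V (Img T N V) = q ^ e ==> invs T N V 1 = gb q e 1"
proof -
  note l = quotD[OF assms(1)]
  obtain R k where R: "R \<subseteq> A" "finite R" "\<And>a. a \<in> A ==> \<exists>r\<in>R. a - r \<in> M"
    "\<And>r s. r \<in> R ==> s \<in> R ==> r - s \<in> M ==> r = s"
    and k: "\<And>r. r \<in> R ==> idx (Ker (\<lambda>v. T v - r \<star> v) N V) N = q ^ k r"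
      "\<And>r. r \<in> R ==> idx V (Img (\<lambda>v. T v - r \<star> v) N V) = q ^ k r"
    and c: "invs T N V 1 = (\<Sum>r\<in>R. gb q (k r) 1)"
    "card {W \<in> betw N V. idx W N = q \<and> T ` W \<subseteq> W} = (\<Sum>r\<in>R. gb q (k r) 1)"
    by (rule eigenspace_counts[OF assms]) (rule that)
  show "card {W \<in> betw N V. idx W N = q \<and> T ` W \<subseteq> W} = invs T N V 1" using c by simp
  have K: "Ker (\<lambda>v. T v - r \<star> v) N V \<in> betw N V" if "r \<in> R" for r
  proof (rule Ker_betw[OF assms(1) lin_shift[OF assms(3)]])
    have "r \<in> A" using that R by auto
    thus "(\<lambda>v. T v - r \<star> v) ` V \<subseteq> V" "(\<lambda>v. T v - r \<star> v) ` N \<subseteq> N"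
      using assms(4,5) l by (auto intro!: lat_diff lat_scale)
  qed
  have ev: "\<exists>v\<in>V. v \<notin> N \<and> T v - r \<star> v \<in> N" if "r \<in> R" "k r \<noteq> 0" for r
  proof -
    have "Ker (\<lambda>v. T v - r \<star> v) N V \<noteq> N" using k(1)[OF that(1)] idx_self[OF l(1)] that(2) q_power_eq_iff[of "k r" 0] by (metis power_0)
    moreover have "N \<subseteq> Ker (\<lambda>v. T v - r \<star> v) N V" using K[OF that(1)] by (simp add: betw_def)
    ultimately show ?thesis by (auto simp: Ker_def)
  qed
  have kd: "k r \<le> d" if "r \<in> R" for r
    using idx_le_power[OF assms(1,2) K[OF that]] k(1)[OF that] by (metis diff_le_self q_power_eq_iff)
  \<comment> \<open>The value j = 0, belonging to the residues that are no eigenvalues, is left out: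
    their number is not bounded by d, and they contribute \<open>gb q 0 1\<close>, which is
    0.\<close>
  define n where "n = restrict (\<lambda>j. card {r \<in> R. k r = j}) {1..d}"
  have "n j \<le> d" if "j \<in> {1..d}" for j
  proof -
    have "n j \<le> card {r \<in> R. \<exists>v\<in>V. v \<notin> N \<and> T v - r \<star> v \<in> N}"
      using that R(2) ev by (auto simp: n_def intro!: card_mono)
    thus ?thesis using eigenvalue_bound[OF assms R(1,2,4)] by simp
  qed
  hence n: "n \<in> {1..d} \<rightarrow>\<^sub>E {..d}" by (auto simp: n_def)
  have "(\<Sum>r\<in>R. gb q (k r) 1) = (\<Sum>j\<in>{..d}. \<Sum>r\<in>{r \<in> R. k r = j}. gb q (k r) 1)"
    by (rule sum.group[symmetric]) (use R kd in auto)
  also have "\<dots> = (\<Sum>j\<in>{..d}. card {r \<in> R. k r = j} * gb q j 1)"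
    by (rule sum.cong[OF refl]) simp
  also have "\<dots> = (\<Sum>j\<in>{1..d}. n j * gb q j 1)"
    by (rule sum.mono_neutral_cong_right) (auto simp: n_def not_le)
  finally show "invs T N V 1 \<in> eigen_counts d q" using n c unfolding eigen_counts_def by auto
  assume nil: "\<And>v. v \<in> V ==> (T ^^ m) v \<in> N" and e: "idx V (Img T N V) = q ^ e"
  \<comment> \<open>The representative of the residue 0, which need not be 0 itself.\<close>
  obtain r0 where r0: "r0 \<in> R" "0 - r0 \<in> M" using R(3)[OF zero_A] by blast
  have r0M: "r0 \<in> M" using uminus_M[OF r0(2)] by simp
  have "k r = 0" if r: "r \<in> R" "r \<noteq> r0" for r
  proof (rule ccontr)
    assume "k r \<noteq> 0"
    then obtain v where v: "v \<in> V" "v \<notin> N" "T v - r \<star> v \<in> N" using ev r by blast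
    have rA: "r \<in> A" using r R by auto
    have "r - r0 \<notin> M" using r r0 R by blast
    hence rM: "r \<notin> M" using diff_M[OF _ r0M] by blast
    \<comment> \<open>An eigenvector for a unit r satisfies T^m v = r^m v modulo N, so no power of T
      can kill it.\<close>
    have "(T ^^ j) v - r ^ j \<star> v \<in> N" for j
    proof (induction j)
      case (Suc j)
      have "(T ^^ Suc j) v - r ^ Suc j \<star> v = T ((T ^^ j) v - r ^ j \<star> v) + r ^ j \<star> (T v - r \<star> v)"
        using assms(3) unfolding lin_diff[OF assms(3)] by (simp add: lin_def scale_right_diff_distrib mult.commute)
      moreover have "r ^ j \<in> A" by (induction j) (auto simp: one_A rA mult_A)
      ultimately show ?case using Suc v assms(5) l(1) by (auto intro!: lat_add lat_scale)
    qed (use lat_zero[OF l(1)] in simp)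
    from lat_diff[OF l(1) nil[OF v(1)] this[of m]] have "(T ^^ m) v - ((T ^^ m) v - r ^ m \<star> v) \<in> N" .
    moreover have "(T ^^ m) v - ((T ^^ m) v - r ^ m \<star> v) = r ^ m \<star> v" by (simp only: diff_diff_eq2 add_diff_cancel_left')
    ultimately have "r ^ m \<star> v \<in> N" by metis
    moreover have "r ^ j \<star> v \<notin> N" for j
    proof (induction j)
      case (Suc j)
      have "r ^ Suc j \<star> v = r \<star> (r ^ j \<star> v)" by simp
      thus ?case using Suc lat_unit_iff[OF l(1) rA rM] by metis
    qed (use v in simp)
    ultimately show False by blast
  qed
  hence "(\<Sum>r\<in>R. gb q (k r) 1) = (\<Sum>r\<in>{r0}. gb q (k r) 1)"
    by (intro sum.mono_neutral_right) (use R r0 in auto)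
  moreover have "Img (\<lambda>v. T v - r0 \<star> v) N V = Img T N V"
  proof -
    have "\<exists>v' n'. T v - r0 \<star> v + n = T v' + n' \<and> v' \<in> V \<and> n' \<in> N" "\<exists>v' n'. T v + n = T v' - r0 \<star> v' + n' \<and> v' \<in> V \<and> n' \<in> N" if "v \<in> V" "n \<in> N" for v n
    proof -
      have *: "r0 \<star> v \<in> N" using l(4)[OF r0M that(1)] .
      have "T v - r0 \<star> v + n = T v + (n - r0 \<star> v)" "T v + n = T v - r0 \<star> v + (n + r0 \<star> v)" by simp_all
      thus "\<exists>v' n'. T v - r0 \<star> v + n = T v' + n' \<and> v' \<in> V \<and> n' \<in> N" "\<exists>v' n'. T v + n = T v' - r0 \<star> v' + n' \<and> v' \<in> V \<and> n' \<in> N"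
        using lat_diff[OF l(1) that(2) *] lat_add[OF l(1) that(2) *] that by blast+
    qed
    thus ?thesis unfolding Img_def by fast
  qed
  hence "k r0 = e" using k(2)[OF r0(1)] e by simp
  ultimately show "invs T N V 1 = gb q e 1" using c by simp
qed

lemma
  assumes "quot N V" "idx V N = q ^ d" "T ` V \<subseteq> V" "T ` N \<subseteq> N"
  shows invs_0: "invs T N V 0 = 1" and invs_top: "invs T N V d = 1" and invs_gt: "i > d ==> invs T N V i = 0"
proof -
  note l = quotD[OF assms(1)]
  have *: "idx V W = q ^ 0 \<longleftrightarrow> W = V" "idx V W = q ^ d \<longleftrightarrow> W = N" if W: "W \<in> betw N V" for W
  proof -
    show "idx V W = q ^ 0 \<longleftrightarrow> W = V" using idx_eq_1_iff[OF quot_upper[OF assms(1) W]] by auto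
    show "idx V W = q ^ d \<longleftrightarrow> W = N" using idx_upper_iff[OF assms(1,2) W, of d] idx_eq_1_iff[OF quot_lower[OF assms(1) W]] by simp
  qed
  have "{W \<in> betw N V. idx V W = q ^ 0 \<and> T ` W \<subseteq> W} = {V}" using * betw_ends[OF assms(1)] assms(3) by blast
  thus "invs T N V 0 = 1" by (simp only: invs_def) simp
  have "{W \<in> betw N V. idx V W = q ^ d \<and> T ` W \<subseteq> W} = {N}" using * betw_ends[OF assms(1)] assms(4) by blast
  thus "invs T N V d = 1" by (simp only: invs_def) simp
  assume i: "i > d"
  have "idx V W \<noteq> q ^ i" if "W \<in> betw N V" for W
    using idx_le_power[OF assms(1,2) that] i by (metis linorder_not_le q_power_eq_iff)
  hence "{W \<in> betw N V. idx V W = q ^ i \<and> T ` W \<subseteq> W} = {}" by blast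
  thus "invs T N V i = 0" by (simp only: invs_def card.empty)
qed

text \<open>Up to dimension 3 a proper nonzero subspace is a hyperplane or a line, and invariant
  lines are as many as invariant hyperplanes; so a single number determines all counts.\<close>

lemma invs_le_3:
  assumes "quot N V" "idx V N = q ^ d" "lin T" "T ` V \<subseteq> V" "T ` N \<subseteq> N" "d \<le> 3"
  shows "invs T N V i = (if i = 0 \<or> i = d then 1 else if i < d then invs T N V 1 else 0)"
proof -
  have "invs T N V 2 = invs T N V 1" if "d = 3"
  proof -
    have "{W \<in> betw N V. idx V W = q ^ 2 \<and> T ` W \<subseteq> W} = {W \<in> betw N V. idx W N = q \<and> T ` W \<subseteq> W}"
      using idx_upper_iff[OF assms(1,2), of _ 2] that by auto
    thus ?thesis using invs_lines[OF assms(1-5)] by (simp only: invs_def)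
  qed
  moreover have "i = 1 \<or> i = 2" if "i \<noteq> 0" "i \<noteq> d" "i < d" using that assms(6) by linarith
  ultimately show ?thesis using invs_0 invs_top invs_gt assms by (cases "i < d") auto
qed

end

section \<open>Lie lattices and the counts of their subalgebras and ideals\<close>

locale lie_lattice = lattice_space A M scale
  for A M :: "'k::field set" and scale :: "'k => 'v::ab_group_add => 'v" (infixr \<open>\<star>\<close> 75) +
  fixes br :: "'v => 'v => 'v" and N \<Lambda> :: "'v set"
  assumes quot_\<Lambda>: "quot N \<Lambda>"
    and lin_right: "lin (br u)" and lin_left: "lin (\<lambda>v. br v u)" and br_self: "br u u = 0"
    and br_\<Lambda>: "u \<in> \<Lambda> ==> v \<in> \<Lambda> ==> br u v \<in> \<Lambda>" and br_N: "u \<in> \<Lambda> ==> v \<in> N ==> br u v \<in> N"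
begin

lemma br_add [simp]: "br u (v + w) = br u v + br u w" "br (v + w) u = br v u + br w u"
  using lin_right lin_left by (simp_all add: lin_def)
lemma br_scale [simp]: "br u (a \<star> v) = a \<star> br u v" "br (a \<star> v) u = a \<star> br v u"
  using lin_right lin_left by (simp_all add: lin_def)
lemma br_diff [simp]: "br u (v - w) = br u v - br u w" "br (v - w) u = br v u - br w u"
  using lin_diff lin_right lin_left by blast+
lemma br_anti: "br u v = - br v u"
proof -
  have "br (u + v) (u + v) = br u v + br v u" unfolding br_add by (simp add: br_self)
  thus ?thesis by (simp add: br_self eq_neg_iff_add_eq_0)
qed

lemma \<Lambda>_facts: "lat N" "lat \<Lambda>" "N \<subseteq> \<Lambda>"
  using quotD[OF quot_\<Lambda>] by auto

fun closed :: "zeta_type => 'v set => bool" where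
  "closed Subalgebras U \<longleftrightarrow> (\<forall>u\<in>U. \<forall>v\<in>U. br u v \<in> U)"
| "closed Ideals U \<longleftrightarrow> (\<forall>u\<in>\<Lambda>. \<forall>v\<in>U. br u v \<in> U)"

definition num :: "zeta_type => nat => nat" where
  "num t i = card {U \<in> betw N \<Lambda>. idx \<Lambda> U = q ^ i \<and> closed t U}"

lemma closed_\<Lambda>: "closed t \<Lambda>" by (cases t) (auto intro: br_\<Lambda>)
lemma closed_N: "closed t N" using \<Lambda>_facts by (cases t) (auto intro: br_N)

lemma ideal_imp_closed: "U \<subseteq> \<Lambda> ==> closed Ideals U ==> closed t U"
  by (cases t) auto

lemma idx_0_iff: "quot N U ==> W \<in> betw N U ==> idx U W = q ^ 0 \<longleftrightarrow> W = U"
  using idx_eq_1_iff[OF quot_upper[of N U W]] by auto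

text \<open>Modulo N the lattice is spanned by one vector, whose bracket with itself
  vanishes.\<close>

lemma line_closed:
  assumes U: "U \<in> betw N \<Lambda>" "idx U N = q" shows "closed Subalgebras U"
proof -
  have Q: "quot N U" using quot_lower[OF quot_\<Lambda> U(1)] .
  have l: "lat U" "N \<subseteq> U" "U \<subseteq> \<Lambda>" using U by (auto simp: betw_def)
  have "U \<noteq> N" using U(2) idx_self[OF \<Lambda>_facts(1)] q_ge_2 by auto
  then obtain x where x: "x \<in> U" "x \<notin> N" using l by auto
  have Ux: "U = adj N x" using adj_eq_of_idx_q[OF Q betw_ends(1)[OF Q] U(2) x] .
  have "br u v \<in> U" if uv: "u \<in> U" "v \<in> U" for u v
  proof -
    obtain a c b d where *: "c \<in> N" "a \<in> A" "u = c + a \<star> x" "d \<in> N" "b \<in> A" "v = d + b \<star> x"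
      using uv Ux by (auto simp: adj_def)
    have "br u v = br u d + b \<star> br c x" using * by (simp add: br_self)
    also have "br c x = - br x c" by (rule br_anti)
    finally have e: "br u v = br u d + b \<star> - br x c" .
    have "u \<in> \<Lambda>" "x \<in> \<Lambda>" using uv x l by auto
    hence "br u v \<in> N" unfolding e
      using lat_add[OF \<Lambda>_facts(1) br_N lat_scale[OF \<Lambda>_facts(1) _ lat_minus[OF \<Lambda>_facts(1) br_N]]] * by blast
    thus ?thesis using l by auto
  qed
  thus ?thesis by simp
qed

text \<open>Brackets of W with y + u, and of W with itself, stay in U, and W + A (y + u) meets U
  exactly in W; so the large lattice is closed exactly when W is closed and normalised by y + u.
  This test is applied in all three types of algebra.\<close>

lemma closed_adj:
  assumes U: "U \<in> betw N \<Lambda>" "y \<notin> U" "\<Lambda> = adj U y" "closed Subalgebras U"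
    and W: "W \<in> betw N U" "u \<in> U" and y: "\<And>w. w \<in> W ==> br (y + u) w \<in> U"
  shows "closed Subalgebras (adj W (y + u)) \<longleftrightarrow> closed Subalgebras W \<and> br (y + u) ` W \<subseteq> W"
proof
  note l = betwD[OF W(1)]
  have H: "W \<subseteq> adj W (y + u)" "y + u \<in> adj W (y + u)" "adj W (y + u) \<inter> U = W"
    using subset_adj[OF l(1)] mem_adj[OF l(1)] complement_adj(2)[OF quot_\<Lambda> U(1-3) W] by auto
  { assume c: "closed Subalgebras (adj W (y + u))"
    have "br v w \<in> W" if "v \<in> W" "w \<in> W" for v w
    proof -
      have "br v w \<in> adj W (y + u)" using c H that by auto
      moreover have "br v w \<in> U" using U(4) l that by auto
      ultimately show ?thesis using H(3) by blast
    qed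
    moreover have "br (y + u) w \<in> W" if "w \<in> W" for w
    proof -
      have "br (y + u) w \<in> adj W (y + u)" using c H that by (auto simp del: br_add)
      thus ?thesis using H(3) y[OF that] by blast
    qed
    ultimately show "closed Subalgebras W \<and> br (y + u) ` W \<subseteq> W" by (auto simp del: br_add) }
  { assume c: "closed Subalgebras W \<and> br (y + u) ` W \<subseteq> W"
    have m: "br (y + u) w \<in> W" if "w \<in> W" for w using c that by blast
    have "br g h \<in> W" if "g \<in> adj W (y + u)" "h \<in> adj W (y + u)" for g h
    proof -
      obtain w a w' b where *: "w \<in> W" "a \<in> A" "g = w + a \<star> (y + u)" "w' \<in> W" "b \<in> A" "h = w' + b \<star> (y + u)"
        using \<open>g \<in> _\<close> \<open>h \<in> _\<close> by (auto simp: adj_def)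
      have "br g h = br w w' + b \<star> br w (y + u) + a \<star> br (y + u) w' + (a * b) \<star> br (y + u) (y + u)"
        unfolding * by (simp add: algebra_simps)
      also have "br w (y + u) = - br (y + u) w" by (rule br_anti)
      finally have "br g h = br w w' + b \<star> - br (y + u) w + a \<star> br (y + u) w'" by (simp only: br_self scale_zero_right add_0_right)
      moreover have "br w w' \<in> W" using c * by auto
      ultimately show ?thesis using m * l(1) by (metis lat_add lat_scale lat_minus)
    qed
    thus "closed Subalgebras (adj W (y + u))" using H(1) by auto }
qed

lemma num_0: "num t 0 = 1"
proof -
  have "{U \<in> betw N \<Lambda>. idx \<Lambda> U = q ^ 0 \<and> closed t U} = {\<Lambda>}"
    using idx_0_iff[OF quot_\<Lambda>] betw_ends[OF quot_\<Lambda>] closed_\<Lambda> by blast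
  thus ?thesis by (simp only: num_def) simp
qed

lemma
  assumes "idx \<Lambda> N = q ^ n"
  shows num_top: "num t n = 1" and num_gt: "i > n ==> num t i = 0"
    and num_lines: "n = Suc m ==> num Subalgebras m = gb q n m"
proof -
  have "idx \<Lambda> U = q ^ n \<longleftrightarrow> U = N" if "U \<in> betw N \<Lambda>" for U
    using idx_upper_iff[OF quot_\<Lambda> assms that, of n] idx_eq_1_iff[OF quot_lower[OF quot_\<Lambda> that]] by simp
  hence "{U \<in> betw N \<Lambda>. idx \<Lambda> U = q ^ n \<and> closed t U} = {N}"
    using betw_ends[OF quot_\<Lambda>] closed_N by blast
  thus "num t n = 1" by (simp only: num_def) simp
  { assume "i > n"
    hence "idx \<Lambda> U \<noteq> q ^ i" if "U \<in> betw N \<Lambda>" for U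
      using idx_le_power[OF quot_\<Lambda> assms that] by (metis linorder_not_le q_power_eq_iff)
    hence "{U \<in> betw N \<Lambda>. idx \<Lambda> U = q ^ i \<and> closed t U} = {}" by blast
    thus "num t i = 0" by (simp only: num_def card.empty) }
  { assume n: "n = Suc m"
    have "closed Subalgebras U" if U: "U \<in> betw N \<Lambda>" "idx \<Lambda> U = q ^ m" for U
      using line_closed[OF U(1)] idx_upper_iff[OF quot_\<Lambda> assms U(1), of m] U(2) n by simp
    hence "{U \<in> betw N \<Lambda>. idx \<Lambda> U = q ^ m \<and> closed Subalgebras U} = {U \<in> betw N \<Lambda>. idx \<Lambda> U = q ^ m}" by blast
    thus "num Subalgebras m = gb q n m" using card_betw[OF quot_\<Lambda> assms] by (simp only: num_def) }
qed

end

subsection \<open>An abelian ideal of codimension one\<close>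

text \<open>Modulo N, V is an abelian ideal of dimension d and x spans a complement; e is the corank
  of ad x on V.\<close>

locale almost_abelian = lie_lattice A M scale br N \<Lambda>
  for A M :: "'k::field set" and scale :: "'k => 'v::ab_group_add => 'v" (infixr \<open>\<star>\<close> 75)
    and br N \<Lambda> +
  fixes V x d e
  assumes V: "V \<in> betw N \<Lambda>" and x: "x \<notin> V" and \<Lambda>_eq: "\<Lambda> = adj V x"
    and abelian: "v \<in> V ==> w \<in> V ==> br v w \<in> N" and x_V: "v \<in> V ==> br x v \<in> V"
    and idx_V: "idx V N = q ^ d" and idx_im: "idx V (Img (br x) N V) = q ^ e"
begin

lemmas facts = complement_facts[OF quot_\<Lambda> V x \<Lambda>_eq]

lemma Img_in: "Img (br x) N V \<in> betw N V"
  by (rule Img_betw[OF facts(7) lin_right]) (use x_V br_N facts in auto)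

text \<open>Every lattice inside V is a subalgebra, which gives the Gaussian term. Adding v to x
  does not change the action on W modulo N, so for every v the condition on W + A (x + v) is
  invariance of W under ad x.\<close>

lemma num_Subalgebras: "num Subalgebras i = (if i = 0 then 0 else gb q d (i - 1)) + q ^ i * invs (br x) N V i"
proof -
  have "closed Subalgebras H" if "H \<in> betw N V" for H
    using that abelian by (auto simp: betw_def)
  hence "{H \<in> betw N V. idx V H = q ^ (i - 1) \<and> closed Subalgebras H} = {H \<in> betw N V. idx V H = q ^ (i - 1)}" by blast
  hence 1: "card {H \<in> betw N V. idx V H = q ^ (i - 1) \<and> closed Subalgebras H} = gb q d (i - 1)"
    using card_betw[OF facts(7) idx_V] by simp
  have "closed Subalgebras (adj W (x + v)) \<longleftrightarrow> br x ` W \<subseteq> W" if W: "W \<in> betw N V" and v: "v \<in> V" for W v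
  proof -
    note l = betwD[OF W(1)]
    have c: "closed Subalgebras V" "closed Subalgebras W" using abelian l facts by auto
    have vw: "br v w \<in> W" if "w \<in> W" for w using abelian[OF v, of w] that l by auto
    have "br (x + v) w \<in> V" if "w \<in> W" for w
      using x_V[of w] vw[OF that] that l lat_add[OF facts(2)] by auto
    hence "closed Subalgebras (adj W (x + v)) \<longleftrightarrow> br (x + v) ` W \<subseteq> W"
      using closed_adj[OF V x \<Lambda>_eq c(1) W v] c(2) by blast
    also have "br (x + v) w \<in> W \<longleftrightarrow> br x w \<in> W" if "w \<in> W" for w using lat_add_iff[OF l(1) vw[OF that]] by simp
    hence "br (x + v) ` W \<subseteq> W \<longleftrightarrow> br x ` W \<subseteq> W" by (auto simp del: br_add)
    finally show ?thesis .
  qed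
  from count_split_const[OF quot_\<Lambda> V x \<Lambda>_eq, of i "closed Subalgebras" "\<lambda>W. br x ` W \<subseteq> W", OF this]
  show ?thesis unfolding num_def invs_def 1 .
qed

text \<open>Inside V an ideal is a subspace invariant under ad x. An ideal containing some x + v
  contains [V, x + v], which modulo N is the image of ad x on V; so its trace on V lies above that
  image, and this suffices. The image has codimension e, whence \<open>gb q e i\<close>.\<close>

lemma num_Ideals: "num Ideals i = (if i = 0 then 0 else invs (br x) N V (i - 1)) + q ^ i * gb q e i"
proof -
  have *: "closed Ideals H \<longleftrightarrow> br x ` H \<subseteq> H" if "H \<in> betw N V" for H
  proof
    have l: "lat H" "N \<subseteq> H" "H \<subseteq> V" using that by (auto simp: betw_def)
    assume c: "br x ` H \<subseteq> H"
    have "br u h \<in> H" if uh: "u \<in> \<Lambda>" "h \<in> H" for u h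
    proof -
      obtain v a where "v \<in> V" "a \<in> A" "u = v + a \<star> x" using uh \<Lambda>_eq by (auto simp: adj_def)
      thus ?thesis using abelian[of v h] uh c l by (auto intro!: lat_add lat_scale)
    qed
    thus "closed Ideals H" by simp
  qed (use facts(6) in auto)
  have "{H \<in> betw N V. idx V H = q ^ (i - 1) \<and> closed Ideals H} = {H \<in> betw N V. idx V H = q ^ (i - 1) \<and> br x ` H \<subseteq> H}"
    using * by blast
  hence 1: "card {H \<in> betw N V. idx V H = q ^ (i - 1) \<and> closed Ideals H} = invs (br x) N V (i - 1)"
    by (simp add: invs_def)
  have Im: "br x u \<in> Img (br x) N V" if "u \<in> V" for u
  proof -
    have "br x u = br x u + 0" by simp
    thus ?thesis using that lat_zero[OF facts(1)] unfolding Img_def by blast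
  qed
  have "closed Ideals (adj W (x + v)) \<longleftrightarrow> Img (br x) N V \<subseteq> W" if W: "W \<in> betw N V" and v: "v \<in> V" for W v
  proof
    note l = betwD[OF W(1)]
    have la: "lat (adj W (x + v))" using lat_adj[OF l(1)] .
    { assume c: "closed Ideals (adj W (x + v))"
      have "br x u \<in> W" if u: "u \<in> V" for u
      proof -
        have "br u (x + v) \<in> adj W (x + v)" using c u mem_adj[OF l(1), of "x + v"] facts by (auto simp del: br_add)
        moreover have "br u v \<in> adj W (x + v)" using abelian[OF u v] l subset_adj[OF l(1), of "x + v"] by auto
        ultimately have "br u x \<in> adj W (x + v)" using lat_diff[OF la, of "br u (x + v)" "br u v"] by simp
        hence "br x u \<in> adj W (x + v)" using lat_minus[OF la] br_anti[of x u] by simp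
        thus ?thesis using complement_adj(2)[OF quot_\<Lambda> V x \<Lambda>_eq W v] x_V u l by auto
      qed
      thus "Img (br x) N V \<subseteq> W" using l by (auto simp: Img_def intro!: lat_add) }
    { assume c: "Img (br x) N V \<subseteq> W"
      have t: "br x u \<in> W" if "u \<in> V" for u using Im[OF that] c by auto
      have "br u h \<in> W" if "u \<in> \<Lambda>" "h \<in> adj W (x + v)" for u h
      proof -
        obtain w a u' b where *: "w \<in> W" "a \<in> A" "h = w + a \<star> (x + v)" "u' \<in> V" "b \<in> A" "u = u' + b \<star> x"
          using \<open>u \<in> \<Lambda>\<close> \<open>h \<in> _\<close> \<Lambda>_eq by (auto simp: adj_def)
        have "br u h = br u' w + a \<star> br u' v + a \<star> br u' x + b \<star> br x w + (b * a) \<star> br x v"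
          unfolding * by (simp add: br_self algebra_simps)
        also have "br u' x = - br x u'" by (rule br_anti)
        finally have e: "br u h = br u' w + a \<star> br u' v + a \<star> - br x u' + b \<star> br x w + (b * a) \<star> br x v" .
        have "br u' w \<in> W" "br u' v \<in> W" using abelian[of u' w] abelian[of u' v] * v l by auto
        moreover have "br x w \<in> W" "br x v \<in> W" "- br x u' \<in> W" using t * v l lat_minus[OF l(1)] by auto
        ultimately show ?thesis unfolding e using * l(1) by (intro lat_add lat_scale mult_A)
      qed
      thus "closed Ideals (adj W (x + v))" using subset_adj[OF l(1), of "x + v"] by auto }
  qed
  note 2 = count_split_const[OF quot_\<Lambda> V x \<Lambda>_eq, of i "closed Ideals" "\<lambda>W. Img (br x) N V \<subseteq> W", OF this]
  have "W \<in> betw N V \<and> Img (br x) N V \<subseteq> W \<longleftrightarrow> W \<in> betw (Img (br x) N V) V" for W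
    using Img_in by (auto simp: betw_def)
  hence "{W \<in> betw N V. idx V W = q ^ i \<and> Img (br x) N V \<subseteq> W} = {W \<in> betw (Img (br x) N V) V. idx V W = q ^ i}" by blast
  hence "card {W \<in> betw N V. idx V W = q ^ i \<and> Img (br x) N V \<subseteq> W} = gb q e i"
    using card_betw[OF quot_upper[OF facts(7) Img_in] idx_im] by simp
  thus ?thesis using 2 unfolding num_def 1 by simp
qed

end

subsection \<open>The plane with the identity and a second commuting operator\<close>

text \<open>Modulo N, x acts on the plane V as the identity, y preserves V and commutes with x, and
  \<open>nonscalar\<close> says that no combination y - a x kills V.\<close>

locale plane_pencil = lie_lattice A M scale br N \<Lambda>
  for A M :: "'k::field set" and scale :: "'k => 'v::ab_group_add => 'v" (infixr \<open>\<star>\<close> 75)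
    and br N \<Lambda> +
  fixes U V x y
  assumes U: "U \<in> betw N \<Lambda>" and V: "V \<in> betw N U" and x: "x \<notin> V" and y: "y \<notin> U"
    and U_eq: "U = adj V x" and \<Lambda>_eq: "\<Lambda> = adj U y"
    and abelian: "v \<in> V ==> w \<in> V ==> br v w \<in> N" and x_V: "v \<in> V ==> br x v - v \<in> N"
    and y_V: "v \<in> V ==> br y v \<in> V" and commute: "br x y \<in> N" and idx_V: "idx V N = q ^ 2"
    and nonscalar: "a \<in> A ==> \<exists>v\<in>V. br y v - a \<star> v \<notin> N"
begin

lemma quots: "quot N \<Lambda>" "quot N U" "quot N V"
  using quot_lower quot_\<Lambda> U V by blast+

lemmas lats = quotD(1,2,3)[OF quots(2)] quotD(2,3)[OF quots(3)]

lemma sub: "V \<subseteq> U" "U \<subseteq> \<Lambda>" "x \<in> U" "y \<in> \<Lambda>"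
  using U V complement_facts[OF quots(2) V x U_eq] complement_facts[OF quots(1) U y \<Lambda>_eq] by (auto simp: betw_def)

lemma T_facts: "br y ` V \<subseteq> V" "br y ` N \<subseteq> N"
  using y_V br_N sub by auto


text \<open>The bracket on U modulo N in coordinates. It shows that the bracket of two elements of U
  is a combination of these two, so that every lattice in U is a subalgebra.\<close>

lemma br_U:
  assumes "v \<in> V" "a \<in> A" "w \<in> V" "b \<in> A"
  shows "br (v + a \<star> x) (w + b \<star> x) - (a \<star> w - b \<star> v) \<in> N"
proof -
  have "br (v + a \<star> x) (w + b \<star> x) = br v w + a \<star> br x w + b \<star> br v x" by (simp add: br_self)
  also have "br v x = - br x v" by (rule br_anti)
  also have "br v w + a \<star> br x w + b \<star> - br x v - (a \<star> w - b \<star> v) = br v w + (a \<star> (br x w - w) - b \<star> (br x v - v))"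
    by (simp add: algebra_simps)
  finally have e: "br (v + a \<star> x) (w + b \<star> x) - (a \<star> w - b \<star> v) = br v w + (a \<star> (br x w - w) - b \<star> (br x v - v))" .
  show ?thesis unfolding e
    by (rule lat_add[OF lats(1) abelian[OF assms(1,3)] lat_diff[OF lats(1) lat_scale[OF lats(1) assms(2) x_V[OF assms(3)]]
      lat_scale[OF lats(1) assms(4) x_V[OF assms(1)]]]])
qed

lemma lower_closed:
  assumes "W \<in> betw N U" shows "closed Subalgebras W"
proof -
  have l: "lat W" "N \<subseteq> W" "W \<subseteq> U" using assms by (auto simp: betw_def)
  have "br g h \<in> W" if gh: "g \<in> W" "h \<in> W" for g h
  proof -
    have "g \<in> adj V x" "h \<in> adj V x" using gh l U_eq by auto
    then obtain v a w b where *: "v \<in> V" "a \<in> A" "g = v + a \<star> x" "w \<in> V" "b \<in> A" "h = w + b \<star> x"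
      by (auto simp: adj_def)
    have "a \<star> w - b \<star> v = a \<star> h - b \<star> g" using * by (simp add: algebra_simps mult.commute)
    hence "a \<star> w - b \<star> v \<in> W" using lat_diff[OF l(1) lat_scale[OF l(1)] lat_scale[OF l(1)]] gh * by metis
    moreover have "br g h - (a \<star> w - b \<star> v) \<in> W" using br_U[of v a w b] * l by auto
    ultimately show ?thesis using lat_diff_iff[OF l(1)] by blast
  qed
  thus ?thesis by simp
qed

lemma y_U: assumes "w \<in> U" shows "br y w \<in> U"
proof -
  obtain v a where *: "v \<in> V" "a \<in> A" "w = v + a \<star> x" using assms U_eq by (auto simp: adj_def)
  have "br y x = - br x y" by (rule br_anti)
  hence "br y x \<in> N" using commute lat_minus[OF lats(1)] by simp
  thus ?thesis using * y_V sub lats by (auto intro!: lat_add lat_scale)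
qed

lemma closed_upper:
  assumes W: "W \<in> betw N U" and u: "u \<in> U"
  shows "closed Subalgebras (adj W (y + u)) \<longleftrightarrow> br (y + u) ` W \<subseteq> W"
proof -
  have "br (y + u) w \<in> U" if "w \<in> W" for w
    using y_U[of w] lower_closed[OF betw_ends(2)[OF quots(2)]] that u W lat_add[OF lats(2)] by (auto simp: betw_def)
  thus ?thesis using closed_adj[OF U y \<Lambda>_eq lower_closed[OF betw_ends(2)[OF quots(2)]] W u] lower_closed[OF W] by blast
qed

text \<open>Elements of U act on V as scalars modulo N, so adding u to y does not affect whether W
  is preserved; either all cosets qualify or none.\<close>

lemma fibre_below:
  assumes "W \<in> betw N V"
  shows "card {c \<in> cosets U W. \<exists>u\<in>c. closed Subalgebras (adj W (y + u))} = (if br y ` W \<subseteq> W then idx U W else 0)"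
proof -
  have l: "lat W" "N \<subseteq> W" "W \<subseteq> V" using assms by (auto simp: betw_def)
  have W: "W \<in> betw N U" using assms sub by (auto simp: betw_def)
  have *: "br (y + u) ` W \<subseteq> W \<longleftrightarrow> br y ` W \<subseteq> W" if u: "u \<in> U" for u
  proof -
    obtain v a where ua: "v \<in> V" "a \<in> A" "u = v + a \<star> x" using u U_eq by (auto simp: adj_def)
    have "br u w \<in> W" if "w \<in> W" for w
    proof -
      have "br u w - (a \<star> w - 0 \<star> v) \<in> W" using br_U[of v a w 0] ua that l zero_A by auto
      moreover have "a \<star> w - 0 \<star> v \<in> W" using ua that l lat_scale by simp
      ultimately show ?thesis using lat_diff_iff[OF l(1)] by blast
    qed
    hence "br (y + u) w \<in> W \<longleftrightarrow> br y w \<in> W" if "w \<in> W" for w using lat_add_iff[OF l(1)] that by simp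
    thus ?thesis by (auto simp del: br_add)
  qed
  have "c \<subseteq> U \<and> c \<noteq> {}" if "c \<in> cosets U W" for c
    using that W lat_add[OF lats(2)] l lat_zero[OF l(1)] by (auto simp: cosets_def betw_def)
  moreover have "closed Subalgebras (adj W (y + u)) \<longleftrightarrow> br y ` W \<subseteq> W" if "u \<in> U" for u
    using closed_upper[OF W that] *[OF that] by metis
  ultimately have "(\<exists>u\<in>c. closed Subalgebras (adj W (y + u))) \<longleftrightarrow> br y ` W \<subseteq> W" if "c \<in> cosets U W" for c
    using that by (metis all_not_in_conv subsetD)
  hence "{c \<in> cosets U W. \<exists>u\<in>c. closed Subalgebras (adj W (y + u))} = (if br y ` W \<subseteq> W then cosets U W else {})" by (auto simp del: closed.simps)
  thus ?thesis by (simp add: idx_def)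
qed

text \<open>W contains some x + v0, and the bracket of y + u with it is [y, v0] - u modulo W. So u
  is determined modulo W, and exactly one coset qualifies if ad y preserves the trace of W on
  V.\<close>

lemma fibre_not_below:
  assumes W: "W \<in> betw N U" and nW: "\<not> W \<subseteq> V"
  shows "card {c \<in> cosets U W. \<exists>u\<in>c. closed Subalgebras (adj W (y + u))} = (if br y ` (W \<inter> V) \<subseteq> W \<inter> V then 1 else 0)"
proof -
  note l = betwD[OF W(1)]
  obtain v0 where v0: "v0 \<in> V" "W = adj (W \<inter> V) (x + v0)"
    using complement_adj_exhaust[OF quots(2) V x U_eq W nW] by blast
  define W2 where "W2 = W \<inter> V"
  have l2: "lat W2" "N \<subseteq> W2" "W2 \<subseteq> V" "W2 \<subseteq> W" using l lats by (auto simp: W2_def lat_Int)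
  have xv0: "x + v0 \<in> W" using mem_adj[OF l2(1), of "x + v0"] v0 by (simp add: W2_def)
  have inW: "h \<in> W \<longleftrightarrow> h \<in> W2" if "h \<in> V" for h using that by (simp add: W2_def)
  have uW: "br u w \<in> W2" if u: "u \<in> U" and w: "w \<in> W2" for u w
  proof -
    obtain v a where ua: "v \<in> V" "a \<in> A" "u = v + a \<star> x" using u U_eq by (auto simp: adj_def)
    have "br u w - (a \<star> w - 0 \<star> v) \<in> W2" using br_U[of v a w 0] ua w l2 zero_A by auto
    moreover have "a \<star> w - 0 \<star> v \<in> W2" using ua w l2 lat_scale by simp
    ultimately show ?thesis using lat_diff_iff[OF l2(1)] by blast
  qed
  \<comment> \<open>With u = v + a x, the bracket [u, x + v0] is a v0 - v = a (x + v0) - u modulo N,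
    and x + v0 is in W.\<close>
  have key: "br (y + u) (x + v0) \<in> W \<longleftrightarrow> br y v0 - u \<in> W" if u: "u \<in> U" for u
  proof -
    obtain v a where ua: "v \<in> V" "a \<in> A" "u = v + a \<star> x" using u U_eq by (auto simp: adj_def)
    have "br y x = - br x y" by (rule br_anti)
    hence "br y x \<in> W" using commute lat_minus[OF lats(1)] l by auto
    moreover have b: "br u (x + v0) - (a \<star> v0 - v) \<in> W" using br_U[of v a v0 1] ua v0 l one_A by (auto simp: add.commute)
    ultimately have "br y x + (br u (x + v0) - (a \<star> v0 - v)) \<in> W" using lat_add[OF l(1)] by blast
    moreover have "a \<star> (x + v0) \<in> W" using xv0 ua l lat_scale by blast
    ultimately have "(br y x + (br u (x + v0) - (a \<star> v0 - v))) + a \<star> (x + v0) \<in> W" using lat_add[OF l(1)] by blast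
    moreover have "br (y + u) (x + v0) - (br y v0 - u) = (br y x + (br u (x + v0) - (a \<star> v0 - v))) + a \<star> (x + v0)"
      using ua by (simp add: algebra_simps)
    ultimately have d: "br (y + u) (x + v0) - (br y v0 - u) \<in> W" by (simp only:)
    have e: "br (y + u) (x + v0) = (br (y + u) (x + v0) - (br y v0 - u)) + (br y v0 - u)" by simp
    show ?thesis
      using lat_add[OF l(1) d, of "br y v0 - u"] lat_diff[OF l(1) _ d, of "br (y + u) (x + v0)"] e
      by (metis diff_diff_eq2 add_diff_cancel_left')
  qed
  have P: "br (y + u) ` W \<subseteq> W \<longleftrightarrow> br y ` W2 \<subseteq> W2 \<and> br y v0 - u \<in> W" if u: "u \<in> U" for u
  proof
    assume c: "br (y + u) ` W \<subseteq> W"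
    have "br y w \<in> W2" if w: "w \<in> W2" for w
    proof -
      have "br (y + u) w \<in> W" using c w l2 by blast
      moreover have "br u w \<in> W" using uW[OF u w] l2 by auto
      ultimately have "br y w \<in> W" using lat_add_iff[OF l(1)] by simp
      thus ?thesis using inW y_V w l2 by blast
    qed
    thus "br y ` W2 \<subseteq> W2 \<and> br y v0 - u \<in> W" using key[OF u] c xv0 by blast
  next
    assume c: "br y ` W2 \<subseteq> W2 \<and> br y v0 - u \<in> W"
    have "br (y + u) h \<in> W" if "h \<in> W" for h
    proof -
      obtain w b where wb: "w \<in> W2" "b \<in> A" "h = w + b \<star> (x + v0)"
        using \<open>h \<in> W\<close> v0 unfolding adj_def W2_def by blast
      have "br (y + u) h = br y w + br u w + b \<star> br (y + u) (x + v0)" using wb(3) by (simp add: algebra_simps)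
      moreover have "br y w \<in> W" "br u w \<in> W" using c wb uW[OF u wb(1)] l2 by auto
      moreover have "br (y + u) (x + v0) \<in> W" using key[OF u] c by blast
      ultimately show ?thesis using wb l(1) by (metis lat_add lat_scale)
    qed
    thus "br (y + u) ` W \<subseteq> W" by blast
  qed
  have yv: "br y v0 \<in> U" using y_V v0 sub by auto
  show ?thesis
  proof (cases "br y ` W2 \<subseteq> W2")
    case True
    have "{c \<in> cosets U W. \<exists>u\<in>c. closed Subalgebras (adj W (y + u))} = {(+) (br y v0) ` W}"
    proof (intro equalityI subsetI)
      fix c assume "c \<in> {c \<in> cosets U W. \<exists>u\<in>c. closed Subalgebras (adj W (y + u))}"
      then obtain r u where c: "r \<in> U" "c = (+) r ` W" "u \<in> c" "closed Subalgebras (adj W (y + u))" by (auto simp: cosets_def)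
      then obtain w where w: "w \<in> W" "u = r + w" by auto
      hence u: "u \<in> U" using c l lat_add[OF lats(2)] by auto
      have "br y v0 - u \<in> W" using closed_upper[OF W u] P[OF u] c by blast
      hence "br y v0 - u + w \<in> W" using lat_add[OF l(1)] w by blast
      hence "br y v0 - r \<in> W" using w by simp
      thus "c \<in> {(+) (br y v0) ` W}" using coset_eq_iff[OF lat_addgrp[OF l(1)]] c by blast
    next
      fix c assume c: "c \<in> {(+) (br y v0) ` W}"
      have "br y v0 \<in> c" using c lat_zero[OF l(1)] by (metis add.right_neutral image_eqI singletonD)
      moreover have "closed Subalgebras (adj W (y + br y v0))"
        using closed_upper[OF W yv] P[OF yv] True lat_zero[OF l(1)] by simp
      ultimately show "c \<in> {c \<in> cosets U W. \<exists>u\<in>c. closed Subalgebras (adj W (y + u))}"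
        using c yv unfolding cosets_def by blast
    qed
    thus ?thesis using True by (simp add: W2_def)
  next
    case False
    have "\<not> closed Subalgebras (adj W (y + u))" if "u \<in> c" "c \<in> cosets U W" for u c
    proof -
      have "u \<in> U" using that l lat_add[OF lats(2)] by (auto simp: cosets_def)
      thus ?thesis using closed_upper[OF W] P False by blast
    qed
    hence "{c \<in> cosets U W. \<exists>u\<in>c. closed Subalgebras (adj W (y + u))} = {}" by blast
    thus ?thesis using False by (simp only: card.empty W2_def if_False)
  qed
qed

text \<open>All lattices inside U count. For the others the trace W on U has codimension i. An
  invariant W inside V contributes q^i; a W not inside V contributes 1 if its trace on V is
  invariant, but q^i such W share the same trace.\<close>

lemma num_Subalgebras:
  "num Subalgebras i = (if i = 0 then 0 else gb q 3 (i - 1)) +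
     q ^ i * ((if i = 0 then 0 else invs (br y) N V (i - 1)) + invs (br y) N V i)"
proof -
  have iU: "idx U N = q ^ 3"
    using idx_mult[OF quots(2) V] complement_facts(8)[OF quots(2) V x U_eq] idx_V by (simp add: eval_nat_numeral)
  have "{H \<in> betw N U. idx U H = q ^ (i - 1) \<and> closed Subalgebras H} = {H \<in> betw N U. idx U H = q ^ (i - 1)}"
    using lower_closed by blast
  hence 1: "card {H \<in> betw N U. idx U H = q ^ (i - 1) \<and> closed Subalgebras H} = gb q 3 (i - 1)"
    using card_betw[OF quots(2) iU] by simp
  let ?S = "{W \<in> betw N U. idx U W = q ^ i}"
  have fin: "finite ?S" using finite_betw[OF quots(2)] by simp
  have "(\<Sum>W\<in>?S. card {c \<in> cosets U W. \<exists>v\<in>c. closed Subalgebras (adj W (y + v))}) =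
    (\<Sum>W\<in>?S. (if W \<subseteq> V \<and> br y ` W \<subseteq> W then q ^ i else 0) + (if \<not> W \<subseteq> V \<and> br y ` (W \<inter> V) \<subseteq> W \<inter> V then 1 else 0))"
  proof (rule sum.cong[OF refl])
    fix W assume W: "W \<in> ?S"
    show "card {c \<in> cosets U W. \<exists>v\<in>c. closed Subalgebras (adj W (y + v))} =
      (if W \<subseteq> V \<and> br y ` W \<subseteq> W then q ^ i else 0) + (if \<not> W \<subseteq> V \<and> br y ` (W \<inter> V) \<subseteq> W \<inter> V then 1 else 0)"
      using fibre_below[of W] fibre_not_below[of W] W by (cases "W \<subseteq> V") (auto simp: betw_def)
  qed
  also have "\<dots> = q ^ i * card {W \<in> ?S. W \<subseteq> V \<and> br y ` W \<subseteq> W} + card {W \<in> ?S. \<not> W \<subseteq> V \<and> br y ` (W \<inter> V) \<subseteq> W \<inter> V}"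
    using fin by (simp add: sum.distrib sum.If_cases Int_def)
  also have "{W \<in> ?S. W \<subseteq> V \<and> br y ` W \<subseteq> W} = {W \<in> betw N U. idx U W = q ^ i \<and> W \<subseteq> V \<and> br y ` W \<subseteq> W}" by auto
  also have "card \<dots> = (if i = 0 then 0 else invs (br y) N V (i - 1))"
    unfolding count_below[OF quots(2) V x U_eq] invs_def ..
  also have "{W \<in> ?S. \<not> W \<subseteq> V \<and> br y ` (W \<inter> V) \<subseteq> W \<inter> V} = {W \<in> betw N U. idx U W = q ^ i \<and> \<not> W \<subseteq> V \<and> br y ` (W \<inter> V) \<subseteq> W \<inter> V}" by auto
  \<comment> \<open>The count of all W with invariant trace on V comes from
    \<open>count_split_const\<close>; those inside V are then subtracted.\<close>
  also have "card \<dots> = q ^ i * invs (br y) N V i"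
  proof -
    have "br y ` (H \<inter> V) \<subseteq> H \<inter> V \<longleftrightarrow> br y ` W \<subseteq> W" if "H = adj W (x + v)" "W \<in> betw N V" "v \<in> V" for H W v
      using complement_adj(2)[OF quots(2) V x U_eq that(2,3)] that(1) by simp
    hence "card {W \<in> betw N U. idx U W = q ^ i \<and> br y ` (W \<inter> V) \<subseteq> W \<inter> V} =
      (if i = 0 then 0 else card {H \<in> betw N V. idx V H = q ^ (i - 1) \<and> br y ` (H \<inter> V) \<subseteq> H \<inter> V}) +
      q ^ i * card {W \<in> betw N V. idx V W = q ^ i \<and> br y ` W \<subseteq> W}"
      by (intro count_split_const[OF quots(2) V x U_eq]) blast
    moreover have "{W \<in> betw N U. idx U W = q ^ i \<and> br y ` (W \<inter> V) \<subseteq> W \<inter> V} =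
      {W \<in> betw N U. idx U W = q ^ i \<and> W \<subseteq> V \<and> br y ` (W \<inter> V) \<subseteq> W \<inter> V} \<union>
      {W \<in> betw N U. idx U W = q ^ i \<and> \<not> W \<subseteq> V \<and> br y ` (W \<inter> V) \<subseteq> W \<inter> V}" by blast
    moreover have "card ({W \<in> betw N U. idx U W = q ^ i \<and> W \<subseteq> V \<and> br y ` (W \<inter> V) \<subseteq> W \<inter> V} \<union>
      {W \<in> betw N U. idx U W = q ^ i \<and> \<not> W \<subseteq> V \<and> br y ` (W \<inter> V) \<subseteq> W \<inter> V}) =
      card {W \<in> betw N U. idx U W = q ^ i \<and> W \<subseteq> V \<and> br y ` (W \<inter> V) \<subseteq> W \<inter> V} +
      card {W \<in> betw N U. idx U W = q ^ i \<and> \<not> W \<subseteq> V \<and> br y ` (W \<inter> V) \<subseteq> W \<inter> V}"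
      by (rule card_Un_disjoint) (use finite_betw[OF quots(2)] in auto)
    ultimately show ?thesis unfolding count_below[OF quots(2) V x U_eq] invs_def by (simp split: if_splits)
  qed
  finally show ?thesis using count_split[OF quots(1) U y \<Lambda>_eq, of i "closed Subalgebras"] 1
    unfolding num_def by (simp add: algebra_simps split: if_splits)
qed

end

section \<open>Ideals of the plane pencil\<close>

context plane_pencil
begin

lemma \<Lambda>_decomp:
  assumes "g \<in> \<Lambda>"
  obtains v c e where "v \<in> V" "c \<in> A" "e \<in> A" "g = (v + c \<star> x) + e \<star> y"
proof -
  obtain u e where "u \<in> U" "e \<in> A" "g = u + e \<star> y" using assms \<Lambda>_eq by (auto simp: adj_def)
  moreover from this obtain v c where "v \<in> V" "c \<in> A" "u = v + c \<star> x" using U_eq by (auto simp: adj_def)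
  ultimately show ?thesis using that by blast
qed

lemma br_Ux:
  assumes W: "lat W" "N \<subseteq> W" "w \<in> W" "w \<in> V" "u \<in> U" shows "br u w \<in> W"
proof -
  obtain v a where ua: "v \<in> V" "a \<in> A" "u = v + a \<star> x" using assms U_eq by (auto simp: adj_def)
  have "br u w - (a \<star> w - 0 \<star> v) \<in> W" using br_U[of v a w 0] ua W zero_A by auto
  moreover have "a \<star> w - 0 \<star> v \<in> W" using ua W lat_scale by simp
  ultimately show ?thesis using lat_diff_iff[OF W(1)] by blast
qed

lemma lower_ideal:
  assumes "H \<in> betw N V" shows "closed Ideals H \<longleftrightarrow> br y ` H \<subseteq> H"
proof
  have l: "lat H" "N \<subseteq> H" "H \<subseteq> V" using assms by (auto simp: betw_def)
  assume c: "br y ` H \<subseteq> H"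
  have "br g h \<in> H" if g: "g \<in> \<Lambda>" and h: "h \<in> H" for g h
  proof -
    obtain u e where *: "u \<in> U" "e \<in> A" "g = u + e \<star> y" using g \<Lambda>_eq by (auto simp: adj_def)
    have "br u h \<in> H" using br_Ux[OF l(1,2) h _ *(1)] h l by auto
    moreover have "br y h \<in> H" using c h by auto
    ultimately show ?thesis using * l(1) lat_add lat_scale by simp
  qed
  thus "closed Ideals H" by simp
qed (use sub in auto)

text \<open>An ideal inside U that contains some x + v contains [V, x + v], which is V modulo N,
  hence is all of U. The ideals inside V are the subspaces invariant under ad y, as x acts there as
  the identity; their codimension in U is one more than in V.\<close>

lemma card_lower_ideals:
  "card {H \<in> betw N U. idx U H = q ^ j \<and> closed Ideals H} = (if j = 0 then 1 else invs (br y) N V (j - 1))"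
proof -
  have "closed Ideals (adj W (x + v)) \<longleftrightarrow> W = V" if W: "W \<in> betw N V" and v: "v \<in> V" for W v
  proof
    note l = betwD[OF W(1)]
    let ?H = "adj W (x + v)"
    have lH: "lat ?H" "W \<subseteq> ?H" "x + v \<in> ?H" "?H \<inter> V = W"
      using lat_adj[OF l(1)] subset_adj[OF l(1)] mem_adj[OF l(1)] complement_adj(2)[OF quots(2) V x U_eq W v] by auto
    { assume c: "closed Ideals ?H"
      have "v' \<in> W" if v': "v' \<in> V" for v'
      proof -
        have "br v' (x + v) \<in> ?H" using c lH v' sub by (auto simp del: br_add)
        moreover have "br (v' + 0 \<star> x) (v + 1 \<star> x) - (0 \<star> v - 1 \<star> v') \<in> N" using br_U[OF v' zero_A v one_A] .
        hence "br v' (x + v) + v' \<in> ?H" using l lH by (auto simp: add.commute)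
        ultimately have "v' \<in> ?H" using lat_diff[OF lH(1), of "br v' (x + v) + v'" "br v' (x + v)"] by simp
        thus ?thesis using lH v' by blast
      qed
      thus "W = V" using l by blast }
    { assume "W = V"
      hence H: "?H = U"
        using complement_adj_exhaust[OF quots(2) V x U_eq betw_ends(2)[OF quots(2)]] sub x
          complement_adj_eq_iff[OF quots(2) V x U_eq betw_ends(2)[OF quots(3)] v] lat_diff[OF lats(4) v]
        by (metis inf.absorb2 subsetD)
      have "br g h \<in> U" if g: "g \<in> \<Lambda>" and h: "h \<in> U" for g h
      proof -
        obtain u e where *: "u \<in> U" "e \<in> A" "g = u + e \<star> y" using g \<Lambda>_eq by (auto simp: adj_def)
        have "br u h \<in> U" using lower_closed[OF betw_ends(2)[OF quots(2)]] * h by auto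
        thus ?thesis using * y_U[OF h] lats(2) lat_add lat_scale by simp
      qed
      thus "closed Ideals ?H" using H by simp }
  qed
  note c = count_split_const[OF quots(2) V x U_eq, of j "closed Ideals" "\<lambda>W. W = V", OF this]
  have "{W \<in> betw N V. idx V W = q ^ j \<and> W = V} = (if j = 0 then {V} else {})"
    using idx_0_iff[OF quots(3) betw_ends(2)[OF quots(3)]] betw_ends(2)[OF quots(3)] q_power_eq_iff[of 0 j] idx_self[OF lats(4)]
    by auto
  hence 1: "card {W \<in> betw N V. idx V W = q ^ j \<and> W = V} = (if j = 0 then 1 else 0)" by simp
  have "{H \<in> betw N V. idx V H = q ^ (j - 1) \<and> closed Ideals H} = {H \<in> betw N V. idx V H = q ^ (j - 1) \<and> br y ` H \<subseteq> H}"
    using lower_ideal by blast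
  thus ?thesis using c 1 by (simp add: invs_def del: closed.simps)
qed

text \<open>Modulo N, the bracket of x with y + v' + a x is v', and the bracket of v with it is
  -([y, v] + a v). These lie in V, so the ideal condition forces them into W. Elements of V and x
  preserve W by themselves; ad y has to be required to do so.\<close>

lemma upper_ideal:
  assumes W: "W \<in> betw N V" and u: "v' \<in> V" "a \<in> A"
  shows "closed Ideals (adj W (y + (v' + a \<star> x))) \<longleftrightarrow> (br y ` W \<subseteq> W \<and> v' \<in> W \<and> (\<forall>v\<in>V. br y v + a \<star> v \<in> W))"
proof -
  define u where "u = v' + a \<star> x"
  note l = betwD[OF W(1)]
  have WU: "W \<in> betw N U" using W sub by (auto simp: betw_def)
  have uU: "u \<in> U" using assms sub lats by (auto simp: u_def intro!: lat_add lat_scale)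
  let ?H = "adj W (y + u)"
  have lH: "lat ?H" "W \<subseteq> ?H" "y + u \<in> ?H" "?H \<inter> U = W"
    using lat_adj[OF l(1)] subset_adj[OF l(1)] mem_adj[OF l(1)] complement_adj(2)[OF quots(1) U y \<Lambda>_eq WU uU] by auto
  have W_eq: "h \<in> ?H \<longleftrightarrow> h \<in> W" if "h \<in> V" for h using lH that sub by blast
  have bx: "br x (y + u) \<in> W \<longleftrightarrow> v' \<in> W" and bx': "br x (y + u) \<in> V"
  proof -
    have e: "br x (y + u) = v' + (br x y + (br x v' - v'))" by (simp add: u_def br_self)
    have n: "br x y + (br x v' - v') \<in> N" using commute x_V[OF assms(2)] lat_add[OF lats(1)] by blast
    show "br x (y + u) \<in> W \<longleftrightarrow> v' \<in> W" unfolding e using lat_add_iff[OF l(1)] n l by blast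
    show "br x (y + u) \<in> V" unfolding e using lat_add[OF lats(4) assms(2)] n l by blast
  qed
  have bv: "br v (y + u) \<in> W \<longleftrightarrow> br y v + a \<star> v \<in> W" and bv': "br v (y + u) \<in> V" if v: "v \<in> V" for v
  proof -
    have 1: "br v x = - br x v" "br v y = - br y v" by (rule br_anti)+
    have e: "br v (y + u) = - (br y v + a \<star> v) + (br v v' - a \<star> (br x v - v))"
      by (simp add: u_def 1 scale_right_diff_distrib)
    have n: "br v v' - a \<star> (br x v - v) \<in> N" using abelian[OF v assms(2)] x_V[OF v] assms(3) lat_diff[OF lats(1)] lat_scale[OF lats(1)] by blast
    have m: "br y v + a \<star> v \<in> V" using y_V[OF v] v assms(3) lat_add[OF lats(4)] lat_scale[OF lats(4)] by blast
    have "- (br y v + a \<star> v) \<in> W \<longleftrightarrow> br y v + a \<star> v \<in> W"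
      using lat_minus[OF l(1), of "br y v + a \<star> v"] lat_minus[OF l(1), of "- (br y v + a \<star> v)"]
      unfolding minus_minus by blast
    thus "br v (y + u) \<in> W \<longleftrightarrow> br y v + a \<star> v \<in> W" unfolding e using lat_add_iff[OF l(1)] n l by blast
    show "br v (y + u) \<in> V" unfolding e using lat_add[OF lats(4) lat_minus[OF lats(4) m]] n l by blast
  qed
  show ?thesis
  proof
    assume "closed Ideals (adj W (y + (v' + a \<star> x)))"
    hence c: "br g h \<in> ?H" if "g \<in> \<Lambda>" "h \<in> ?H" for g h using that by (simp add: u_def)
    have "br y w \<in> W" if w: "w \<in> W" for w
    proof -
      have "br y w \<in> ?H" "br y w \<in> V" using c[OF sub(4), of w] w lH(2) y_V[of w] l by blast+
      thus ?thesis using W_eq by blast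
    qed
    moreover have "br x (y + u) \<in> W" using c[of x "y + u"] W_eq[OF bx'] lH sub by auto
    moreover have "br v (y + u) \<in> W" if "v \<in> V" for v using c[of v "y + u"] W_eq[OF bv'[OF that]] lH sub that by auto
    ultimately show "br y ` W \<subseteq> W \<and> v' \<in> W \<and> (\<forall>v\<in>V. br y v + a \<star> v \<in> W)" using bx bv by blast
  next
    assume c: "br y ` W \<subseteq> W \<and> v' \<in> W \<and> (\<forall>v\<in>V. br y v + a \<star> v \<in> W)"
    have yW: "br y w \<in> W" if "w \<in> W" for w using c that by blast
    have "br y (y + u) \<in> W"
    proof -
      have "br y x = - br x y" by (rule br_anti)
      hence "br y x \<in> W" using commute lat_minus[OF lats(1)] l by auto
      moreover have "br y (y + u) = br y v' + a \<star> br y x" by (simp add: br_self u_def)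
      ultimately show ?thesis using yW c assms(3) l(1) lat_add lat_scale by metis
    qed
    hence "br g (y + u) \<in> W" if g: "g \<in> \<Lambda>" for g
    proof -
      obtain v c' e where *: "v \<in> V" "c' \<in> A" "e \<in> A" "g = (v + c' \<star> x) + e \<star> y" using \<Lambda>_decomp[OF g] .
      have "br g (y + u) = br v (y + u) + c' \<star> br x (y + u) + e \<star> br y (y + u)" unfolding * by (simp add: algebra_simps)
      moreover have "br v (y + u) \<in> W" "br x (y + u) \<in> W" using bx bv[OF *(1)] c * by blast+
      ultimately show ?thesis using \<open>br y (y + u) \<in> W\<close> * l(1) lat_add lat_scale by metis
    qed
    moreover have "br g w \<in> W" if "g \<in> \<Lambda>" "w \<in> W" for g w
    proof -
      obtain r e where *: "r \<in> U" "e \<in> A" "g = r + e \<star> y" using \<open>g \<in> \<Lambda>\<close> \<Lambda>_eq by (auto simp: adj_def)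
      have "br r w \<in> W" using br_Ux[OF l(1,2) \<open>w \<in> W\<close> _ *(1)] that l by auto
      thus ?thesis using * yW[OF \<open>w \<in> W\<close>] l(1) lat_add lat_scale by simp
    qed
    ultimately have "br g h \<in> W" if gh: "g \<in> \<Lambda>" "h \<in> ?H" for g h
    proof -
      obtain w b where "w \<in> W" "b \<in> A" "h = w + b \<star> (y + u)" using gh(2) by (auto simp: adj_def)
      thus ?thesis using \<open>\<And>g. g \<in> \<Lambda> ==> br g (y + u) \<in> W\<close>[OF gh(1)] \<open>\<And>g w. g \<in> \<Lambda> ==> w \<in> W ==> br g w \<in> W\<close>[OF gh(1)]
        l(1) lat_add lat_scale br_add(1)[of g w "b \<star> (y + u)"] br_scale(1)[of g b "y + u"] by metis
    qed
    thus "closed Ideals (adj W (y + (v' + a \<star> x)))" using lH by (auto simp: u_def[symmetric])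
  qed
qed

text \<open>If W is not inside V, the ideal would contain V and x, hence W = U. For W = V the
  conditions on u are automatic. For an invariant hyperplane W of V, ad y acts on V / W as a scalar
  \<mu>, which forces a = -\<mu> modulo M and v' in W: one coset. A W that is not invariant fails at
  once, and W = N would make ad y a scalar modulo N, against \<open>nonscalar\<close>.\<close>

lemma fibre_ideal:
  assumes W: "W \<in> betw N U" "idx U W = q ^ i" "i \<noteq> 0"
  shows "card {c \<in> cosets U W. \<exists>u\<in>c. closed Ideals (adj W (y + u))} =
    (if W = V then q else if W \<subseteq> V \<and> idx V W = q \<and> br y ` W \<subseteq> W then 1 else 0)"
proof -
  note l = betwD[OF W(1)]
  let ?C = "{c \<in> cosets U W. \<exists>u\<in>c. closed Ideals (adj W (y + u))}"
  have cU: "u \<in> U" if "u \<in> c" "c \<in> cosets U W" for u c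
    using that l lat_add[OF lats(2)] by (auto simp: cosets_def)
  have coset: "c = (+) u ` W" if uc: "u \<in> c" "c \<in> cosets U W" for u c
  proof -
    obtain r w where "r \<in> U" "c = (+) r ` W" "w \<in> W" "u = r + w" using uc by (auto simp: cosets_def)
    thus ?thesis using coset_eq_iff[OF lat_addgrp[OF l(1)], of u r] by simp
  qed
  have selfc: "u \<in> (+) u ` W" for u using lat_zero[OF l(1)] by (metis add.right_neutral image_eqI)
  show ?thesis
  proof (cases "W \<subseteq> V")
    case False
    have "\<not> closed Ideals (adj W (y + u))" if u: "u \<in> U" for u
    proof
      let ?H = "adj W (y + u)"
      assume c: "closed Ideals ?H"
      have lH: "lat ?H" "W \<subseteq> ?H" "?H \<inter> U = W"
        using lat_adj[OF l(1)] subset_adj[OF l(1)] complement_adj(2)[OF quots(1) U y \<Lambda>_eq W(1) u] by auto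
      obtain v0 where v0: "v0 \<in> V" "W = adj (W \<inter> V) (x + v0)"
        using complement_adj_exhaust[OF quots(2) V x U_eq W(1) False] by blast
      have xv0: "x + v0 \<in> W" using v0(2) mem_adj[OF lat_Int[OF l(1) lats(4)], of "x + v0"] by simp
      have VW: "v' \<in> W" if v': "v' \<in> V" for v'
      proof -
        have "br v' (x + v0) \<in> ?H" using c lH(2) xv0 v' sub(1,2) unfolding closed.simps by blast
        moreover have "br (v' + 0 \<star> x) (v0 + 1 \<star> x) - (0 \<star> v0 - 1 \<star> v') \<in> N" using br_U[OF v' zero_A v0(1) one_A] .
        hence "br v' (x + v0) + v' \<in> ?H" using l lH by (auto simp: add.commute)
        ultimately have "v' \<in> ?H" using lat_diff[OF lH(1), of "br v' (x + v0) + v'" "br v' (x + v0)"] by simp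
        thus ?thesis using lH v' sub by blast
      qed
      have "x \<in> W" using lat_diff[OF l(1) xv0 VW[OF v0(1)]] by simp
      hence "U \<subseteq> W" using adj_subset[OF l(1), of V x] VW U_eq by blast
      hence "W = U" using l by blast
      thus False using W idx_self[OF lats(2)] q_power_eq_iff[of 0 i] by simp
    qed
    hence "?C = {}" using cU by blast
    thus ?thesis using False by (simp only: card.empty) auto
  next
    case True
    hence WV: "W \<in> betw N V" using l by (auto simp: betw_def)
    show ?thesis
    proof (cases "W = V")
      case WeqV: True
      have "closed Ideals (adj W (y + u))" if u: "u \<in> U" for u
      proof -
        obtain v a where ua: "v \<in> V" "a \<in> A" "u = v + a \<star> x" using u U_eq by (auto simp: adj_def)
        show ?thesis unfolding ua(3) using upper_ideal[OF WV ua(1,2)] WeqV ua y_V lats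
          by (auto intro!: lat_add lat_scale)
      qed
      hence "?C = cosets U W" using selfc cU by (auto simp: cosets_def simp del: closed.simps)
      thus ?thesis using WeqV complement_facts(8)[OF quots(2) V x U_eq] by (simp add: idx_def)
    next
      case WneqV: False
      show ?thesis
      proof (cases "idx V W = q \<and> br y ` W \<subseteq> W")
        case c: True
        obtain t where t: "t \<in> V" "t \<notin> W" using WneqV True by auto
        have Vt: "V = adj W t" using adj_eq_of_idx_q[OF quots(3) WV _ t] c by blast
        have mt: "m \<star> t \<in> W" if "m \<in> M" for m using quotD(4)[OF quots(3) that t(1)] l by auto
        obtain \<mu> where \<mu>: "\<mu> \<in> A" "\<And>r v. r \<in> A ==> \<mu> - r \<in> M ==> v \<in> V ==> br y v - r \<star> v \<in> W"
          using eigenvalue_of_line[OF quots(3) l(1) lats(5) y_V _ lin_right Vt t(1) mt] c by blast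
        have \<mu>': "br y v + - \<mu> \<star> v \<in> W" if "v \<in> V" for v using \<mu>(2)[OF \<mu>(1) _ that] zero_M by simp
        have ideal_iff: "closed Ideals (adj W (y + (v + a \<star> x))) \<longleftrightarrow> v \<in> W \<and> a + \<mu> \<in> M" if va: "v \<in> V" "a \<in> A" for v a
        proof -
          have "(\<forall>v\<in>V. br y v + a \<star> v \<in> W) \<longleftrightarrow> a + \<mu> \<in> M"
          proof
            assume *: "\<forall>v\<in>V. br y v + a \<star> v \<in> W"
            have "(br y t + a \<star> t) - (br y t + - \<mu> \<star> t) \<in> W" using lat_diff[OF l(1)] * \<mu>' t by blast
            hence "(a + \<mu>) \<star> t \<in> W" by (simp add: algebra_simps)
            thus "a + \<mu> \<in> M" using adj_coeff[OF l(1) t(2) mt] va \<mu> add_A by blast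
          next
            assume *: "a + \<mu> \<in> M"
            show "\<forall>v\<in>V. br y v + a \<star> v \<in> W"
            proof
              fix v assume v: "v \<in> V"
              have "br y v + a \<star> v = (br y v + - \<mu> \<star> v) + (a + \<mu>) \<star> v" by (simp add: algebra_simps)
              moreover have "(a + \<mu>) \<star> v \<in> W" using quotD(4)[OF quots(3) * v] l by auto
              ultimately show "br y v + a \<star> v \<in> W" using lat_add[OF l(1) \<mu>'[OF v]] by metis
            qed
          qed
          thus ?thesis using upper_ideal[OF WV va] c by blast
        qed
        have "?C = {(+) (0 + - \<mu> \<star> x) ` W}"
        proof (intro equalityI subsetI)
          fix k assume k: "k \<in> ?C"
          then obtain u where u: "u \<in> k" "closed Ideals (adj W (y + u))" "k \<in> cosets U W" by blast
          obtain v a where ua: "v \<in> V" "a \<in> A" "u = v + a \<star> x" using cU[OF u(1,3)] U_eq by (auto simp: adj_def)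
          have *: "v \<in> W" "a + \<mu> \<in> M" using ideal_iff[OF ua(1,2)] u(2) ua(3) by blast+
          have "(a + \<mu>) \<star> x \<in> W" using quotD(4)[OF quots(2) *(2) sub(3)] l by auto
          moreover have "u - (0 + - \<mu> \<star> x) = v + (a + \<mu>) \<star> x" using ua by (simp add: algebra_simps)
          ultimately have "u - (0 + - \<mu> \<star> x) \<in> W" using lat_add[OF l(1) *(1)] by simp
          thus "k \<in> {(+) (0 + - \<mu> \<star> x) ` W}" using coset[OF u(1,3)] coset_eq_iff[OF lat_addgrp[OF l(1)]] by blast
        next
          fix k assume k: "k \<in> {(+) (0 + - \<mu> \<star> x) ` W}"
          have "0 + - \<mu> \<star> x \<in> U" using \<mu> sub lats uminus_A by (auto intro!: lat_add lat_scale lat_minus simp: lat_zero)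
          moreover have "closed Ideals (adj W (y + (0 + - \<mu> \<star> x)))"
            using ideal_iff[of 0 "- \<mu>"] lat_zero[OF lats(4)] lat_zero[OF l(1)] \<mu> uminus_A zero_M by simp
          ultimately show "k \<in> ?C" using k selfc unfolding cosets_def by blast
        qed
        thus ?thesis using c WneqV True by (simp del: closed.simps)
      next
        case c: False
        have "\<not> closed Ideals (adj W (y + u))" if u: "u \<in> U" for u
        proof
          assume cl: "closed Ideals (adj W (y + u))"
          obtain v a where ua: "v \<in> V" "a \<in> A" "u = v + a \<star> x" using u U_eq by (auto simp: adj_def)
          have *: "br y ` W \<subseteq> W" "\<forall>v\<in>V. br y v + a \<star> v \<in> W" using upper_ideal[OF WV ua(1,2)] cl ua(3) by blast+
          obtain j where j: "j \<le> 2" "idx V W = q ^ j" "idx W N = q ^ (2 - j)" using idx_le_power[OF quots(3) idx_V WV] .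
          have "j \<noteq> 0" using j idx_0_iff[OF quots(3) WV] WneqV by auto
          moreover have "j \<noteq> 1" using j c * by auto
          ultimately have "j = 2" using j by linarith
          hence "W = N" using j idx_eq_1_iff[OF quot_lower[OF quots(3) WV]] by simp
          moreover obtain v1 where "v1 \<in> V" "br y v1 - (- a) \<star> v1 \<notin> N" using nonscalar[OF uminus_A[OF ua(2)]] by blast
          ultimately show False using * by auto
        qed
        hence "?C = {}" using cU by blast
        thus ?thesis using WneqV c True by (simp only: card.empty) auto
      qed
    qed
  qed
qed

lemma num_Ideals:
  "num Ideals i = (if i = 0 then 1 else if i = 1 then 1 + q else
     if i = 2 then 1 + invs (br y) N V 1 else invs (br y) N V (i - 2))"
proof (cases "i = 0")
  case True thus ?thesis using num_0 by simp
next
  case False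
  let ?S = "{W \<in> betw N U. idx U W = q ^ i}"
  let ?f = "\<lambda>W. if W = V then q else if W \<subseteq> V \<and> idx V W = q \<and> br y ` W \<subseteq> W then 1 else 0"
  have idxU: "idx U W = q * idx V W" if "W \<in> betw N V" for W
  proof -
    have "quot W U" "V \<in> betw W U" using that quot_upper[OF quots(2)] sub lats by (auto simp: betw_def)
    thus ?thesis using idx_mult[of W U V] complement_facts(8)[OF quots(2) V x U_eq] by simp
  qed
  have fin: "finite ?S" using finite_betw[OF quots(2)] by simp
  have 1: "num Ideals i = (if i - 1 = 0 then 1 else invs (br y) N V (i - 1 - 1)) + (\<Sum>W\<in>?S. ?f W)"
  proof -
    have "(\<Sum>W\<in>?S. card {c \<in> cosets U W. \<exists>v\<in>c. closed Ideals (adj W (y + v))}) = (\<Sum>W\<in>?S. ?f W)"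
      by (rule sum.cong[OF refl], rule fibre_ideal[where i = i]) (use False in auto)
    thus ?thesis using False count_split[OF quots(1) U y \<Lambda>_eq, of i "closed Ideals"] card_lower_ideals[of "i - 1"]
      unfolding num_def by simp
  qed
  have V1: "idx V V = 1" using idx_self[OF lats(4)] .
  consider "i = 1" | "i = 2" | "i \<ge> 3" using False by linarith
  hence "(\<Sum>W\<in>?S. ?f W) = (if i = 1 then q else if i = 2 then invs (br y) N V 1 else 0)"
  proof cases
    case 1
    have "?f W = (if W = V then q else 0)" if "W \<in> ?S" for W
      using idxU[of W] that 1 q_ge_2 by (auto simp: betw_def)
    hence "(\<Sum>W\<in>?S. ?f W) = (\<Sum>W\<in>?S. if W = V then q else 0)" by (intro sum.cong) auto
    also have "\<dots> = q" using fin V 1 idxU[OF betw_ends(2)[OF quots(3)]] V1 by simp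
    finally show ?thesis using 1 by simp
  next
    case 2
    have "(\<Sum>W\<in>?S. ?f W) = (\<Sum>W\<in>{W \<in> betw N V. idx V W = q ^ 1 \<and> br y ` W \<subseteq> W}. 1)"
    proof (rule sum.mono_neutral_cong_right[OF fin])
      show "{W \<in> betw N V. idx V W = q ^ 1 \<and> br y ` W \<subseteq> W} \<subseteq> ?S"
        using idxU 2 sub by (auto simp: betw_def power2_eq_square)
      have ne: "V \<notin> ?S" using idxU[OF betw_ends(2)[OF quots(3)]] V1 2 q_ge_2 by (auto simp: power2_eq_square)
      show "\<forall>W\<in>?S - {W \<in> betw N V. idx V W = q ^ 1 \<and> br y ` W \<subseteq> W}. ?f W = 0"
        using ne by (auto simp: betw_def)
      show "?f W = 1" if "W \<in> {W \<in> betw N V. idx V W = q ^ 1 \<and> br y ` W \<subseteq> W}" for W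
        using that V1 q_ge_2 by (auto simp: betw_def)
    qed
    thus ?thesis using 2 by (simp add: invs_def)
  next
    case 3
    have "?f W = 0" if W: "W \<in> ?S" for W
    proof -
      have "W \<noteq> V"
        using idxU[OF betw_ends(2)[OF quots(3)]] V1 3 W q_power_eq_iff[of 1 i] by (auto simp del: q_power_eq_iff)
      moreover have "idx V W \<noteq> q" if "W \<subseteq> V"
      proof -
        have "q * idx V W = q ^ i" using idxU[of W] W that by (auto simp: betw_def)
        thus ?thesis using 3 q_power_eq_iff[of 2 i] by (auto simp: power2_eq_square simp del: q_power_eq_iff)
      qed
      ultimately show ?thesis by auto
    qed
    thus ?thesis using 3 by simp
  qed
  thus ?thesis using 1 False invs_0[OF quots(3) idx_V T_facts] by (auto simp: numeral_2_eq_2)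
qed

end

subsection \<open>Extensions of the Heisenberg algebra\<close>

text \<open>Modulo N, V is the Heisenberg algebra with centre the line Z, and x spans a complement.
  The condition \<open>onto\<close>, that ad x is surjective on V / Z, comes from V being the
  derived algebra.\<close>

locale heisenberg_ext = lie_lattice A M scale br N \<Lambda>
  for A M :: "'k::field set" and scale :: "'k => 'v::ab_group_add => 'v" (infixr \<open>\<star>\<close> 75)
    and br N \<Lambda> +
  fixes V Z x
  assumes V: "V \<in> betw N \<Lambda>" and x: "x \<notin> V" and \<Lambda>_eq: "\<Lambda> = adj V x"
    and Z: "Z \<in> betw N V" and idx_V: "idx V Z = q ^ 2" and idx_Z: "idx Z N = q"
    and V_V: "v \<in> V ==> w \<in> V ==> br v w \<in> Z" and V_Z: "v \<in> V ==> z \<in> Z ==> br v z \<in> N"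
    and nondeg: "v \<in> V ==> v \<notin> Z ==> \<exists>w\<in>V. br v w \<notin> N"
    and x_V: "v \<in> V ==> br x v \<in> V" and x_Z: "z \<in> Z ==> br x z \<in> Z"
    and onto: "Img (br x) Z V = V"
begin

lemma quots: "quot N \<Lambda>" "quot N V" "quot Z V" "quot N Z"
  using quot_lower quot_upper quot_\<Lambda> V Z by blast+

lemmas lats = quotD(1,2,3)[OF quots(2)] quotD(1,3)[OF quots(3)] quotD(3)[OF quots(4)]

lemma sub: "V \<subseteq> \<Lambda>" "x \<in> \<Lambda>"
  using V complement_facts[OF quots(1) V x \<Lambda>_eq] by (auto simp: betw_def)

lemma idx_VN: "idx V N = q ^ 3"
  using idx_mult[OF quots(2) Z] idx_V idx_Z by (simp add: eval_nat_numeral)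

lemma V_closed: "closed Subalgebras V"
  using V_V lats by auto

lemma T_facts: "br x ` V \<subseteq> V" "br x ` Z \<subseteq> Z" using x_V x_Z by auto

lemma Z_V: "z \<in> Z ==> v \<in> V ==> br z v \<in> N"
  using V_Z[of v z] lat_minus[OF lats(1)] br_anti[of z v] by simp

lemma Z_adj: "z \<in> Z ==> z \<notin> N ==> Z = adj N z"
  using adj_eq_of_idx_q[OF quots(4) betw_ends(1)[OF quots(4)] idx_Z] .

text \<open>Modulo N, brackets of V depend only on classes modulo Z. So W already realises a bracket
  that is nonzero modulo N, and the line Z is spanned by it.\<close>

lemma contains_Z:
  assumes W: "W \<in> betw N V" "closed Subalgebras W" and dec: "\<And>u. u \<in> V ==> \<exists>w\<in>W. \<exists>z\<in>Z. u = w + z"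
  shows "Z \<subseteq> W"
proof -
  note l = betwD[OF W(1)]
  have "V \<noteq> Z" using idx_V idx_self[OF lats(4)] q_power_eq_iff[of 0 2] by auto
  then obtain v where v: "v \<in> V" "v \<notin> Z" using lats by auto
  obtain w where w: "w \<in> V" "br v w \<notin> N" using nondeg v by blast
  obtain w1 z1 where 1: "w1 \<in> W" "z1 \<in> Z" "v = w1 + z1" using dec v by blast
  obtain w2 z2 where 2: "w2 \<in> W" "z2 \<in> Z" "w = w2 + z2" using dec w by blast
  have "br v w = br w1 w2 + (br w1 z2 + br z1 w)" unfolding 1 2 by (simp add: algebra_simps)
  moreover have "br w1 z2 + br z1 w \<in> N" using V_Z[of w1 z2] Z_V[of z1 w] 1 2 w l lat_add[OF lats(1)] by blast
  ultimately have n: "br w1 w2 \<notin> N" using w(2) lat_add[OF lats(1)] by auto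
  have wz: "br w1 w2 \<in> Z" "br w1 w2 \<in> W" using V_V[of w1 w2] W(2) 1 2 l by auto
  have "Z = adj N (br w1 w2)" using Z_adj[OF wz(1) n] .
  thus ?thesis using adj_subset[OF l(1,2) wz(2)] by simp
qed

text \<open>A closed hyperplane not containing Z would be a complement of it and would then contain
  Z after all; conversely all brackets of V lie in Z.\<close>

lemma hyperplane_closed_iff:
  assumes W: "W \<in> betw N V" "idx V W = q" shows "closed Subalgebras W \<longleftrightarrow> Z \<subseteq> W"
proof
  note l = betwD[OF W(1)]
  { assume c: "closed Subalgebras W"
    show "Z \<subseteq> W"
    proof (rule ccontr)
      assume "\<not> Z \<subseteq> W"
      then obtain z where z: "z \<in> Z" "z \<notin> W" by blast
      have Vz: "V = adj W z" using adj_eq_of_idx_q[OF quots(2) W] z lats by blast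
      have "\<exists>w\<in>W. \<exists>z\<in>Z. u = w + z" if u: "u \<in> V" for u
      proof -
        obtain w a where "w \<in> W" "a \<in> A" "u = w + a \<star> z" using u Vz unfolding adj_def by blast
        thus ?thesis using lat_scale[OF lats(4)] z by blast
      qed
      hence "Z \<subseteq> W" by (rule contains_Z[OF W(1) c])
      thus False using z by blast
    qed }
  { assume "Z \<subseteq> W" thus "closed Subalgebras W" using V_V l by (auto simp: subset_iff) }
qed

lemma closed_upper:
  assumes W: "W \<in> betw N V" and v: "v \<in> V"
  shows "closed Subalgebras (adj W (x + v)) \<longleftrightarrow> closed Subalgebras W \<and> br (x + v) ` W \<subseteq> W"
proof (rule closed_adj[OF V x \<Lambda>_eq V_closed W v])
  fix w assume "w \<in> W"
  hence "w \<in> V" using W by (auto simp: betw_def)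
  thus "br (x + v) w \<in> V" using x_V V_closed v lat_add[OF lats(2)] by simp
qed

text \<open>Codimension 1: V itself, and W + A (x + v) for the hyperplanes W of V that contain Z and
  are preserved by ad x; ad v moves W into Z and does not matter.\<close>

lemma num_Subalgebras_1: "num Subalgebras 1 = 1 + q * invs (br x) Z V 1"
proof -
  have P: "closed Subalgebras (adj W (x + v)) \<longleftrightarrow> Z \<subseteq> W \<and> br x ` W \<subseteq> W"
    if W: "W \<in> betw N V" "idx V W = q ^ 1" and v: "v \<in> V" for W v
  proof -
    have l: "lat W" "W \<subseteq> V" using W by (auto simp: betw_def)
    have "br (x + v) ` W \<subseteq> W \<longleftrightarrow> br x ` W \<subseteq> W" if "Z \<subseteq> W"
    proof -
      have "br (x + v) w \<in> W \<longleftrightarrow> br x w \<in> W" if "w \<in> W" for w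
      proof -
        have "br v w \<in> W" using V_V[OF v] that l \<open>Z \<subseteq> W\<close> by blast
        thus ?thesis using lat_add_iff[OF l(1)] by simp
      qed
      thus ?thesis by (auto simp del: br_add)
    qed
    thus ?thesis using closed_upper[OF W(1) v] hyperplane_closed_iff[OF W(1)] W(2) by auto
  qed
  have 0: "card {H \<in> betw N V. idx V H = q ^ 0 \<and> closed Subalgebras H} = 1"
  proof -
    have "{H \<in> betw N V. idx V H = q ^ 0 \<and> closed Subalgebras H} = {V}"
      using idx_0_iff[OF quots(2)] betw_ends[OF quots(2)] V_closed by blast
    thus ?thesis by (simp only:) simp
  qed
  have "{W \<in> betw N V. idx V W = q ^ 1 \<and> Z \<subseteq> W \<and> br x ` W \<subseteq> W} = {W \<in> betw Z V. idx V W = q ^ 1 \<and> br x ` W \<subseteq> W}"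
    using lats by (auto simp: betw_def)
  thus ?thesis using count_split_const[OF quots(1) V x \<Lambda>_eq, of 1 "closed Subalgebras" "\<lambda>W. Z \<subseteq> W \<and> br x ` W \<subseteq> W", OF P] 0
    unfolding num_def invs_def by simp
qed

text \<open>For a line W other than Z the only possible P is Z + W, so the condition is that W maps
  to an eigenline of ad x on V / Z.\<close>

definition inv_over :: "'v set => bool" where
  "inv_over W \<longleftrightarrow> (\<exists>P\<in>betw Z V. idx V P = q ^ 1 \<and> br x ` P \<subseteq> P \<and> W \<subseteq> P)"

lemma line_facts:
  assumes W: "W \<in> betw N V" "idx W N = q" "W \<noteq> Z"
  obtains w0 where "w0 \<in> W" "w0 \<notin> Z" "W = adj N w0" "W \<inter> Z = N"
    "adj Z w0 \<in> betw Z V" "idx V (adj Z w0) = q ^ 1" "W \<subseteq> adj Z w0"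
    "\<And>P. P \<in> betw Z V ==> idx V P = q ^ 1 ==> W \<subseteq> P ==> P = adj Z w0"
proof -
  note l = betwD[OF W(1)]
  have Q: "quot N W" using quot_lower[OF quots(2) W(1)] .
  have line: "W = adj N w" if "w \<in> W" "w \<notin> N" for w
    using adj_eq_of_idx_q[OF Q betw_ends(1)[OF Q] W(2) that] .
  have nz: "\<not> W \<subseteq> Z"
  proof
    assume "W \<subseteq> Z"
    have "W \<noteq> N" using W(2) idx_self[OF lats(1)] q_ge_2 by auto
    then obtain w where w: "w \<in> W" "w \<notin> N" using l by auto
    thus False using line[OF w] Z_adj[of w] \<open>W \<subseteq> Z\<close> W(3) by auto
  qed
  then obtain w0 where w0: "w0 \<in> W" "w0 \<notin> Z" by blast
  have w0V: "w0 \<in> V" using w0 l by blast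
  have WZ: "W \<inter> Z = N"
  proof -
    have "w \<in> N" if "w \<in> W" "w \<in> Z" for w using line[OF that(1)] Z_adj[OF that(2)] W(3) by blast
    thus ?thesis using l lats by blast
  qed
  have W0: "W = adj N w0" using line[OF w0(1)] w0 lats by blast
  have b: "adj Z w0 \<in> betw Z V" using lat_adj[OF lats(4)] subset_adj[OF lats(4)] adj_subset[OF lats(2,5) w0V] by (simp add: betw_def)
  have "idx (adj Z w0) Z = q" by (rule idx_adj[OF lats(4) w0(2)]) (use quotD(4)[OF quots(3) _ w0V] in auto)
  hence i: "idx V (adj Z w0) = q ^ 1" using idx_mult[OF quots(3) b] idx_V q_ge_2 by (simp add: power2_eq_square)
  have s: "W \<subseteq> adj Z w0" unfolding W0 using lats unfolding adj_def by blast
  have "P = adj Z w0" if P: "P \<in> betw Z V" "idx V P = q ^ 1" "W \<subseteq> P" for P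
  proof -
    have "lat P" "Z \<subseteq> P" "w0 \<in> P" using P w0 by (auto simp: betw_def)
    hence "adj Z w0 \<in> betw Z P" using adj_subset[of P Z w0] b by (auto simp: betw_def)
    thus ?thesis using betw_eq_if_idx[OF quots(3) P(1), of "adj Z w0"] P i by simp
  qed
  thus ?thesis using that[OF w0 W0 WZ b i s] by blast
qed

text \<open>W is spanned by some w0 modulo N, and the question is whether [x + v, w0] lies in W.
  This needs [x, w0] = z + a w0 with z in Z, which is \<open>inv_over\<close>; then v must satisfy
  [w0, v] = z modulo N. Solutions exist because the bracket with w0 maps V onto Z, and they form a
  coset of the centraliser of w0, in which W has index q.\<close>

lemma fibre_line:
  assumes W: "W \<in> betw N V" "idx W N = q" "W \<noteq> Z"
  shows "card {c \<in> cosets V W. \<exists>v\<in>c. closed Subalgebras (adj W (x + v))} = (if inv_over W then q else 0)"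
proof -
  note l = betwD[OF W(1)]
  obtain w0 where w0: "w0 \<in> W" "w0 \<notin> Z" "W = adj N w0" "W \<inter> Z = N"
    "adj Z w0 \<in> betw Z V" "idx V (adj Z w0) = q ^ 1" "W \<subseteq> adj Z w0"
    and P: "\<And>P. P \<in> betw Z V ==> idx V P = q ^ 1 ==> W \<subseteq> P ==> P = adj Z w0"
    using line_facts[OF W] by metis
  have w0V: "w0 \<in> V" using w0 l by blast
  have lP: "lat (adj Z w0)" "Z \<subseteq> adj Z w0" "w0 \<in> adj Z w0" using lat_adj[OF lats(4)] subset_adj[OF lats(4)] mem_adj[OF lats(4)] by auto
  have inv: "inv_over W \<longleftrightarrow> br x w0 \<in> adj Z w0"
  proof
    assume "inv_over W"
    thus "br x w0 \<in> adj Z w0" using P lP unfolding inv_over_def by blast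
  next
    assume c: "br x w0 \<in> adj Z w0"
    have "br x p \<in> adj Z w0" if "p \<in> adj Z w0" for p
    proof -
      obtain z a where "z \<in> Z" "a \<in> A" "p = z + a \<star> w0" using \<open>p \<in> _\<close> by (auto simp: adj_def)
      thus ?thesis using c x_Z lP by (auto intro!: lat_add lat_scale)
    qed
    thus "inv_over W" using w0 unfolding inv_over_def by blast
  qed
  define XS where "XS = {v \<in> V. br (x + v) w0 \<in> W}"
  have clW: "closed Subalgebras W" using line_closed W V by (auto simp: betw_def)
  have cl: "closed Subalgebras (adj W (x + v)) \<longleftrightarrow> v \<in> XS" if v: "v \<in> V" for v
  proof -
    have "br (x + v) w \<in> W" if c: "br (x + v) w0 \<in> W" and w: "w \<in> W" for w
    proof -
      obtain n a where "n \<in> N" "a \<in> A" "w = n + a \<star> w0" using w w0(3) unfolding adj_def by blast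
      moreover have "br (x + v) n \<in> N" if "n \<in> N" for n
        by (rule br_N[OF _ that]) (use v sub \<Lambda>_facts lat_add in blast)
      ultimately show ?thesis using c l lat_add[OF l(1)] lat_scale[OF l(1)] br_add(1)[of "x + v" n "a \<star> w0"] br_scale(1)
        by (metis subsetD)
    qed
    hence "br (x + v) ` W \<subseteq> W \<longleftrightarrow> v \<in> XS" using w0(1) v by (auto simp: XS_def simp del: br_add)
    thus ?thesis using closed_upper[OF W(1) v] clW by blast
  qed
  have eqX: "{c \<in> cosets V W. \<exists>v\<in>c. closed Subalgebras (adj W (x + v))} = (\<lambda>v. (+) v ` W) ` XS"
  proof (intro equalityI subsetI)
    fix c assume "c \<in> {c \<in> cosets V W. \<exists>v\<in>c. closed Subalgebras (adj W (x + v))}"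
    then obtain r w where c: "r \<in> V" "c = (+) r ` W" "w \<in> W" "closed Subalgebras (adj W (x + (r + w)))" by (auto simp: cosets_def)
    have "r + w \<in> V" using c l lat_add[OF lats(2)] by blast
    moreover have "c = (+) (r + w) ` W" using coset_eq_iff[OF lat_addgrp[OF l(1)], of "r + w" r] c by simp
    ultimately show "c \<in> (\<lambda>v. (+) v ` W) ` XS" using cl c by blast
  next
    fix c assume "c \<in> (\<lambda>v. (+) v ` W) ` XS"
    then obtain v where v: "v \<in> XS" "c = (+) v ` W" by blast
    have "v \<in> V" using v by (simp add: XS_def)
    moreover have "v \<in> c" using v lat_zero[OF l(1)] by (metis add.right_neutral image_eqI)
    ultimately show "c \<in> {c \<in> cosets V W. \<exists>v\<in>c. closed Subalgebras (adj W (x + v))}" using v cl unfolding cosets_def by blast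
  qed
  show ?thesis
  proof (cases "inv_over W")
    case False
    have "v \<notin> XS" for v
    proof
      assume v: "v \<in> XS"
      hence "br (x + v) w0 \<in> adj Z w0" "br v w0 \<in> adj Z w0" using w0(7) V_V w0V lP by (auto simp: XS_def simp del: br_add)
      hence "br x w0 \<in> adj Z w0" using lat_diff[OF lP(1), of "br (x + v) w0" "br v w0"] by simp
      thus False using inv False by blast
    qed
    hence "XS = {}" by blast
    thus ?thesis unfolding eqX using False by simp
  next
    case True
    then obtain z a where z: "z \<in> Z" "a \<in> A" "br x w0 = z + a \<star> w0" using inv by (auto simp: adj_def)
    define C where "C = Ker (br w0) N V"
    have T: "br w0 ` V \<subseteq> V" "br w0 ` N \<subseteq> N" using V_V[OF w0V] lats br_N w0V sub by blast+
    note KI = Ker_betw[OF quots(2) lin_right T] Img_betw[OF quots(2) lin_right T] idx_Img[OF quots(2) lin_right T]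
    \<comment> \<open>By nondegeneracy the image is strictly larger than N, and Z is a line.\<close>
    have ImZ: "Img (br w0) N V = Z"
    proof
      show s: "Img (br w0) N V \<subseteq> Z" using V_V[OF w0V] lats by (auto simp: Img_def intro!: lat_add)
      obtain w where w: "w \<in> V" "br w0 w \<notin> N" using nondeg[OF w0V w0(2)] by blast
      have "br w0 w = br w0 w + 0" by simp
      hence "br w0 w \<in> Img (br w0) N V" using w lat_zero[OF lats(1)] unfolding Img_def by blast
      moreover have "lat (Img (br w0) N V)" "N \<subseteq> Img (br w0) N V" using KI(2) by (auto simp: betw_def)
      moreover have "Z = adj N (br w0 w)" using Z_adj[OF V_V[OF w0V w(1)] w(2)] .
      ultimately show "Z \<subseteq> Img (br w0) N V" using adj_subset by metis
    qed
    have C: "C \<in> betw N V" "idx C N = q ^ 2" using KI ImZ idx_V by (auto simp: C_def)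
    have WC: "W \<in> betw N C"
    proof -
      have "br w0 w \<in> N" if w: "w \<in> W" for w
      proof -
        obtain n b where "n \<in> N" "b \<in> A" "w = n + b \<star> w0" using w w0(3) unfolding adj_def by blast
        thus ?thesis using T(2) by (auto simp: br_self)
      qed
      thus ?thesis using l by (auto simp: betw_def C_def Ker_def)
    qed
    have iC: "idx C W = q"
      using idx_mult[OF quot_lower[OF quots(2) C(1)] WC] C(2) W(2) q_ge_2 by (simp add: power2_eq_square)
    obtain v1 n where v1: "v1 \<in> V" "n \<in> N" "z = br w0 v1 + n" using z(1) ImZ unfolding Img_def by blast
    have "br v1 w0 = - br w0 v1" by (rule br_anti)
    hence e: "br (x + v1) w0 = n + a \<star> w0" using z v1 by simp
    have "br (x + v1) w0 \<in> W" unfolding e w0(3) using adjI v1 z by blast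
    hence v1X: "v1 \<in> XS" using v1 unfolding XS_def by blast
    have Xeq: "XS = (+) v1 ` C"
    proof -
      have "v \<in> XS \<longleftrightarrow> v - v1 \<in> C" if v: "v \<in> V" for v
      proof -
        have d: "v - v1 \<in> V" using v v1 lat_diff[OF lats(2)] by blast
        have e: "br (x + v) w0 = br (x + v1) w0 + br (v - v1) w0" by simp
        have "br (v - v1) w0 = - br w0 (v - v1)" by (rule br_anti)
        hence "br (v - v1) w0 \<in> N \<longleftrightarrow> br w0 (v - v1) \<in> N"
          using lat_minus[OF lats(1), of "br w0 (v - v1)"] lat_minus[OF lats(1), of "- br w0 (v - v1)"] by (simp only: minus_minus) blast
        moreover have "v \<in> XS \<longleftrightarrow> br (v - v1) w0 \<in> W"
        proof -
          have "br (x + v1) w0 \<in> W" using v1X by (simp add: XS_def)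
          hence "br (x + v) w0 \<in> W \<longleftrightarrow> br (v - v1) w0 \<in> W" unfolding e using lat_add_iff[OF l(1), of "br (x + v1) w0" "br (v - v1) w0"] by (simp only: add.commute[of "br (x + v1) w0"])
          thus ?thesis using v by (simp add: XS_def)
        qed
        moreover have "br (v - v1) w0 \<in> W \<longleftrightarrow> br (v - v1) w0 \<in> N" using w0(4) V_V[OF d w0V] by blast
        ultimately show ?thesis using d by (simp add: C_def Ker_def)
      qed
      moreover have "XS \<subseteq> V" "(+) v1 ` C \<subseteq> V" using C(1) v1 lat_add[OF lats(2)] by (auto simp: XS_def betw_def)
      moreover have "v \<in> (+) v1 ` C \<longleftrightarrow> v - v1 \<in> C" for v
        by (auto simp: image_iff) (metis add.commute diff_add_cancel)
      ultimately show ?thesis by blast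
    qed
    have "idx C W = card ((\<lambda>u. (+) (v1 + u) ` W) ` C)"
      by (rule idx_eq_card_image[OF lat_addgrp[OF l(1)]]) (simp add: coset_eq_iff[OF lat_addgrp[OF l(1)]])
    thus ?thesis unfolding eqX using Xeq iC True by (simp add: image_image)
  qed
qed

text \<open>Inside V the hyperplanes of V containing Z are counted. For the others the trace W is a
  line: W = Z allows every v, and each other line inside an invariant plane P contributes q. Such a
  P contains 1 + q lines, one of which is Z, so it accounts for q^2 lattices.\<close>

lemma num_Subalgebras_2: "num Subalgebras 2 = gb q 2 1 + q ^ 2 + q ^ 2 * invs (br x) Z V 1"
proof -
  let ?L = "{W \<in> betw N V. idx V W = q ^ 2}"
  let ?f = "\<lambda>W. card {c \<in> cosets V W. \<exists>v\<in>c. closed Subalgebras (adj W (x + v))}"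
  have fin: "finite (betw N V)" using finite_betw[OF quots(2)] .
  have L: "idx V W = q ^ 2 \<longleftrightarrow> idx W N = q" if "W \<in> betw N V" for W
    using idx_upper_iff[OF quots(2) idx_VN that, of 2] by simp
  have "{H \<in> betw N V. idx V H = q ^ 1 \<and> closed Subalgebras H} = {H \<in> betw Z V. idx V H = q ^ 1}"
  proof (intro equalityI subsetI)
    fix H assume "H \<in> {H \<in> betw N V. idx V H = q ^ 1 \<and> closed Subalgebras H}"
    thus "H \<in> {H \<in> betw Z V. idx V H = q ^ 1}" using hyperplane_closed_iff[of H] by (auto simp: betw_def simp del: closed.simps)
  next
    fix H assume H: "H \<in> {H \<in> betw Z V. idx V H = q ^ 1}"
    hence "H \<in> betw N V" using lats by (auto simp: betw_def)
    thus "H \<in> {H \<in> betw N V. idx V H = q ^ 1 \<and> closed Subalgebras H}"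
      using hyperplane_closed_iff[of H] H by (auto simp: betw_def simp del: closed.simps)
  qed
  hence 1: "card {H \<in> betw N V. idx V H = q ^ (2 - 1) \<and> closed Subalgebras H} = gb q 2 1"
    using card_betw[OF quots(3) idx_V, of 1] by simp
  have ZL: "Z \<in> ?L" using Z idx_V by simp
  have fZ: "?f Z = q ^ 2"
  proof -
    have "br (x + v) ` Z \<subseteq> Z" if "v \<in> V" for v
      using x_Z V_Z[OF that] lats by (auto intro!: lat_add)
    moreover have "closed Subalgebras Z" using V_V lats by (auto simp: subset_iff)
    ultimately have "closed Subalgebras (adj Z (x + v))" if "v \<in> V" for v using closed_upper[OF Z that] that by blast
    moreover have "c \<noteq> {} \<and> c \<subseteq> V" if "c \<in> cosets V Z" for c
      using that lats lat_zero[OF lats(4)] lat_add[OF lats(2)] by (auto simp: cosets_def)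
    ultimately have "{c \<in> cosets V Z. \<exists>v\<in>c. closed Subalgebras (adj Z (x + v))} = cosets V Z" by blast
    thus ?thesis using idx_V by (simp add: idx_def)
  qed
  have "(\<Sum>W\<in>?L. ?f W) = ?f Z + (\<Sum>W\<in>?L - {Z}. ?f W)"
    by (rule sum.remove) (use fin ZL in auto)
  also have "(\<Sum>W\<in>?L - {Z}. ?f W) = (\<Sum>W\<in>?L - {Z}. if inv_over W then q else 0)"
    by (rule sum.cong[OF refl], rule fibre_line) (use L in auto)
  also have "\<dots> = q * card {W \<in> ?L - {Z}. inv_over W}"
    using fin by (simp add: sum.If_cases Int_def)
  also have "{W \<in> ?L - {Z}. inv_over W} = (\<Union>P\<in>{P \<in> betw Z V. idx V P = q ^ 1 \<and> br x ` P \<subseteq> P}. {W \<in> betw N P. idx W N = q} - {Z})"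
  proof (intro equalityI subsetI)
    fix W assume W: "W \<in> {W \<in> ?L - {Z}. inv_over W}"
    then obtain P where "P \<in> betw Z V" "idx V P = q ^ 1" "br x ` P \<subseteq> P" "W \<subseteq> P" unfolding inv_over_def by blast
    moreover have "W \<in> betw N P" using W \<open>W \<subseteq> P\<close> by (auto simp: betw_def)
    ultimately show "W \<in> (\<Union>P\<in>{P \<in> betw Z V. idx V P = q ^ 1 \<and> br x ` P \<subseteq> P}. {W \<in> betw N P. idx W N = q} - {Z})"
      using W L by blast
  next
    fix W assume "W \<in> (\<Union>P\<in>{P \<in> betw Z V. idx V P = q ^ 1 \<and> br x ` P \<subseteq> P}. {W \<in> betw N P. idx W N = q} - {Z})"
    then obtain P where P: "P \<in> betw Z V" "idx V P = q ^ 1" "br x ` P \<subseteq> P" "W \<in> betw N P" "idx W N = q" "W \<noteq> Z" by blast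
    have "W \<in> betw N V" "W \<subseteq> P" using P by (auto simp: betw_def)
    thus "W \<in> {W \<in> ?L - {Z}. inv_over W}" using L P unfolding inv_over_def by blast
  qed
  also have "card \<dots> = (\<Sum>P\<in>{P \<in> betw Z V. idx V P = q ^ 1 \<and> br x ` P \<subseteq> P}. card ({W \<in> betw N P. idx W N = q} - {Z}))"
  proof (rule card_UN_disjoint)
    show "finite {P \<in> betw Z V. idx V P = q ^ 1 \<and> br x ` P \<subseteq> P}" using finite_betw[OF quots(3)] by simp
    have "finite (betw N P)" if "P \<in> betw Z V" for P
    proof -
      have "P \<in> betw N V" using that lats by (auto simp: betw_def)
      thus ?thesis using finite_betw[OF quot_lower[OF quots(2)]] by simp
    qed
    thus "\<forall>P\<in>{P \<in> betw Z V. idx V P = q ^ 1 \<and> br x ` P \<subseteq> P}. finite ({W \<in> betw N P. idx W N = q} - {Z})"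
      by simp
    have False if PP: "P \<in> betw Z V" "idx V P = q ^ 1" "P' \<in> betw Z V" "idx V P' = q ^ 1" "P \<noteq> P'"
      and W: "W \<in> betw N P" "W \<in> betw N P'" "idx W N = q" "W \<noteq> Z" for P P' W
    proof -
      have "W \<in> betw N V" using W PP by (auto simp: betw_def)
      then obtain w0 where "\<And>P. P \<in> betw Z V ==> idx V P = q ^ 1 ==> W \<subseteq> P ==> P = adj Z w0"
        using line_facts[of W] W by metis
      from this[of P] this[of P'] show False using PP W by (auto simp: betw_def)
    qed
    thus "\<forall>P\<in>{P \<in> betw Z V. idx V P = q ^ 1 \<and> br x ` P \<subseteq> P}. \<forall>P'\<in>{P \<in> betw Z V. idx V P = q ^ 1 \<and> br x ` P \<subseteq> P}.
      P \<noteq> P' \<longrightarrow> ({W \<in> betw N P. idx W N = q} - {Z}) \<inter> ({W \<in> betw N P'. idx W N = q} - {Z}) = {}" by blast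
  qed
  also have "\<dots> = (\<Sum>P\<in>{P \<in> betw Z V. idx V P = q ^ 1 \<and> br x ` P \<subseteq> P}. q)"
  proof (rule sum.cong[OF refl])
    fix P assume P: "P \<in> {P \<in> betw Z V. idx V P = q ^ 1 \<and> br x ` P \<subseteq> P}"
    have PN: "P \<in> betw N V" using P lats by (auto simp: betw_def)
    have "idx P N = q ^ 2" using idx_upper_iff[OF quots(2) idx_VN PN, of 1] P by (simp add: power2_eq_square)
    hence "card {W \<in> betw N P. idx W N = q} = 1 + q"
      using card_lines[OF quot_lower[OF quots(2) PN], of 2] gb_1[of q 2] by (simp add: eval_nat_numeral)
    moreover have "Z \<in> {W \<in> betw N P. idx W N = q}" using P Z idx_Z by (auto simp: betw_def)
    ultimately show "card ({W \<in> betw N P. idx W N = q} - {Z}) = q" by (simp add: card_Diff_singleton)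
  qed
  finally have "(\<Sum>W\<in>?L. ?f W) = q ^ 2 + q * (invs (br x) Z V 1 * q)" using fZ by (simp add: invs_def)
  thus ?thesis using count_split[OF quots(1) V x \<Lambda>_eq, of 2 "closed Subalgebras"] 1
    unfolding num_def by (simp add: power2_eq_square)
qed

text \<open>No proper ideal leaves V: if it contains x + v, its trace W on V contains [x + v, V],
  which by \<open>onto\<close> covers V modulo Z; being closed, W contains Z and therefore all of
  V.\<close>

lemma num_Ideals:
  assumes "i \<noteq> 0"
  shows "num Ideals i = card {H \<in> betw N V. idx V H = q ^ (i - 1) \<and> closed Ideals H}"
proof -
  have "closed Ideals (adj W (x + v)) \<longleftrightarrow> False" if W: "W \<in> betw N V" "idx V W = q ^ i" and v: "v \<in> V" for W v
  proof
    note l = betwD[OF W(1)]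
    have H: "W \<subseteq> adj W (x + v)" "x + v \<in> adj W (x + v)" "adj W (x + v) \<inter> V = W" "adj W (x + v) \<subseteq> \<Lambda>"
      using subset_adj[OF l(1)] mem_adj[OF l(1)] complement_adj(1,2)[OF quots(1) V x \<Lambda>_eq W(1) v] by (auto simp: betw_def)
    assume c: "closed Ideals (adj W (x + v))"
    have cW: "closed Subalgebras W"
      using closed_upper[OF W(1) v] ideal_imp_closed[OF H(4) c, of Subalgebras] by blast
    have dec: "\<exists>w\<in>W. \<exists>z\<in>Z. t = w + z" if t: "t \<in> V" for t
    proof -
      have "t \<in> Img (br x) Z V" using t onto by simp
      then obtain u z where uz: "u \<in> V" "z \<in> Z" "t = br x u + z" unfolding Img_def by blast
      have "br u (x + v) \<in> adj W (x + v)" using c H uz sub by (auto simp del: br_add)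
      moreover have bV: "br (x + v) u \<in> V" using x_V[OF uz(1)] V_closed v uz lat_add[OF lats(2)] by simp
      moreover have "br u (x + v) = - br (x + v) u" by (rule br_anti)
      ultimately have "- br (x + v) u \<in> W" using H(3) lat_minus[OF lats(2) bV] by auto
      hence "br (x + v) u \<in> W" using lat_minus[OF l(1), of "- br (x + v) u"] by (simp only: minus_minus)
      moreover have "z - br v u \<in> Z" using uz V_V[OF v] lat_diff[OF lats(4)] by blast
      moreover have "t = br (x + v) u + (z - br v u)" using uz by simp
      ultimately show ?thesis by blast
    qed
    have "Z \<subseteq> W" by (rule contains_Z[OF W(1) cW dec])
    have "t \<in> W" if "t \<in> V" for t
    proof -
      obtain w z where "w \<in> W" "z \<in> Z" "t = w + z" using dec \<open>t \<in> V\<close> by blast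
      thus ?thesis using \<open>Z \<subseteq> W\<close> lat_add[OF l(1)] by blast
    qed
    hence "W = V" using l by blast
    thus False using W(2) idx_self[OF lats(2)] assms q_power_eq_iff[of 0 i] by simp
  qed simp
  from count_split_const[OF quots(1) V x \<Lambda>_eq, of i "closed Ideals" "\<lambda>_. False", OF this]
  show ?thesis using assms unfolding num_def by simp
qed

lemma ideal_lower_iff:
  assumes "H \<in> betw N V"
  shows "closed Ideals H \<longleftrightarrow> br x ` H \<subseteq> H \<and> (\<forall>v\<in>V. \<forall>h\<in>H. br v h \<in> H)"
proof
  have l: "lat H" "N \<subseteq> H" "H \<subseteq> V" using assms by (auto simp: betw_def)
  assume c: "br x ` H \<subseteq> H \<and> (\<forall>v\<in>V. \<forall>h\<in>H. br v h \<in> H)"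
  have "br g h \<in> H" if g: "g \<in> \<Lambda>" and h: "h \<in> H" for g h
  proof -
    obtain v a where "v \<in> V" "a \<in> A" "g = v + a \<star> x" using g \<Lambda>_eq by (auto simp: adj_def)
    thus ?thesis using c h l(1) lat_add lat_scale by auto
  qed
  thus "closed Ideals H" by simp
qed (use sub in auto)

lemma num_Ideals_1: "num Ideals 1 = 1"
proof -
  have "closed Ideals V" using ideal_lower_iff[OF betw_ends(2)[OF quots(2)]] T_facts V_closed by auto
  hence "{H \<in> betw N V. idx V H = q ^ 0 \<and> closed Ideals H} = {V}"
    using idx_0_iff[OF quots(2)] betw_ends[OF quots(2)] by blast
  hence "card {H \<in> betw N V. idx V H = q ^ (1 - 1) \<and> closed Ideals H} = 1" by (simp only: diff_self_eq_0) simp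
  thus ?thesis using num_Ideals[of 1] by simp
qed

lemma num_Ideals_2: "num Ideals 2 = invs (br x) Z V 1"
proof -
  have "H \<in> betw N V \<and> idx V H = q ^ 1 \<and> closed Ideals H \<longleftrightarrow> H \<in> betw Z V \<and> idx V H = q ^ 1 \<and> br x ` H \<subseteq> H" for H
  proof
    assume H: "H \<in> betw N V \<and> idx V H = q ^ 1 \<and> closed Ideals H"
    hence "closed Subalgebras H" using ideal_imp_closed[of H Subalgebras] sub by (auto simp: betw_def simp del: closed.simps)
    hence "Z \<subseteq> H" using hyperplane_closed_iff[of H] H by simp
    thus "H \<in> betw Z V \<and> idx V H = q ^ 1 \<and> br x ` H \<subseteq> H" using H ideal_lower_iff by (auto simp: betw_def simp del: closed.simps)
  next
    assume H: "H \<in> betw Z V \<and> idx V H = q ^ 1 \<and> br x ` H \<subseteq> H"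
    have "H \<in> betw N V" using H lats by (auto simp: betw_def)
    moreover have "br v h \<in> H" if "v \<in> V" "h \<in> H" for v h using V_V[OF that(1), of h] that H by (auto simp: betw_def)
    ultimately show "H \<in> betw N V \<and> idx V H = q ^ 1 \<and> closed Ideals H" using H ideal_lower_iff by blast
  qed
  hence "{H \<in> betw N V. idx V H = q ^ (2 - 1) \<and> closed Ideals H} = {H \<in> betw Z V. idx V H = q ^ 1 \<and> br x ` H \<subseteq> H}"
    by simp
  thus ?thesis using num_Ideals[of 2] by (simp add: invs_def)
qed

text \<open>A line other than Z has a bracket that is an element of Z outside N, so it is not an
  ideal.\<close>

lemma num_Ideals_3: "num Ideals 3 = 1"
proof -
  have L: "idx V W = q ^ 2 \<longleftrightarrow> idx W N = q" if "W \<in> betw N V" for W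
    using idx_upper_iff[OF quots(2) idx_VN that, of 2] by simp
  have "H = Z" if H: "H \<in> betw N V" "idx V H = q ^ 2" "closed Ideals H" for H
  proof (rule ccontr)
    assume "H \<noteq> Z"
    then obtain w0 where w0: "w0 \<in> H" "w0 \<notin> Z" "H \<inter> Z = N" using line_facts[of H] H L by metis
    have w0V: "w0 \<in> V" using w0 H by (auto simp: betw_def)
    obtain w where w: "w \<in> V" "br w0 w \<notin> N" using nondeg[OF w0V w0(2)] by blast
    have "br w w0 \<in> H" using H(3) w w0 sub by auto
    moreover have "br w w0 \<in> Z" using V_V w w0V by blast
    ultimately have "br w w0 \<in> N" using w0 by blast
    moreover have "br w0 w = - br w w0" by (rule br_anti)
    ultimately show False using w lat_minus[OF lats(1)] by simp
  qed
  moreover have "closed Ideals Z"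
  proof -
    have "br v h \<in> Z" if "v \<in> V" "h \<in> Z" for v h using V_Z[OF that] lats by blast
    thus ?thesis using ideal_lower_iff[OF Z] T_facts(2) by blast
  qed
  ultimately have "{H \<in> betw N V. idx V H = q ^ 2 \<and> closed Ideals H} = {Z}" using Z idx_V by blast
  hence "card {H \<in> betw N V. idx V H = q ^ 2 \<and> closed Ideals H} = 1" by (simp only:) simp
  thus ?thesis using num_Ideals[of 3] by (simp del: closed.simps)
qed

end

section \<open>Coordinates on a free Lie algebra\<close>

abbreviation OK :: "'k::field_char_0 ring" where "OK \<equiv> ring_of_integers"

lemma OK_simps [simp]:
  "x \<in> carrier OK \<longleftrightarrow> algebraic_int x" "x \<otimes>\<^bsub>OK\<^esub> y = x * y" "x \<oplus>\<^bsub>OK\<^esub> y = x + y"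
  "\<one>\<^bsub>OK\<^esub> = 1" "\<zero>\<^bsub>OK\<^esub> = 0"
  by (simp_all add: ring_of_integers_def)

definition vscale :: "'k::field => (nat => 'k) => nat => 'k" where
  "vscale r v = (\<lambda>i. r * v i)"

lemma vscale_apply [simp]: "vscale r v i = r * v i"
  by (simp add: vscale_def)

lemma minus_fun_apply' [simp]: "(u - v) i = u i - (v i :: 'k::ab_group_add)"
  by (simp add: fun_diff_def)

lemma sum_fun_apply [simp]: "(\<Sum>i\<in>S. f i) k = (\<Sum>i\<in>S. f i k :: 'k::comm_monoid_add)"
  by (induction S rule: infinite_finite_induct) auto

interpretation vs: vector_space "vscale :: 'k::field => (nat => 'k) => nat => 'k"
  by unfold_locales (auto simp: fun_eq_iff algebra_simps)

locale lie_coords = lie_algebra OK L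
  for L :: "('k::field_char_0, 'a) lie_module" +
  fixes n :: nat and b :: "nat => 'a"
  assumes b_carrier: "b \<in> {..<n} \<rightarrow> carrier L"
    and b_basis: "x \<in> carrier L ==>
      \<exists>!c. c \<in> {..<n} \<rightarrow>\<^sub>E carrier OK \<and> x = (\<Oplus>\<^bsub>L\<^esub> i \<in> {..<n}. c i \<odot>\<^bsub>L\<^esub> b i)"
begin

text \<open>Coordinates are padded by 0 from n on, so that K^n is realised for every n inside the
  single type of functions on the natural numbers.\<close>

definition coord :: "'a => nat => 'k" where
  "coord x i = (if i < n then (THE c. c \<in> {..<n} \<rightarrow>\<^sub>E carrier OK \<and> x = (\<Oplus>\<^bsub>L\<^esub> i \<in> {..<n}. c i \<odot>\<^bsub>L\<^esub> b i)) i else 0)"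

definition vec :: "(nat => 'k) => 'a" where
  "vec c = (\<Oplus>\<^bsub>L\<^esub> i \<in> {..<n}. c i \<odot>\<^bsub>L\<^esub> b i)"

text \<open>Closure of the algebraic integers under sums and products is contained in the hypothesis
  that L is a module over them, since a module lives over a commutative ring.\<close>

lemma int_add: "algebraic_int x ==> algebraic_int y ==> algebraic_int (x + y :: 'k)"
  using R.add.m_closed[of x y] by simp
lemma int_mult: "algebraic_int x ==> algebraic_int y ==> algebraic_int (x * y :: 'k)"
  using R.m_closed[of x y] by simp
lemma int_diff: "algebraic_int x ==> algebraic_int y ==> algebraic_int (x - y :: 'k)"
  using int_add[of x "- y"] by simp

lemma b_in [simp]: "i < n ==> b i \<in> carrier L" using b_carrier by auto

lemma vec_term: "(\<And>i. i < n ==> algebraic_int (c i)) ==> i < n ==> c i \<odot>\<^bsub>L\<^esub> b i \<in> carrier L"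
  by (intro smult_closed) auto

lemma vec_closed:
  assumes "\<And>i. i < n ==> algebraic_int (c i)" shows "vec c \<in> carrier L"
  unfolding vec_def by (intro M.finsum_closed) (simp add: Pi_iff vec_term assms)

lemma coord_unique:
  assumes "\<And>i. i < n ==> algebraic_int (c i)" "i < n" shows "coord (vec c) i = c i"
proof -
  let ?c = "restrict c {..<n}"
  have "vec c = (\<Oplus>\<^bsub>L\<^esub> i \<in> {..<n}. ?c i \<odot>\<^bsub>L\<^esub> b i)"
    unfolding vec_def by (rule M.finsum_cong') (simp_all add: Pi_iff vec_term assms)
  moreover have "?c \<in> {..<n} \<rightarrow>\<^sub>E carrier OK" using assms by auto
  ultimately have "(THE c'. c' \<in> {..<n} \<rightarrow>\<^sub>E carrier OK \<and> vec c = (\<Oplus>\<^bsub>L\<^esub> i \<in> {..<n}. c' i \<odot>\<^bsub>L\<^esub> b i)) = ?c"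
    using b_basis[OF vec_closed[of c]] assms by (intro the1_equality) auto
  thus ?thesis using assms by (simp add: coord_def)
qed

lemma coord_ge [simp]: "i \<ge> n ==> coord x i = 0" by (simp add: coord_def)

lemma
  assumes "x \<in> carrier L"
  shows coord_int: "algebraic_int (coord x i)" and vec_coord: "vec (coord x) = x"
proof -
  define c where "c = (THE c. c \<in> {..<n} \<rightarrow>\<^sub>E carrier OK \<and> x = (\<Oplus>\<^bsub>L\<^esub> i \<in> {..<n}. c i \<odot>\<^bsub>L\<^esub> b i))"
  have c: "c \<in> {..<n} \<rightarrow>\<^sub>E carrier OK" "x = (\<Oplus>\<^bsub>L\<^esub> i \<in> {..<n}. c i \<odot>\<^bsub>L\<^esub> b i)"
    using theI'[OF b_basis[OF assms]] by (auto simp: c_def)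
  have cc: "coord x i = c i" if "i < n" for i using that by (simp add: coord_def c_def)
  show i: "algebraic_int (coord x i)" for i using c cc by (cases "i < n") auto
  show "vec (coord x) = x"
    unfolding vec_def by (subst (2) c(2), rule M.finsum_cong') (use c cc in \<open>auto intro!: smult_closed\<close>)
qed

lemma vec_add:
  assumes "\<And>i. i < n ==> algebraic_int (c i)" "\<And>i. i < n ==> algebraic_int (d i)"
  shows "vec c \<oplus>\<^bsub>L\<^esub> vec d = vec (\<lambda>i. c i + d i)"
proof -
  have "vec (\<lambda>i. c i + d i) = (\<Oplus>\<^bsub>L\<^esub> i \<in> {..<n}. c i \<odot>\<^bsub>L\<^esub> b i \<oplus>\<^bsub>L\<^esub> d i \<odot>\<^bsub>L\<^esub> b i)"
    unfolding vec_def
  proof (rule M.finsum_cong'[OF refl])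
    fix i assume "i \<in> {..<n}"
    thus "(c i + d i) \<odot>\<^bsub>L\<^esub> b i = c i \<odot>\<^bsub>L\<^esub> b i \<oplus>\<^bsub>L\<^esub> d i \<odot>\<^bsub>L\<^esub> b i"
      using smult_l_distr[of "c i" "d i" "b i"] assms by simp
  qed (auto intro!: M.add.m_closed vec_term assms)
  thus ?thesis unfolding vec_def by (subst M.finsum_addf[symmetric]) (auto intro!: vec_term assms)
qed

lemma vec_scale:
  assumes "\<And>i. i < n ==> algebraic_int (c i)" "algebraic_int r"
  shows "r \<odot>\<^bsub>L\<^esub> vec c = vec (\<lambda>i. r * c i)"
proof -
  have "r \<odot>\<^bsub>L\<^esub> vec c = (\<Oplus>\<^bsub>L\<^esub> i \<in> {..<n}. r \<odot>\<^bsub>L\<^esub> (c i \<odot>\<^bsub>L\<^esub> b i))"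
    unfolding vec_def by (rule finsum_smult_ldistr) (auto intro!: vec_term assms simp: assms)
  also have "\<dots> = vec (\<lambda>i. r * c i)" unfolding vec_def
  proof (rule M.finsum_cong'[OF refl])
    fix i assume "i \<in> {..<n}"
    thus "r \<odot>\<^bsub>L\<^esub> (c i \<odot>\<^bsub>L\<^esub> b i) = (r * c i) \<odot>\<^bsub>L\<^esub> b i"
      using smult_assoc1[of r "c i" "b i"] assms by simp
  qed (auto intro!: smult_closed simp: assms int_mult)
  finally show ?thesis .
qed

lemma coord_eqI:
  assumes "x = vec c" "\<And>i. i < n ==> algebraic_int (c i)" "\<And>i. i \<ge> n ==> c i = 0"
  shows "coord x = c"
proof
  fix i show "coord x i = c i" using coord_unique[of c i] assms by (cases "i < n") auto
qed

lemma coord_add: "x \<in> carrier L ==> y \<in> carrier L ==> coord (x \<oplus>\<^bsub>L\<^esub> y) = coord x + coord y"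
  by (rule coord_eqI) (use vec_add[of "coord x" "coord y"] in \<open>auto simp: coord_int vec_coord int_add plus_fun_def\<close>)

lemma coord_smult: "x \<in> carrier L ==> algebraic_int r ==> coord (r \<odot>\<^bsub>L\<^esub> x) = vscale r (coord x)"
  by (rule coord_eqI) (use vec_scale[of "coord x" r] in \<open>auto simp: coord_int vec_coord int_mult vscale_def\<close>)

lemma coord_zero: "coord \<zero>\<^bsub>L\<^esub> = 0"
  using coord_add[of "\<zero>\<^bsub>L\<^esub>" "\<zero>\<^bsub>L\<^esub>"] by simp


lemma vec_partial:
  assumes "k \<le> n" "\<And>i. i < n ==> algebraic_int (c i)"
  shows "(\<Oplus>\<^bsub>L\<^esub> i \<in> {..<k}. c i \<odot>\<^bsub>L\<^esub> b i) \<in> carrier L"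
    and "k < n ==> (\<Oplus>\<^bsub>L\<^esub> i \<in> {..<Suc k}. c i \<odot>\<^bsub>L\<^esub> b i) = c k \<odot>\<^bsub>L\<^esub> b k \<oplus>\<^bsub>L\<^esub> (\<Oplus>\<^bsub>L\<^esub> i \<in> {..<k}. c i \<odot>\<^bsub>L\<^esub> b i)"
proof -
  show "(\<Oplus>\<^bsub>L\<^esub> i \<in> {..<k}. c i \<odot>\<^bsub>L\<^esub> b i) \<in> carrier L"
    using assms by (intro M.finsum_closed) (auto intro!: vec_term)
  assume "k < n"
  thus "(\<Oplus>\<^bsub>L\<^esub> i \<in> {..<Suc k}. c i \<odot>\<^bsub>L\<^esub> b i) = c k \<odot>\<^bsub>L\<^esub> b k \<oplus>\<^bsub>L\<^esub> (\<Oplus>\<^bsub>L\<^esub> i \<in> {..<k}. c i \<odot>\<^bsub>L\<^esub> b i)"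
    unfolding lessThan_Suc using assms by (subst M.finsum_insert) (auto intro!: vec_term)
qed

text \<open>The bracket of L in coordinates, extended bilinearly from the structure constants to
  K^n; entries from n on are ignored.\<close>

definition br :: "(nat => 'k) => (nat => 'k) => nat => 'k" where
  "br u v k = (\<Sum>i<n. \<Sum>j<n. u i * v j * coord (lie L (b i) (b j)) k)"

lemma br_ge: "k \<ge> n ==> br u v k = 0" by (simp add: br_def)

lemma br_linear:
  "br u (v + w) = br u v + br u w" "br (v + w) u = br v u + br w u"
  "br u (vscale r v) = vscale r (br u v)" "br (vscale r v) u = vscale r (br v u)"
  by (auto simp: fun_eq_iff br_def algebra_simps sum.distrib sum_distrib_left)

lemma lie_sum_right:
  assumes "k \<le> n" "x \<in> carrier L" "y \<in> carrier L"
  shows "coord (lie L x (\<Oplus>\<^bsub>L\<^esub> j \<in> {..<k}. coord y j \<odot>\<^bsub>L\<^esub> b j)) = (\<Sum>j<k. vscale (coord y j) (coord (lie L x (b j))))"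
  using assms(1)
proof (induction k)
  case 0
  have "lie L x \<zero>\<^bsub>L\<^esub> = lie L x (0 \<odot>\<^bsub>L\<^esub> \<zero>\<^bsub>L\<^esub>)" using smult_r_null[of 0] by simp
  also have "\<dots> = 0 \<odot>\<^bsub>L\<^esub> lie L x \<zero>\<^bsub>L\<^esub>" using lie_smult_right[of 0 x "\<zero>\<^bsub>L\<^esub>"] assms by simp
  also have "\<dots> = \<zero>\<^bsub>L\<^esub>" using smult_l_null[of "lie L x \<zero>\<^bsub>L\<^esub>"] lie_closed assms by simp
  finally show ?case by (simp add: coord_zero)
next
  case (Suc k)
  let ?s = "\<Oplus>\<^bsub>L\<^esub> j \<in> {..<k}. coord y j \<odot>\<^bsub>L\<^esub> b j"
  have c: "?s \<in> carrier L" "coord y k \<odot>\<^bsub>L\<^esub> b k \<in> carrier L"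
    using vec_partial(1)[of k "coord y"] Suc vec_term[of "coord y" k] assms coord_int by auto
  have "(\<Oplus>\<^bsub>L\<^esub> j \<in> {..<Suc k}. coord y j \<odot>\<^bsub>L\<^esub> b j) = coord y k \<odot>\<^bsub>L\<^esub> b k \<oplus>\<^bsub>L\<^esub> ?s"
    using vec_partial(2)[of k "coord y"] Suc assms coord_int by auto
  hence "lie L x (\<Oplus>\<^bsub>L\<^esub> j \<in> {..<Suc k}. coord y j \<odot>\<^bsub>L\<^esub> b j) = coord y k \<odot>\<^bsub>L\<^esub> lie L x (b k) \<oplus>\<^bsub>L\<^esub> lie L x ?s"
    using lie_add_right[OF assms(2) c(2,1)] lie_smult_right[of "coord y k" x "b k"] Suc assms coord_int by simp
  thus ?case using coord_add[of "coord y k \<odot>\<^bsub>L\<^esub> lie L x (b k)" "lie L x ?s"] coord_smult[of "lie L x (b k)" "coord y k"]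
      Suc assms c coord_int lie_closed by (simp add: add.commute)
qed

lemma lie_sum_left:
  assumes "k \<le> n" "x \<in> carrier L" "y \<in> carrier L"
  shows "coord (lie L (\<Oplus>\<^bsub>L\<^esub> j \<in> {..<k}. coord y j \<odot>\<^bsub>L\<^esub> b j) x) = (\<Sum>j<k. vscale (coord y j) (coord (lie L (b j) x)))"
  using assms(1)
proof (induction k)
  case 0
  have "lie L \<zero>\<^bsub>L\<^esub> x = lie L (0 \<odot>\<^bsub>L\<^esub> \<zero>\<^bsub>L\<^esub>) x" using smult_r_null[of 0] by simp
  also have "\<dots> = 0 \<odot>\<^bsub>L\<^esub> lie L \<zero>\<^bsub>L\<^esub> x" using lie_smult_left[of 0 "\<zero>\<^bsub>L\<^esub>" x] assms by simp
  also have "\<dots> = \<zero>\<^bsub>L\<^esub>" using smult_l_null[of "lie L \<zero>\<^bsub>L\<^esub> x"] lie_closed assms by simp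
  finally show ?case by (simp add: coord_zero)
next
  case (Suc k)
  let ?s = "\<Oplus>\<^bsub>L\<^esub> j \<in> {..<k}. coord y j \<odot>\<^bsub>L\<^esub> b j"
  have c: "?s \<in> carrier L" "coord y k \<odot>\<^bsub>L\<^esub> b k \<in> carrier L"
    using vec_partial(1)[of k "coord y"] Suc vec_term[of "coord y" k] assms coord_int by auto
  have "(\<Oplus>\<^bsub>L\<^esub> j \<in> {..<Suc k}. coord y j \<odot>\<^bsub>L\<^esub> b j) = coord y k \<odot>\<^bsub>L\<^esub> b k \<oplus>\<^bsub>L\<^esub> ?s"
    using vec_partial(2)[of k "coord y"] Suc assms coord_int by auto
  hence "lie L (\<Oplus>\<^bsub>L\<^esub> j \<in> {..<Suc k}. coord y j \<odot>\<^bsub>L\<^esub> b j) x = coord y k \<odot>\<^bsub>L\<^esub> lie L (b k) x \<oplus>\<^bsub>L\<^esub> lie L ?s x"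
    using lie_add_left[OF c(2,1) assms(2)] lie_smult_left[of "coord y k" "b k" x] Suc assms coord_int by simp
  thus ?case using coord_add[of "coord y k \<odot>\<^bsub>L\<^esub> lie L (b k) x" "lie L ?s x"] coord_smult[of "lie L (b k) x" "coord y k"]
      Suc assms c coord_int lie_closed by (simp add: add.commute)
qed

lemma coord_lie:
  assumes "x \<in> carrier L" "y \<in> carrier L" shows "coord (lie L x y) = br (coord x) (coord y)"
proof -
  have "coord (lie L x y) = coord (lie L (vec (coord x)) y)" using assms vec_coord by simp
  also have "\<dots> = (\<Sum>i<n. vscale (coord x i) (coord (lie L (b i) y)))"
    unfolding vec_def using lie_sum_left[of n y x] assms by simp
  also have "\<dots> = (\<Sum>i<n. vscale (coord x i) (\<Sum>j<n. vscale (coord y j) (coord (lie L (b i) (b j)))))"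
    using lie_sum_right[of n _ y] assms vec_coord[of y] unfolding vec_def by (intro sum.cong) auto
  finally show ?thesis by (simp add: fun_eq_iff br_def sum_distrib_left mult.assoc)
qed

definition ambient :: "(nat => 'k) set" where "ambient = {v. \<forall>i\<ge>n. v i = 0}"

lemma br_ambient: "br u v \<in> ambient" by (simp add: ambient_def br_ge)

end

section \<open>Reduction modulo a prime in coordinates\<close>

text \<open>The additive extension of \<phi> to the free abelian group on its domain; maps out of
  the formal sums behind the tensor product are given in this way.\<close>

definition wsum :: "('p => 'k::field_char_0) => ('p \<Rightarrow>\<^sub>0 int) => 'k" where
  "wsum \<phi> f = (\<Sum>p\<in>Poly_Mapping.keys f. of_int (Poly_Mapping.lookup f p) * \<phi> p)"

lemma wsum_superset:
  "finite S ==> Poly_Mapping.keys f \<subseteq> S ==> wsum \<phi> f = (\<Sum>p\<in>S. of_int (Poly_Mapping.lookup f p) * \<phi> p)"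
  unfolding wsum_def by (rule sum.mono_neutral_left) (auto simp: in_keys_iff)

lemma wsum_0 [simp]: "wsum \<phi> 0 = 0" by (simp add: wsum_def)

lemma wsum_of [simp]: "wsum \<phi> (frag_of p) = \<phi> p"
  by (simp add: wsum_def)

lemma wsum_add: "wsum \<phi> (f + g) = wsum \<phi> f + wsum \<phi> g"
proof -
  let ?S = "Poly_Mapping.keys f \<union> Poly_Mapping.keys g"
  have "finite ?S" "Poly_Mapping.keys (f + g) \<subseteq> ?S" using keys_add[of f g] by auto
  thus ?thesis
    using wsum_superset[of ?S "f + g" \<phi>] wsum_superset[of ?S f \<phi>] wsum_superset[of ?S g \<phi>]
    by (simp add: lookup_add algebra_simps sum.distrib)
qed

lemma wsum_cmul: "wsum \<phi> (frag_cmul c f) = of_int c * wsum \<phi> f"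
  using wsum_superset[of "Poly_Mapping.keys f" "frag_cmul c f" \<phi>] keys_cmul[of c f]
  by (simp add: wsum_def sum_distrib_left mult.assoc)

lemma wsum_minus: "wsum \<phi> (- f) = - wsum \<phi> f"
  using wsum_cmul[of \<phi> "-1" f] by simp

lemma wsum_diff: "wsum \<phi> (f - g) = wsum \<phi> f - wsum \<phi> g"
  using wsum_add[of \<phi> f "- g"] by (simp add: wsum_minus)

lemma wsum_sum: "wsum \<phi> (\<Sum>i\<in>S. g i) = (\<Sum>i\<in>S. wsum \<phi> (g i))"
  by (induction S rule: infinite_finite_induct) (auto simp: wsum_add)

lemma wsum_extend: "wsum \<phi> (frag_extend g f) = wsum (\<lambda>p. wsum \<phi> (g p)) f"
  unfolding frag_extend_def wsum_sum wsum_cmul by (simp add: wsum_def)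

lemma wsum_linear: "wsum (\<lambda>p. c * \<phi> p) f = c * wsum \<phi> f"
  by (simp add: wsum_def sum_distrib_left algebra_simps)

lemma wsum_swap_sum: "wsum (\<lambda>p. \<Sum>i\<in>S. \<phi> i p) f = (\<Sum>i\<in>S. wsum (\<phi> i) f)"
  unfolding wsum_def sum_distrib_left by (rule sum.swap)

lemma (in lie_coords) br_wsum_left: "br (\<lambda>i. wsum (\<lambda>p. \<phi> p i) f) w k = wsum (\<lambda>p. br (\<phi> p) w k) f"
proof -
  have "wsum (\<lambda>p. br (\<phi> p) w k) f = (\<Sum>i<n. \<Sum>j<n. wsum (\<lambda>p. (w j * coord (lie L (b i) (b j)) k) * \<phi> p i) f)"
    unfolding br_def wsum_swap_sum by (simp add: mult_ac)
  thus ?thesis unfolding wsum_linear br_def by (simp add: mult_ac)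
qed

lemma (in lie_coords) br_wsum_right: "br w (\<lambda>i. wsum (\<lambda>p. \<phi> p i) f) k = wsum (\<lambda>p. br w (\<phi> p) k) f"
proof -
  have "wsum (\<lambda>p. br w (\<phi> p) k) f = (\<Sum>i<n. \<Sum>j<n. wsum (\<lambda>p. (w i * coord (lie L (b i) (b j)) k) * \<phi> p j) f)"
    unfolding br_def wsum_swap_sum by (simp add: mult_ac)
  thus ?thesis unfolding wsum_linear br_def by (simp add: mult_ac)
qed

text \<open>A plays the part of the local ring at I inside K. The last assumption says that A has no
  residues beyond those of algebraic integers, so that A / M agrees with the quotient of the ring of
  integers by I.\<close>

locale reduction_coords = lie_coords L n b + local_ring A M
  for L :: "('k::field_char_0, 'a) lie_module" and n b and A M :: "'k set" +
  fixes I :: "'k set"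
  assumes I: "ideal I OK" and I_eq: "I = {x. algebraic_int x \<and> x \<in> M}"
    and int_A: "algebraic_int x ==> x \<in> A"
    and A_int: "a \<in> A ==> \<exists>r. algebraic_int r \<and> a - r \<in> M"
begin

abbreviation F where "F \<equiv> OK Quot I"

text \<open>The residue class of a in the quotient by I, written as the set of algebraic integers
  congruent to a modulo M; it makes sense for every a in A.\<close>

definition hcl :: "'k => 'k set" where "hcl a = {r. algebraic_int r \<and> r - a \<in> M}"

lemma hcl_eq_iff: "a \<in> A ==> a' \<in> A ==> hcl a = hcl a' \<longleftrightarrow> a - a' \<in> M"
proof
  assume a: "a \<in> A" "a' \<in> A"
  { assume e: "hcl a = hcl a'"
    obtain r where r: "algebraic_int r" "a - r \<in> M" using A_int a by blast
    have "r - a \<in> M" using uminus_M[OF r(2)] by simp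
    hence "r \<in> hcl a'" using r e by (auto simp: hcl_def)
    hence "r - a' \<in> M" by (simp add: hcl_def)
    from add_M[OF r(2) this] show "a - a' \<in> M" by simp }
  { assume e: "a - a' \<in> M"
    have "r - a \<in> M \<longleftrightarrow> r - a' \<in> M" for r
      using add_M[OF _ e, of "r - a"] diff_M[OF _ e, of "r - a'"] by auto
    thus "hcl a = hcl a'" by (simp add: hcl_def) }
qed

lemma hcl_rep: "a \<in> A ==> \<exists>r. algebraic_int r \<and> hcl a = hcl r \<and> r \<in> A"
  using A_int hcl_eq_iff int_A by metis

lemma coset_eq_hcl: "algebraic_int r ==> I +>\<^bsub>OK\<^esub> r = hcl r"
proof -
  assume r: "algebraic_int r"
  have "x \<in> I +>\<^bsub>OK\<^esub> r \<longleftrightarrow> x \<in> hcl r" for x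
  proof -
    have "x \<in> I +>\<^bsub>OK\<^esub> r \<longleftrightarrow> (\<exists>i\<in>I. x = i + r)" by (auto simp: a_r_coset_def')
    also have "\<dots> \<longleftrightarrow> x - r \<in> I" by (metis add_diff_cancel_right' diff_add_cancel)
    also have "\<dots> \<longleftrightarrow> x \<in> hcl r" using int_diff[of x r] int_add[of "x - r" r] r by (auto simp: I_eq hcl_def)
    finally show ?thesis .
  qed
  thus ?thesis by blast
qed

lemma carrier_F: "carrier F = hcl ` A"
proof -
  have "carrier OK = {r :: 'k. algebraic_int r}" by auto
  hence "carrier F = (\<Union>r\<in>{r. algebraic_int r}. {I +>\<^bsub>OK\<^esub> r})" by (simp add: FactRing_def A_RCOSETS_def')
  also have "\<dots> = (\<Union>r\<in>{r. algebraic_int r}. {hcl r})" using coset_eq_hcl by (intro SUP_cong) auto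
  also have "\<dots> = hcl ` A" using hcl_rep int_A by blast
  finally show ?thesis .
qed

lemma hcl_carrier [simp]: "a \<in> A ==> hcl a \<in> carrier F" by (simp add: carrier_F)

lemma F_ops:
  "\<one>\<^bsub>F\<^esub> = hcl 1" "\<zero>\<^bsub>F\<^esub> = hcl 0"
  "a \<in> A ==> a' \<in> A ==> hcl a \<otimes>\<^bsub>F\<^esub> hcl a' = hcl (a * a')"
  "a \<in> A ==> a' \<in> A ==> hcl a \<oplus>\<^bsub>F\<^esub> hcl a' = hcl (a + a')"
proof -
  interpret I: ideal I OK by (rule I)
  show "\<one>\<^bsub>F\<^esub> = hcl 1" using coset_eq_hcl[of 1] by (simp add: FactRing_def)
  show "\<zero>\<^bsub>F\<^esub> = hcl 0" by (simp add: FactRing_def hcl_def I_eq)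
  assume a: "a \<in> A" "a' \<in> A"
  obtain r r' where r: "algebraic_int r" "hcl a = hcl r" "r \<in> A" "algebraic_int r'" "hcl a' = hcl r'" "r' \<in> A"
    using hcl_rep a by meson
  have d: "a - r \<in> M" "a' - r' \<in> M" using r hcl_eq_iff a by auto
  have "hcl a \<otimes>\<^bsub>F\<^esub> hcl a' = hcl (r * r')"
    using r I.rcoset_mult_add[of r r'] coset_eq_hcl int_mult by (simp add: FactRing_def)
  moreover have "a * a' - r * r' \<in> M"
  proof -
    have "a * a' - r * r' = a * (a' - r') + r' * (a - r)" by (simp add: algebra_simps)
    thus ?thesis using d a r mult_M add_M by metis
  qed
  ultimately show "hcl a \<otimes>\<^bsub>F\<^esub> hcl a' = hcl (a * a')" using hcl_eq_iff[of "a * a'" "r * r'"] a r mult_A by simp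
  have "hcl a \<oplus>\<^bsub>F\<^esub> hcl a' = hcl (r + r')"
    using r I.a_rcos_sum[of r r'] coset_eq_hcl int_add by (simp add: FactRing_def)
  moreover have "(a + a') - (r + r') \<in> M" using add_M[OF d] by (simp add: algebra_simps)
  ultimately show "hcl a \<oplus>\<^bsub>F\<^esub> hcl a' = hcl (a + a')" using hcl_eq_iff[of "a + a'" "r + r'"] a r add_A by simp
qed

lemma card_F: "card (carrier F) = q"
  using idx_eq_card_image[OF addgrp_M, of A hcl] hcl_eq_iff by (simp add: carrier_F q_def)

definition rep :: "'k set => 'k" where "rep s = (SOME r. algebraic_int r \<and> hcl r = s)"

lemma rep: "s \<in> carrier F ==> algebraic_int (rep s) \<and> hcl (rep s) = s"
proof -
  assume "s \<in> carrier F"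
  hence "\<exists>r. algebraic_int r \<and> hcl r = s" using hcl_rep carrier_F by (metis imageE)
  thus ?thesis unfolding rep_def by (rule someI_ex)
qed

lemma rep_hcl: "a \<in> A ==> rep (hcl a) - a \<in> M"
  using rep[of "hcl a"] hcl_eq_iff[of "rep (hcl a)" a] int_A by auto

definition FR :: "('a \<times> 'k set \<Rightarrow>\<^sub>0 int) set" where
  "FR = {f. Poly_Mapping.keys f \<subseteq> carrier L \<times> carrier F}"

text \<open>Sends x \<otimes> s to an integral representative of s times the coordinates of x.
  Representatives are not additive, so only the value modulo M is meaningful.\<close>

definition ev :: "('a \<times> 'k set \<Rightarrow>\<^sub>0 int) => nat => 'k" where
  "ev f i = wsum (\<lambda>p. rep (snd p) * coord (fst p) i) f"

abbreviation TK where "TK \<equiv> tensor_kernel OK F (\<lambda>r. I +>\<^bsub>OK\<^esub> r) L"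

lemma FR_closed: "f \<in> FR ==> g \<in> FR ==> f + g \<in> FR" "f \<in> FR ==> g \<in> FR ==> f - g \<in> FR" "0 \<in> FR" "f \<in> FR ==> - f \<in> FR"
  using keys_add[of f g] keys_diff[of f g] by (auto simp: FR_def)
lemma FR_of [simp]: "frag_of p \<in> FR \<longleftrightarrow> p \<in> carrier L \<times> carrier F" by (simp add: FR_def)

lemma ev_simps: "ev (f + g) = ev f + ev g" "ev (f - g) = ev f - ev g" "ev 0 = 0" "ev (- f) = - ev f"
  "ev (frag_of (x, s)) = vscale (rep s) (coord x)"
  by (auto simp: ev_def wsum_add wsum_diff wsum_minus fun_eq_iff)

lemma of_int_A: "of_int k \<in> A"
proof (rule int_A)
  show "algebraic_int (of_int k :: 'k)" by (rule int_imp_algebraic_int) simp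
qed

lemma wsum_M: "(\<And>p. p \<in> Poly_Mapping.keys f ==> \<phi> p \<in> M) ==> wsum \<phi> f \<in> M"
proof -
  assume "\<And>p. p \<in> Poly_Mapping.keys f ==> \<phi> p \<in> M"
  moreover have "sum g S \<in> M" if "\<And>p. p \<in> S ==> g p \<in> M" for g :: "_ => 'k" and S
    using that by (induction S rule: infinite_finite_induct) (auto simp: zero_M add_M)
  ultimately show ?thesis unfolding wsum_def by (metis (no_types, lifting) mult_M of_int_A)
qed

lemma wsum_cong_M: "(\<And>p. p \<in> Poly_Mapping.keys f ==> \<phi> p - \<psi> p \<in> M) ==> wsum \<phi> f - wsum \<psi> f \<in> M"
proof -
  assume "\<And>p. p \<in> Poly_Mapping.keys f ==> \<phi> p - \<psi> p \<in> M"
  hence "wsum (\<lambda>p. \<phi> p - \<psi> p) f \<in> M" by (rule wsum_M)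
  thus ?thesis by (simp add: wsum_def algebra_simps sum_subtractf)
qed

definition \<Lambda> :: "(nat => 'k) set" where "\<Lambda> = {v \<in> ambient. \<forall>i. v i \<in> A}"
definition \<Lambda>M :: "(nat => 'k) set" where "\<Lambda>M = {v \<in> ambient. \<forall>i. v i \<in> M}"

lemma coord_\<Lambda>: "x \<in> carrier L ==> coord x \<in> \<Lambda>"
  by (auto simp: \<Lambda>_def ambient_def intro: int_A coord_int)

lemma coord_A: "x \<in> carrier L ==> coord x i \<in> A"
  by (intro int_A coord_int)

lemma \<Lambda>_closed: "u \<in> \<Lambda> ==> v \<in> \<Lambda> ==> u + v \<in> \<Lambda>" "u \<in> \<Lambda> ==> v \<in> \<Lambda> ==> u - v \<in> \<Lambda>" "0 \<in> \<Lambda>" "a \<in> A ==> v \<in> \<Lambda> ==> vscale a v \<in> \<Lambda>"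
  by (auto simp: \<Lambda>_def ambient_def add_A diff_A zero_A mult_A)
lemma \<Lambda>M_closed: "u \<in> \<Lambda>M ==> v \<in> \<Lambda>M ==> u + v \<in> \<Lambda>M" "u \<in> \<Lambda>M ==> v \<in> \<Lambda>M ==> u - v \<in> \<Lambda>M" "0 \<in> \<Lambda>M"
  "a \<in> A ==> v \<in> \<Lambda>M ==> vscale a v \<in> \<Lambda>M" "m \<in> M ==> v \<in> \<Lambda> ==> vscale m v \<in> \<Lambda>M" "\<Lambda>M \<subseteq> \<Lambda>"
  "v \<in> \<Lambda>M ==> - v \<in> \<Lambda>M"
  using mult_M[of _ m] M_subset
  by (auto simp: \<Lambda>_def \<Lambda>M_def ambient_def add_M diff_M zero_M mult_M uminus_M mult.commute[of m])

lemma ev_\<Lambda>: "f \<in> FR ==> ev f \<in> \<Lambda>"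
proof -
  assume f: "f \<in> FR"
  have "ev f i \<in> A" for i
  proof -
    have "sum g S \<in> A" if "\<And>p. p \<in> S ==> g p \<in> A" for g :: "_ => 'k" and S
      using that by (induction S rule: infinite_finite_induct) (auto simp: zero_A add_A)
    moreover have "rep (snd p) * coord (fst p) i \<in> A" if "p \<in> Poly_Mapping.keys f" for p
      using f that rep coord_A int_A by (intro mult_A) (auto simp: FR_def)
    ultimately show ?thesis unfolding ev_def wsum_def using of_int_A mult_A by (metis (no_types, lifting))
  qed
  moreover have "ev f i = 0" if "i \<ge> n" for i using that by (simp add: ev_def wsum_def)
  ultimately show ?thesis by (simp add: \<Lambda>_def ambient_def)
qed

lemma coset_F: "algebraic_int r ==> I +>\<^bsub>OK\<^esub> r \<in> carrier F"
  by (simp add: coset_eq_hcl int_A)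

interpretation TF: group "tensor_free F L"
  by (simp add: tensor_free_def)

lemma TF_simps [simp]: "carrier (tensor_free F L) = FR" "x \<otimes>\<^bsub>tensor_free F L\<^esub> y = x + y" "\<one>\<^bsub>tensor_free F L\<^esub> = 0"
  by (simp_all add: tensor_free_def FR_def free_Abelian_group_def)

lemma TF_inv [simp]: "x \<in> FR ==> inv\<^bsub>tensor_free F L\<^esub> x = - x"
  by (simp add: tensor_free_def FR_def)

lemma F_ring: "cring F"
  by (rule ideal.quotient_is_cring[OF I R.is_cring])

abbreviation "gens \<equiv>
   {frag_of (x \<oplus>\<^bsub>L\<^esub> y, a) - frag_of (x, a) - frag_of (y, a) | x y a.
         x \<in> carrier L \<and> y \<in> carrier L \<and> a \<in> carrier F}
    \<union> {frag_of (x, a \<oplus>\<^bsub>F\<^esub> b) - frag_of (x, a) - frag_of (x, b) | x a b.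
         x \<in> carrier L \<and> a \<in> carrier F \<and> b \<in> carrier F}
    \<union> {frag_of (r \<odot>\<^bsub>L\<^esub> x, a) - frag_of (x, (I +>\<^bsub>OK\<^esub> r) \<otimes>\<^bsub>F\<^esub> a) | r x a.
         r \<in> carrier OK \<and> x \<in> carrier L \<and> a \<in> carrier F}"

lemma gens_FR: "gens \<subseteq> FR"
proof -
  interpret Fc: cring F by (rule F_ring)
  show ?thesis using coset_F by (auto intro!: FR_closed)
qed

text \<open>Additivity in x is respected exactly. Additivity in the scalar and the passage of ring
  elements across the tensor sign are respected modulo M, since \<open>rep\<close> is compatible
  with the ring operations only up to M.\<close>

lemma gens_ev: "g \<in> gens ==> ev g \<in> \<Lambda>M"
proof -
  interpret Fc: cring F by (rule F_ring)
  assume "g \<in> gens"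
  then consider (1) x y a where "g = frag_of (x \<oplus>\<^bsub>L\<^esub> y, a) - frag_of (x, a) - frag_of (y, a)" "x \<in> carrier L" "y \<in> carrier L" "a \<in> carrier F"
    | (2) x a b where "g = frag_of (x, a \<oplus>\<^bsub>F\<^esub> b) - frag_of (x, a) - frag_of (x, b)" "x \<in> carrier L" "a \<in> carrier F" "b \<in> carrier F"
    | (3) r x a where "g = frag_of (r \<odot>\<^bsub>L\<^esub> x, a) - frag_of (x, (I +>\<^bsub>OK\<^esub> r) \<otimes>\<^bsub>F\<^esub> a)" "algebraic_int r" "x \<in> carrier L" "a \<in> carrier F"
    by auto
  thus ?thesis
  proof cases
    case 1
    hence "ev g = 0" unfolding 1(1) ev_simps by (simp add: coord_add fun_eq_iff algebra_simps)
    thus ?thesis using \<Lambda>M_closed by simp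
  next
    case 2
    have e: "ev g = vscale (rep (a \<oplus>\<^bsub>F\<^esub> b) - rep a - rep b) (coord x)" unfolding 2(1) ev_simps by (simp add: fun_eq_iff algebra_simps)
    have "rep a \<in> A" "rep b \<in> A" "hcl (rep a) = a" "hcl (rep b) = b" using rep 2 int_A by auto
    hence "a \<oplus>\<^bsub>F\<^esub> b = hcl (rep a + rep b)" using F_ops(4) by metis
    hence "rep (a \<oplus>\<^bsub>F\<^esub> b) - (rep a + rep b) \<in> M" using rep_hcl add_A \<open>rep a \<in> A\<close> \<open>rep b \<in> A\<close> by metis
    hence "rep (a \<oplus>\<^bsub>F\<^esub> b) - rep a - rep b \<in> M" by (simp add: algebra_simps)
    thus ?thesis unfolding e using 2 by (intro \<Lambda>M_closed coord_\<Lambda>)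
  next
    case 3
    have e: "ev g = vscale (rep a * r - rep ((I +>\<^bsub>OK\<^esub> r) \<otimes>\<^bsub>F\<^esub> a)) (coord x)" using 3 unfolding 3(1) ev_simps by (simp add: coord_smult fun_eq_iff algebra_simps)
    have *: "rep a \<in> A" "hcl (rep a) = a" "r \<in> A" using rep 3 int_A by auto
    hence "(I +>\<^bsub>OK\<^esub> r) \<otimes>\<^bsub>F\<^esub> a = hcl (r * rep a)" using F_ops(3)[of r "rep a"] coset_eq_hcl 3 by simp
    hence "rep ((I +>\<^bsub>OK\<^esub> r) \<otimes>\<^bsub>F\<^esub> a) - r * rep a \<in> M" using rep_hcl mult_A * by metis
    hence "rep a * r - rep ((I +>\<^bsub>OK\<^esub> r) \<otimes>\<^bsub>F\<^esub> a) \<in> M" using uminus_M by (fastforce simp: algebra_simps)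
    thus ?thesis unfolding e using 3 by (intro \<Lambda>M_closed coord_\<Lambda>)
  qed
qed

lemma TK_def': "TK = generate (tensor_free F L) gens"
  by (simp only: tensor_kernel_def Un_assoc)

lemma TK_subgroup: "subgroup TK (tensor_free F L)"
  unfolding TK_def' using TF.generate_is_subgroup gens_FR by simp

lemma TK_closed: "f \<in> TK ==> g \<in> TK ==> f + g \<in> TK" "f \<in> TK ==> - f \<in> TK" "0 \<in> TK" "f \<in> TK ==> g \<in> TK ==> f - g \<in> TK" "TK \<subseteq> FR"
proof -
  show 1: "f \<in> TK ==> g \<in> TK ==> f + g \<in> TK" using subgroup.m_closed[OF TK_subgroup, of f g] by simp
  show 4: "TK \<subseteq> FR" using subgroup.subset[OF TK_subgroup] by simp
  show 2: "f \<in> TK ==> - f \<in> TK" for f using subgroup.m_inv_closed[OF TK_subgroup, of f] 4 TF_inv by auto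
  show 3: "0 \<in> TK" using subgroup.one_closed[OF TK_subgroup] by simp
  show "f \<in> TK ==> g \<in> TK ==> f - g \<in> TK"
    using 2[of g] subgroup.m_closed[OF TK_subgroup, of f "- g"] by simp
qed

lemma TK_gen: "g \<in> gens ==> g \<in> TK"
  unfolding TK_def' by (rule generate.incl)

lemma TK_ev: "f \<in> TK ==> ev f \<in> \<Lambda>M"
proof -
  have "subgroup {f \<in> FR. ev f \<in> \<Lambda>M} (tensor_free F L)"
    by (rule subgroup.intro) (auto simp: ev_simps intro!: FR_closed \<Lambda>M_closed)
  hence "TK \<subseteq> {f \<in> FR. ev f \<in> \<Lambda>M}" unfolding TK_def'
    by (intro TF.generate_subgroup_incl) (use gens_FR gens_ev in blast)+
  thus "f \<in> TK ==> ev f \<in> \<Lambda>M" by blast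
qed

text \<open>Expand 0 as 0 + 0 in the additivity relations.\<close>

lemma TK_zero: "x \<in> carrier L ==> frag_of (x, hcl 0) \<in> TK" "s \<in> carrier F ==> frag_of (\<zero>\<^bsub>L\<^esub>, s) \<in> TK"
proof -
  interpret Fc: cring F by (rule F_ring)
  have z: "hcl 0 = \<zero>\<^bsub>F\<^esub>" by (simp add: F_ops)
  { assume "x \<in> carrier L"
    hence "frag_of (x, \<zero>\<^bsub>F\<^esub> \<oplus>\<^bsub>F\<^esub> \<zero>\<^bsub>F\<^esub>) - frag_of (x, \<zero>\<^bsub>F\<^esub>) - frag_of (x, \<zero>\<^bsub>F\<^esub>) \<in> gens" by blast
    from TK_gen[OF this] have "- frag_of (x, \<zero>\<^bsub>F\<^esub>) \<in> TK" by simp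
    from TK_closed(2)[OF this] show "frag_of (x, hcl 0) \<in> TK" by (simp add: z) }
  { assume "s \<in> carrier F"
    hence "frag_of (\<zero>\<^bsub>L\<^esub> \<oplus>\<^bsub>L\<^esub> \<zero>\<^bsub>L\<^esub>, s) - frag_of (\<zero>\<^bsub>L\<^esub>, s) - frag_of (\<zero>\<^bsub>L\<^esub>, s) \<in> gens" by blast
    from TK_gen[OF this] have "- frag_of (\<zero>\<^bsub>L\<^esub>, s) \<in> TK" by simp
    from TK_closed(2)[OF this] show "frag_of (\<zero>\<^bsub>L\<^esub>, s) \<in> TK" by simp }
qed

text \<open>Every residue class is the class of an algebraic integer r, and x \<otimes> r = r x
  \<otimes> 1; so a formal sum can be collected into one term.\<close>

lemma FR_single: "f \<in> FR ==> \<exists>x\<in>carrier L. f - frag_of (x, hcl 1) \<in> TK"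
proof -
  interpret Fc: cring F by (rule F_ring)
  have one: "hcl 1 \<in> carrier F" using one_A by simp
  assume "f \<in> FR"
  hence "Poly_Mapping.keys f \<subseteq> carrier L \<times> carrier F" by (simp add: FR_def)
  thus ?thesis
  proof (rule free_Abelian_group_induct[where P = "\<lambda>f. \<exists>x\<in>carrier L. f - frag_of (x, hcl 1) \<in> TK"])
    show "\<exists>x\<in>carrier L. 0 - frag_of (x, hcl 1) \<in> TK" by (intro bexI[of _ "\<zero>\<^bsub>L\<^esub>"]) (use TK_closed(2)[OF TK_zero(2)[OF one]] in auto)
  next
    fix f g
    assume "\<exists>x\<in>carrier L. f - frag_of (x, hcl 1) \<in> TK" "\<exists>x\<in>carrier L. g - frag_of (x, hcl 1) \<in> TK"
    then obtain x y where xy: "x \<in> carrier L" "y \<in> carrier L" "f - frag_of (x, hcl 1) \<in> TK" "g - frag_of (y, hcl 1) \<in> TK" by blast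
    have "x \<ominus>\<^bsub>L\<^esub> y \<in> carrier L" using xy by simp
    hence g: "frag_of ((x \<ominus>\<^bsub>L\<^esub> y) \<oplus>\<^bsub>L\<^esub> y, hcl 1) - frag_of (x \<ominus>\<^bsub>L\<^esub> y, hcl 1) - frag_of (y, hcl 1) \<in> gens" using xy one by blast
    have e: "(x \<ominus>\<^bsub>L\<^esub> y) \<oplus>\<^bsub>L\<^esub> y = x" using xy by (simp add: a_minus_def M.a_assoc M.l_neg)
    have t: "frag_of (x, hcl 1) - frag_of (x \<ominus>\<^bsub>L\<^esub> y, hcl 1) - frag_of (y, hcl 1) \<in> TK"
      using TK_gen[OF g] unfolding e .
    have "(f - frag_of (x, hcl 1)) - (g - frag_of (y, hcl 1)) + (frag_of (x, hcl 1) - frag_of (x \<ominus>\<^bsub>L\<^esub> y, hcl 1) - frag_of (y, hcl 1)) \<in> TK"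
      by (rule TK_closed(1)[OF TK_closed(4)[OF xy(3,4)] t])
    hence "f - g - frag_of (x \<ominus>\<^bsub>L\<^esub> y, hcl 1) \<in> TK" by (simp add: algebra_simps)
    thus "\<exists>x\<in>carrier L. f - g - frag_of (x, hcl 1) \<in> TK" using xy by blast
  next
    fix p assume "p \<in> carrier L \<times> carrier F"
    then obtain x s where p: "p = (x, s)" "x \<in> carrier L" "s \<in> carrier F" by auto
    have r: "algebraic_int (rep s)" "hcl (rep s) = s" using rep p by auto
    have g: "frag_of (rep s \<odot>\<^bsub>L\<^esub> x, hcl 1) - frag_of (x, (I +>\<^bsub>OK\<^esub> rep s) \<otimes>\<^bsub>F\<^esub> hcl 1) \<in> gens"
    proof -
      have "rep s \<in> carrier OK" using r by simp
      thus ?thesis using p(2) one by blast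
    qed
    have e: "(I +>\<^bsub>OK\<^esub> rep s) \<otimes>\<^bsub>F\<^esub> hcl 1 = s"
      using coset_eq_hcl[OF r(1)] F_ops(3)[of "rep s" 1] r int_A one_A by simp
    have "frag_of (rep s \<odot>\<^bsub>L\<^esub> x, hcl 1) - frag_of (x, s) \<in> TK" using TK_gen[OF g] unfolding e .
    from TK_closed(2)[OF this] have "frag_of p - frag_of (rep s \<odot>\<^bsub>L\<^esub> x, hcl 1) \<in> TK" by (simp add: p)
    thus "\<exists>x\<in>carrier L. frag_of p - frag_of (x, hcl 1) \<in> TK" using p r by (intro bexI[of _ "rep s \<odot>\<^bsub>L\<^esub> x"]) auto
  qed
qed

text \<open>When x is expanded in the basis, each term c b \<otimes> 1 equals b \<otimes> c, and c
  has residue 0.\<close>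

lemma TK_single: assumes "x \<in> carrier L" "coord x \<in> \<Lambda>M" shows "frag_of (x, hcl 1) \<in> TK"
proof -
  have one: "hcl 1 \<in> carrier F" using one_A by simp
  have c: "algebraic_int (coord x i)" for i using coord_int assms by blast
  have "frag_of (\<Oplus>\<^bsub>L\<^esub> i \<in> {..<k}. coord x i \<odot>\<^bsub>L\<^esub> b i, hcl 1) \<in> TK" if "k \<le> n" for k
    using that
  proof (induction k)
    case 0 show ?case using TK_zero(2)[OF one] by simp
  next
    case (Suc k)
    let ?s = "\<Oplus>\<^bsub>L\<^esub> i \<in> {..<k}. coord x i \<odot>\<^bsub>L\<^esub> b i" and ?t = "coord x k \<odot>\<^bsub>L\<^esub> b k"
    have s: "?s \<in> carrier L" "?t \<in> carrier L" using vec_partial(1)[of k "coord x"] Suc c by auto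
    have e: "(\<Oplus>\<^bsub>L\<^esub> i \<in> {..<Suc k}. coord x i \<odot>\<^bsub>L\<^esub> b i) = ?t \<oplus>\<^bsub>L\<^esub> ?s" using vec_partial(2)[of k "coord x"] Suc c by simp
    have g: "frag_of (?t \<oplus>\<^bsub>L\<^esub> ?s, hcl 1) - frag_of (?t, hcl 1) - frag_of (?s, hcl 1) \<in> TK" using s one by (intro TK_gen) blast
    have t: "frag_of (?t, hcl 1) \<in> TK"
    proof -
      have "coord x k \<in> carrier OK" "b k \<in> carrier L" using c Suc by simp_all
      hence "frag_of (?t, hcl 1) - frag_of (b k, (I +>\<^bsub>OK\<^esub> coord x k) \<otimes>\<^bsub>F\<^esub> hcl 1) \<in> TK"
        using one by (intro TK_gen) blast
      moreover have "(I +>\<^bsub>OK\<^esub> coord x k) \<otimes>\<^bsub>F\<^esub> hcl 1 = hcl (coord x k)"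
        using coset_eq_hcl c F_ops(3)[of "coord x k" 1] int_A one_A by simp
      moreover have "hcl (coord x k) = hcl 0" using hcl_eq_iff[of "coord x k" 0] c int_A zero_A assms(2) by (simp add: \<Lambda>M_def)
      moreover have "frag_of (b k, hcl 0) \<in> TK" using TK_zero Suc by simp
      ultimately show ?thesis using TK_closed(1)[of "frag_of (?t, hcl 1) - frag_of (b k, hcl 0)" "frag_of (b k, hcl 0)"] by simp
    qed
    have s': "frag_of (?s, hcl 1) \<in> TK" using Suc by simp
    have "(frag_of (?t \<oplus>\<^bsub>L\<^esub> ?s, hcl 1) - frag_of (?t, hcl 1) - frag_of (?s, hcl 1)) + (frag_of (?t, hcl 1) + frag_of (?s, hcl 1)) \<in> TK"
      by (rule TK_closed(1)[OF g TK_closed(1)[OF t s']])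
    thus ?case unfolding e by (simp add: algebra_simps)
  qed
  from this[of n] show ?thesis using vec_coord[OF assms(1)] by (simp add: vec_def)
qed

lemma ev_single: "x \<in> carrier L ==> ev (frag_of (x, hcl 1)) - coord x \<in> \<Lambda>M"
proof -
  assume x: "x \<in> carrier L"
  have "ev (frag_of (x, hcl 1)) - coord x = vscale (rep (hcl 1) - 1) (coord x)" by (auto simp: ev_simps fun_eq_iff algebra_simps)
  thus ?thesis using \<Lambda>M_closed(5)[OF rep_hcl[OF one_A] coord_\<Lambda>[OF x]] by simp
qed

text \<open>A formal sum is congruent to some x \<otimes> 1, and if it evaluates into M^n, then so
  do the coordinates of x, which makes x \<otimes> 1 a relation. Consequently the reduction is the
  quotient of A^n by M^n.\<close>

lemma TK_iff: "f \<in> TK \<longleftrightarrow> f \<in> FR \<and> ev f \<in> \<Lambda>M"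
proof
  assume f: "f \<in> FR \<and> ev f \<in> \<Lambda>M"
  then obtain x where x: "x \<in> carrier L" "f - frag_of (x, hcl 1) \<in> TK" using FR_single by blast
  have "ev f - ev (frag_of (x, hcl 1)) \<in> \<Lambda>M" using TK_ev[OF x(2)] by (simp add: ev_simps(2))
  hence "ev f - (ev f - ev (frag_of (x, hcl 1))) - (ev (frag_of (x, hcl 1)) - coord x) \<in> \<Lambda>M"
    using f ev_single[OF x(1)] \<Lambda>M_closed(2) by blast
  hence "coord x \<in> \<Lambda>M" by simp
  from TK_closed(1)[OF x(2) TK_single[OF x(1) this]] show "f \<in> TK" by simp
qed (use TK_ev TK_closed in auto)

end

text \<open>A hyperplane and a complement are split off repeatedly. Only generation is recorded;
  uniqueness of the coefficients modulo M is recovered later by counting.\<close>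

lemma (in lattice_space) lattice_basis:
  assumes "quot N U" "idx U N = q ^ d"
  shows "\<exists>w. (\<forall>i<d. w i \<in> U) \<and> (\<forall>u\<in>U. \<exists>a. (\<forall>i<d. a i \<in> A) \<and> u - (\<Sum>i<d. a i \<star> w i) \<in> N)"
  using assms
proof (induction d arbitrary: U)
  case 0
  hence "U = N" using idx_eq_1_iff by simp
  thus ?case by simp
next
  case (Suc d)
  have "U \<noteq> N" using Suc(3) idx_self[OF quotD(1)[OF Suc(2)]] q_power_eq_iff[of "Suc d" 0] by auto
  then obtain x where x: "x \<in> U" "x \<notin> N" using quotD(3)[OF Suc(2)] by auto
  obtain V where V: "V \<in> betw N U" "x \<notin> V" "U = adj V x" using hyperplane_exists[OF Suc(2) x] .
  note f = complement_facts[OF Suc(2) V]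
  have "idx V N = q ^ d" using idx_mult[OF Suc(2) V(1)] f(8) Suc(3) q_ge_2 by simp
  then obtain w where w: "\<forall>i<d. w i \<in> V" "\<And>u. u \<in> V ==> \<exists>a. (\<forall>i<d. a i \<in> A) \<and> u - (\<Sum>i<d. a i \<star> w i) \<in> N"
    using Suc(1)[OF f(7)] by blast
  define w' where "w' = w(d := x)"
  have "\<exists>a. (\<forall>i<Suc d. a i \<in> A) \<and> u - (\<Sum>i<Suc d. a i \<star> w' i) \<in> N" if u: "u \<in> U" for u
  proof -
    obtain v c where vc: "v \<in> V" "c \<in> A" "u = v + c \<star> x" using u V(3) by (auto simp: adj_def)
    obtain a where a: "\<forall>i<d. a i \<in> A" "v - (\<Sum>i<d. a i \<star> w i) \<in> N" using w(2)[OF vc(1)] by blast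
    have "(\<Sum>i<d. (a(d := c)) i \<star> w' i) = (\<Sum>i<d. a i \<star> w i)" by (intro sum.cong) (auto simp: w'_def)
    hence "u - (\<Sum>i<Suc d. (a(d := c)) i \<star> w' i) = v - (\<Sum>i<d. a i \<star> w i)" using vc by (simp add: w'_def algebra_simps)
    moreover have "\<forall>i<Suc d. (a(d := c)) i \<in> A" using a vc by (auto simp: less_Suc_eq)
    ultimately show ?thesis using a(2) by metis
  qed
  moreover have "\<forall>i<Suc d. w' i \<in> U" using w f x by (auto simp: w'_def less_Suc_eq)
  ultimately show ?case by blast
qed

context lie_coords
begin

definition unit :: "nat => nat => 'k" where "unit i = coord (b i)"

lemma unit_apply: "i < n ==> unit i j = (if j = i then 1 else 0)"
proof -
  assume i: "i < n"
  let ?c = "\<lambda>j. if j = i then 1 else 0 :: 'k"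
  have int: "algebraic_int (?c j)" for j by simp
  have "vec ?c = (\<Oplus>\<^bsub>L\<^esub> j \<in> {..<n}. if i = j then b j else \<zero>\<^bsub>L\<^esub>)"
    unfolding vec_def
  proof (rule M.finsum_cong'[OF refl])
    fix j assume "j \<in> {..<n}"
    thus "?c j \<odot>\<^bsub>L\<^esub> b j = (if i = j then b j else \<zero>\<^bsub>L\<^esub>)"
      using smult_one[of "b j"] smult_l_null[of "b j"] by simp
  qed auto
  also have "\<dots> = b i" using i by (intro M.finsum_singleton) auto
  finally have "coord (b i) = ?c"
    by (intro coord_eqI) (use i int in auto)
  thus ?thesis by (simp add: unit_def)
qed



lemma br_0: "br u 0 = 0" "br 0 u = 0"
  by (simp_all add: br_def fun_eq_iff)

lemma br_sum_right: "br u (sum f S) = (\<Sum>i\<in>S. br u (f i))"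
proof (induction S rule: infinite_finite_induct)
  case (insert x S)
  show ?case unfolding sum.insert[OF insert(1,2)] br_linear(1) insert(3) ..
next
  case empty
  show ?case unfolding sum.empty br_0 ..
next
  case (infinite S)
  show ?case unfolding sum.infinite[OF infinite] br_0 ..
qed

lemma br_sum_left: "br (sum f S) u = (\<Sum>i\<in>S. br (f i) u)"
proof (induction S rule: infinite_finite_induct)
  case (insert x S)
  show ?case unfolding sum.insert[OF insert(1,2)] br_linear(2) insert(3) ..
next
  case empty
  show ?case unfolding sum.empty br_0 ..
next
  case (infinite S)
  show ?case unfolding sum.infinite[OF infinite] br_0 ..
qed

lemma lie_anti: "x \<in> carrier L ==> y \<in> carrier L ==> coord (lie L x y) + coord (lie L y x) = 0"
proof -
  assume xy: "x \<in> carrier L" "y \<in> carrier L"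
  have "coord (lie L (x \<oplus>\<^bsub>L\<^esub> y) (x \<oplus>\<^bsub>L\<^esub> y)) = 0" "coord (lie L x x) = 0" "coord (lie L y y) = 0"
    using lie_self xy by (simp_all add: coord_zero)
  thus ?thesis using xy by (simp add: coord_lie coord_add br_linear add.commute)
qed

lemma br_self: "br u u = 0"
proof
  fix k
  have "br u u k = (\<Sum>i<n. \<Sum>j<n. u j * u i * coord (lie L (b j) (b i)) k)"
    unfolding br_def by (rule sum.swap)
  also have "\<dots> = (\<Sum>i<n. \<Sum>j<n. - (u i * u j * coord (lie L (b i) (b j)) k))"
  proof (intro sum.cong refl)
    fix i j assume "i \<in> {..<n}" "j \<in> {..<n}"
    hence "coord (lie L (b i) (b j)) k + coord (lie L (b j) (b i)) k = 0"
      using fun_cong[OF lie_anti[of "b i" "b j"], of k] by simp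
    hence "coord (lie L (b j) (b i)) k = - coord (lie L (b i) (b j)) k" by (simp add: eq_neg_iff_add_eq_0 add.commute)
    thus "u j * u i * coord (lie L (b j) (b i)) k = - (u i * u j * coord (lie L (b i) (b j)) k)" by simp
  qed
  also have "\<dots> = - br u u k" by (simp add: br_def sum_negf)
  finally show "br u u k = 0 k" by simp
qed

text \<open>The identity is known on the basis, where it comes from L, and must be extended by
  linearity. The Jacobi expression J is linear in its first argument and cyclically symmetric, so
  the arguments can be rotated to the front one after another.\<close>

lemma br_jacobi: "br u (br v w) + br v (br w u) + br w (br u v) = 0"
proof -
  define J where "J u v w = br u (br v w) + br v (br w u) + br w (br u v)" for u v w
  have lin: "J (\<Sum>i<n. vscale (u i) (f i)) v w = (\<Sum>i<n. vscale (u i) (J (f i) v w))" for u v w and f :: "nat => nat => 'k"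
  proof -
    have l: "br (\<Sum>i<n. vscale (u i) (f i)) x = (\<Sum>i<n. vscale (u i) (br (f i) x))" for x
      unfolding br_sum_left br_linear(4) ..
    show ?thesis unfolding J_def l br_sum_right br_linear(3) by (simp add: fun_eq_iff sum.distrib algebra_simps)
  qed
  have cyc: "J u v w = J v w u" for u v w by (simp add: J_def algebra_simps)
  have red: "J u v w = (\<Sum>i<n. vscale (u i) (J (unit i) v w))" for u v w
  proof -
    \<comment> \<open>The vector u need not equal the sum, as it may have entries from n on, but
      \<open>br\<close> does not see them.\<close>
    have e: "br u x = br (\<Sum>i<n. vscale (u i) (unit i)) x" for u x
    proof -
      have "u k = (\<Sum>i<n. vscale (u i) (unit i)) k" if "k < n" for k
      proof -
        have "(\<Sum>i<n. vscale (u i) (unit i)) k = (\<Sum>i<n. if i = k then u k else 0)"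
          unfolding sum_fun_apply vscale_apply by (intro sum.cong) (auto simp: unit_apply)
        thus ?thesis using that by simp
      qed
      thus ?thesis unfolding br_def fun_eq_iff by (intro allI sum.cong refl) simp
    qed
    have e': "br x u = br x (\<Sum>i<n. vscale (u i) (unit i))" for u x
    proof -
      have "br x u + br u x = 0" "br x (\<Sum>i<n. vscale (u i) (unit i)) + br (\<Sum>i<n. vscale (u i) (unit i)) x = 0"
        using br_self[of "x + u"] br_self[of "x + (\<Sum>i<n. vscale (u i) (unit i))"] br_self
        unfolding br_linear by (simp_all add: add.commute)
      thus ?thesis using e[of u x] by (metis add_right_cancel)
    qed
    have "J u v w = J (\<Sum>i<n. vscale (u i) (unit i)) v w"
      unfolding J_def by (metis e e')
    thus ?thesis using lin by simp
  qed
  have J0: "J (unit i) (unit j) (unit k) = 0" if "i < n" "j < n" "k < n" for i j k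
  proof -
    have c: "b i \<in> carrier L" "b j \<in> carrier L" "b k \<in> carrier L" using that by auto
    have "coord (lie L (b i) (lie L (b j) (b k)) \<oplus>\<^bsub>L\<^esub> lie L (b j) (lie L (b k) (b i)) \<oplus>\<^bsub>L\<^esub> lie L (b k) (lie L (b i) (b j))) = 0"
      using jacobi[OF c] by (simp add: coord_zero)
    thus ?thesis using c by (simp add: J_def coord_add coord_lie lie_closed unit_def)
  qed
  have 1: "J (unit i) (unit j) w = 0" if "i < n" "j < n" for i j w
  proof -
    have "J (unit i) (unit j) w = J w (unit i) (unit j)" by (metis cyc)
    also have "\<dots> = (\<Sum>k<n. vscale (w k) (J (unit k) (unit i) (unit j)))" by (rule red)
    also have "\<dots> = 0" using J0 that by (simp add: fun_eq_iff)
    finally show ?thesis .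
  qed
  have 2: "J (unit i) v w = 0" if "i < n" for i v w
  proof -
    have "J (unit i) v w = J v w (unit i)" by (rule cyc)
    also have "\<dots> = (\<Sum>k<n. vscale (v k) (J (unit k) w (unit i)))" by (rule red)
    also have "\<dots> = (\<Sum>k<n. vscale (v k) (J (unit i) (unit k) w))" by (metis cyc)
    also have "\<dots> = 0" using 1 that by (simp add: fun_eq_iff)
    finally show ?thesis .
  qed
  have "J u v w = 0" using red[of u v w] 2 by (simp add: fun_eq_iff)
  thus ?thesis by (simp add: J_def)
qed

end

section \<open>The reduction identified with a quotient of lattices\<close>

context reduction_coords
begin

lemma lie_A: "i < n ==> j < n ==> coord (lie L (b i) (b j)) k \<in> A"
  by (intro coord_A lie_closed) auto

lemma sum_in_A: "(\<And>p. p \<in> S ==> g p \<in> A) ==> sum g S \<in> A"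
  by (induction S rule: infinite_finite_induct) (auto simp: zero_A add_A)
lemma sum_in_M: "(\<And>p. p \<in> S ==> g p \<in> M) ==> sum g S \<in> M"
  by (induction S rule: infinite_finite_induct) (auto simp: zero_M add_M)

lemma br_\<Lambda>': "u \<in> \<Lambda> ==> v \<in> \<Lambda> ==> br u v \<in> \<Lambda>"
  using br_ambient unfolding \<Lambda>_def br_def by (auto intro!: sum_in_A mult_A lie_A)

lemma br_\<Lambda>M: "u \<in> \<Lambda> ==> v \<in> \<Lambda>M ==> br u v \<in> \<Lambda>M"
proof -
  assume uv: "u \<in> \<Lambda>" "v \<in> \<Lambda>M"
  have "u i * v j * coord (lie L (b i) (b j)) k \<in> M" if "i < n" "j < n" for i j k
  proof -
    have "coord (lie L (b i) (b j)) k * (u i * v j) \<in> M" using uv that by (intro mult_M lie_A) (auto simp: \<Lambda>_def \<Lambda>M_def)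
    thus ?thesis by (simp add: mult_ac)
  qed
  thus ?thesis using br_ambient unfolding \<Lambda>M_def br_def by (auto intro!: sum_in_M)
qed

lemma coset_PiE:
  defines "\<phi> \<equiv> \<lambda>v. \<lambda>i\<in>{..<n}. (+) (v i) ` M"
  shows "\<phi> ` \<Lambda> = {..<n} \<rightarrow>\<^sub>E cosets A M"
    and "u \<in> \<Lambda> ==> v \<in> \<Lambda> ==> \<phi> u = \<phi> v \<longleftrightarrow> u - v \<in> \<Lambda>M"
proof -
  show "\<phi> ` \<Lambda> = {..<n} \<rightarrow>\<^sub>E cosets A M"
  proof (intro equalityI subsetI)
    fix y assume "y \<in> {..<n} \<rightarrow>\<^sub>E cosets A M"
    hence y: "\<forall>i\<in>{..<n}. \<exists>a\<in>A. y i = (+) a ` M" "y \<in> extensional {..<n}"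
      unfolding PiE_iff cosets_def by blast+
    then obtain a where a: "\<forall>i\<in>{..<n}. a i \<in> A \<and> y i = (+) (a i) ` M" by metis
    define v where "v i = (if i < n then a i else 0)" for i
    have "v \<in> \<Lambda>" using a zero_A by (auto simp: \<Lambda>_def ambient_def v_def)
    moreover have "\<phi> v = y" using a y(2) by (auto simp: \<phi>_def v_def fun_eq_iff extensional_def restrict_def)
    ultimately show "y \<in> \<phi> ` \<Lambda>" by blast
  qed (auto simp: \<phi>_def cosets_def \<Lambda>_def)
  assume uv: "u \<in> \<Lambda>" "v \<in> \<Lambda>"
  have "\<phi> u = \<phi> v \<longleftrightarrow> (\<forall>i<n. (+) (u i) ` M = (+) (v i) ` M)" by (auto simp: \<phi>_def fun_eq_iff restrict_def)
  also have "\<dots> \<longleftrightarrow> (\<forall>i<n. u i - v i \<in> M)" using coset_eq_iff[OF addgrp_M] by blast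
  also have "\<dots> \<longleftrightarrow> u - v \<in> \<Lambda>M"
  proof -
    have "u i - v i = 0" if "i \<ge> n" for i using uv that by (simp add: \<Lambda>_def ambient_def)
    hence "u - v \<in> \<Lambda>M \<longleftrightarrow> (\<forall>i. u i - v i \<in> M)" by (simp add: \<Lambda>M_def ambient_def)
    also have "\<dots> \<longleftrightarrow> (\<forall>i<n. u i - v i \<in> M)"
      using zero_M \<open>\<And>i. i \<ge> n ==> u i - v i = 0\<close> by (metis linorder_not_le)
    finally show ?thesis ..
  qed
  finally show "\<phi> u = \<phi> v \<longleftrightarrow> u - v \<in> \<Lambda>M" .
qed

lemma addgrp_\<Lambda>M: "addgrp \<Lambda>M" using \<Lambda>M_closed by (simp add: addgrp_def)

lemma idx_\<Lambda>: "idx \<Lambda> \<Lambda>M = q ^ n" and finite_\<Lambda>: "finite (cosets \<Lambda> \<Lambda>M)"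
proof -
  let ?\<phi> = "\<lambda>v :: nat => 'k. \<lambda>i\<in>{..<n}. (+) (v i) ` M"
  show "idx \<Lambda> \<Lambda>M = q ^ n"
    using idx_eq_card_image[OF addgrp_\<Lambda>M, of \<Lambda> ?\<phi>] coset_PiE by (simp add: card_PiE q_def idx_def)
  show "finite (cosets \<Lambda> \<Lambda>M)"
    using finite_cosets_iff_image[OF addgrp_\<Lambda>M, of \<Lambda> ?\<phi>] coset_PiE finite_residues by (simp add: finite_PiE)
qed

sublocale LL: lie_lattice A M vscale br \<Lambda>M \<Lambda>
proof -
  interpret LS: lattice_space A M vscale ..
  have q: "LS.quot \<Lambda>M \<Lambda>"
    unfolding LS.quot_def LS.lat_def using \<Lambda>_closed \<Lambda>M_closed finite_\<Lambda> by auto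
  show "lie_lattice A M vscale br \<Lambda>M \<Lambda>"
    by unfold_locales (use q br_\<Lambda>' br_\<Lambda>M br_self in \<open>auto simp: LS.lin_def br_linear\<close>)
qed

abbreviation Lb where "Lb \<equiv> reduction OK I L"

text \<open>The element of the reduction with coordinate vector v: a coset of the relations,
  described through \<open>ev\<close>.\<close>

definition cls :: "(nat => 'k) => ('a \<times> 'k set \<Rightarrow>\<^sub>0 int) set" where
  "cls v = {f \<in> FR. ev f - v \<in> \<Lambda>M}"

lemma exists_ev: "v \<in> \<Lambda> ==> \<exists>f. f \<in> cls v"
proof -
  assume v: "v \<in> \<Lambda>"
  hence "\<forall>i. \<exists>r. algebraic_int r \<and> v i - r \<in> M" using A_int by (simp add: \<Lambda>_def)
  then obtain r where r: "\<And>i. algebraic_int (r i)" "\<And>i. v i - r i \<in> M" by metis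
  have x: "vec r \<in> carrier L" by (rule vec_closed) (rule r)
  have c: "coord (vec r) i = r i" if "i < n" for i using coord_unique[OF r(1) that] .
  have "coord (vec r) i - v i \<in> M" for i
    using c[of i] uminus_M[OF r(2)[of i]] v zero_M by (cases "i < n") (auto simp: \<Lambda>_def ambient_def)
  hence "coord (vec r) - v \<in> \<Lambda>M" using v by (auto simp: \<Lambda>M_def \<Lambda>_def ambient_def)
  from \<Lambda>M_closed(1)[OF ev_single[OF x] this] have "ev (frag_of (vec r, hcl 1)) - v \<in> \<Lambda>M" by simp
  thus ?thesis using x one_A by (intro exI[of _ "frag_of (vec r, hcl 1)"]) (simp add: cls_def)
qed

lemma cls_eqI: "v - w \<in> \<Lambda>M ==> cls v = cls w"
proof -
  assume d: "v - w \<in> \<Lambda>M"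
  have "ev f - v \<in> \<Lambda>M \<longleftrightarrow> ev f - w \<in> \<Lambda>M" for f
    using \<Lambda>M_closed(1)[OF _ d, of "ev f - v"] \<Lambda>M_closed(2)[OF _ d, of "ev f - w"] by auto
  thus ?thesis by (simp add: cls_def)
qed

lemma cls_eq_iff: "v \<in> \<Lambda> ==> cls v = cls w \<longleftrightarrow> v - w \<in> \<Lambda>M"
proof
  assume v: "v \<in> \<Lambda>" "cls v = cls w"
  obtain f where f: "f \<in> cls v" using exists_ev v by blast
  moreover have "f \<in> cls w" using f v(2) by simp
  ultimately have "(ev f - w) - (ev f - v) \<in> \<Lambda>M" using f \<Lambda>M_closed(2) unfolding cls_def by blast
  thus "v - w \<in> \<Lambda>M" by simp
qed (rule cls_eqI)

lemma coset_TK: "f \<in> FR ==> TK #>\<^bsub>tensor_free F L\<^esub> f = cls (ev f)"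
proof -
  assume f: "f \<in> FR"
  have "g \<in> TK #>\<^bsub>tensor_free F L\<^esub> f \<longleftrightarrow> g \<in> cls (ev f)" for g
  proof -
    have "g \<in> TK #>\<^bsub>tensor_free F L\<^esub> f \<longleftrightarrow> (\<exists>h\<in>TK. g = h + f)" by (auto simp: r_coset_def)
    also have "\<dots> \<longleftrightarrow> g - f \<in> TK" by (metis add_diff_cancel_right' diff_add_cancel)
    also have "\<dots> \<longleftrightarrow> g \<in> cls (ev f)"
      using FR_closed(1)[of "g - f" f] FR_closed(2)[of g f] f by (auto simp: TK_iff cls_def ev_simps)
    finally show ?thesis .
  qed
  thus ?thesis by blast
qed

lemma cls_ev: "f \<in> cls v ==> cls (ev f) = cls v"
  by (intro cls_eqI) (simp add: cls_def)

lemma carrier_Lb: "carrier Lb = cls ` \<Lambda>"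
proof -
  have "carrier Lb = (\<Union>f\<in>FR. {TK #>\<^bsub>tensor_free F L\<^esub> f})"
    by (simp add: reduction_def base_change_def Let_def FactGroup_def RCOSETS_def)
  also have "\<dots> = (\<lambda>f. cls (ev f)) ` FR" using coset_TK by auto
  also have "\<dots> = cls ` \<Lambda>"
  proof (intro equalityI subsetI)
    fix y assume "y \<in> cls ` \<Lambda>"
    then obtain v where v: "v \<in> \<Lambda>" "y = cls v" by blast
    obtain f where f: "f \<in> cls v" using exists_ev v by blast
    have "cls (ev f) = cls v" "f \<in> FR" using f cls_ev by (auto simp: cls_def)
    thus "y \<in> (\<lambda>f. cls (ev f)) ` FR" using v by blast
  qed (use ev_\<Lambda> in auto)
  finally show ?thesis .
qed

lemma zero_Lb: "\<zero>\<^bsub>Lb\<^esub> = cls 0"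
proof -
  have "\<zero>\<^bsub>Lb\<^esub> = TK" by (simp add: reduction_def base_change_def Let_def FactGroup_def)
  also have "\<dots> = cls 0" by (auto simp: TK_iff cls_def)
  finally show ?thesis .
qed

lemma add_Lb: assumes "v \<in> \<Lambda>" "w \<in> \<Lambda>" shows "cls v \<oplus>\<^bsub>Lb\<^esub> cls w = cls (v + w)"
proof -
  have "cls v \<oplus>\<^bsub>Lb\<^esub> cls w = (\<Union>f\<in>cls v. \<Union>g\<in>cls w. {f + g})"
    by (simp add: reduction_def base_change_def Let_def FactGroup_def set_mult_def)
  also have "\<dots> = cls (v + w)"
  proof (intro equalityI subsetI)
    fix k assume "k \<in> (\<Union>f\<in>cls v. \<Union>g\<in>cls w. {f + g})"
    then obtain f g where "f \<in> cls v" "g \<in> cls w" "k = f + g" by blast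
    thus "k \<in> cls (v + w)" using \<Lambda>M_closed(1)[of "ev f - v" "ev g - w"] FR_closed(1)[of f g]
      by (auto simp: cls_def ev_simps algebra_simps)
  next
    fix k assume k: "k \<in> cls (v + w)"
    obtain g where g: "g \<in> cls w" using exists_ev assms by blast
    have "k - g \<in> cls v" using k g \<Lambda>M_closed(2)[of "ev k - (v + w)" "ev g - w"] FR_closed(2)[of k g]
      by (auto simp: cls_def ev_simps algebra_simps)
    moreover have "k = (k - g) + g" by simp
    ultimately show "k \<in> (\<Union>f\<in>cls v. \<Union>g\<in>cls w. {f + g})" using g by blast
  qed
  finally show ?thesis .
qed

lemma FR_extend: "f \<in> FR ==> (\<And>p. p \<in> Poly_Mapping.keys f ==> g p \<in> FR) ==> frag_extend g f \<in> FR"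
  unfolding frag_extend_def FR_def
proof (clarsimp)
  fix a s assume a: "\<And>a b. (a, b) \<in> Poly_Mapping.keys f ==> Poly_Mapping.keys (g (a, b)) \<subseteq> carrier L \<times> carrier F"
    and k: "(a, s) \<in> Poly_Mapping.keys (\<Sum>i\<in>Poly_Mapping.keys f. frag_cmul (Poly_Mapping.lookup f i) (g i))"
  have "(a, s) \<in> (\<Union>i\<in>Poly_Mapping.keys f. Poly_Mapping.keys (frag_cmul (Poly_Mapping.lookup f i) (g i)))"
    using k Poly_Mapping.keys_sum[of "\<lambda>i. frag_cmul (Poly_Mapping.lookup f i) (g i)" "Poly_Mapping.keys f"] by blast
  then obtain i where "i \<in> Poly_Mapping.keys f" "(a, s) \<in> Poly_Mapping.keys (g i)" using keys_cmul by fastforce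
  thus "a \<in> carrier L \<and> s \<in> carrier F" using a[of "fst i" "snd i"] by auto
qed

lemma ev_extend: "ev (frag_extend g f) i = wsum (\<lambda>p. ev (g p) i) f"
  by (simp add: ev_def wsum_extend)

lemma rep_mult: assumes "s \<in> carrier F" "t \<in> carrier F" shows "rep (s \<otimes>\<^bsub>F\<^esub> t) - rep s * rep t \<in> M"
proof -
  have *: "rep s \<in> A" "hcl (rep s) = s" "rep t \<in> A" "hcl (rep t) = t" using rep assms int_A by auto
  hence "s \<otimes>\<^bsub>F\<^esub> t = hcl (rep s * rep t)" using F_ops(3) by metis
  thus ?thesis using rep_hcl mult_A * by metis
qed

lemma \<Lambda>M_I: "(\<And>i. i < n ==> v i \<in> M) ==> v \<in> ambient ==> v \<in> \<Lambda>M"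
  using zero_M unfolding \<Lambda>M_def ambient_def by (auto) (metis linorder_not_le)

lemma ambient_diff: "u \<in> ambient ==> v \<in> ambient ==> u - v \<in> ambient" by (simp add: ambient_def)
lemma \<Lambda>_ambient: "v \<in> \<Lambda> ==> v \<in> ambient" by (simp add: \<Lambda>_def)

lemma const_UN: "S \<noteq> {} ==> (\<And>f. f \<in> S ==> g f = c) ==> (\<Union>f\<in>S. g f) = c" by auto

lemma smult_Lb: assumes "a \<in> A" "v \<in> \<Lambda>" shows "hcl a \<odot>\<^bsub>Lb\<^esub> cls v = cls (vscale a v)"
proof -
  interpret Fc: cring F by (rule F_ring)
  let ?g = "\<lambda>(x, t). frag_of (x, hcl a \<otimes>\<^bsub>F\<^esub> t)"
  have "hcl a \<odot>\<^bsub>Lb\<^esub> cls v = (\<Union>f\<in>cls v. TK #>\<^bsub>tensor_free F L\<^esub> frag_extend ?g f)"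
    by (simp add: reduction_def base_change_def Let_def)
  also have "\<dots> = cls (vscale a v)"
  proof (rule const_UN)
    show "cls v \<noteq> {}" using exists_ev assms by blast
    fix f assume f: "f \<in> cls v"
    hence fF: "f \<in> FR" by (simp add: cls_def)
    have gF: "frag_extend ?g f \<in> FR"
      by (rule FR_extend[OF fF]) (use fF assms in \<open>auto simp: FR_def\<close>)
    have "ev (frag_extend ?g f) i - a * ev f i \<in> M" for i
    proof -
      have "rep (snd p) \<in> A" "rep (hcl a \<otimes>\<^bsub>F\<^esub> snd p) - a * rep (snd p) \<in> M" "coord (fst p) i \<in> A" if p: "p \<in> Poly_Mapping.keys f" for p
      proof -
        have s: "snd p \<in> carrier F" "fst p \<in> carrier L" using p fF by (auto simp: FR_def)
        show r: "rep (snd p) \<in> A" "coord (fst p) i \<in> A" using rep[OF s(1)] int_A coord_A s by auto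
        have "rep (hcl a \<otimes>\<^bsub>F\<^esub> snd p) - rep (hcl a) * rep (snd p) \<in> M" using rep_mult s assms by simp
        moreover have "rep (snd p) * (rep (hcl a) - a) \<in> M" using rep_hcl[OF assms(1)] r mult_M by blast
        ultimately have "(rep (hcl a \<otimes>\<^bsub>F\<^esub> snd p) - rep (hcl a) * rep (snd p)) + rep (snd p) * (rep (hcl a) - a) \<in> M" by (rule add_M)
        thus "rep (hcl a \<otimes>\<^bsub>F\<^esub> snd p) - a * rep (snd p) \<in> M" by (simp add: algebra_simps)
      qed
      hence "coord (fst p) i * (rep (hcl a \<otimes>\<^bsub>F\<^esub> snd p) - a * rep (snd p)) \<in> M" if "p \<in> Poly_Mapping.keys f" for p
        using mult_M that by blast
      hence "wsum (\<lambda>p. rep (hcl a \<otimes>\<^bsub>F\<^esub> snd p) * coord (fst p) i) f - wsum (\<lambda>p. a * (rep (snd p) * coord (fst p) i)) f \<in> M"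
        by (intro wsum_cong_M) (simp add: algebra_simps)
      thus ?thesis unfolding ev_extend wsum_linear by (simp add: ev_def case_prod_beta)
    qed
    hence 1: "ev (frag_extend ?g f) - vscale a (ev f) \<in> \<Lambda>M"
      using \<Lambda>_ambient[OF ev_\<Lambda>[OF gF]] \<Lambda>_ambient[OF ev_\<Lambda>[OF fF]] by (intro \<Lambda>M_I) (auto simp: ambient_def)
    have "vscale a (ev f - v) \<in> \<Lambda>M" using f assms \<Lambda>M_closed(4) by (simp add: cls_def)
    from \<Lambda>M_closed(1)[OF 1 this] have "ev (frag_extend ?g f) - vscale a v \<in> \<Lambda>M" by (simp add: fun_eq_iff algebra_simps vs.scale_right_diff_distrib)
    thus "TK #>\<^bsub>tensor_free F L\<^esub> frag_extend ?g f = cls (vscale a v)"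
      using coset_TK[OF gF] cls_eqI by simp
  qed
  finally show ?thesis .
qed

text \<open>The bracket of the reduction is a union over representatives, which collapses because
  all of them give one class. Evaluating the bracket of formal sums term by term differs from
  \<open>br\<close> of the evaluations only through \<open>rep\<close> of products, hence by an
  element of M^n.\<close>

lemma lie_Lb: assumes "v \<in> \<Lambda>" "w \<in> \<Lambda>" shows "lie Lb (cls v) (cls w) = cls (br v w)"
proof -
  interpret Fc: cring F by (rule F_ring)
  let ?h = "\<lambda>x a (y, b). frag_of (lie L x y, a \<otimes>\<^bsub>F\<^esub> b)"
  let ?g = "\<lambda>g (x, a). frag_extend (?h x a) g"
  have "lie Lb (cls v) (cls w) = (\<Union>f\<in>cls v. \<Union>g\<in>cls w. TK #>\<^bsub>tensor_free F L\<^esub> frag_extend (?g g) f)"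
    by (simp add: reduction_def base_change_def Let_def)
  also have "\<dots> = cls (br v w)"
  proof (rule const_UN, use exists_ev assms in blast, rule const_UN, use exists_ev assms in blast)
    fix f g assume fg: "f \<in> cls v" "g \<in> cls w"
    hence FRfg: "f \<in> FR" "g \<in> FR" by (auto simp: cls_def)
    have kf: "fst p \<in> carrier L \<and> snd p \<in> carrier F" if "p \<in> Poly_Mapping.keys f" for p using that FRfg by (auto simp: FR_def)
    have kg: "fst p \<in> carrier L \<and> snd p \<in> carrier F" if "p \<in> Poly_Mapping.keys g" for p using that FRfg by (auto simp: FR_def)
    have hF: "frag_extend (?h x a) g \<in> FR" if "x \<in> carrier L" "a \<in> carrier F" for x a
      by (rule FR_extend[OF FRfg(2)]) (use that kg lie_closed in \<open>auto simp: case_prod_beta\<close>)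
    have gF: "frag_extend (?g g) f \<in> FR"
      by (rule FR_extend[OF FRfg(1)]) (use kf hF in \<open>auto simp: case_prod_beta\<close>)
    have "ev (frag_extend (?g g) f) k - br (ev f) (ev g) k \<in> M" for k
    proof -
      let ?\<phi> = "\<lambda>p i. rep (snd p) * coord (fst p) i"
      have e: "br (ev f) (ev g) k = wsum (\<lambda>p. wsum (\<lambda>r. br (?\<phi> p) (?\<phi> r) k) g) f"
        unfolding ev_def br_wsum_left br_wsum_right ..
      have "ev (frag_extend (?g g) f) k = wsum (\<lambda>p. wsum (\<lambda>r. rep (snd p \<otimes>\<^bsub>F\<^esub> snd r) * coord (lie L (fst p) (fst r)) k) g) f"
        unfolding ev_extend case_prod_beta by (simp add: ev_def)
      moreover have "wsum (\<lambda>p. wsum (\<lambda>r. rep (snd p \<otimes>\<^bsub>F\<^esub> snd r) * coord (lie L (fst p) (fst r)) k) g) f -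
        wsum (\<lambda>p. wsum (\<lambda>r. br (?\<phi> p) (?\<phi> r) k) g) f \<in> M"
      proof (intro wsum_cong_M)
        fix p r assume p: "p \<in> Poly_Mapping.keys f" and r: "r \<in> Poly_Mapping.keys g"
        have "?\<phi> p = vscale (rep (snd p)) (coord (fst p))" for p by (simp add: fun_eq_iff)
        hence "br (?\<phi> p) (?\<phi> r) k = rep (snd p) * rep (snd r) * br (coord (fst p)) (coord (fst r)) k"
          by (simp add: br_linear)
        also have "br (coord (fst p)) (coord (fst r)) = coord (lie L (fst p) (fst r))" using coord_lie kf[OF p] kg[OF r] by simp
        finally have b: "br (?\<phi> p) (?\<phi> r) k = rep (snd p) * rep (snd r) * coord (lie L (fst p) (fst r)) k" .
        have "coord (lie L (fst p) (fst r)) k * (rep (snd p \<otimes>\<^bsub>F\<^esub> snd r) - rep (snd p) * rep (snd r)) \<in> M"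
          using rep_mult coord_A lie_closed kf[OF p] kg[OF r] by (intro mult_M) auto
        thus "rep (snd p \<otimes>\<^bsub>F\<^esub> snd r) * coord (lie L (fst p) (fst r)) k - br (?\<phi> p) (?\<phi> r) k \<in> M"
          unfolding b by (simp add: algebra_simps)
      qed
      ultimately show ?thesis using e by simp
    qed
    hence 1: "ev (frag_extend (?g g) f) - br (ev f) (ev g) \<in> \<Lambda>M"
      using \<Lambda>_ambient[OF ev_\<Lambda>[OF gF]] br_ambient by (intro \<Lambda>M_I ambient_diff) auto
    have d: "ev f - v \<in> \<Lambda>M" "ev g - w \<in> \<Lambda>M" using fg by (auto simp: cls_def)
    \<comment> \<open>Independence of the representatives: the difference of the brackets of (ev f,
      ev g) and (v, w) is split by changing one argument at a time.\<close>
    have "br (ev f) (ev g - w) \<in> \<Lambda>M" using d ev_\<Lambda> FRfg br_\<Lambda>M by blast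
    moreover have "br (ev f - v) w \<in> \<Lambda>M"
      unfolding LL.br_anti[of "ev f - v" w] using br_\<Lambda>M[OF assms(2) d(1)] by (rule \<Lambda>M_closed(7))
    ultimately have "br (ev f) (ev g - w) + br (ev f - v) w \<in> \<Lambda>M" by (rule \<Lambda>M_closed(1))
    hence "br (ev f) (ev g) - br v w \<in> \<Lambda>M" by simp
    from \<Lambda>M_closed(1)[OF 1 this] have "ev (frag_extend (?g g) f) - br v w \<in> \<Lambda>M" by simp
    thus "TK #>\<^bsub>tensor_free F L\<^esub> frag_extend (?g g) f = cls (br v w)"
      using coset_TK[OF gF] cls_eqI by simp
  qed
  finally show ?thesis .
qed

end

section \<open>Submodules, ranks and codimensions in the reduction\<close>

context reduction_coords
begin

abbreviation Lat where "Lat \<equiv> LL.betw \<Lambda>M \<Lambda>"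

lemma Lat_facts: assumes "W \<in> Lat" shows "LL.lat W" "\<Lambda>M \<subseteq> W" "W \<subseteq> \<Lambda>"
  using assms by (auto simp: LL.betw_def)

lemma cls_mem_iff: "W \<in> Lat ==> v \<in> \<Lambda> ==> cls v \<in> cls ` W \<longleftrightarrow> v \<in> W"
proof
  assume W: "W \<in> Lat" and v: "v \<in> \<Lambda>" "cls v \<in> cls ` W"
  then obtain w where w: "w \<in> W" "cls v = cls w" by blast
  have "v - w \<in> W" using cls_eq_iff[OF v(1)] w(2) Lat_facts[OF W] by blast
  thus "v \<in> W" using LL.lat_diff_iff[OF Lat_facts(1)[OF W] w(1)] by blast
qed blast

lemma cls_image_inj: "inj_on (\<lambda>W. cls ` W) Lat"
proof (rule inj_onI)
  have *: "W = {v \<in> \<Lambda>. cls v \<in> cls ` W}" if "W \<in> Lat" for W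
    using cls_mem_iff[OF that] Lat_facts[OF that] by blast
  fix W V assume "W \<in> Lat" "V \<in> Lat" "cls ` W = cls ` V"
  thus "W = V" using *[of W] *[of V] by simp
qed

lemma abelian_group_restrict:
  assumes W: "W \<in> Lat" shows "abelian_group (Lb\<lparr>carrier := cls ` W\<rparr>)"
proof (rule abelian_groupI)
  note l = Lat_facts[OF W]
  have add: "cls u \<oplus>\<^bsub>Lb\<^esub> cls v = cls (u + v)" if "u \<in> W" "v \<in> W" for u v
    using add_Lb that l by blast
  have s: "u + v \<in> W" if "u \<in> W" "v \<in> W" for u v using LL.lat_add[OF l(1) that] .
  have z: "0 \<in> W" using LL.lat_zero[OF l(1)] .
  let ?X = "Lb\<lparr>carrier := cls ` W\<rparr>"
  show "x \<oplus>\<^bsub>?X\<^esub> y \<in> carrier ?X" if "x \<in> carrier ?X" "y \<in> carrier ?X" for x y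
    using that add s by auto
  show "\<zero>\<^bsub>?X\<^esub> \<in> carrier ?X" using z zero_Lb by simp
  show "x \<oplus>\<^bsub>?X\<^esub> y \<oplus>\<^bsub>?X\<^esub> w = x \<oplus>\<^bsub>?X\<^esub> (y \<oplus>\<^bsub>?X\<^esub> w)" if "x \<in> carrier ?X" "y \<in> carrier ?X" "w \<in> carrier ?X" for x y w
    using that add s by (auto simp: add.assoc)
  show "x \<oplus>\<^bsub>?X\<^esub> y = y \<oplus>\<^bsub>?X\<^esub> x" if "x \<in> carrier ?X" "y \<in> carrier ?X" for x y
    using that add by (auto simp: add.commute)
  show "\<zero>\<^bsub>?X\<^esub> \<oplus>\<^bsub>?X\<^esub> x = x" if "x \<in> carrier ?X" for x
    using that add[OF z] zero_Lb by auto
  show "\<exists>y\<in>carrier ?X. y \<oplus>\<^bsub>?X\<^esub> x = \<zero>\<^bsub>?X\<^esub>" if x: "x \<in> carrier ?X" for x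
  proof -
    obtain w where w: "w \<in> W" "x = cls w" using x by auto
    have "- w \<in> W" using LL.lat_minus[OF l(1) w(1)] .
    thus ?thesis using add[of "- w" w] w zero_Lb by (intro bexI[of _ "cls (- w)"]) auto
  qed
qed

lemma \<Lambda>_Lat: "\<Lambda> \<in> Lat" using LL.betw_ends(2)[OF LL.quot_\<Lambda>] .

lemma abelian_group_Lb: "abelian_group Lb"
  using abelian_group_restrict[OF \<Lambda>_Lat] by (simp flip: carrier_Lb)

text \<open>Taking preimages under \<open>cls\<close> turns submodules of the reduction into
  lattices between M^n and A^n.\<close>

lemma submodule_iff: "submodule U F Lb \<longleftrightarrow> (\<exists>W\<in>Lat. U = cls ` W)"
proof
  interpret abelian_group Lb by (rule abelian_group_Lb)
  assume U: "submodule U F Lb"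
  hence sg: "subgroup U (add_monoid Lb)" by (rule submodule.axioms)
  have Uc: "U \<subseteq> cls ` \<Lambda>" using subgroup.subset[OF sg] by (simp add: carrier_Lb)
  define W where "W = {v \<in> \<Lambda>. cls v \<in> U}"
  have "LL.lat W" unfolding LL.lat_def
  proof (intro conjI ballI)
    show "0 \<in> W" using subgroup.one_closed[OF sg] zero_Lb \<Lambda>_closed by (simp add: W_def)
    show "u + v \<in> W" if "u \<in> W" "v \<in> W" for u v
      using subgroup.m_closed[OF sg, of "cls u" "cls v"] add_Lb that \<Lambda>_closed by (simp add: W_def)
    show "vscale a u \<in> W" if "a \<in> A" "u \<in> W" for a u
      using submodule.smult_closed[OF U hcl_carrier, of a "cls u"] smult_Lb that \<Lambda>_closed by (simp add: W_def)
  qed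
  moreover have "\<Lambda>M \<subseteq> W"
  proof
    fix v assume v: "v \<in> \<Lambda>M"
    hence "cls v = cls 0" by (intro cls_eqI) simp
    thus "v \<in> W" using v \<Lambda>M_closed(6) subgroup.one_closed[OF sg] zero_Lb by (auto simp: W_def)
  qed
  ultimately have "W \<in> Lat" by (auto simp: LL.betw_def W_def)
  moreover have "U = cls ` W" using Uc by (auto simp: W_def)
  ultimately show "\<exists>W\<in>Lat. U = cls ` W" by blast
next
  interpret abelian_group Lb by (rule abelian_group_Lb)
  assume "\<exists>W\<in>Lat. U = cls ` W"
  then obtain W where W: "W \<in> Lat" "U = cls ` W" by blast
  note l = Lat_facts[OF W(1)]
  have inv: "inv\<^bsub>add_monoid Lb\<^esub> (cls w) = cls (- w)" if "w \<in> W" for w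
  proof (rule group.inv_equality)
    show "group (add_monoid Lb)" by (rule a_group)
    have "- w \<in> W" using LL.lat_minus[OF l(1) that] .
    thus "cls (- w) \<otimes>\<^bsub>add_monoid Lb\<^esub> cls w = \<one>\<^bsub>add_monoid Lb\<^esub>" "cls w \<in> carrier (add_monoid Lb)" "cls (- w) \<in> carrier (add_monoid Lb)"
      using add_Lb[of "- w" w] zero_Lb that l carrier_Lb by auto
  qed
  show "submodule U F Lb"
  proof (intro submodule.intro subgroup.intro submodule_axioms.intro)
    show "U \<subseteq> carrier (add_monoid Lb)" using W l carrier_Lb by auto
    show "x \<otimes>\<^bsub>add_monoid Lb\<^esub> y \<in> U" if "x \<in> U" "y \<in> U" for x y
    proof -
      obtain u v where uv: "u \<in> W" "v \<in> W" "x = cls u" "y = cls v" using \<open>x \<in> U\<close> \<open>y \<in> U\<close> W(2) by auto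
      have "cls u \<oplus>\<^bsub>Lb\<^esub> cls v = cls (u + v)" using uv l add_Lb by blast
      thus ?thesis using uv W(2) LL.lat_add[OF l(1) uv(1,2)] by simp
    qed
    show "\<one>\<^bsub>add_monoid Lb\<^esub> \<in> U" using W LL.lat_zero[OF l(1)] zero_Lb by simp
    show "inv\<^bsub>add_monoid Lb\<^esub> x \<in> U" if "x \<in> U" for x
      using that W inv LL.lat_minus[OF l(1)] by auto
    show "s \<odot>\<^bsub>Lb\<^esub> x \<in> U" if sx: "s \<in> carrier F" "x \<in> U" for s x
    proof -
      obtain a w where aw: "a \<in> A" "s = hcl a" "w \<in> W" "x = cls w" using sx W(2) carrier_F by auto
      have "hcl a \<odot>\<^bsub>Lb\<^esub> cls w = cls (vscale a w)" using aw l smult_Lb by blast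
      thus ?thesis using aw W(2) LL.lat_scale[OF l(1) aw(1,3)] by simp
    qed
  qed
qed

lemma counted_iff: assumes W: "W \<in> Lat" shows "counted t F Lb (cls ` W) \<longleftrightarrow> LL.closed t W"
proof -
  note l = Lat_facts[OF W]
  have s: "submodule (cls ` W) F Lb" using W submodule_iff by blast
  have m: "lie Lb (cls u) (cls v) \<in> cls ` W \<longleftrightarrow> br u v \<in> W" if "u \<in> \<Lambda>" "v \<in> \<Lambda>" for u v
    using lie_Lb[OF that] cls_mem_iff[OF W] LL.br_\<Lambda>[OF that] by simp
  show ?thesis
  proof (cases t)
    case Subalgebras
    have "counted t F Lb (cls ` W) \<longleftrightarrow> (\<forall>u\<in>W. \<forall>v\<in>W. lie Lb (cls u) (cls v) \<in> cls ` W)"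
      using s Subalgebras by (simp add: lie_subalgebra_def)
    also have "\<dots> \<longleftrightarrow> LL.closed t W" unfolding Subalgebras LL.closed.simps
      by (intro ball_cong refl m) (use l in blast)+
    finally show ?thesis .
  next
    case Ideals
    have "counted t F Lb (cls ` W) \<longleftrightarrow> (\<forall>u\<in>\<Lambda>. \<forall>v\<in>W. lie Lb (cls u) (cls v) \<in> cls ` W)"
      using s Ideals by (simp add: lie_ideal_def carrier_Lb)
    also have "\<dots> \<longleftrightarrow> LL.closed t W" unfolding Ideals LL.closed.simps
      by (intro ball_cong refl m) (use l in blast)+
    finally show ?thesis .
  qed
qed

lemma card_cls: assumes W: "W \<in> Lat" shows "card (cls ` W) = idx W \<Lambda>M"
proof -
  have "idx W \<Lambda>M = card (cls ` W)"
    by (rule idx_eq_card_image[OF addgrp_\<Lambda>M]) (use cls_eq_iff Lat_facts[OF W] in blast)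
  thus ?thesis ..
qed

lemma finsum_cls:
  assumes W: "W \<in> Lat" and "finite S" "\<And>i. i \<in> S ==> a i \<in> A" "\<And>i. i \<in> S ==> w i \<in> W"
  shows "(\<Oplus>\<^bsub>Lb\<lparr>carrier := cls ` W\<rparr>\<^esub> i \<in> S. hcl (a i) \<odot>\<^bsub>Lb\<lparr>carrier := cls ` W\<rparr>\<^esub> cls (w i)) = cls (\<Sum>i\<in>S. vscale (a i) (w i))"
  using assms(2-4)
proof (induction S)
  let ?X = "Lb\<lparr>carrier := cls ` W\<rparr>"
  interpret abelian_group ?X by (rule abelian_group_restrict[OF W])
  note l = Lat_facts[OF W]
  case empty
  have "finsum ?X (\<lambda>i. hcl (a i) \<odot>\<^bsub>?X\<^esub> cls (w i)) {} = \<zero>\<^bsub>?X\<^esub>" by (rule finsum_empty)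
  also have "\<dots> = cls 0" using zero_Lb by simp
  finally show ?case unfolding sum.empty .
next
  let ?X = "Lb\<lparr>carrier := cls ` W\<rparr>"
  interpret abelian_group ?X by (rule abelian_group_restrict[OF W])
  note l = Lat_facts[OF W]
  case (insert x S)
  have t: "hcl (a i) \<odot>\<^bsub>?X\<^esub> cls (w i) = cls (vscale (a i) (w i)) \<and> vscale (a i) (w i) \<in> W" if "i \<in> insert x S" for i
    using smult_Lb[of "a i" "w i"] insert(4,5)[OF that] l LL.lat_scale[OF l(1)] by auto
  have "finsum ?X (\<lambda>i. hcl (a i) \<odot>\<^bsub>?X\<^esub> cls (w i)) (insert x S) =
    (hcl (a x) \<odot>\<^bsub>?X\<^esub> cls (w x)) \<oplus>\<^bsub>?X\<^esub> finsum ?X (\<lambda>i. hcl (a i) \<odot>\<^bsub>?X\<^esub> cls (w i)) S"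
    by (rule finsum_insert) (use insert t in auto)
  also have "finsum ?X (\<lambda>i. hcl (a i) \<odot>\<^bsub>?X\<^esub> cls (w i)) S = cls (\<Sum>i\<in>S. vscale (a i) (w i))"
    using insert by blast
  also have "(hcl (a x) \<odot>\<^bsub>?X\<^esub> cls (w x)) = cls (vscale (a x) (w x))" using t by blast
  also have "cls (vscale (a x) (w x)) \<oplus>\<^bsub>?X\<^esub> cls (\<Sum>i\<in>S. vscale (a i) (w i)) = cls (vscale (a x) (w x) + (\<Sum>i\<in>S. vscale (a i) (w i)))"
  proof -
    have "(\<Sum>i\<in>S. vscale (a i) (w i)) \<in> W" by (rule LL.lat_sum[OF l(1)]) (use t in blast)
    thus ?thesis using add_Lb[of "vscale (a x) (w x)" "\<Sum>i\<in>S. vscale (a i) (w i)"] t l by auto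
  qed
  finally show ?case unfolding sum.insert[OF insert(1,2)] .
qed

text \<open>A basis of length d puts coefficient tuples in bijection with the module, so its size is
  q^d. Conversely a generating family of length d exists, and a surjection between finite sets of
  the same size q^d is injective.\<close>

lemma free_of_rank_iff:
  assumes W: "W \<in> Lat" shows "free_of_rank F (Lb\<lparr>carrier := cls ` W\<rparr>) d \<longleftrightarrow> idx W \<Lambda>M = q ^ d"
proof
  let ?X = "Lb\<lparr>carrier := cls ` W\<rparr>"
  interpret abelian_group ?X by (rule abelian_group_restrict[OF W])
  note l = Lat_facts[OF W]
  have Q: "LL.quot \<Lambda>M W" using LL.quot_lower[OF LL.quot_\<Lambda> W] .
  have fin: "finite (carrier F)"
    unfolding carrier_F using finite_cosets_iff_image[OF addgrp_M, of A hcl] hcl_eq_iff finite_residues by blast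
  have card: "card ({..<d} \<rightarrow>\<^sub>E carrier F) = q ^ d" by (simp add: card_PiE card_F)
  have finW: "finite (cls ` W)" using card_cls[OF W] LL.idx_pos[OF Q] card_gt_0_iff by metis
  { assume "free_of_rank F ?X d"
    then obtain c where "c \<in> {..<d} \<rightarrow> carrier ?X \<and>
      (\<forall>x\<in>carrier ?X. \<exists>!r. r \<in> {..<d} \<rightarrow>\<^sub>E carrier F \<and> x = (\<Oplus>\<^bsub>?X\<^esub> i \<in> {..<d}. r i \<odot>\<^bsub>?X\<^esub> c i))"
      unfolding free_of_rank_def by (elim exE)
    moreover have "carrier ?X = cls ` W" by simp
    ultimately have c: "c \<in> {..<d} \<rightarrow> cls ` W"
      "\<And>x. x \<in> cls ` W ==> \<exists>!r. r \<in> {..<d} \<rightarrow>\<^sub>E carrier F \<and> x = (\<Oplus>\<^bsub>?X\<^esub> i \<in> {..<d}. r i \<odot>\<^bsub>?X\<^esub> c i)"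
      by (simp_all only:)
    let ?f = "\<lambda>r. \<Oplus>\<^bsub>?X\<^esub> i \<in> {..<d}. r i \<odot>\<^bsub>?X\<^esub> c i"
    have into: "?f r \<in> cls ` W" if r: "r \<in> {..<d} \<rightarrow>\<^sub>E carrier F" for r
    proof -
      have "r i \<odot>\<^bsub>?X\<^esub> c i \<in> cls ` W" if i: "i \<in> {..<d}" for i
      proof -
        have "r i \<in> hcl ` A" using PiE_mem[OF r i] unfolding carrier_F .
        moreover have "c i \<in> cls ` W" using funcset_mem[OF c(1) i] .
        ultimately obtain a w where "a \<in> A" "r i = hcl a" "w \<in> W" "c i = cls w" by blast
        moreover from this have "hcl a \<odot>\<^bsub>Lb\<^esub> cls w = cls (vscale a w)" using l smult_Lb by blast
        ultimately show ?thesis using LL.lat_scale[OF l(1)] by simp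
      qed
      hence "?f r \<in> carrier ?X" by (intro finsum_closed) auto
      thus ?thesis by simp
    qed
    have "bij_betw ?f ({..<d} \<rightarrow>\<^sub>E carrier F) (cls ` W)"
      unfolding bij_betw_def
    proof
      show "inj_on ?f ({..<d} \<rightarrow>\<^sub>E carrier F)"
      proof (rule inj_onI)
        fix r s assume rs: "r \<in> {..<d} \<rightarrow>\<^sub>E carrier F" "s \<in> {..<d} \<rightarrow>\<^sub>E carrier F" "?f r = ?f s"
        from c(2)[OF into[OF rs(1)]] show "r = s" by (rule ex1E) (use rs in blast)
      qed
      show "?f ` ({..<d} \<rightarrow>\<^sub>E carrier F) = cls ` W"
      proof (intro equalityI subsetI)
        fix x assume "x \<in> cls ` W"
        from c(2)[OF this] show "x \<in> ?f ` ({..<d} \<rightarrow>\<^sub>E carrier F)"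
        proof (rule ex1E)
          fix r assume "r \<in> {..<d} \<rightarrow>\<^sub>E carrier F \<and> x = ?f r"
          thus ?thesis by (intro image_eqI[of _ _ r]) auto
        qed
      next
        fix x assume "x \<in> ?f ` ({..<d} \<rightarrow>\<^sub>E carrier F)"
        then obtain r where "r \<in> {..<d} \<rightarrow>\<^sub>E carrier F" "x = ?f r" by (elim imageE)
        thus "x \<in> cls ` W" using into by (simp only:)
      qed
    qed
    from bij_betw_same_card[OF this] show "idx W \<Lambda>M = q ^ d" unfolding card card_cls[OF W] by (rule sym) }
  { assume i: "idx W \<Lambda>M = q ^ d"
    obtain w where w: "\<forall>i<d. w i \<in> W" "\<And>u. u \<in> W ==> \<exists>a. (\<forall>i<d. a i \<in> A) \<and> u - (\<Sum>i<d. vscale (a i) (w i)) \<in> \<Lambda>M"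
      using LL.lattice_basis[OF Q i] by blast
    let ?c = "\<lambda>i. cls (w i)"
    let ?f = "\<lambda>r. \<Oplus>\<^bsub>?X\<^esub> i \<in> {..<d}. r i \<odot>\<^bsub>?X\<^esub> ?c i"
    have surj: "\<exists>r \<in> {..<d} \<rightarrow>\<^sub>E carrier F. x = ?f r" if x: "x \<in> cls ` W" for x
    proof -
      obtain u where u: "u \<in> W" "x = cls u" using x by blast
      obtain a where a: "\<forall>i<d. a i \<in> A" "u - (\<Sum>i<d. vscale (a i) (w i)) \<in> \<Lambda>M" using w(2)[OF u(1)] by blast
      have "x = cls (\<Sum>i<d. vscale (a i) (w i))" using cls_eqI[OF a(2)] u by simp
      also have "\<dots> = ?f (\<lambda>i. hcl (a i))" by (rule finsum_cls[symmetric, OF W]) (use a w in auto)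
      also have "\<dots> = ?f (\<lambda>i\<in>{..<d}. hcl (a i))"
      proof (rule finsum_cong'[OF refl])
        show "(\<lambda>i. (\<lambda>i\<in>{..<d}. hcl (a i)) i \<odot>\<^bsub>?X\<^esub> ?c i) \<in> {..<d} \<rightarrow> carrier ?X"
        proof
          fix i assume i: "i \<in> {..<d}"
          have "hcl (a i) \<odot>\<^bsub>Lb\<^esub> cls (w i) = cls (vscale (a i) (w i))" using a w l i smult_Lb by auto
          thus "(\<lambda>i\<in>{..<d}. hcl (a i)) i \<odot>\<^bsub>?X\<^esub> ?c i \<in> carrier ?X" using i a w LL.lat_scale[OF l(1)] by simp
        qed
      qed auto
      finally show ?thesis using a by (intro bexI[of _ "\<lambda>i\<in>{..<d}. hcl (a i)"]) auto
    qed
    let ?D = "{r \<in> {..<d} \<rightarrow>\<^sub>E carrier F. ?f r \<in> cls ` W}"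
    have finD: "finite ({..<d} \<rightarrow>\<^sub>E carrier F)" using fin by (intro finite_PiE) auto
    have im: "?f ` ?D = cls ` W"
    proof (intro equalityI subsetI)
      fix x assume x: "x \<in> cls ` W"
      obtain r where r: "r \<in> {..<d} \<rightarrow>\<^sub>E carrier F" "x = ?f r" using bexE[OF surj[OF x]] .
      have "?f r \<in> cls ` W" using x unfolding r(2) .
      hence "r \<in> ?D" using r(1) by (intro CollectI conjI)
      thus "x \<in> ?f ` ?D" unfolding r(2) by (rule imageI)
    next
      fix x assume "x \<in> ?f ` ?D"
      then obtain r where "r \<in> ?D" "x = ?f r" by (elim imageE)
      thus "x \<in> cls ` W" by (simp only: mem_Collect_eq)
    qed
    have cD: "card ?D = card (cls ` W)"
    proof (rule antisym)
      show "card ?D \<le> card (cls ` W)" using card_mono[OF finD, of ?D] card card_cls[OF W] i by auto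
      show "card (cls ` W) \<le> card ?D" using card_image_le[of ?D ?f] finD im by simp
    qed
    hence "?D = {..<d} \<rightarrow>\<^sub>E carrier F" using card_subset_eq[OF finD, of ?D] card card_cls[OF W] i by auto
    moreover have "inj_on ?f ?D" using eq_card_imp_inj_on[of ?D ?f] finD im cD by simp
    ultimately have inj: "inj_on ?f ({..<d} \<rightarrow>\<^sub>E carrier F)" by simp
    show "free_of_rank F ?X d" unfolding free_of_rank_def
    proof (intro exI[of _ ?c] conjI ballI)
      show "?c \<in> {..<d} \<rightarrow> carrier ?X" using w by auto
      fix x assume "x \<in> carrier ?X"
      hence x: "x \<in> cls ` W" by simp
      obtain r where r: "r \<in> {..<d} \<rightarrow>\<^sub>E carrier F" "x = ?f r" using bexE[OF surj[OF x]] .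
      show "\<exists>!r. r \<in> {..<d} \<rightarrow>\<^sub>E carrier F \<and> x = ?f r"
      proof (rule ex1I[of _ r])
        show "r \<in> {..<d} \<rightarrow>\<^sub>E carrier F \<and> x = ?f r" using r by (rule conjI)
        fix s assume s: "s \<in> {..<d} \<rightarrow>\<^sub>E carrier F \<and> x = ?f s"
        show "s = r" by (rule inj_onD[OF inj _ conjunct1[OF s] r(1)]) (use s r(2) in metis)
      qed
    qed }
qed

lemma has_codim_iff: assumes W: "W \<in> Lat" shows "has_codim F Lb (cls ` W) i \<longleftrightarrow> idx \<Lambda> W = q ^ i"
proof -
  have "free_of_rank F Lb m \<longleftrightarrow> idx \<Lambda> \<Lambda>M = q ^ m" for m
    using free_of_rank_iff[OF \<Lambda>_Lat, of m] by (simp flip: carrier_Lb)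
  hence 1: "free_of_rank F Lb m \<longleftrightarrow> n = m" for m using idx_\<Lambda> by simp
  obtain j where j: "j \<le> n" "idx \<Lambda> W = q ^ j" "idx W \<Lambda>M = q ^ (n - j)" using LL.idx_le_power[OF LL.quot_\<Lambda> idx_\<Lambda> W] .
  have "has_codim F Lb (cls ` W) i \<longleftrightarrow> (\<exists>d. n - j = d \<and> n = d + i)"
    using free_of_rank_iff[OF W] 1 j by (simp add: has_codim_def)
  also have "\<dots> \<longleftrightarrow> i = j" using j(1) by auto
  finally show ?thesis using j by auto
qed

text \<open>From here on the tensor product is gone: the coefficients of the zeta functions are
  counts of lattices in K^n.\<close>

theorem num_codim_eq: "num_codim t F Lb i = LL.num t i"
proof -
  have "{U. counted t F Lb U \<and> has_codim F Lb U i} = (\<lambda>W. cls ` W) ` {W \<in> Lat. idx \<Lambda> W = q ^ i \<and> LL.closed t W}"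
  proof (intro equalityI subsetI)
    fix U assume U: "U \<in> {U. counted t F Lb U \<and> has_codim F Lb U i}"
    hence "submodule U F Lb" by (cases t) (auto simp: lie_subalgebra_def lie_ideal_def)
    then obtain W where "W \<in> Lat" "U = cls ` W" using submodule_iff by blast
    thus "U \<in> (\<lambda>W. cls ` W) ` {W \<in> Lat. idx \<Lambda> W = q ^ i \<and> LL.closed t W}"
      using U counted_iff has_codim_iff by blast
  next
    fix U assume "U \<in> (\<lambda>W. cls ` W) ` {W \<in> Lat. idx \<Lambda> W = q ^ i \<and> LL.closed t W}"
    thus "U \<in> {U. counted t F Lb U \<and> has_codim F Lb U i}" using counted_iff has_codim_iff by blast
  qed
  moreover have "inj_on (\<lambda>W. cls ` W) {W \<in> Lat. idx \<Lambda> W = q ^ i \<and> LL.closed t W}"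
    using cls_image_inj by (rule inj_on_subset) auto
  ultimately show ?thesis by (simp add: num_codim_def LL.num_def card_image)
qed

end

section \<open>Primes of a number ring\<close>

text \<open>That the algebraic integers form a commutative ring is assumed here; in the theorem it
  is supplied by the module L.\<close>

locale number_ring =
  fixes ty :: "'k::field_char_0 itself"
  assumes nf: "number_field TYPE('k)" and cr: "cring (OK :: 'k ring)"
begin

abbreviation int_el :: "'k => bool" where "int_el \<equiv> algebraic_int"

sublocale OK: cring "OK :: 'k ring" by (rule cr)

lemma int_add: "int_el x ==> int_el y ==> int_el (x + y)"
  using OK.add.m_closed[of x y] by simp
lemma int_mult: "int_el x ==> int_el y ==> int_el (x * y)"
  using OK.m_closed[of x y] by simp
lemma int_diff: "int_el x ==> int_el y ==> int_el (x - y)"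
  using int_add[of x "- y"] by simp
lemma int_of_int: "int_el (of_int k)"
  by (rule int_imp_algebraic_int) simp
lemma int_sum: "(\<And>i. i \<in> S ==> int_el (f i)) ==> int_el (sum f S)"
  by (induction S rule: infinite_finite_induct) (auto intro: int_add)
lemma int_power: "int_el x ==> int_el (x ^ k)"
  by (induction k) (auto intro: int_mult)

interpretation rv: vector_space "\<lambda>(r::rat) (x::'k). of_rat r * x"
  by unfold_locales (auto simp: algebra_simps of_rat_add of_rat_mult)

lemma spanning: obtains B :: "'k set" where "finite B" "rv.span B = UNIV"
  using nf by (auto simp: number_field_def)

lemma dependent_rat:
  fixes S :: "'k set"
  assumes "finite S" "\<not> rv.independent S"
  obtains a :: "'k => int" where "\<exists>s\<in>S. a s \<noteq> 0" "(\<Sum>s\<in>S. of_int (a s) * s) = 0"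
proof -
  obtain u :: "'k => rat" and v where u: "v \<in> S" "u v \<noteq> 0" "(\<Sum>s\<in>S. of_rat (u s) * s) = 0"
    using rv.dependent_finite[OF assms(1)] assms(2) by blast
  \<comment> \<open>A common denominator of the coefficients.\<close>
  define D where "D = (\<Prod>s\<in>S. snd (quotient_of (u s)))"
  have pos: "snd (quotient_of r) > 0" for r by (simp add: quotient_of_denom_pos')
  have D: "D \<noteq> 0" unfolding D_def using assms(1) pos by (auto simp: less_le)
  have "\<exists>a::int. of_int a = of_int D * u s" if s: "s \<in> S" for s
  proof -
    have "D = snd (quotient_of (u s)) * (\<Prod>s\<in>S - {s}. snd (quotient_of (u s)))"
      unfolding D_def using assms(1) s by (rule prod.remove)
    moreover have "u s = of_int (fst (quotient_of (u s))) / of_int (snd (quotient_of (u s)))"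
      by (rule quotient_of_div) simp
    hence "of_int (snd (quotient_of (u s))) * u s = of_int (fst (quotient_of (u s)))"
      using pos[of "u s"] by (simp add: field_simps)
    ultimately have "of_int D * u s = of_int (fst (quotient_of (u s)) * (\<Prod>s\<in>S - {s}. snd (quotient_of (u s))))"
      by (simp add: mult_ac)
    thus ?thesis by metis
  qed
  then obtain a :: "'k => int" where a: "\<And>s. s \<in> S ==> of_int (a s) = of_int D * u s" by metis
  have "(\<Sum>s\<in>S. of_int (a s) * s) = (\<Sum>s\<in>S. of_int D * (of_rat (u s) * s))"
  proof (rule sum.cong[OF refl])
    fix s assume "s \<in> S"
    hence "(of_rat (of_int (a s)) :: 'k) = of_rat (of_int D * u s)" using a by simp
    thus "of_int (a s) * s = of_int D * (of_rat (u s) * s)" by (simp add: of_rat_mult)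
  qed
  hence "(\<Sum>s\<in>S. of_int (a s) * s) = 0" using u(3) by (simp flip: sum_distrib_left)
  moreover have "a v \<noteq> 0" using a[OF u(1)] u(2) D by auto
  ultimately show ?thesis using that u(1) by blast
qed

text \<open>The powers of x up to the size of a spanning set are either linearly dependent over the
  rationals or not even distinct; both give a polynomial with root x.\<close>

lemma algebraic_all: "algebraic (x :: 'k)"
proof -
  obtain B :: "'k set" where B: "finite B" "rv.span B = UNIV" by (rule spanning)
  let ?S = "(\<lambda>i. x ^ i) ` {..card B}"
  show ?thesis
  proof (cases "inj_on (\<lambda>i. x ^ i) {..card B}")
    case True
    hence "card ?S = Suc (card B)" by (simp add: card_image)
    hence "\<not> rv.independent ?S" using rv.independent_span_bound[OF B(1), of ?S] B(2) by auto
    then obtain a :: "'k => int" where a: "\<exists>s\<in>?S. a s \<noteq> 0" "(\<Sum>s\<in>?S. of_int (a s) * s) = 0"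
      using dependent_rat[of ?S] by blast
    define p :: "'k poly" where "p = (\<Sum>i\<le>card B. monom (of_int (a (x ^ i))) i)"
    have c: "coeff p i = (if i \<le> card B then of_int (a (x ^ i)) else 0)" for i
    proof -
      have "coeff p i = (\<Sum>j\<le>card B. if j = i then of_int (a (x ^ j)) else 0)" by (simp add: p_def coeff_sum coeff_monom)
      thus ?thesis by simp
    qed
    have "poly p x = (\<Sum>i\<le>card B. of_int (a (x ^ i)) * x ^ i)" by (simp add: p_def poly_sum poly_monom)
    also have "\<dots> = (\<Sum>s\<in>?S. of_int (a s) * s)" using True by (simp add: sum.reindex)
    finally have "poly p x = 0" using a by simp
    moreover obtain i where "i \<le> card B" "a (x ^ i) \<noteq> 0" using a(1) by blast
    hence "coeff p i \<noteq> 0" using c by simp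
    hence "p \<noteq> 0" by auto
    ultimately show ?thesis using c by (intro algebraicI[of p]) auto
  next
    case False
    then obtain i j where ij: "x ^ i = x ^ j" "i \<noteq> j" by (auto simp: inj_on_def)
    define p :: "'k poly" where "p = monom 1 i - monom 1 j"
    have "coeff p i = 1" using ij by (simp add: p_def)
    hence "p \<noteq> 0" by auto
    moreover have "poly p x = 0" using ij by (simp add: p_def poly_monom)
    ultimately show ?thesis by (intro algebraicI[of p]) (auto simp: p_def)
  qed
qed

text \<open>If c is the leading coefficient of an integer polynomial p of positive degree n with
  root x, then c x is a root of c^(n-1) p(X / c), which is monic with integer coefficients.\<close>

lemma denominator: "\<exists>m::int. m \<noteq> 0 \<and> int_el (of_int m * x)"
proof -
  obtain p :: "int poly" where p: "p \<noteq> 0" "poly (map_poly of_int p) x = 0"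
    using algebraic_all[of x] by (rule algebraicE')
  define n where "n = degree p"
  define c where "c = lead_coeff p"
  show ?thesis
  proof (cases n)
    case 0
    then obtain k where "p = [:k:]" "k \<noteq> 0" using p(1) by (auto simp: n_def elim!: degree_eq_zeroE)
    thus ?thesis using p(2) by (simp add: map_poly_pCons)
  next
    case (Suc m)
    define r :: "int poly" where "r = monom 1 n + (\<Sum>i<n. monom (coeff p i * c ^ (m - i)) i)"
    have co: "coeff r i = (if i = n then 1 else if i < n then coeff p i * c ^ (m - i) else 0)" for i
    proof -
      have "coeff (\<Sum>i<n. monom (coeff p i * c ^ (m - i)) i) i = (\<Sum>j<n. if j = i then coeff p j * c ^ (m - j) else 0)"
        by (simp add: coeff_sum coeff_monom)
      thus ?thesis by (auto simp: r_def coeff_monom)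
    qed
    have deg: "degree r = n"
      by (rule antisym) (use co in \<open>auto intro!: degree_le le_degree\<close>)
    have "poly (map_poly of_int r) (of_int c * x) = (\<Sum>i\<le>n. of_int (coeff r i) * (of_int c * x) ^ i)"
      by (simp add: poly_altdef degree_map_poly deg coeff_map_poly)
    also have "\<dots> = (of_int c * x) ^ n + (\<Sum>i<n. of_int (coeff p i * c ^ (m - i)) * (of_int c * x) ^ i)"
    proof -
      have "{..n} = insert n {..<n}" by auto
      thus ?thesis by (simp add: co)
    qed
    also have "(\<Sum>i<n. of_int (coeff p i * c ^ (m - i)) * (of_int c * x) ^ i) = (\<Sum>i<n. of_int c ^ m * (of_int (coeff p i) * x ^ i))"
    proof (rule sum.cong[OF refl])
      fix i assume "i \<in> {..<n}"
      hence "m = (m - i) + i" using Suc by simp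
      hence "(of_int c :: 'k) ^ m = of_int c ^ (m - i) * of_int c ^ i" by (metis power_add)
      thus "of_int (coeff p i * c ^ (m - i)) * (of_int c * x) ^ i = of_int c ^ m * (of_int (coeff p i) * x ^ i)"
        by (simp add: power_mult_distrib mult_ac)
    qed
    also have "(of_int c * x) ^ n = of_int c ^ m * (of_int (coeff p n) * x ^ n)"
      using Suc by (simp add: power_mult_distrib c_def n_def mult_ac)
    also have "of_int c ^ m * (of_int (coeff p n) * x ^ n) + (\<Sum>i<n. of_int c ^ m * (of_int (coeff p i) * x ^ i)) =
      of_int c ^ m * (\<Sum>i\<le>n. of_int (coeff p i) * x ^ i)"
    proof -
      have "{..n} = insert n {..<n}" by auto
      thus ?thesis by (simp add: sum_distrib_left algebra_simps)
    qed
    also have "(\<Sum>i\<le>n. of_int (coeff p i) * x ^ i) = 0"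
      using p(2) by (simp add: poly_altdef degree_map_poly n_def coeff_map_poly)
    finally have "int_el (of_int c * x)" using deg co unfolding algebraic_int_altdef_ipoly by (intro exI[of _ r]) simp
    moreover have "c \<noteq> 0" using p(1) by (simp add: c_def)
    ultimately show ?thesis by blast
  qed
qed

lemma ideal_mult: "ideal I OK ==> x \<in> I ==> int_el r ==> r * (x::'k) \<in> I"
  using ideal.I_l_closed[of I OK x r] by simp
lemma ideal_int: "ideal I OK ==> (x::'k) \<in> I ==> int_el x"
  using ideal.Icarr[of I OK x] by simp
lemma ideal_add: "ideal I OK ==> (x::'k) \<in> I ==> y \<in> I ==> x + y \<in> I"
  using additive_subgroup.a_closed[of I OK x y] by (simp add: ideal.axioms)
lemma ideal_0: "ideal I OK ==> (0::'k) \<in> I"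
  using additive_subgroup.zero_closed[of I OK] by (simp add: ideal.axioms)
lemma ideal_minus: "ideal I OK ==> (x::'k) \<in> I ==> - x \<in> I"
  using ideal_mult[of I x "-1"] by simp
lemma ideal_diff: "ideal I OK ==> (x::'k) \<in> I ==> y \<in> I ==> x - y \<in> I"
  using ideal_add[of I x "- y"] ideal_minus by simp

definition P where "P = (nonzero_primes OK :: 'k set set)"

lemma PD:
  assumes "I \<in> P"
  shows "ideal I OK" "I \<noteq> {0}" "1 \<notin> I" "\<And>a b. int_el a ==> int_el b ==> a * b \<in> I ==> a \<in> I \<or> b \<in> I"
proof -
  have p: "primeideal I OK" "I \<noteq> {0}" using assms by (auto simp: P_def nonzero_primes_def)
  show i: "ideal I OK" using p by (simp add: primeideal.axioms)
  show "I \<noteq> {0}" by fact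
  show "a \<in> I \<or> b \<in> I" if "int_el a" "int_el b" "a * b \<in> I" for a b
    using primeideal.I_prime[OF p(1), of a b] that by simp
  show "1 \<notin> I"
  proof
    assume "1 \<in> I"
    hence "carrier OK \<subseteq> I" using ideal_mult[OF i, of 1] by fastforce
    moreover have "I \<subseteq> carrier OK" using ideal_int[OF i] by auto
    ultimately show False using primeideal.I_notcarr[OF p(1)] by blast
  qed
qed

text \<open>Take a monic integer polynomial vanishing at a nonzero x in I and cancel X while the
  constant term is 0; the constant term that remains is a multiple of x.\<close>

lemma integer_in_prime: assumes "I \<in> P" shows "\<exists>m::nat. m \<noteq> 0 \<and> of_nat m \<in> I"
proof -
  note I = PD[OF assms]
  obtain x where x: "x \<in> I" "x \<noteq> 0" using I(2) ideal_0[OF I(1)] by blast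
  have xi: "int_el x" using ideal_int[OF I(1) x(1)] .
  obtain r :: "int poly" where r: "poly (map_poly of_int r) x = 0" "lead_coeff r = 1"
    using xi unfolding algebraic_int_altdef_ipoly by blast
  have "\<exists>m::int. m \<noteq> 0 \<and> of_int m \<in> I" if "poly (map_poly of_int r) x = 0" "r \<noteq> 0" for r :: "int poly"
    using that
  proof (induction r)
    case (pCons a r)
    have e: "of_int a + x * poly (map_poly of_int r) x = 0" using pCons by (simp add: map_poly_pCons)
    show ?case
    proof (cases "a = 0")
      case True
      thus ?thesis using e x pCons by auto
    next
      case False
      have "int_el (poly (map_poly of_int r) x)"
        unfolding poly_altdef by (intro int_sum int_mult int_power xi) (simp add: coeff_map_poly int_of_int)
      from ideal_minus[OF I(1) ideal_mult[OF I(1) x(1) this]] have "- (x * poly (map_poly of_int r) x) \<in> I" by (simp add: mult.commute)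
      moreover have "of_int a = - (x * poly (map_poly of_int r) x)" using e by (simp add: eq_neg_iff_add_eq_0)
      ultimately show ?thesis using False by metis
    qed
  qed simp
  note * = this
  have "r \<noteq> 0" using r(2) by auto
  then obtain m :: int where m: "m \<noteq> 0" "of_int m \<in> I" using *[OF r(1)] by blast
  have "of_int \<bar>m\<bar> \<in> I" using m(2) ideal_minus[OF I(1) m(2)] by (simp add: abs_if)
  hence "of_nat (nat \<bar>m\<bar>) \<in> I" by simp
  thus ?thesis using m(1) by (intro exI[of _ "nat \<bar>m\<bar>"]) simp
qed

lemma prime_in_prime:
  assumes "I \<in> P" "m \<noteq> 0" "of_nat m \<in> I" shows "\<exists>p. Factorial_Ring.prime p \<and> p dvd m \<and> of_nat p \<in> I"
  using assms(2,3)
proof (induction m rule: less_induct)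
  case (less m)
  note I = PD[OF assms(1)]
  have "m \<noteq> 1" using less I(3) by auto
  then obtain p where p: "Factorial_Ring.prime p" "p dvd m" using prime_factor_nat by blast
  then obtain k where k: "m = p * k" by auto
  have "of_nat p * of_nat k \<in> I" using less k by simp
  hence "of_nat p \<in> I \<or> of_nat k \<in> I" using I(4)[of "of_nat p" "of_nat k"] int_of_int[of "int p"] int_of_int[of "int k"] by simp
  thus ?case
  proof
    assume "of_nat k \<in> I"
    moreover have "k < m" "k \<noteq> 0" using k less p prime_gt_1_nat[of p] by auto
    ultimately obtain p' where "Factorial_Ring.prime p'" "p' dvd k" "of_nat p' \<in> I" using less(1) by blast
    thus ?thesis using k by auto
  qed (use p in blast)
qed

text \<open>The algebraic integers modulo p form a vector space over the field with p elements, of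
  dimension at most the degree of K: a family independent modulo p is independent over the
  rationals. A maximal such family S gives the residues, with coefficients from 0 to p - 1.\<close>

lemma residues_finite:
  assumes p: "Factorial_Ring.prime (p::nat)"
  obtains C :: "'k set" where "finite C" "\<And>c. c \<in> C ==> int_el c"
    "\<And>x. int_el x ==> \<exists>c\<in>C. \<exists>t. int_el t \<and> x - c = of_nat p * t"
proof -
  define pO where "pO = {of_nat p * t | t :: 'k. int_el t}"
  have pO_add: "x \<in> pO ==> y \<in> pO ==> x + y \<in> pO" for x y
    unfolding pO_def by (clarsimp simp flip: distrib_left) (use int_add in blast)
  have pO_mult: "x \<in> pO ==> int_el r ==> r * x \<in> pO" for x r
  proof -
    assume "x \<in> pO" "int_el r"
    then obtain t where "int_el t" "x = of_nat p * t" by (auto simp: pO_def)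
    hence "r * x = of_nat p * (r * t)" "int_el (r * t)" using int_mult \<open>int_el r\<close> by auto
    thus "r * x \<in> pO" unfolding pO_def by blast
  qed
  have pO_diff: "x \<in> pO ==> y \<in> pO ==> x - y \<in> pO" for x y
    using pO_add[of x "- y"] pO_mult[of y "-1"] by simp
  have pO_sum: "(\<And>i. i \<in> S ==> f i \<in> pO) ==> sum f S \<in> pO" for f and S :: "'k set"
  proof (induction S rule: infinite_finite_induct)
    case (insert x F) thus ?case using pO_add by simp
  qed (auto simp: pO_def intro!: exI[of _ 0])
  have pI: "int p dvd a ==> int_el s ==> of_int a * s \<in> pO" for a s
  proof -
    assume "int p dvd a" "int_el s"
    then obtain k where "a = int p * k" by auto
    hence "of_int a * s = of_nat p * (of_int k * s)" by simp
    moreover have "int_el (of_int k * s)" using \<open>int_el s\<close> int_mult int_of_int by blast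
    ultimately show "of_int a * s \<in> pO" unfolding pO_def by blast
  qed
  define ind where "ind S \<longleftrightarrow> finite S \<and> (\<forall>s\<in>S. int_el s) \<and>
    (\<forall>a :: 'k => int. (\<Sum>s\<in>S. of_int (a s) * s) \<in> pO \<longrightarrow> (\<forall>s\<in>S. int p dvd a s))" for S
  obtain B :: "'k set" where B: "finite B" "rv.span B = UNIV" by (rule spanning)
  have bound: "card S \<le> card B" if S: "ind S" for S
  proof -
    have fin: "finite S" using S by (simp add: ind_def)
    \<comment> \<open>Infinite descent: in an integral relation every coefficient is divisible by p,
      and dividing by p gives a smaller relation.\<close>
    have desc: "\<not> (\<exists>s\<in>S. a s \<noteq> 0)" if "(\<Sum>s\<in>S. of_int (a s) * s) = 0" for a :: "'k => int"
      using that
    proof (induction "nat (\<Sum>s\<in>S. \<bar>a s\<bar>)" arbitrary: a rule: less_induct)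
      case less
      show ?case
      proof
        assume "\<exists>s\<in>S. a s \<noteq> 0"
        then obtain s0 where s0: "s0 \<in> S" "a s0 \<noteq> 0" by blast
        have "0 \<in> pO" unfolding pO_def by (auto intro!: exI[of _ 0])
        hence d: "\<forall>s\<in>S. int p dvd a s" using S less(2) unfolding ind_def by metis
        define a' where "a' s = a s div int p" for s
        have a: "a s = int p * a' s" if "s \<in> S" for s using d that by (simp add: a'_def)
        have "(\<Sum>s\<in>S. of_int (a s) * s) = of_nat p * (\<Sum>s\<in>S. of_int (a' s) * s)"
          using a by (simp add: sum_distrib_left mult_ac)
        hence z: "(\<Sum>s\<in>S. of_int (a' s) * s) = 0" using less(2) p by auto
        have sa: "(\<Sum>s\<in>S. \<bar>a s\<bar>) = int p * (\<Sum>s\<in>S. \<bar>a' s\<bar>)"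
          unfolding sum_distrib_left by (rule sum.cong[OF refl]) (simp add: a abs_mult)
        have "a' s0 \<noteq> 0" using a[OF s0(1)] s0(2) by auto
        hence "(\<Sum>s\<in>S. \<bar>a' s\<bar>) > 0" using sum_pos2[OF fin s0(1), of "\<lambda>s. \<bar>a' s\<bar>"] by simp
        hence "(\<Sum>s\<in>S. \<bar>a' s\<bar>) < (\<Sum>s\<in>S. \<bar>a s\<bar>)" using sa prime_gt_1_nat[OF p] by simp
        hence "nat (\<Sum>s\<in>S. \<bar>a' s\<bar>) < nat (\<Sum>s\<in>S. \<bar>a s\<bar>)" using \<open>(\<Sum>s\<in>S. \<bar>a' s\<bar>) > 0\<close> by simp
        from less(1)[OF this z] show False using \<open>a' s0 \<noteq> 0\<close> s0 by blast
      qed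
    qed
    have "rv.independent S" using dependent_rat[OF fin] desc by metis
    thus ?thesis using rv.independent_span_bound[OF B(1), of S] B(2) by auto
  qed
  have "ind {}" by (simp add: ind_def)
  hence "\<exists>S. ind S \<and> (\<forall>T. ind T \<longrightarrow> card T \<le> card S)"
    by (rule ex_has_greatest_nat[where b = "Suc (card B)"]) (simp add: bound less_Suc_eq_le)
  then obtain S where S: "ind S" "\<And>T. ind T ==> card T \<le> card S" by (elim exE conjE) simp
  have fin: "finite S" and Si: "\<And>s. s \<in> S ==> int_el s" using S(1) by (auto simp: ind_def)
  define C where "C = (\<lambda>a. \<Sum>s\<in>S. of_int (a s) * s) ` (S \<rightarrow>\<^sub>E {0..<int p})"
  have finC: "finite C" unfolding C_def using fin by (intro finite_imageI finite_PiE) auto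
  have Ci: "int_el c" if "c \<in> C" for c
    using that Si by (auto simp: C_def intro!: int_sum int_mult int_of_int)
  have dep: "\<exists>a. x - (\<Sum>s\<in>S. of_int (a s) * s) \<in> pO" if x: "int_el x" for x
  proof (cases "x \<in> S")
    case True
    have "(\<Sum>s\<in>S. of_int ((\<lambda>s. if s = x then 1 else 0) s) * s) = (\<Sum>s\<in>S. if s = x then x else 0)"
      by (intro sum.cong) auto
    also have "\<dots> = x" using fin True by simp
    finally show ?thesis by (intro exI[of _ "\<lambda>s. if s = x then 1 else 0"]) (auto simp: pO_def intro!: exI[of _ 0])
  next
    case False
    have "\<not> ind (insert x S)" using S(2)[of "insert x S"] False fin by auto
    then obtain a :: "'k => int" where a: "(\<Sum>s\<in>insert x S. of_int (a s) * s) \<in> pO" "\<not> (\<forall>s\<in>insert x S. int p dvd a s)"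
      using fin Si x unfolding ind_def by auto
    have e: "of_int (a x) * x + (\<Sum>s\<in>S. of_int (a s) * s) \<in> pO" using a(1) False fin by simp
    \<comment> \<open>By maximality x and S are dependent modulo p; if p divided the coefficient of
      x, the relation would be one of S alone. So that coefficient can be inverted modulo p.\<close>
    have "\<not> int p dvd a x"
    proof
      assume d: "int p dvd a x"
      have "(of_int (a x) * x + (\<Sum>s\<in>S. of_int (a s) * s)) - of_int (a x) * x \<in> pO"
        using pO_diff[OF e pI[OF d x]] .
      hence "\<forall>s\<in>S. int p dvd a s" using S(1) unfolding ind_def by simp
      thus False using a(2) d by blast
    qed
    moreover have "Factorial_Ring.prime (int p)" using p by simp
    ultimately have "Rings.coprime (int p) (a x)" by (intro prime_imp_coprime) auto
    hence "gcd (a x) (int p) = 1" by (simp add: coprime_iff_gcd_eq_1 gcd.commute)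
    then obtain t u where "t * a x + u * int p = 1" using bezout_int[of "a x" "int p"] by auto
    hence "a x * t - 1 = int p * (- u)" by (simp add: algebra_simps)
    hence t: "int p dvd a x * t - 1" by (rule dvdI)
    have "of_int t * (of_int (a x) * x + (\<Sum>s\<in>S. of_int (a s) * s)) - of_int (a x * t - 1) * x \<in> pO"
      using pO_diff[OF pO_mult[OF e int_of_int[of t]] pI[OF t x]] .
    moreover have "of_int t * (of_int (a x) * x + (\<Sum>s\<in>S. of_int (a s) * s)) - of_int (a x * t - 1) * x =
      x - (\<Sum>s\<in>S. of_int (- t * a s) * s)"
      by (simp add: algebra_simps sum_distrib_left sum_negf)
    ultimately show ?thesis by (intro exI[of _ "\<lambda>s. - t * a s"]) simp
  qed
  have red: "\<exists>c\<in>C. \<exists>t. int_el t \<and> x - c = of_nat p * t" if x: "int_el x" for x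
  proof -
    obtain a where a: "x - (\<Sum>s\<in>S. of_int (a s) * s) \<in> pO" using dep[OF x] by blast
    define a' where "a' = restrict (\<lambda>s. a s mod int p) S"
    have pp: "int p > 0" using p by (simp add: prime_gt_0_nat)
    have c: "(\<Sum>s\<in>S. of_int (a' s) * s) \<in> C" unfolding C_def using pp by (intro imageI) (auto simp: a'_def)
    have "(\<Sum>s\<in>S. of_int (a s - a' s) * s) \<in> pO"
      by (rule pO_sum, rule pI) (auto simp: a'_def Si mod_eq_dvd_iff[symmetric])
    from pO_add[OF a this] have "x - (\<Sum>s\<in>S. of_int (a' s) * s) \<in> pO"
      by (simp add: algebra_simps sum_subtractf)
    thus ?thesis using c unfolding pO_def by blast
  qed
  show ?thesis using that[OF finC Ci red] by blast
qed

text \<open>An ideal containing p is a union of residue classes modulo p, so it is determined by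
  which of the finitely many representatives in C it contains.\<close>

lemma finite_primes_over: assumes m: "(m::nat) \<noteq> 0" shows "finite {I \<in> P. of_nat m \<in> I}"
proof -
  have pr: "finite {I \<in> P. of_nat p \<in> I}" if p: "Factorial_Ring.prime p" for p :: nat
  proof -
    obtain C :: "'k set" where C: "finite C" "\<And>c. c \<in> C ==> int_el c"
      "\<And>x. int_el x ==> \<exists>c\<in>C. \<exists>t. int_el t \<and> x - c = of_nat p * t" using residues_finite[OF p] by metis
    have *: "x \<in> I \<longleftrightarrow> c \<in> I" if I: "I \<in> P" "of_nat p \<in> I" and c: "x - c = of_nat p * t" "int_el t" for I x c t
    proof -
      have d: "x - c \<in> I" using ideal_mult[OF PD(1)[OF I(1)] I(2) c(2)] c(1) by (simp add: mult.commute)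
      show ?thesis using ideal_add[OF PD(1)[OF I(1)] d, of c] ideal_diff[OF PD(1)[OF I(1)] _ d, of x] by auto
    qed
    have sub: "I \<subseteq> J" if I: "I \<in> P" "of_nat p \<in> I" and J: "J \<in> P" "of_nat p \<in> J" and eq: "I \<inter> C = J \<inter> C" for I J
    proof
      fix x assume x: "x \<in> I"
      obtain c t where c: "c \<in> C" "int_el t" "x - c = of_nat p * t" using C(3)[OF ideal_int[OF PD(1)[OF I(1)] x]] by blast
      have "c \<in> I" using *[OF I c(3,2)] x by blast
      hence "c \<in> J" using c eq by blast
      thus "x \<in> J" using *[OF J c(3,2)] by blast
    qed
    have "inj_on (\<lambda>I. I \<inter> C) {I \<in> P. of_nat p \<in> I}"
      by (rule inj_onI) (use sub in \<open>auto intro!: equalityI\<close>)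
    thus ?thesis by (rule inj_on_finite[where B = "Pow C"]) (use C in auto)
  qed
  have "{I \<in> P. of_nat m \<in> I} \<subseteq> (\<Union>p\<in>{p. Factorial_Ring.prime p \<and> p dvd m}. {I \<in> P. of_nat p \<in> I})"
    using prime_in_prime m by blast
  moreover have "finite {p. Factorial_Ring.prime p \<and> p dvd m}" using m by (intro finite_subset[OF _ finite_divisors_nat]) auto
  ultimately show ?thesis using pr by (rule_tac finite_subset) auto
qed

section \<open>Localisation at a prime and finiteness of exceptional primes\<close>

definition loc where "loc I = {a / s | a s :: 'k. int_el a \<and> int_el s \<and> s \<notin> I}"
definition locM where "locM I = {a / s | a s :: 'k. a \<in> I \<and> int_el s \<and> s \<notin> I}"

text \<open>The substantial point is that every s outside I is invertible modulo I, so that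
  fractions with denominators outside I are congruent to algebraic integers.\<close>

lemma loc_facts:
  assumes I: "I \<in> P"
  shows "local_ring (loc I) (locM I)" "I = {x. int_el x \<and> x \<in> locM I}" "\<And>x. int_el x ==> x \<in> loc I"
    "\<And>a. a \<in> loc I ==> \<exists>r. int_el r \<and> a - r \<in> locM I"
proof -
  note D = PD[OF I]
  have s0: "s \<noteq> 0" if "s \<notin> I" for s using that ideal_0[OF D(1)] by auto
  have smult: "s * t \<notin> I" if "int_el s" "int_el t" "s \<notin> I" "t \<notin> I" for s t using D(4) that by blast
  obtain p where p: "Factorial_Ring.prime p" "of_nat p \<in> I" using integer_in_prime[OF I] prime_in_prime[OF I] by blast
  obtain C :: "'k set" where C: "finite C" "\<And>c. c \<in> C ==> int_el c"
    "\<And>x. int_el x ==> \<exists>c\<in>C. \<exists>t. int_el t \<and> x - c = of_nat p * t" using residues_finite[OF p(1)] by metis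
  have CI: "\<exists>c\<in>C. x - c \<in> I" if x: "int_el x" for x
  proof -
    obtain c t where "c \<in> C" "int_el t" "x - c = of_nat p * t" using C(3)[OF x] by blast
    thus ?thesis using ideal_mult[OF D(1) p(2), of t] by (metis mult.commute)
  qed
  \<comment> \<open>By pigeonhole two powers of s agree modulo I, so I contains s^i (1 - s^(j-i))
    for some i < j, and primality removes the factor s^i.\<close>
  have inv: "\<exists>t. int_el t \<and> 1 - s * t \<in> I" if s: "int_el s" "s \<notin> I" for s
  proof -
    have "\<forall>i. \<exists>c\<in>C. s ^ i - c \<in> I" using CI int_power[OF s(1)] by blast
    then obtain c where c: "\<And>i. c i \<in> C" "\<And>i. s ^ i - c i \<in> I" by metis
    have "\<not> inj (c :: nat => 'k)"
    proof
      assume "inj c"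
      hence "infinite (range c)" by (simp add: finite_image_iff)
      thus False using finite_subset[of "range c" C] c(1) C(1) by blast
    qed
    then obtain i j where ij: "c i = c j" "i \<noteq> j" by (auto simp: inj_def)
    obtain i j where ij: "c i = c j" "i < j"
    proof (cases "i < j")
      case True thus ?thesis using that ij by blast
    next
      case False thus ?thesis using that[of j i] ij by simp
    qed
    have "s ^ i - s ^ j \<in> I" using ideal_diff[OF D(1) c(2)[of i] c(2)[of j]] ij(1) by simp
    moreover have "s ^ i - s ^ j = s ^ i * (1 - s * s ^ (j - i - 1))"
    proof -
      have "j = i + Suc (j - i - 1)" using ij(2) by simp
      hence "s ^ j = s ^ i * s ^ Suc (j - i - 1)" by (metis power_add)
      thus ?thesis by (simp add: algebra_simps)
    qed
    ultimately have "s ^ i * (1 - s * s ^ (j - i - 1)) \<in> I" by simp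
    moreover have "s ^ i \<notin> I"
    proof (induction i)
      case (Suc i) thus ?case using smult[OF s(1) int_power[OF s(1)] s(2)] by simp
    qed (use D in simp)
    ultimately have "1 - s * s ^ (j - i - 1) \<in> I" using D(4) int_power[OF s(1)] int_mult[OF s(1)] int_diff by (metis algebraic_int_1)
    thus ?thesis using int_power[OF s(1)] by blast
  qed
  show int_loc: "\<And>x. int_el x ==> x \<in> loc I"
  proof -
    fix x :: 'k assume x: "int_el x"
    have "x = x / 1" "int_el (1 :: 'k)" by simp_all
    thus "x \<in> loc I" unfolding loc_def using D(3) x by blast
  qed
  have locI: "a / s \<in> loc I" if "int_el a" "int_el s" "s \<notin> I" for a s using that unfolding loc_def by blast
  have locMI: "a / s \<in> locM I" if "a \<in> I" "int_el s" "s \<notin> I" for a s using that unfolding locM_def by blast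
  show A_int: "\<exists>r. int_el r \<and> a - r \<in> locM I" if a: "a \<in> loc I" for a
  proof -
    obtain x s where xs: "int_el x" "int_el s" "s \<notin> I" "a = x / s" using a by (auto simp: loc_def)
    obtain t where t: "int_el t" "1 - s * t \<in> I" using inv xs by blast
    have "a - x * t = x * (1 - s * t) / s" using xs s0[OF xs(3)] by (simp add: field_simps)
    moreover have "x * (1 - s * t) \<in> I" using ideal_mult[OF D(1) t(2) xs(1)] .
    ultimately show ?thesis using locMI xs t int_mult by metis
  qed
  show Ieq: "I = {x. int_el x \<and> x \<in> locM I}"
  proof (intro equalityI subsetI)
    fix x assume "x \<in> I"
    hence "x / 1 \<in> locM I" using D(3) by (intro locMI) auto
    thus "x \<in> {x. int_el x \<and> x \<in> locM I}" using ideal_int[OF D(1) \<open>x \<in> I\<close>] by simp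
  next
    fix x assume x: "x \<in> {x. int_el x \<and> x \<in> locM I}"
    then obtain a s where as: "a \<in> I" "int_el s" "s \<notin> I" "x = a / s" by (auto simp: locM_def)
    hence "x * s \<in> I" using s0 by simp
    thus "x \<in> I" using D(4)[of x s] x as by blast
  qed
  show "local_ring (loc I) (locM I)"
  proof
    show "1 \<in> loc I" using int_loc by simp
    show "a - b \<in> loc I" if ab: "a \<in> loc I" "b \<in> loc I" for a b
    proof -
      obtain x s y t where *: "int_el x" "int_el s" "s \<notin> I" "a = x / s" "int_el y" "int_el t" "t \<notin> I" "b = y / t"
        using ab by (auto simp: loc_def)
      have "s \<noteq> 0" "t \<noteq> 0" using * s0 by blast+
      hence "a - b = (x * t - y * s) / (s * t)" unfolding *(4,8) by (simp add: field_simps)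
      thus ?thesis using locI[of "x * t - y * s" "s * t"] * smult int_mult int_diff by simp
    qed
    show "a * b \<in> loc I" if ab: "a \<in> loc I" "b \<in> loc I" for a b
    proof -
      obtain x s y t where *: "int_el x" "int_el s" "s \<notin> I" "a = x / s" "int_el y" "int_el t" "t \<notin> I" "b = y / t"
        using ab by (auto simp: loc_def)
      have "a * b = (x * y) / (s * t)" using * by simp
      thus ?thesis using locI[of "x * y" "s * t"] * smult int_mult by simp
    qed
    show "locM I \<subseteq> loc I" using ideal_int[OF D(1)] unfolding loc_def locM_def by blast
    show "addgrp (locM I)" unfolding addgrp_def
    proof (intro conjI ballI)
      show "0 \<in> locM I" using locMI[OF ideal_0[OF D(1)], of 1] D(3) by simp
      fix a b assume ab: "a \<in> locM I" "b \<in> locM I"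
      obtain x s y t where *: "x \<in> I" "int_el s" "s \<notin> I" "a = x / s" "y \<in> I" "int_el t" "t \<notin> I" "b = y / t"
        using ab by (auto simp: locM_def)
      have "s \<noteq> 0" "t \<noteq> 0" using * s0 by blast+
      hence "a - b = (t * x - s * y) / (s * t)" unfolding *(4,8) by (simp add: field_simps)
      moreover have "t * x - s * y \<in> I" using * ideal_mult[OF D(1)] ideal_diff[OF D(1)] by blast
      ultimately show "a - b \<in> locM I" using locMI[of "t * x - s * y" "s * t"] * smult int_mult by simp
    qed
    show "a * m \<in> locM I" if am: "a \<in> loc I" "m \<in> locM I" for a m
    proof -
      obtain x s y t where *: "int_el x" "int_el s" "s \<notin> I" "a = x / s" "y \<in> I" "int_el t" "t \<notin> I" "m = y / t"
        using am by (auto simp: loc_def locM_def)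
      have "a * m = (x * y) / (s * t)" using * by simp
      thus ?thesis using locMI[of "x * y" "s * t"] * smult int_mult ideal_mult[OF D(1)] by simp
    qed
    show "1 \<notin> locM I" using Ieq D(3) by auto
    show "inverse a \<in> loc I" if a: "a \<in> loc I" "a \<notin> locM I" for a
    proof -
      obtain x s where *: "int_el x" "int_el s" "s \<notin> I" "a = x / s" using a by (auto simp: loc_def)
      hence "x \<notin> I" using a(2) locMI by blast
      thus ?thesis using * locI[of s x] by (simp add: field_simps)
    qed
    show "finite (cosets (loc I) (locM I))"
    proof (rule finite_subset)
      show "cosets (loc I) (locM I) \<subseteq> (\<lambda>c. (+) c ` locM I) ` C"
      proof
        fix y assume "y \<in> cosets (loc I) (locM I)"
        then obtain a where a: "a \<in> loc I" "y = (+) a ` locM I" by (auto simp: cosets_def)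
        obtain r where r: "int_el r" "a - r \<in> locM I" using A_int a by blast
        obtain c where c: "c \<in> C" "r - c \<in> I" using CI r by blast
        have "r - c \<in> locM I" using c(2) Ieq by blast
        hence "(a - r) + (r - c) \<in> locM I" using addgrp_add[OF \<open>addgrp (locM I)\<close> r(2)] by blast
        hence "a - c \<in> locM I" by simp
        hence "y = (+) c ` locM I" using coset_eq_iff[OF \<open>addgrp (locM I)\<close>] a by blast
        thus "y \<in> (\<lambda>c. (+) c ` locM I) ` C" using c by blast
      qed
      show "finite ((\<lambda>c. (+) c ` locM I) ` C)" using C by simp
    qed
  qed
qed

definition almost_all :: "'k set filter" where "almost_all = inf cofinite (principal P)"

lemma eventually_almost_all: "eventually Q almost_all \<longleftrightarrow> finite {I \<in> P. \<not> Q I}"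
  by (simp add: almost_all_def eventually_inf_principal eventually_cofinite)

text \<open>Only the finitely many primes containing a denominator of x can fail.\<close>

lemma eventually_loc: "\<forall>\<^sub>F I in almost_all. x \<in> loc I"
proof -
  obtain m :: int where m: "m \<noteq> 0" "int_el (of_int m * x)" using denominator by blast
  have "{I \<in> P. x \<notin> loc I} \<subseteq> {I \<in> P. of_nat (nat \<bar>m\<bar>) \<in> I}"
  proof
    fix I assume I: "I \<in> {I \<in> P. x \<notin> loc I}"
    have "of_int m \<in> I"
    proof (rule ccontr)
      assume "of_int m \<notin> I"
      hence "(of_int m * x) / of_int m \<in> loc I" using m int_of_int unfolding loc_def by blast
      thus False using m I by simp
    qed
    hence "of_int \<bar>m\<bar> \<in> I" using ideal_minus[OF PD(1), of I "of_int m"] I by (simp add: abs_if)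
    thus "I \<in> {I \<in> P. of_nat (nat \<bar>m\<bar>) \<in> I}" using I by simp
  qed
  moreover have "finite {I \<in> P. of_nat (nat \<bar>m\<bar>) \<in> I}" by (rule finite_primes_over) (use m(1) in simp)
  ultimately show ?thesis unfolding eventually_almost_all by (rule finite_subset)
qed

lemma eventually_P: "\<forall>\<^sub>F I in almost_all. I \<in> P"
  by (simp add: eventually_almost_all)

text \<open>Two of the q + 1 integers from 0 to q are congruent modulo I, so I contains a positive
  integer at most q; each such integer lies in finitely many primes.\<close>

lemma finite_small_norm: "finite {I \<in> P. local_ring.q (loc I) (locM I) \<le> N}"
proof (rule finite_subset)
  show "{I \<in> P. local_ring.q (loc I) (locM I) \<le> N} \<subseteq> (\<Union>k\<in>{1..N}. {I \<in> P. of_nat k \<in> I})"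
  proof
    fix I assume I: "I \<in> {I \<in> P. local_ring.q (loc I) (locM I) \<le> N}"
    hence IP: "I \<in> P" by simp
    interpret local_ring "loc I" "locM I" by (rule loc_facts(1)[OF IP])
    let ?f = "\<lambda>i::nat. (+) (of_nat i) ` locM I"
    have "\<not> inj_on ?f {0..q}"
    proof
      assume "inj_on ?f {0..q}"
      hence "card (?f ` {0..q}) = Suc q" by (simp add: card_image)
      moreover have "?f ` {0..q} \<subseteq> cosets (loc I) (locM I)"
        using loc_facts(3)[OF IP] int_of_int[of "int _"] by (fastforce simp: cosets_def)
      hence "card (?f ` {0..q}) \<le> q" using card_mono[OF finite_residues] by (simp add: q_def idx_def)
      ultimately show False by simp
    qed
    then obtain i j where ij: "?f i = ?f j" "i < j" "j \<le> q"
      by (auto simp: inj_on_def) (metis linorder_neqE_nat)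
    have "of_nat j - of_nat i \<in> locM I" using ij(1) coset_eq_iff[OF addgrp_M, of "of_nat j" "of_nat i"] by simp
    hence "of_nat (j - i) \<in> locM I" using ij(2) by (simp add: of_nat_diff)
    moreover have "int_el (of_nat (j - i))" using int_of_int[of "int (j - i)"] by simp
    ultimately have "of_nat (j - i) \<in> I" using loc_facts(2)[OF IP] by blast
    moreover have "j - i \<in> {1..N}" using ij I by auto
    ultimately show "I \<in> (\<Union>k\<in>{1..N}. {I \<in> P. of_nat k \<in> I})" using IP by blast
  qed
  show "finite (\<Union>k\<in>{1..N}. {I \<in> P. of_nat k \<in> I})" using finite_primes_over by auto
qed

end

section \<open>Solvable Lie algebras of dimension at most four in characteristic zero\<close>

text \<open>Solvability is encoded as \<open>solv\<close>: no nonzero subspace S is contained in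
  [S, S]. Such an S would lie in every term of the derived series; this form spares carrying the
  series through the classification.\<close>

locale solvable_bracket = vector_space scale
  for scale :: "'k::field_char_0 => 'v::ab_group_add => 'v" (infixr \<open>\<star>\<close> 75) +
  fixes br :: "'v => 'v => 'v" and g :: "'v set" and n :: nat
  assumes g_subspace: "subspace g"
    and br_add: "br u (v + w) = br u v + br u w" "br (v + w) u = br v u + br w u"
    and br_scale: "br u (a \<star> v) = a \<star> br u v" "br (a \<star> v) u = a \<star> br v u"
    and br_self: "br u u = 0"
    and jacobi: "br u (br v w) + br v (br w u) + br w (br u v) = 0"
    and br_g: "br u v \<in> g"
    and fin_dim: "\<exists>B. finite B \<and> independent B \<and> span B = g \<and> card B = n"
    and solv: "subspace S ==> S \<subseteq> g ==> S \<subseteq> span {br u v | u v. u \<in> S \<and> v \<in> S} ==> S = {0}"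
begin

lemma br_anti: "br v u = - br u v"
proof -
  have "br (u + v) (u + v) = br u v + br v u" unfolding br_add by (simp add: br_self)
  thus ?thesis by (simp add: br_self eq_neg_iff_add_eq_0 add.commute)
qed

lemma br_zero: "br u 0 = 0" "br 0 u = 0"
  using br_scale(1)[of u 0 0] br_scale(2)[of 0 0 u] by simp_all
lemma br_minus: "br u (- v) = - br u v" "br (- v) u = - br v u"
  using br_scale(1)[of u "-1" v] br_scale(2)[of "-1" v u] by simp_all
lemma br_diff: "br u (v - w) = br u v - br u w" "br (v - w) u = br v u - br w u"
  using br_add(1)[of u v "- w"] br_add(2)[of v "- w" u] by (simp_all add: br_minus)

lemmas br_simps = br_add br_scale br_zero br_minus br_diff br_self

lemma leibniz: "br u (br v w) = br (br u v) w + br v (br u w)"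
proof -
  have "br w u = - br u w" "br w (br u v) = - br (br u v) w" by (rule br_anti)+
  hence "br u (br v w) - br v (br u w) - br (br u v) w = 0" using jacobi[of u v w] by (simp add: br_minus)
  thus ?thesis by (simp add: algebra_simps)
qed

lemma sub_g: "0 \<in> g" "u \<in> g ==> v \<in> g ==> u + v \<in> g" "u \<in> g ==> v \<in> g ==> u - v \<in> g" "u \<in> g ==> a \<star> u \<in> g"
  using g_subspace subspace_0 subspace_add subspace_diff subspace_scale by blast+

lemma span_sub_g: "S \<subseteq> g ==> span S \<subseteq> g"
  using g_subspace by (rule span_minimal[rotated])

lemma span1: "u \<in> span {a} \<longleftrightarrow> (\<exists>k. u = k \<star> a)"
  by (auto simp: span_singleton)
lemma span_ins: "u \<in> span (insert a S) \<longleftrightarrow> (\<exists>k. u - k \<star> a \<in> span S)"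
  by (simp add: span_breakdown_eq)
lemma span2: "u \<in> span {a, b} \<longleftrightarrow> (\<exists>k l. u = k \<star> a + l \<star> b)"
  unfolding span_ins[of u a] span1 by (simp only: diff_eq_eq add_ac)
lemma span3: "u \<in> span {a, b, c} \<longleftrightarrow> (\<exists>k l m. u = k \<star> a + l \<star> b + m \<star> c)"
  unfolding span_ins[of u a] span2 by (simp only: diff_eq_eq add_ac)
lemma span4: "u \<in> span {a, b, c, d} \<longleftrightarrow> (\<exists>k l m o'. u = k \<star> a + l \<star> b + m \<star> c + o' \<star> d)"
  unfolding span_ins[of u a] span3 by (simp only: diff_eq_eq add_ac)

lemma indep2:
  assumes "independent {a, b}" "a \<noteq> b" "k \<star> a + l \<star> b = 0" shows "k = 0 \<and> l = 0"
proof -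
  have a: "a \<notin> span {b}" using independent_insert[of a "{b}"] assms by simp
  have "b \<noteq> 0" using assms(1) dependent_zero[of "{a, b}"] by auto
  have "k = 0"
  proof (rule ccontr)
    assume k: "k \<noteq> 0"
    have "k \<star> a = (- l) \<star> b" using assms(3) by (simp add: eq_neg_iff_add_eq_0)
    hence "inverse k \<star> (k \<star> a) = inverse k \<star> ((- l) \<star> b)" by simp
    hence "a = (inverse k * - l) \<star> b" using k by simp
    thus False using a span1 by blast
  qed
  thus ?thesis using assms(3) \<open>b \<noteq> 0\<close> by simp
qed

lemma dim_g: "dim g = n"
  using fin_dim dim_eq_card_independent by (metis dim_span)

lemma fin_indep: "S \<subseteq> g ==> independent S ==> finite S \<and> card S \<le> n"
  using fin_dim independent_span_bound by metis

lemma basis_card: "independent S ==> span S = g ==> card S = n"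
  using dim_g dim_eq_card_independent dim_span by metis

lemma extend:
  assumes "S \<subseteq> g" "independent S"
  obtains B where "S \<subseteq> B" "B \<subseteq> g" "independent B" "span B = g" "card B = n" "finite B"
proof -
  obtain B where B: "S \<subseteq> B" "B \<subseteq> g" "independent B" "g \<subseteq> span B" using maximal_independent_subset_extend[OF assms] by blast
  have "span B = g" using B span_sub_g by blast
  thus ?thesis using that[OF B(1-3)] basis_card B fin_indep by blast
qed

lemma basisI:
  assumes "finite S" "card S \<le> n" "S \<subseteq> g" "g \<subseteq> span S" shows "independent S" "card S = n" "span S = g"
proof -
  obtain B where B: "B \<subseteq> S" "independent B" "S \<subseteq> span B" using maximal_independent_subset by blast
  show sp: "span S = g" using assms span_sub_g by blast
  have "span B = g" using B sp span_mono span_span by (metis subset_antisym span_mono)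
  hence c: "card B = n" using basis_card B by blast
  hence "B = S" using B assms card_subset_eq[OF assms(1) B(1)] card_mono[OF assms(1) B(1)] by simp
  thus "independent S" "card S = n" using B c by auto
qed

section \<open>Derived subspaces and the three normal forms\<close>

definition brs :: "'v set => 'v set" where "brs S = span {br u v | u v. u \<in> S \<and> v \<in> S}"

lemma brsI: "u \<in> S ==> v \<in> S ==> br u v \<in> brs S" unfolding brs_def by (rule span_base) blast
lemma brs_least: "subspace W ==> (\<And>u v. u \<in> S ==> v \<in> S ==> br u v \<in> W) ==> brs S \<subseteq> W"
  unfolding brs_def by (intro span_minimal) auto
lemma brs_g: "brs S \<subseteq> g" using brs_least[OF g_subspace] br_g by blast
lemma brs_subspace: "subspace (brs S)" unfolding brs_def by (rule subspace_span)
lemma brs_proper: "subspace S ==> S \<subseteq> g ==> S \<noteq> {0} ==> \<not> S \<subseteq> brs S"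
  using solv unfolding brs_def by blast

text \<open>\<open>E\<close> is a basis of an abelian ideal of codimension one with complement x.
  \<open>E1\<close> is a basis of the image of ad x and part of \<open>E\<close>, so that the image
  is again spanned by basis vectors and can be followed to the lattices.\<close>

definition form_A where
  "form_A x E E1 \<longleftrightarrow> x \<notin> E \<and> finite E \<and> independent (insert x E) \<and> span (insert x E) = g \<and>
     (\<forall>u\<in>span E. \<forall>v\<in>span E. br u v = 0) \<and> E1 \<subseteq> E \<and> (\<forall>v\<in>g. br x v \<in> span E1) \<and> (\<forall>u\<in>E1. \<exists>v\<in>g. u = br x v)"

text \<open>A Heisenberg ideal with basis a, b, z and a complement x; the last two conditions say
  that ad x is surjective on the ideal modulo z.\<close>

definition form_B where
  "form_B x a b z \<longleftrightarrow> card {x, a, b, z} = 4 \<and> independent {x, a, b, z} \<and> span {x, a, b, z} = g \<and>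
     br a b = z \<and> br z a = 0 \<and> br z b = 0 \<and> br x a \<in> span {a, b, z} \<and> br x b \<in> span {a, b, z} \<and> br x z \<in> span {z} \<and>
     a \<in> span {br x a, br x b, z} \<and> b \<in> span {br x a, br x b, z}"

text \<open>The plane has the cyclic basis v, w = [y, v], so that ad y is visibly no scalar at any
  prime where these vectors stay part of a basis.\<close>

definition form_C where
  "form_C x y v w \<longleftrightarrow> card {x, y, v, w} = 4 \<and> independent {x, y, v, w} \<and> span {x, y, v, w} = g \<and>
     br v w = 0 \<and> br x v = v \<and> br x w = w \<and> br x y = 0 \<and> br y v = w \<and> br y w \<in> span {v, w}"

lemma form_A_I:
  assumes V: "subspace V" "V \<subseteq> g" "\<And>u v. u \<in> V ==> v \<in> V ==> br u v = 0" "\<And>u v. u \<in> g ==> v \<in> g ==> br u v \<in> V"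
    and x: "x \<in> g" "x \<notin> V" "g \<subseteq> span (insert x V)"
  shows "\<exists>x E E1. form_A x E E1"
proof -
  define W where "W = {br x v | v. v \<in> g}"
  have "subspace W" unfolding W_def
  proof (rule subspaceI, goal_cases)
    case 1
    have "0 = br x 0" by (simp add: br_zero)
    thus ?case using sub_g(1) by blast
  next
    case (2 u v)
    then obtain a b where "u = br x a" "v = br x b" "a \<in> g" "b \<in> g" by blast
    hence "u + v = br x (a + b)" "a + b \<in> g" using sub_g by (simp_all add: br_add)
    thus ?case by blast
  next
    case (3 c u)
    then obtain a where "u = br x a" "a \<in> g" by blast
    hence "c \<star> u = br x (c \<star> a)" "c \<star> a \<in> g" using sub_g by (simp_all add: br_scale)
    thus ?case by blast
  qed
  have WV: "W \<subseteq> V" using V(4) x by (auto simp: W_def)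
  obtain E1 where E1: "E1 \<subseteq> W" "independent E1" "W \<subseteq> span E1" using maximal_independent_subset by blast
  have sE1: "span E1 = W" using E1 span_minimal[OF E1(1) \<open>subspace W\<close>] by blast
  obtain E where E: "E1 \<subseteq> E" "E \<subseteq> V" "independent E" "V \<subseteq> span E"
    using maximal_independent_subset_extend[of E1 V] E1 WV by blast
  have sE: "span E = V" using E span_minimal[OF E(2) V(1)] by blast
  have "independent (insert x E)" using independent_insertI[of x E] x sE E by simp
  moreover have "span (insert x E) = g"
  proof
    show "span (insert x E) \<subseteq> g" using subset_trans[OF E(2) V(2)] x(1) by (intro span_sub_g) simp
    have "span E \<subseteq> span (insert x E)" by (rule span_mono) blast
    hence "insert x V \<subseteq> span (insert x E)" using sE span_base[of x "insert x E"] by simp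
    hence "span (insert x V) \<subseteq> span (insert x E)" by (rule span_minimal) (rule subspace_span)
    thus "g \<subseteq> span (insert x E)" using x by blast
  qed
  moreover have "x \<notin> E" using x(2) E(2) by blast
  moreover have "finite E" using fin_indep[OF subset_trans[OF E(2) V(2)] E(3)] ..
  moreover have "\<forall>v\<in>g. br x v \<in> W" "\<forall>u\<in>E1. \<exists>v\<in>g. u = br x v" using E1(1) unfolding W_def by blast+
  ultimately have "form_A x E E1" unfolding form_A_def sE sE1
    using V(3) E(1) by blast
  thus ?thesis by blast
qed

text \<open>On a common eigenvector c of g every commutator acts as a commutator of scalars, that
  is, as 0.\<close>

lemma char_lemma:
  assumes c: "\<And>u. u \<in> g ==> br u c \<in> span {c}" shows "d \<in> brs g ==> br d c = 0"
proof -
  have "subspace {d. br d c = 0}" by (rule subspaceI) (auto simp: br_simps)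
  moreover have "br (br u v) c = 0" if uv: "u \<in> g" "v \<in> g" for u v
  proof -
    obtain k l where kl: "br u c = k \<star> c" "br v c = l \<star> c" using c uv span1 by metis
    have "br u (br v c) = br (br u v) c + br v (br u c)" by (rule leibniz)
    thus ?thesis using kl by (simp add: br_simps mult.commute)
  qed
  ultimately have "brs g \<subseteq> {d. br d c = 0}" by (intro brs_least) auto
  thus "d \<in> brs g ==> br d c = 0" by blast
qed

text \<open>All brackets within the plane are multiples of c = [e, f], so c is a common eigenvector
  of g and is killed by the derived algebra, which contains e and f. Writing c = k e + l f gives k c
  = l c = 0, so c = 0.\<close>

lemma plane_ideal_abelian:
  assumes ef: "independent {e, f}" "e \<noteq> f" "span {e, f} \<subseteq> brs g" "\<And>u h. u \<in> g ==> h \<in> span {e, f} ==> br u h \<in> span {e, f}"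
  shows "u \<in> span {e, f} ==> v \<in> span {e, f} ==> br u v = 0"
proof -
  define c where "c = br e f"
  have prod: "br u v \<in> span {c}" if uv: "u \<in> span {e, f}" "v \<in> span {e, f}" for u v
  proof -
    obtain k l where "u = k \<star> e + l \<star> f" using uv(1) span2 by blast
    moreover obtain k' l' where "v = k' \<star> e + l' \<star> f" using uv(2) span2 by blast
    moreover have "br f e = - c" unfolding c_def by (rule br_anti)
    ultimately have "br u v = (k * l' - l * k') \<star> c" by (simp add: br_simps c_def[symmetric] algebra_simps)
    thus ?thesis using span1 by blast
  qed
  have ee: "e \<in> span {e, f}" "f \<in> span {e, f}" by (auto intro: span_base)
  have ceg: "e \<in> g" "f \<in> g" using ee ef(3) brs_g by blast+
  have "br u c \<in> span {c}" if u: "u \<in> g" for u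
  proof -
    have "br u c = br (br u e) f + br e (br u f)" unfolding c_def by (rule leibniz)
    moreover have "br (br u e) f \<in> span {c}" "br e (br u f) \<in> span {c}" using prod ef(4)[OF u] ee by blast+
    ultimately show ?thesis using span_add by metis
  qed
  hence ch: "br d c = 0" if "d \<in> brs g" for d using char_lemma that by blast
  have "br e c = 0" "br f c = 0" using ch ef(3) ee by blast+
  moreover have "c \<in> span {e, f}" using ef(4)[OF ceg(1) ee(2)] by (simp add: c_def)
  then obtain k l where kl: "c = k \<star> e + l \<star> f" using span2 by blast
  ultimately have "br e (k \<star> e + l \<star> f) = 0" "br f (k \<star> e + l \<star> f) = 0" by metis+
  moreover have "br f e = - c" unfolding c_def by (rule br_anti)
  ultimately have "l \<star> c = 0" "k \<star> c = 0" by (simp_all add: br_simps c_def[symmetric])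
  hence "c = 0" using kl by auto
  thus "u \<in> span {e, f} ==> v \<in> span {e, f} ==> br u v = 0" using prod[of u v] by (simp add: span1)
qed

text \<open>If z is not central, its centraliser has codimension one and is abelian by the Leibniz
  rule. If z is central, the bracket is an alternating form \<omega> on g modulo z, a space of
  dimension at most 3. For b outside the radical, the hyperplane orthogonal to b contains b in its
  own radical, and at most one dimension is left modulo b, so it is isotropic.\<close>

lemma line_derived:
  assumes n4: "n \<le> 4" and z: "z \<noteq> 0" "brs g = span {z}"
  shows "\<exists>x E E1. form_A x E E1"
proof -
  have zg: "z \<in> g" using brs_g z span_base[of z "{z}"] by blast
  have "\<exists>k. br u v = k \<star> z" if "u \<in> g" "v \<in> g" for u v using brsI[OF that] z span1 by metis
  then obtain \<omega> where \<omega>: "br u v = \<omega> u v \<star> z" if "u \<in> g" "v \<in> g" for u v by metis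
  show ?thesis
  proof (cases "\<exists>h\<in>g. br h z \<noteq> 0")
    case True
    then obtain h0 where h0: "h0 \<in> g" "br h0 z \<noteq> 0" by blast
    define h where "h = inverse (\<omega> h0 z) \<star> h0"
    have "\<omega> h0 z \<noteq> 0" using h0 \<omega>[OF h0(1) zg] by auto
    hence h: "h \<in> g" "br h z = z" using h0 \<omega>[OF h0(1) zg] sub_g by (auto simp: h_def br_simps)
    define V where "V = {u \<in> g. br u z = 0}"
    show ?thesis
    proof (rule form_A_I[of V h])
      show "subspace V" unfolding V_def by (rule subspaceI) (auto simp: br_simps sub_g)
      show "V \<subseteq> g" "h \<in> g" "h \<notin> V" using h z by (auto simp: V_def)
      show "br u v = 0" if "u \<in> V" "v \<in> V" for u v
      proof -
        have uv: "u \<in> g" "v \<in> g" "br u z = 0" "br v z = 0" using that by (auto simp: V_def)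
        have e: "br h u = \<omega> h u \<star> z" "br h v = \<omega> h v \<star> z" using \<omega> h uv by blast+
        have "br h (br u v) = br (br h u) v + br u (br h v)" by (rule leibniz)
        also have "\<dots> = 0" unfolding e using uv br_anti[of z v] by (simp add: br_simps)
        finally have "\<omega> u v \<star> z = 0" using \<omega>[OF uv(1,2)] h by (simp add: br_simps)
        thus ?thesis using \<omega>[OF uv(1,2)] by simp
      qed
      show "br u v \<in> V" if "u \<in> g" "v \<in> g" for u v
        using \<omega>[OF that] zg by (auto simp: V_def br_simps sub_g)
      show "g \<subseteq> span (insert h V)"
      proof
        fix u assume u: "u \<in> g"
        have "br (u - \<omega> u z \<star> h) z = 0" using \<omega>[OF u zg] h by (simp add: br_simps)
        hence "u - \<omega> u z \<star> h \<in> V" using u h sub_g by (simp add: V_def)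
        thus "u \<in> span (insert h V)" using span_ins span_base by blast
      qed
    qed
  next
    case False
    hence cz: "br u z = 0" if "u \<in> g" for u using that by blast
    have cz': "br z u = 0" if "u \<in> g" for u using cz[OF that] br_anti[of z u] by simp
    have "independent {z}" using z by simp
    then obtain B where B: "{z} \<subseteq> B" "B \<subseteq> g" "independent B" "span B = g" "card B = n" "finite B"
      using extend[of "{z}"] zg by blast
    have "\<exists>b\<in>B - {z}. \<exists>c\<in>B - {z}. br b c \<noteq> 0"
    proof (rule ccontr)
      assume *: "\<not> (\<exists>b\<in>B - {z}. \<exists>c\<in>B - {z}. br b c \<noteq> 0)"
      have 0: "br b c = 0" if "b \<in> B" "c \<in> B" for b c
        using * cz cz' that B(2) by (cases "b = z"; cases "c = z") auto
      have 1: "br b u = 0" if b: "b \<in> B" and u: "u \<in> g" for b u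
      proof -
        have "subspace {u. br b u = 0}" by (rule subspaceI) (auto simp: br_simps)
        hence "span B \<subseteq> {u. br b u = 0}" by (intro span_minimal) (use 0 b in auto)
        thus ?thesis using u B(4) by blast
      qed
      have 2: "br v u = 0" if u: "u \<in> g" and v: "v \<in> g" for u v
      proof -
        have "subspace {v. br v u = 0}" by (rule subspaceI) (auto simp: br_simps)
        hence "span B \<subseteq> {v. br v u = 0}" by (intro span_minimal) (use 1 u in auto)
        thus ?thesis using v B(4) by blast
      qed
      have "brs g \<subseteq> {0}" using 2 by (intro brs_least) auto
      thus False using z span_base[of z "{z}"] by auto
    qed
    then obtain b c where bc: "b \<in> B" "c \<in> B" "b \<noteq> z" "c \<noteq> z" "br b c \<noteq> 0" by blast
    have "b \<noteq> c" using bc br_self by auto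
    have "card (B - {z, b, c}) \<le> 1" using card_Diff_subset[of "{z, b, c}" B] B bc \<open>b \<noteq> c\<close> n4 by simp
    \<comment> \<open>The basis has at most one further vector; a = 0 serves when there is
      none.\<close>
    then obtain a where a: "B - {z, b, c} \<subseteq> {a}" "a \<in> g"
    proof -
      have "card (B - {z, b, c}) = 0 \<or> card (B - {z, b, c}) = 1" using \<open>card (B - {z, b, c}) \<le> 1\<close> by linarith
      thus ?thesis using that[of 0] that B sub_g(1)
        by (metis Diff_subset card_0_eq card_1_singletonE empty_subsetI finite_Diff insert_subset order_refl subset_trans)
    qed
    have "B \<subseteq> {z, a, b, c}" using a by blast
    hence spn: "g \<subseteq> span {z, a, b, c}" using B(4) span_mono by blast
    have bcg: "b \<in> g" "c \<in> g" using bc B by auto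
    define V where "V = {u \<in> g. br b u = 0}"
    have tw: "\<omega> b c \<noteq> 0" using bc(5) \<omega>[OF bcg] by auto
    show ?thesis
    proof (rule form_A_I[of V c])
      show "subspace V" unfolding V_def by (rule subspaceI) (auto simp: br_simps sub_g)
      show "V \<subseteq> g" "c \<in> g" "c \<notin> V" using bcg bc by (auto simp: V_def)
      show "br u v \<in> V" if "u \<in> g" "v \<in> g" for u v
        using \<omega>[OF that] zg cz[OF bcg(1)] by (auto simp: V_def br_simps sub_g)
      show "g \<subseteq> span (insert c V)"
      proof
        fix u assume u: "u \<in> g"
        have "br b (u - (\<omega> b u / \<omega> b c) \<star> c) = 0" using \<omega>[OF bcg(1) u] \<omega>[OF bcg] tw by (simp add: br_simps)
        hence "u - (\<omega> b u / \<omega> b c) \<star> c \<in> V" using u bcg sub_g by (simp add: V_def)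
        thus "u \<in> span (insert c V)" using span_ins span_base by blast
      qed
      show "br u v = 0" if uv: "u \<in> V" "v \<in> V" for u v
      proof -
        have ug: "u \<in> g" "v \<in> g" "br b u = 0" "br b v = 0" using uv by (auto simp: V_def)
        obtain k1 k2 k3 k4 where u: "u = k1 \<star> z + k2 \<star> a + k3 \<star> b + k4 \<star> c" using ug spn span4 by blast
        obtain l1 l2 l3 l4 where v: "v = l1 \<star> z + l2 \<star> a + l3 \<star> b + l4 \<star> c" using ug spn span4 by blast
        define p s t where "p = \<omega> a b" and "s = \<omega> a c" and "t = \<omega> b c"
        have W: "br a b = p \<star> z" "br a c = s \<star> z" "br b c = t \<star> z" using \<omega> a bcg by (auto simp: p_def s_def t_def)
        have W': "br b a = - (p \<star> z)" "br c a = - (s \<star> z)" "br c b = - (t \<star> z)"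
          using br_anti[of b a] br_anti[of c a] br_anti[of c b] W by auto
        have Z: "br z a = 0" "br z b = 0" "br z c = 0" "br a z = 0" "br b z = 0" "br c z = 0" using cz cz' a bcg by auto
        have "br b u = (k4 * t - k2 * p) \<star> z" unfolding u by (simp add: br_simps W W' Z algebra_simps)
        hence e1: "k4 * t = k2 * p" using ug(3) z by simp
        have "br b v = (l4 * t - l2 * p) \<star> z" unfolding v by (simp add: br_simps W W' Z algebra_simps)
        hence e2: "l4 * t = l2 * p" using ug(4) z by simp
        have "br u v = ((k2 * l3 - k3 * l2) * p + (k2 * l4 - k4 * l2) * s + (k3 * l4 - k4 * l3) * t) \<star> z"
          unfolding u v by (simp add: br_simps W W' Z algebra_simps)
        \<comment> \<open>The relations \<open>e1\<close> and \<open>e2\<close> make (k2, k4) and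
          (l2, l4) multiples of (t, p), so the middle minor vanishes and the outer terms
          cancel.\<close>
        moreover have "(k2 * l3 - k3 * l2) * p + (k2 * l4 - k4 * l2) * s + (k3 * l4 - k4 * l3) * t = 0"
        proof -
          have "t * ((k2 * l4 - k4 * l2) * s) = s * (k2 * (l4 * t) - (k4 * t) * l2)" by (simp add: algebra_simps)
          also have "\<dots> = 0" unfolding e1 e2 by (simp add: algebra_simps)
          finally have *: "(k2 * l4 - k4 * l2) * s = 0" using tw by (simp add: t_def)
          have "(k2 * l3 - k3 * l2) * p + (k3 * l4 - k4 * l3) * t = l3 * (k2 * p - k4 * t) + k3 * (l4 * t - l2 * p)"
            by (simp add: algebra_simps)
          also have "\<dots> = 0" unfolding e1 e2 by simp
          finally have **: "(k2 * l3 - k3 * l2) * p + (k3 * l4 - k4 * l3) * t = 0" .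
          show ?thesis unfolding * using ** by (simp only: add_0_right)
        qed
        ultimately show ?thesis by simp
      qed
    qed
  qed
qed

text \<open>The derived algebra D is an abelian plane. If some element outside D centralises it, the
  two span an abelian ideal of dimension 3. Otherwise g / D acts faithfully on D by commuting 2 by 2
  matrices; in dimension 4 these contain a nonzero scalar matrix, which is normalised to the
  identity.\<close>

lemma plane_derived:
  assumes n4: "n \<le> 4" and ab: "independent {a, b}" "a \<noteq> b" "brs g = span {a, b}"
  shows "(\<exists>x E E1. form_A x E E1) \<or> (\<exists>x y v w. form_C x y v w)"
proof -
  let ?D = "span {a, b}"
  have Dg: "?D \<subseteq> g" using brs_g[of g] unfolding ab(3) .
  have abD: "a \<in> ?D" "b \<in> ?D" by (auto intro: span_base)
  have brD: "br u v \<in> ?D" if "u \<in> g" "v \<in> g" for u v using brsI[OF that] ab(3) by simp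
  have abel: "br u v = 0" if "u \<in> ?D" "v \<in> ?D" for u v
    by (rule plane_ideal_abelian[OF ab(1,2) _ _ that]) (use ab(3) brD Dg in auto)
  show ?thesis
  proof (cases "\<exists>u\<in>g. u \<notin> ?D \<and> br u a = 0 \<and> br u b = 0")
    case True
    then obtain u where u: "u \<in> g" "u \<notin> ?D" "br u a = 0" "br u b = 0" by blast
    have iu: "independent (insert u {a, b})" using independent_insertI[OF u(2) ab(1)] .
    let ?V = "span {u, a, b}"
    have Vg: "?V \<subseteq> g" using span_sub_g[of "{u, a, b}"] u Dg abD by blast
    have DV: "?D \<subseteq> ?V" by (rule span_mono) auto
    have av: "br s t = 0" if st: "s \<in> ?V" "t \<in> ?V" for s t
    proof -
      obtain k l m where s: "s = k \<star> u + l \<star> a + m \<star> b" using st span3 by blast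
      obtain k' l' m' where t: "t = k' \<star> u + l' \<star> a + m' \<star> b" using st span3 by blast
      have "br a u = 0" "br b u = 0" "br a b = 0" "br b a = 0" using br_anti[of a u] br_anti[of b u] u abel abD by auto
      thus ?thesis unfolding s t using u by (simp add: br_simps)
    qed
    obtain B where B: "{u, a, b} \<subseteq> B" "B \<subseteq> g" "independent B" "span B = g" "card B = n" "finite B"
      using extend[of "{u, a, b}"] iu u Dg abD by blast
    have "u \<noteq> a" "u \<noteq> b" using u(2) abD by blast+
    hence c3: "card {u, a, b} = 3" using ab(2) by simp
    show ?thesis
    proof (cases "B = {u, a, b}")
      case True
      hence gV: "g = ?V" using B by simp
      hence "brs g \<subseteq> {0}" using av by (intro brs_least) auto
      hence "a = 0" using ab(3) abD by auto
      thus ?thesis using ab(1) dependent_zero[of "{a, b}"] by auto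
    next
      case False
      then obtain x where x: "x \<in> B" "x \<notin> {u, a, b}" using B by auto
      have "card (insert x {u, a, b}) = 4" using x c3 by simp
      hence Bx: "B = insert x {u, a, b}" using card_seteq[of B "insert x {u, a, b}"] B x n4 by auto
      have "x \<notin> ?V" using B(3) independent_insert[of x "{u, a, b}"] x Bx by simp
      have "\<exists>x E E1. form_A x E E1"
      proof (rule form_A_I[of ?V x])
        show "g \<subseteq> span (insert x ?V)" using B(4) Bx span_mono[of B "insert x ?V"] span_superset[of "{u, a, b}"] by blast
      qed (use av Vg x B brD DV \<open>x \<notin> ?V\<close> in auto)
      thus ?thesis ..
    qed
  next
    case False
    hence faith: "u \<in> ?D" if "u \<in> g" "br u a = 0" "br u b = 0" for u using that by blast
    obtain B where B: "{a, b} \<subseteq> B" "B \<subseteq> g" "independent B" "span B = g" "card B = n" "finite B"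
      using extend[of "{a, b}"] ab Dg abD by blast
    have c2: "card {a, b} = 2" using ab by simp
    have cB: "card (B - {a, b}) = n - 2" using card_Diff_subset[of "{a, b}" B] B c2 by simp
    show ?thesis
    proof (cases "n = 4")
      case False
      have "n \<ge> 2" using card_mono[OF B(6,1)] c2 B(5) by simp
      moreover have "B \<noteq> {a, b}"
      proof
        assume "B = {a, b}"
        hence "g = ?D" using B by simp
        hence "brs g \<subseteq> {0}" using abel by (intro brs_least) auto
        hence "a = 0" using ab(3) abD by auto
        thus False using ab(1) dependent_zero[of "{a, b}"] by auto
      qed
      then obtain x where x: "x \<in> B" "x \<notin> {a, b}" using B by auto
      have "card (insert x {a, b}) = 3" using x c2 by simp
      hence Bx: "B = insert x {a, b}" using card_seteq[of B "insert x {a, b}"] B x n4 False by auto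
      have "x \<notin> ?D" using B(3) independent_insert[of x "{a, b}"] x Bx by simp
      have "\<exists>x E E1. form_A x E E1"
      proof (rule form_A_I[of ?D x])
        show "g \<subseteq> span (insert x ?D)" using B(4) Bx span_mono[of B "insert x ?D"] span_superset[of "{a, b}"] by blast
      qed (use abel Dg x B brD \<open>x \<notin> ?D\<close> in auto)
      thus ?thesis ..
    next
      case True
      then obtain p r where pr: "B - {a, b} = {p, r}" "p \<noteq> r" using cB card_2_iff[of "B - {a, b}"] by auto
      have prg: "p \<in> g" "r \<in> g" using pr B by auto
      have abg: "a \<in> g" "b \<in> g" using Dg abD by auto
      obtain p1 p3 where P1: "br p a = p1 \<star> a + p3 \<star> b" using brD[OF prg(1) abg(1)] span2 by blast
      obtain p2 p4 where P2: "br p b = p2 \<star> a + p4 \<star> b" using brD[OF prg(1) abg(2)] span2 by blast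
      obtain r1 r3 where R1: "br r a = r1 \<star> a + r3 \<star> b" using brD[OF prg(2) abg(1)] span2 by blast
      obtain r2 r4 where R2: "br r b = r2 \<star> a + r4 \<star> b" using brD[OF prg(2) abg(2)] span2 by blast
      \<comment> \<open>[p, r] lies in D, which is abelian, so ad p and ad r commute on D.\<close>
      have com: "br p (br r e) = br r (br p e)" if "e \<in> ?D" for e
        using leibniz[of p r e] abel[OF brD[OF prg] that] by simp
      have "(p2 * r3 - r2 * p3) \<star> a + (p3 * r1 + p4 * r3 - (r3 * p1 + r4 * p3)) \<star> b = 0"
        using com[OF abD(1)] unfolding P1 R1 by (simp add: br_simps P1 P2 R1 R2 algebra_simps)
      hence c1: "p2 * r3 = r2 * p3" "p3 * r1 + p4 * r3 = r3 * p1 + r4 * p3" using indep2[OF ab(1,2)] by (metis eq_iff_diff_eq_0)+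
      have "(p1 * r2 + p2 * r4 - (r1 * p2 + r2 * p4)) \<star> a + (p3 * r2 - r3 * p2) \<star> b = 0"
        using com[OF abD(2)] unfolding P2 R2 by (simp add: br_simps P1 P2 R1 R2 algebra_simps)
      hence c2': "p1 * r2 + p2 * r4 = r1 * p2 + r2 * p4" using indep2[OF ab(1,2)] by (metis eq_iff_diff_eq_0)
      \<comment> \<open>Commuting 2 by 2 matrices have proportional traceless parts, so some
        nontrivial combination of ad p and ad r is scalar on D. The coefficients are read off from a
        nonzero entry of the traceless part of ad p, if there is one.\<close>
      have "\<exists>\<alpha> \<beta>. (\<alpha> \<noteq> 0 \<or> \<beta> \<noteq> 0) \<and> \<alpha> * p2 + \<beta> * r2 = 0 \<and> \<alpha> * p3 + \<beta> * r3 = 0 \<and> \<alpha> * (p1 - p4) + \<beta> * (r1 - r4) = 0"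
      proof -
        have d: "p3 * (r1 - r4) = r3 * (p1 - p4)" "r2 * (p1 - p4) = p2 * (r1 - r4)" using c1(2) c2' by (simp_all add: algebra_simps)
        consider "p2 \<noteq> 0" | "p3 \<noteq> 0" | "p1 - p4 \<noteq> 0" | "p2 = 0" "p3 = 0" "p1 - p4 = 0" by blast
        thus ?thesis
        proof cases
          case 1 thus ?thesis using c1(1) d by (intro exI[of _ "- r2"] exI[of _ p2]) (simp add: algebra_simps)
        next
          case 2 thus ?thesis using c1(1) d by (intro exI[of _ "- r3"] exI[of _ p3]) (simp add: algebra_simps)
        next
          case 3 thus ?thesis using c1(1) d by (intro exI[of _ "- (r1 - r4)"] exI[of _ "p1 - p4"]) (simp add: algebra_simps)
        next
          case 4 thus ?thesis by (intro exI[of _ 1] exI[of _ 0]) simp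
        qed
      qed
      then obtain \<alpha> \<beta> where \<alpha>\<beta>: "\<alpha> \<noteq> 0 \<or> \<beta> \<noteq> 0" "\<alpha> * p2 + \<beta> * r2 = 0" "\<alpha> * p3 + \<beta> * r3 = 0" "\<alpha> * (p1 - p4) + \<beta> * (r1 - r4) = 0" by blast
      define s where "s = \<alpha> * p1 + \<beta> * r1"
      define u where "u = \<alpha> \<star> p + \<beta> \<star> r"
      have ug: "u \<in> g" using prg sub_g by (simp add: u_def)
      have s4: "s = \<alpha> * p4 + \<beta> * r4" using \<alpha>\<beta>(4) by (simp add: s_def algebra_simps)
      have "br u a = s \<star> a + (\<alpha> * p3 + \<beta> * r3) \<star> b" by (simp add: u_def s_def br_simps P1 R1 algebra_simps)
      hence ua: "br u a = s \<star> a" using \<alpha>\<beta>(3) by simp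
      have "br u b = (\<alpha> * p2 + \<beta> * r2) \<star> a + s \<star> b" by (simp add: u_def s4 br_simps P2 R2 algebra_simps)
      hence ub: "br u b = s \<star> b" using \<alpha>\<beta>(2) by simp
      have unD: "u \<notin> ?D"
      proof
        assume uD: "u \<in> ?D"
        have Bi: "B = {p, r, a, b}" using pr B(1) by auto
        have ne: "p \<notin> {r, a, b}" "r \<notin> {a, b}" using pr by auto
        have i1: "p \<notin> span {r, a, b}" using independent_insert[of p "{r, a, b}"] B(3) Bi ne by simp
        have "independent {r, a, b}" using B(3) Bi independent_mono[of B "{r, a, b}"] by auto
        hence i2: "r \<notin> span {a, b}" using independent_insert[of r "{a, b}"] ne by simp
        have "\<alpha> \<star> p = u - \<beta> \<star> r" by (simp add: u_def)
        moreover have "u - \<beta> \<star> r \<in> span {r, a, b}" using uD span_mono[of "{a, b}" "{r, a, b}"] by (intro span_diff span_scale) (auto intro: span_base)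
        ultimately have "\<alpha> \<star> p \<in> span {r, a, b}" by simp
        hence "\<alpha> = 0" using i1 span_scale[of "\<alpha> \<star> p" "{r, a, b}" "inverse \<alpha>"] by (cases "\<alpha> = 0") auto
        hence "\<beta> \<star> r \<in> span {a, b}" "\<beta> \<noteq> 0" using uD \<alpha>\<beta>(1) by (auto simp: u_def)
        thus False using i2 span_scale[of "\<beta> \<star> r" "{a, b}" "inverse \<beta>"] by auto
      qed
      \<comment> \<open>With s = 0 the element u would centralise D without lying in it.\<close>
      have "s \<noteq> 0" using faith[OF ug] ua ub unD by auto
      define x where "x = inverse s \<star> u"
      have xg: "x \<in> g" using ug sub_g by (simp add: x_def)
      have xD: "br x e = e" if e: "e \<in> ?D" for e
      proof -
        obtain k l where "e = k \<star> a + l \<star> b" using e span2 by blast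
        thus ?thesis using ua ub \<open>s \<noteq> 0\<close> by (simp add: x_def br_simps algebra_simps)
      qed
      have a0: "a \<noteq> 0" using ab(1) dependent_zero[of "{a, b}"] by auto
      have xnD: "x \<notin> ?D" using xD[OF abD(1)] abel[OF _ abD(1)] a0 by auto
      have ix: "independent {x, a, b}" using independent_insertI[OF xnD ab(1)] .
      obtain B' where B': "{x, a, b} \<subseteq> B'" "B' \<subseteq> g" "independent B'" "span B' = g" "card B' = n" "finite B'"
        using extend[of "{x, a, b}"] ix xg abg by blast
      have "x \<noteq> a" "x \<noteq> b" using xnD abD by blast+
      hence c3: "card {x, a, b} = 3" using ab(2) by simp
      have "B' \<noteq> {x, a, b}" using c3 B'(5) True by auto
      then obtain y0 where y0: "y0 \<in> B'" "y0 \<notin> {x, a, b}" using B'(1) by blast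
      have "card (insert y0 {x, a, b}) = 4" using y0 c3 by simp
      hence By: "B' = insert y0 {x, a, b}" using card_seteq[of B' "insert y0 {x, a, b}"] B' y0 True by auto
      have y0n: "y0 \<notin> span {x, a, b}" using B'(3) independent_insert[of y0 "{x, a, b}"] y0 By by simp
      have y0g: "y0 \<in> g" using y0 B' by auto
      \<comment> \<open>As ad x is the identity on D and [x, y0] lies in D, this correction makes y
        commute with x.\<close>
      define y where "y = y0 - br x y0"
      have wD: "br x y0 \<in> ?D" using brD[OF xg y0g] .
      have yg: "y \<in> g" using y0g br_g sub_g by (simp add: y_def)
      have xy: "br x y = 0" using xD[OF wD] by (simp add: y_def br_simps)
      have Dx: "?D \<subseteq> span {x, a, b}" by (rule span_mono) auto
      have yn: "y - t \<notin> span {x, a, b}" if "t \<in> span {x, a, b}" for t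
      proof
        assume "y - t \<in> span {x, a, b}"
        hence "(y - t) + (t + br x y0) \<in> span {x, a, b}" using that wD Dx by (intro span_add) auto
        thus False using y0n by (simp add: y_def)
      qed
      \<comment> \<open>If every vector of D were an eigenvector of ad y, then ad y would be a
        scalar k there and y - k x would centralise D.\<close>
      have "\<exists>v\<in>?D. br y v \<notin> span {v}"
      proof (rule ccontr)
        assume "\<not> (\<exists>v\<in>?D. br y v \<notin> span {v})"
        hence *: "\<exists>k. br y v = k \<star> v" if "v \<in> ?D" for v using that span1 by blast
        obtain k l m where k: "br y a = k \<star> a" "br y b = l \<star> b" "br y (a + b) = m \<star> (a + b)"
          using *[OF abD(1)] *[OF abD(2)] *[OF span_add[OF abD]] by metis
        have "(k - m) \<star> a + (l - m) \<star> b = 0" using k by (simp add: br_simps algebra_simps)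
        hence "k - m = 0 \<and> l - m = 0" using indep2[OF ab(1,2)] by blast
        hence "br y a = k \<star> a" "br y b = k \<star> b" using k(1,2) by auto
        hence "br (y - k \<star> x) a = 0" "br (y - k \<star> x) b = 0" using xD[OF abD(1)] xD[OF abD(2)] by (simp_all add: br_simps)
        moreover have "y - k \<star> x \<in> g" using yg xg sub_g by simp
        ultimately have "y - k \<star> x \<in> span {x, a, b}" using faith Dx by blast
        moreover have "k \<star> x \<in> span {x, a, b}" by (intro span_scale span_base) simp
        ultimately show False using yn by blast
      qed
      then obtain v where v: "v \<in> ?D" "br y v \<notin> span {v}" by blast
      define w where "w = br y v"
      have wD': "w \<in> ?D" using brD yg v Dg by (auto simp: w_def)
      have v0: "v \<noteq> 0" using v br_zero by auto
      have vw: "independent {w, v}" "w \<noteq> v" using independent_insertI[of w "{v}"] v v0 span_base[of v "{v}"] by (auto simp: w_def)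
      have Dvw: "?D = span {v, w}"
      proof
        show "span {v, w} \<subseteq> ?D" using v wD' by (intro span_minimal subspace_span) auto
        have "{w, v} \<subseteq> span {a, b}" using v wD' by auto
        obtain C where C: "{w, v} \<subseteq> C" "C \<subseteq> ?D" "independent C" "?D \<subseteq> span C"
          using maximal_independent_subset_extend[of "{w, v}" ?D] vw v wD' by auto
        have "finite C \<and> card C \<le> card {a, b}" using independent_span_bound[of "{a, b}" C] C by auto
        hence "C = {w, v}" using C vw c2 card_seteq[of C "{w, v}"] by auto
        thus "?D \<subseteq> span {v, w}" using C by (simp add: insert_commute)
      qed
      have gsp: "g \<subseteq> span {x, y, v, w}"
      proof -
        let ?S = "span {x, y, v, w}"
        have DS: "?D \<subseteq> ?S" unfolding Dvw by (rule span_mono) auto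
        have "y0 = y + br x y0" by (simp add: y_def)
        moreover have "y + br x y0 \<in> ?S" using wD DS by (intro span_add) (auto intro: span_base)
        ultimately have "B' \<subseteq> ?S" using By DS abD by (auto intro: span_base)
        thus ?thesis using B'(4) span_minimal[of B' ?S] subspace_span by blast
      qed
      have S4: "card {x, y, v, w} \<le> n" using True card_insert_le_m1 by (simp add: card_insert_if)
      have bI: "independent {x, y, v, w}" "card {x, y, v, w} = n" "span {x, y, v, w} = g"
        by (rule basisI[OF _ S4 _ gsp]; use xg yg v wD' Dg in auto)+
      have "form_C x y v w" unfolding form_C_def
        using bI True abel[OF v(1) wD'] xD[OF v(1)] xD[OF wD'] xy brD[OF yg, of w] wD' Dg Dvw by (auto simp: w_def)
      thus ?thesis by blast
    qed
  qed
qed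

lemma extend_in:
  assumes "subspace W" "W \<subseteq> g" "S \<subseteq> W" "independent S"
  shows "\<exists>C. S \<subseteq> C \<and> C \<subseteq> W \<and> independent C \<and> span C = W \<and> finite C"
proof -
  obtain C where C: "S \<subseteq> C" "C \<subseteq> W" "independent C" "W \<subseteq> span C"
    using maximal_independent_subset_extend[OF assms(3,4)] by blast
  have "span C = W" using C(4) span_minimal[OF C(2) assms(1)] by blast
  moreover have "finite C" using fin_indep[OF subset_trans[OF C(2) assms(2)] C(3)] ..
  ultimately show ?thesis using C by blast
qed

lemma bases_card: "independent S ==> independent T ==> span S = span T ==> card S = card T"
  using dim_eq_card_independent dim_span by metis

lemma basis_less:
  assumes "subspace W'" "W' \<subseteq> g" "independent S" "independent T" "span T = W'" "span S \<subseteq> W'" "\<not> W' \<subseteq> span S"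
  shows "card S < card T"
proof -
  have "S \<subseteq> W'" using assms(6) span_superset by blast
  then obtain C where C: "S \<subseteq> C" "C \<subseteq> W'" "independent C" "span C = W'" "finite C"
    using extend_in[OF assms(1,2) _ assms(3)] by blast
  have "S \<noteq> C" using C(4) assms(7) by blast
  hence "card S < card C" using C psubset_card_mono[of C S] by blast
  thus ?thesis using bases_card[OF C(3) assms(4)] C(4) assms(5) by simp
qed

lemma brs_ideal:
  assumes S: "S \<subseteq> g" "\<And>u s. u \<in> g ==> s \<in> S ==> br u s \<in> S" and u: "u \<in> g" and e: "e \<in> brs S"
  shows "br u e \<in> brs S"
proof -
  have "subspace {e. br u e \<in> brs S}"
    using brs_subspace[of S] by (auto simp: br_simps subspace_def)
  moreover have "br u (br s t) \<in> brs S" if st: "s \<in> S" "t \<in> S" for s t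
    unfolding leibniz[of u s t] using brsI[OF S(2)[OF u st(1)] st(2)] brsI[OF st(1) S(2)[OF u st(2)]]
    by (rule subspace_add[OF brs_subspace])
  ultimately have "brs S \<subseteq> {e. br u e \<in> brs S}" by (intro brs_least) auto
  thus ?thesis using e by blast
qed

text \<open>Suppose E = [D, D] is a plane in the derived algebra D spanned by E and y. Then E is
  abelian, so [y, E] = E, while [x, y] is \<kappa> y modulo E with \<kappa> nonzero. On E the
  commutator of ad x and ad y is therefore \<kappa> ad y, which makes ad y nilpotent and contradicts
  surjectivity.\<close>

lemma no_plane_in_derived:
  assumes D: "brs g = span {e, f, y}" and x: "x \<in> g" "g \<subseteq> span (insert x (brs g))"
    and ef: "independent {e, f}" "e \<noteq> f" "brs (brs g) = span {e, f}" "\<not> brs g \<subseteq> span {e, f}"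
  shows False
proof -
  let ?D = "brs g" and ?E = "span {e, f}"
  have DI: "br u v \<in> ?D" if "u \<in> g" "v \<in> g" for u v using brsI[OF that] .
  have Dg: "u \<in> ?D ==> u \<in> g" for u using brs_g by blast
  have ED: "?E \<subseteq> ?D" unfolding ef(3)[symmetric] by (rule brs_least[OF brs_subspace]) (use DI Dg in blast)
  have EI: "br u h \<in> ?E" if "u \<in> g" "h \<in> ?E" for u h
    using brs_ideal[OF brs_g _ that(1), of g h] DI Dg that(2) ef(3) by blast
  have abel: "br u v = 0" if "u \<in> ?E" "v \<in> ?E" for u v
    by (rule plane_ideal_abelian[OF ef(1,2) ED EI that])
  have mem: "e \<in> ?E" "f \<in> ?E" "y \<in> ?D" unfolding D by (auto intro: span_base)
  have yg: "y \<in> g" using mem(3) Dg by blast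
  have eg: "e \<in> g" "f \<in> g" using mem ED Dg by blast+
  have Ddec: "\<exists>k. \<exists>h\<in>?E. d = k \<star> y + h" if d: "d \<in> ?D" for d
  proof -
    obtain k l m where "d = k \<star> e + l \<star> f + m \<star> y" using d D span3 by blast
    moreover have "k \<star> e + l \<star> f \<in> ?E" using mem by (intro span_add span_scale)
    ultimately show ?thesis by (metis add.commute)
  qed
  let ?Y = "span {br y e, br y f}"
  have YE: "br y h \<in> ?Y" if h: "h \<in> ?E" for h
  proof -
    obtain k l where "h = k \<star> e + l \<star> f" using h span2 by blast
    hence "br y h = k \<star> br y e + l \<star> br y f" by (simp add: br_simps)
    thus ?thesis using span2 by blast
  qed
  have "brs ?D \<subseteq> ?Y"
  proof (rule brs_least[OF subspace_span])
    fix d d' assume d: "d \<in> ?D" "d' \<in> ?D"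
    obtain k h where h: "h \<in> ?E" "d = k \<star> y + h" using Ddec[OF d(1)] by blast
    obtain k' h' where h': "h' \<in> ?E" "d' = k' \<star> y + h'" using Ddec[OF d(2)] by blast
    have "br d d' = k \<star> br y h' - k' \<star> br y h"
      unfolding h h' using abel[OF h(1) h'(1)] br_anti[of h y] by (simp add: br_simps)
    thus "br d d' \<in> ?Y" using span_diff[OF span_scale[OF YE[OF h'(1)]] span_scale[OF YE[OF h(1)]]] by simp
  qed
  hence onto: "?E \<subseteq> ?Y" unfolding ef(3) .
  obtain \<kappa> w where \<kappa>: "w \<in> ?E" "br x y = \<kappa> \<star> y + w" using Ddec[OF DI[OF x(1) yg]] by blast
  \<comment> \<open>Otherwise ad x maps D into E, and all brackets of g would lie in E.\<close>
  have "\<kappa> \<noteq> 0"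
  proof
    assume k0: "\<kappa> = 0"
    have xD: "br x d \<in> ?E" if d: "d \<in> ?D" for d
    proof -
      obtain k h where h: "h \<in> ?E" "d = k \<star> y + h" using Ddec[OF d] by blast
      have "br x d = k \<star> w + br x h" unfolding h using \<kappa>(2) k0 by (simp add: br_simps)
      thus ?thesis using span_add[OF span_scale[OF \<kappa>(1)] EI[OF x(1) h(1)]] by simp
    qed
    have "?D \<subseteq> ?E"
    proof (rule brs_least[OF subspace_span])
      fix u v assume uv: "u \<in> g" "v \<in> g"
      obtain k where k: "u - k \<star> x \<in> ?D" using uv(1) x(2) span_ins[of u x ?D] span_eq_iff[THEN iffD2, OF brs_subspace[of g]] by auto
      obtain l where l: "v - l \<star> x \<in> ?D" using uv(2) x(2) span_ins[of v x ?D] span_eq_iff[THEN iffD2, OF brs_subspace[of g]] by auto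
      have "br (u - k \<star> x) (v - l \<star> x) \<in> ?E" using brsI[OF k l] ef(3) by simp
      hence "br (u - k \<star> x) (v - l \<star> x) + k \<star> br x (v - l \<star> x) - l \<star> br x (u - k \<star> x) \<in> ?E"
        using xD[OF k] xD[OF l] by (intro span_add span_diff span_scale)
      moreover have "br u v = br (u - k \<star> x) (v - l \<star> x) + k \<star> br x (v - l \<star> x) - l \<star> br x (u - k \<star> x)"
        using br_anti[of u x] by (simp add: br_simps)
      ultimately show "br u v \<in> ?E" by simp
    qed
    thus False using ef(4) by blast
  qed
  obtain x1 x3 where X1: "br x e = x1 \<star> e + x3 \<star> f" using EI[OF x(1) mem(1)] span2 by blast
  obtain x2 x4 where X2: "br x f = x2 \<star> e + x4 \<star> f" using EI[OF x(1) mem(2)] span2 by blast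
  obtain y1 y3 where Y1: "br y e = y1 \<star> e + y3 \<star> f" using EI[OF yg mem(1)] span2 by blast
  obtain y2 y4 where Y2: "br y f = y2 \<star> e + y4 \<star> f" using EI[OF yg mem(2)] span2 by blast
  have com: "br x (br y h) - br y (br x h) - \<kappa> \<star> br y h = 0" if h: "h \<in> ?E" for h
    unfolding leibniz[of x y h] \<kappa>(2) using abel[OF \<kappa>(1) h] by (simp add: br_simps)
  have "(y3 * x2 - x3 * y2 - \<kappa> * y1) \<star> e + (y1 * x3 + y3 * x4 - x1 * y3 - x3 * y4 - \<kappa> * y3) \<star> f = 0"
    using com[OF mem(1)] unfolding X1 Y1 by (simp add: br_simps X1 X2 Y1 Y2 algebra_simps)
  hence "y3 * x2 - x3 * y2 - \<kappa> * y1 = 0 \<and> y1 * x3 + y3 * x4 - x1 * y3 - x3 * y4 - \<kappa> * y3 = 0" by (rule indep2[OF ef(1,2)])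
  hence c1: "y3 * x2 - x3 * y2 = \<kappa> * y1" "y1 * x3 + y3 * x4 - x1 * y3 - x3 * y4 = \<kappa> * y3" by simp_all
  have "(y2 * x1 + y4 * x2 - x2 * y1 - x4 * y2 - \<kappa> * y2) \<star> e + (y2 * x3 - x2 * y3 - \<kappa> * y4) \<star> f = 0"
    using com[OF mem(2)] unfolding X2 Y2 by (simp add: br_simps X1 X2 Y1 Y2 algebra_simps)
  hence "y2 * x1 + y4 * x2 - x2 * y1 - x4 * y2 - \<kappa> * y2 = 0 \<and> y2 * x3 - x2 * y3 - \<kappa> * y4 = 0" by (rule indep2[OF ef(1,2)])
  hence c2: "y2 * x1 + y4 * x2 - x2 * y1 - x4 * y2 = \<kappa> * y2" "y2 * x3 - x2 * y3 = \<kappa> * y4" by simp_all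
  \<comment> \<open>The trace of a commutator vanishes, so ad y has trace 0 on E.\<close>
  have "\<kappa> * (y1 + y4) = 0" unfolding distrib_left c1(1)[symmetric] c2(2)[symmetric] by (simp add: algebra_simps)
  hence y4: "y4 = - y1" using \<open>\<kappa> \<noteq> 0\<close> by (simp add: eq_neg_iff_add_eq_0 add.commute)
  \<comment> \<open>The trace of (ad y)^2 vanishes as well, since \<kappa> (ad y)^2 is the
    commutator times ad y; characteristic 0 allows division by 2.\<close>
  have "2 * \<kappa> * (y1 * y1 + y2 * y3) = 2 * y1 * (\<kappa> * y1) + y3 * (\<kappa> * y2) + y2 * (\<kappa> * y3)" by (simp add: algebra_simps)
  also have "\<dots> = 0" unfolding c1[symmetric] c2[symmetric] y4 by (simp add: algebra_simps)
  finally have sq: "y1 * y1 + y2 * y3 = 0" using \<open>\<kappa> \<noteq> 0\<close> by simp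
  \<comment> \<open>With trace 0 and determinant -(y1^2 + y2 y3) = 0, the Cayley-Hamilton theorem
    makes the square of ad y vanish on E.\<close>
  have "br y (br y e) = (y1 * y1 + y2 * y3) \<star> e" "br y (br y f) = (y1 * y1 + y2 * y3) \<star> f"
    by (simp_all add: Y1 Y2 br_simps y4 algebra_simps)
  hence YY: "br y (br y e) = 0" "br y (br y f) = 0" using sq by simp_all
  have "br y h = 0" if h: "h \<in> ?E" for h
  proof -
    obtain k l where "h = k \<star> br y e + l \<star> br y f" using onto h span2 by blast
    thus ?thesis by (simp add: br_simps YY)
  qed
  hence "br y e = 0" "br y f = 0" using mem by blast+
  hence "e = 0" using onto mem(1) by auto
  thus False using ef(1) dependent_zero[of "{e, f}"] by auto
qed

text \<open>By solvability [D, D] is smaller than the 3-dimensional derived algebra D. If it is 0, D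
  is an abelian ideal; if it is a line, that line is centralised by D and D is a Heisenberg algebra;
  a plane is impossible.\<close>

lemma space_derived:
  assumes n4: "n = 4" and b: "independent BD" "span BD = brs g" "card BD = 3"
  shows "(\<exists>x E E1. form_A x E E1) \<or> (\<exists>x a b z. form_B x a b z)"
proof -
  let ?D = "brs g" let ?E = "brs ?D"
  have DI: "br u v \<in> ?D" if "u \<in> g" "v \<in> g" for u v using brsI[OF that] .
  have Dg: "u \<in> ?D ==> u \<in> g" for u using brs_g by blast
  have ED: "?E \<subseteq> ?D" by (rule brs_least[OF brs_subspace]) (use DI Dg in blast)
  have EI: "br u h \<in> ?E" if "u \<in> g" "h \<in> ?E" for u h
    using brs_ideal[OF brs_g _ that] DI Dg by blast
  have BDg: "BD \<subseteq> g" using b(2) brs_g span_superset by blast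
  obtain B where B: "BD \<subseteq> B" "B \<subseteq> g" "independent B" "span B = g" "card B = n" "finite B"
    using extend[OF BDg b(1)] .
  have "B \<noteq> BD" using B(5) n4 b(3) by auto
  then obtain x where x: "x \<in> B" "x \<notin> BD" using B(1) by blast
  have "finite BD" using b(3) card.infinite by fastforce
  hence "card (insert x BD) = 4" using x b(3) by simp
  hence Bx: "B = insert x BD" using card_seteq[of B "insert x BD"] B x n4 by auto
  have xD: "x \<notin> ?D" using B(3) independent_insert[of x BD] x Bx b(2) by simp
  have xg: "x \<in> g" using x B by blast
  have "insert x BD \<subseteq> insert x ?D" using b(2) span_superset by blast
  hence gx: "g \<subseteq> span (insert x ?D)" using B(4) Bx span_mono by blast
  have D0: "?D \<noteq> {0}"
  proof
    assume D0: "?D = {0}"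
    have "BD \<subseteq> {0}" using span_superset[of BD] unfolding b(2) D0 .
    thus False using card_mono[of "{0}" BD] b(3) by simp
  qed
  have DE: "\<not> ?D \<subseteq> ?E" by (rule brs_proper[OF brs_subspace brs_g D0])
  obtain BE where BE: "BE \<subseteq> ?E" "independent BE" "span BE = ?E" "finite BE"
    using extend_in[OF brs_subspace brs_g, of "{}" ?D] independent_empty by blast
  have "card BE < 3" using basis_less[OF brs_subspace brs_g BE(2) b(1,2)] BE(3) ED DE b(3) by simp
  then consider "card BE = 0" | "card BE = 1" | "card BE = 2" by linarith
  thus ?thesis
  proof cases
    case 1
    hence E0: "?E = {0}" using BE by auto
    have "\<exists>x E E1. form_A x E E1"
    proof (rule form_A_I[of ?D x])
      show "br u v = 0" if "u \<in> ?D" "v \<in> ?D" for u v using brsI[OF that] E0 by simp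
    qed (use brs_subspace brs_g DI xg xD gx in blast)+
    thus ?thesis ..
  next
    case 2
    then obtain c where "BE = {c}" by (auto simp: card_1_singleton_iff)
    hence E: "?E = span {c}" "independent {c}" using BE by auto
    have cD: "c \<in> ?D" using E(1) ED span_base[of c "{c}"] by blast
    have cd: "br d c = 0" if "d \<in> ?D" for d
      by (rule char_lemma[OF _ that]) (use EI E(1) span_base[of c "{c}"] in blast)
    obtain C where C: "{c} \<subseteq> C" "C \<subseteq> ?D" "independent C" "span C = ?D" "finite C"
      using extend_in[OF brs_subspace brs_g, of "{c}" g] cD E(2) by blast
    have "card C = 3" using bases_card[OF C(3) b(1)] C(4) b(2,3) by simp
    hence "card (C - {c}) = 2" using C by simp
    then obtain a b where ab: "C - {c} = {a, b}" "a \<noteq> b" by (auto simp: card_2_iff)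
    have Cab: "C = {c, a, b}" using ab C(1) by blast
    have D: "?D = span {c, a, b}" using C(4) Cab by simp
    have abD: "a \<in> ?D" "b \<in> ?D" using C(2) Cab by auto
    obtain \<gamma> where \<gamma>: "br a b = \<gamma> \<star> c" using brsI[OF abD] E(1) span1 by blast
    have dd: "br d d' \<in> span {br a b}" if dd: "d \<in> ?D" "d' \<in> ?D" for d d'
    proof -
      obtain k l m where d: "d = k \<star> c + l \<star> a + m \<star> b" using dd(1) D span3 by blast
      obtain k' l' m' where d': "d' = k' \<star> c + l' \<star> a + m' \<star> b" using dd(2) D span3 by blast
      have z: "br a c = 0" "br b c = 0" "br c a = 0" "br c b = 0"
        using cd abD br_anti[of c a] br_anti[of c b] by auto
      have "br d d' = (l * m' - m * l') \<star> br a b"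
        unfolding d d' using br_anti[of b a] by (simp add: br_simps z algebra_simps)
      thus ?thesis using span1 by blast
    qed
    define z where "z = br a b"
    have Ez: "?E \<subseteq> span {z}" unfolding z_def by (rule brs_least[OF subspace_span]) (rule dd)
    have "\<gamma> \<noteq> 0"
    proof
      assume "\<gamma> = 0"
      hence "?E \<subseteq> {0}" using Ez \<gamma> by (simp add: z_def)
      hence "c = 0" using E(1) span_base[of c "{c}"] by blast
      thus False using E(2) dependent_zero[of "{c}"] by auto
    qed
    hence cz: "c = inverse \<gamma> \<star> z" using \<gamma> by (simp add: z_def)
    have zD: "z \<in> ?D" "z \<in> ?E" using brsI[OF abD] ED by (auto simp: z_def)
    have Dz: "?D \<subseteq> span {a, b, z}" unfolding D
      by (rule span_minimal[OF _ subspace_span]) (auto simp: cz intro: span_base span_scale)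
    have zab: "br z a = 0" "br z b = 0" using cd abD br_anti[of c a] br_anti[of c b] by (auto simp: z_def \<gamma> br_simps)
    let ?W = "span {br x a, br x b, z}"
    have zW: "span {z} \<subseteq> ?W" by (rule span_mono) auto
    have xz: "br x z \<in> span {z}" using EI[OF xg zD(2)] Ez by blast
    have xW: "br x d \<in> ?W" if d: "d \<in> ?D" for d
    proof -
      obtain k l m where d: "d = k \<star> a + l \<star> b + m \<star> z" using d Dz span3 by blast
      have "k \<star> br x a + l \<star> br x b + m \<star> br x z \<in> ?W"
        using xz zW by (intro span_add span_scale) (auto intro: span_base)
      thus ?thesis unfolding d by (simp add: br_simps)
    qed
    \<comment> \<open>Modulo z all brackets of g come from ad x on D. As D is the derived algebra,
      ad x is surjective on D modulo z.\<close>
    have DW: "?D \<subseteq> ?W"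
    proof (rule brs_least[OF subspace_span])
      fix u v assume uv: "u \<in> g" "v \<in> g"
      obtain k where k: "u - k \<star> x \<in> ?D" using uv(1) gx span_ins[of u x ?D] span_eq_iff[THEN iffD2, OF brs_subspace[of g]] by auto
      obtain l where l: "v - l \<star> x \<in> ?D" using uv(2) gx span_ins[of v x ?D] span_eq_iff[THEN iffD2, OF brs_subspace[of g]] by auto
      have "br (u - k \<star> x) (v - l \<star> x) \<in> ?W" using brsI[OF k l] Ez zW by blast
      hence "br (u - k \<star> x) (v - l \<star> x) + k \<star> br x (v - l \<star> x) - l \<star> br x (u - k \<star> x) \<in> ?W"
        using xW[OF k] xW[OF l] by (intro span_add span_diff span_scale)
      moreover have "br u v = br (u - k \<star> x) (v - l \<star> x) + k \<star> br x (v - l \<star> x) - l \<star> br x (u - k \<star> x)"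
        using br_anti[of u x] by (simp add: br_simps)
      ultimately show "br u v \<in> ?W" by simp
    qed
    have "?D \<subseteq> span {x, a, b, z}" using Dz span_mono[of "{a, b, z}" "{x, a, b, z}"] by blast
    hence "insert x ?D \<subseteq> span {x, a, b, z}" using span_base[of x "{x, a, b, z}"] by simp
    hence gS: "g \<subseteq> span {x, a, b, z}" using gx span_minimal[OF _ subspace_span] by blast
    have c4: "card {x, a, b, z} \<le> n" using n4 by (simp add: card_insert_if)
    have Sg: "{x, a, b, z} \<subseteq> g" using xg abD zD Dg by simp
    have "independent {x, a, b, z}" "card {x, a, b, z} = n" "span {x, a, b, z} = g"
      by (rule basisI[OF _ c4 Sg gS]; simp)+
    moreover have "br x a \<in> span {a, b, z}" "br x b \<in> span {a, b, z}" using DI[OF xg] abD Dg Dz by blast+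
    moreover have "a \<in> ?W" "b \<in> ?W" using DW abD by blast+
    ultimately have "form_B x a b z" unfolding form_B_def using n4 zab xz z_def by blast
    thus ?thesis by blast
  next
    case 3
    then obtain e f where ef: "BE = {e, f}" "e \<noteq> f" by (auto simp: card_2_iff)
    have E: "independent {e, f}" "?E = span {e, f}" using BE ef by auto
    have efD: "{e, f} \<subseteq> ?D" using BE(1) ef ED by blast
    obtain C where C: "{e, f} \<subseteq> C" "C \<subseteq> ?D" "independent C" "span C = ?D" "finite C"
      using extend_in[OF brs_subspace brs_g efD E(1)] by blast
    have "card C = 3" using bases_card[OF C(3) b(1)] C(4) b(2,3) by simp
    hence "card (C - {e, f}) = 1" using C(1,5) ef(2) card_Diff_subset[of "{e, f}" C] by simp
    then obtain y where "C - {e, f} = {y}" by (auto simp: card_1_singleton_iff)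
    hence "C = {e, f, y}" using C(1) by blast
    hence "?D = span {e, f, y}" using C(4) by simp
    thus ?thesis using no_plane_in_derived[of e f y x] xg gx E ef(2) DE by metis
  qed
qed

text \<open>Solvability makes the derived algebra of a nonzero g proper, so its dimension is at most
  3, and each dimension from 1 to 3 has been treated. If it is 0, any hyperplane is an abelian
  ideal.\<close>

theorem classification:
  assumes n4: "n \<le> 4"
  shows "g = {0} \<or> (\<exists>x E E1. form_A x E E1) \<or> (\<exists>x a b z. form_B x a b z) \<or> (\<exists>x y v w. form_C x y v w)"
proof (cases "g = {0}")
  case False
  obtain BD where BD: "BD \<subseteq> brs g" "independent BD" "span BD = brs g" "finite BD"
    using extend_in[OF brs_subspace brs_g, of "{}" g] independent_empty by blast
  obtain B where B: "finite B" "independent B" "span B = g" "card B = n" using fin_dim by blast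
  have "card BD < card B"
    using basis_less[OF g_subspace order_refl BD(2) B(2,3)] BD(3) brs_g brs_proper[OF g_subspace order_refl False] by simp
  then consider "card BD = 0" | "card BD = 1" | "card BD = 2" | "card BD = 3" "n = 4" using B(4) n4 by linarith
  thus ?thesis
  proof cases
    case 1
    hence D0: "brs g = {0}" using BD by auto
    have z: "br u v = 0" if "u \<in> g" "v \<in> g" for u v using brsI[OF that] D0 by simp
    have Bg: "B \<subseteq> g" using B(3) span_superset by blast
    have "B \<noteq> {}" using B(3) False by auto
    then obtain x where x: "x \<in> B" by blast
    have ins: "insert x (B - {x}) = B" using x by blast
    have "\<exists>x E E1. form_A x E E1"
    proof (rule form_A_I[of "span (B - {x})" x])
      show Vg: "span (B - {x}) \<subseteq> g" using Bg by (intro span_sub_g) auto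
      show "br u v = 0" if "u \<in> span (B - {x})" "v \<in> span (B - {x})" for u v using z Vg that by blast
      show "br u v \<in> span (B - {x})" if "u \<in> g" "v \<in> g" for u v using z[OF that] span_zero by simp
      show "x \<notin> span (B - {x})" using B(2) x dependent_def by blast
      have "B \<subseteq> insert x (span (B - {x}))" using ins span_superset[of "B - {x}"] by blast
      thus "g \<subseteq> span (insert x (span (B - {x})))" using B(3) span_mono by blast
      show "x \<in> g" using x Bg by blast
    qed (rule subspace_span)
    thus ?thesis by blast
  next
    case 2
    then obtain z where z: "BD = {z}" by (auto simp: card_1_singleton_iff)
    hence "z \<noteq> 0" using BD(2) dependent_zero[of "{z}"] by auto
    thus ?thesis using line_derived[OF n4, of z] BD(3) z by auto
  next
    case 3
    then obtain a b where "BD = {a, b}" "a \<noteq> b" by (auto simp: card_2_iff)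
    thus ?thesis using plane_derived[OF n4, of a b] BD by auto
  next
    case 4
    thus ?thesis using space_derived[OF 4(2) BD(2,3) 4(1)] by blast
  qed
qed simp

end

section \<open>Lattices spanned by a basis\<close>

context lattice_space
begin

text \<open>For a basis B and S inside it, the A-span of S plus the M-span of B: the lattice that
  reduces to the span of S. In particular \<open>Lc B B\<close> and \<open>Lc B {}\<close> serve as
  top and bottom lattice.\<close>

definition Lc :: "'v set => 'v set => 'v set" where
  "Lc B S = {v \<in> span B. \<forall>b\<in>B. representation B v b \<in> (if b \<in> S then A else M)}"

lemma lin_sum: "lin T ==> T (sum f S) = (\<Sum>i\<in>S. T (f i))"
  by (induction S rule: infinite_finite_induct) (auto simp: lin_zero lin_def)

lemma Lc_mono: "S \<subseteq> S' ==> Lc B S \<subseteq> Lc B S'"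
  using M_subset by (auto simp: Lc_def split: if_splits)

lemma lat_Lc: "independent B ==> lat (Lc B S)"
  unfolding lat_def Lc_def
  by (auto simp: representation_zero representation_add representation_scale span_zero zero_A zero_M
      intro: span_add span_scale add_A add_M mult_A mult_M)

end

locale adapted_lattice = lie_lattice A M scale br N \<Lambda>
  for A M :: "'k::field set" and scale :: "'k => 'v::ab_group_add => 'v" (infixr \<open>\<star>\<close> 75)
    and br N \<Lambda> +
  fixes B
  assumes finite_B: "finite B" and indep_B: "independent B" and \<Lambda>_Lc: "\<Lambda> = Lc B B" and N_Lc: "N = Lc B {}"
begin

lemmas lat_Lc' [simp] = lat_Lc[OF indep_B]

lemma rep_basis: "b \<in> B ==> representation B b c = (if c = b then 1 else 0)"
  using representation_basis[OF indep_B] by simp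

lemma rep_diff: "v \<in> span B ==> u \<in> span B ==> representation B (v - u) c = representation B v c - representation B u c"
  using representation_diff[OF indep_B] by simp

lemma rep_scale: "v \<in> span B ==> representation B (a \<star> v) c = a * representation B v c"
  using representation_scale[OF indep_B] by simp

lemma expand: "v \<in> span B ==> v = (\<Sum>b\<in>B. representation B v b \<star> b)"
  using sum_representation_eq[OF indep_B _ finite_B order_refl] by simp

lemma basis_Lc: "b \<in> S ==> b \<in> B ==> b \<in> Lc B S"
  by (auto simp: Lc_def rep_basis one_A zero_A zero_M span_base)

lemma N_Lc_subset [simp]: "N \<subseteq> Lc B S" unfolding N_Lc by (rule Lc_mono) simp
lemma Lc_\<Lambda>: "S \<subseteq> B ==> Lc B S \<subseteq> \<Lambda>" unfolding \<Lambda>_Lc by (rule Lc_mono)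

lemma Lc_betw: "S \<subseteq> S' ==> Lc B S \<in> betw N (Lc B S')"
  using Lc_mono[of S S' B] by (simp add: betw_def)

lemma basis_\<Lambda>: "b \<in> B ==> b \<in> \<Lambda>" unfolding \<Lambda>_Lc by (rule basis_Lc)

lemma Lc_coeff_span: "v \<in> Lc B S ==> v \<in> span B" by (simp add: Lc_def)

text \<open>Only the basis vectors in S need a test: the others enter with coefficients in M, and M
  \<Lambda> lies in N.\<close>

lemma Lc_map:
  assumes v: "v \<in> Lc B S" and T: "lin T" and W: "lat W" "N \<subseteq> W"
    and S: "\<And>b. b \<in> S ==> b \<in> B ==> T b \<in> W" and \<Lambda>: "\<And>b. b \<in> B ==> T b \<in> \<Lambda>"
  shows "T v \<in> W"
proof -
  let ?r = "representation B v"
  have "T v = T (\<Sum>b\<in>B. ?r b \<star> b)" using expand[OF Lc_coeff_span[OF v]] by simp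
  also have "\<dots> = (\<Sum>b\<in>B. ?r b \<star> T b)" unfolding lin_sum[OF T] using T by (simp add: lin_def)
  also have "\<dots> \<in> W"
  proof (rule lat_sum[OF W(1)])
    fix b assume b: "b \<in> B"
    have r: "?r b \<in> (if b \<in> S then A else M)" using v b by (simp add: Lc_def)
    show "?r b \<star> T b \<in> W"
    proof (cases "b \<in> S")
      case True thus ?thesis using r lat_scale[OF W(1)] S b by simp
    next
      case False thus ?thesis using r quotD(4)[OF quot_\<Lambda>] \<Lambda>[OF b] W(2) by auto
    qed
  qed
  finally show ?thesis .
qed

lemma
  assumes "v \<in> Lc B S" "u \<in> \<Lambda>" "lat W" "N \<subseteq> W"
  shows br_Lc_right: "(\<And>b. b \<in> S ==> b \<in> B ==> br u b \<in> W) ==> br u v \<in> W"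
    and br_Lc_left: "(\<And>b. b \<in> S ==> b \<in> B ==> br b u \<in> W) ==> br v u \<in> W"
proof -
  show "br u v \<in> W" if "\<And>b. b \<in> S ==> b \<in> B ==> br u b \<in> W"
    by (rule Lc_map[OF assms(1) lin_right assms(3,4) that]) (use br_\<Lambda> assms(2) basis_\<Lambda> in blast)+
  show "br v u \<in> W" if "\<And>b. b \<in> S ==> b \<in> B ==> br b u \<in> W"
    by (rule Lc_map[OF assms(1) lin_left assms(3,4) that]) (use br_\<Lambda> assms(2) basis_\<Lambda> in blast)+
qed

lemma br_Lc_Lc:
  assumes "v \<in> Lc B S" "u \<in> Lc B S'" "S \<subseteq> B" "S' \<subseteq> B" "lat W" "N \<subseteq> W" "\<And>b c. b \<in> S ==> c \<in> S' ==> br b c \<in> W"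
  shows "br v u \<in> W"
proof (rule br_Lc_left[OF assms(1) _ assms(5,6)])
  show "u \<in> \<Lambda>" using assms(2) Lc_\<Lambda>[OF assms(4)] by blast
  fix b assume b: "b \<in> S" "b \<in> B"
  show "br b u \<in> W" by (rule br_Lc_right[OF assms(2) basis_\<Lambda>[OF b(2)] assms(5,6)]) (use assms(7) b in blast)
qed

lemma Lc_insert:
  assumes "b \<in> B" "b \<notin> S" shows "b \<notin> Lc B S" and "Lc B (insert b S) = adj (Lc B S) b"
proof -
  show "b \<notin> Lc B S" using assms one_notin_M by (auto simp: Lc_def rep_basis)
  show "Lc B (insert b S) = adj (Lc B S) b"
  proof
    show "adj (Lc B S) b \<subseteq> Lc B (insert b S)"
      by (rule adj_subset) (use Lc_mono[of S "insert b S" B] basis_Lc assms(1) in auto)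
    show "Lc B (insert b S) \<subseteq> adj (Lc B S) b"
    proof
      fix v assume v: "v \<in> Lc B (insert b S)"
      let ?a = "representation B v b"
      have a: "?a \<in> A" "v \<in> span B" using v assms(1) by (auto simp: Lc_def)
      have bs: "b \<in> span B" "?a \<star> b \<in> span B" using assms(1) span_base span_scale by blast+
      have "representation B (v - ?a \<star> b) c = (if c = b then 0 else representation B v c)" for c
        using rep_diff[OF a(2) bs(2)] rep_scale[OF bs(1)] rep_basis[OF assms(1)] by simp
      hence "v - ?a \<star> b \<in> Lc B S"
        using v assms span_diff[OF a(2) bs(2)] zero_M by (auto simp: Lc_def)
      thus "v \<in> adj (Lc B S) b" using adjI[OF _ a(1), of "v - ?a \<star> b" "Lc B S" b] by simp
    qed
  qed
qed

lemma quot_Lc: "S \<subseteq> S' ==> S' \<subseteq> B ==> quot (Lc B S) (Lc B S')"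
  using quot_upper[OF quot_lower[OF quot_\<Lambda>, of "Lc B S'"] Lc_betw, of S] Lc_betw[of S' B] \<Lambda>_Lc by simp

lemma idx_Lc_Un:
  assumes "finite D" "S \<union> D \<subseteq> B" "S \<inter> D = {}" shows "idx (Lc B (S \<union> D)) (Lc B S) = q ^ card D"
  using assms
proof (induction D)
  case empty thus ?case by (simp add: idx_self)
next
  case (insert b D)
  have b: "b \<in> B" "b \<notin> S \<union> D" using insert by auto
  let ?W = "Lc B (S \<union> D)"
  have i1: "idx (Lc B (insert b (S \<union> D))) ?W = q"
    unfolding Lc_insert(2)[OF b]
    by (rule idx_adj) (use Lc_insert(1)[OF b] quotD(4)[OF quot_\<Lambda> _ basis_\<Lambda>[OF b(1)]] subsetD[OF N_Lc_subset] in auto)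
  have "quot (Lc B S) (Lc B (insert b (S \<union> D)))" by (rule quot_Lc) (use insert in auto)
  moreover have "?W \<in> betw (Lc B S) (Lc B (insert b (S \<union> D)))"
    using Lc_mono[of S "S \<union> D" B] Lc_mono[of "S \<union> D" "insert b (S \<union> D)" B] by (auto simp: betw_def)
  ultimately have "idx (Lc B (insert b (S \<union> D))) (Lc B S) = q * idx ?W (Lc B S)"
    using idx_mult i1 by metis
  thus ?case using insert by simp
qed

lemma idx_Lc: "S \<subseteq> S' ==> S' \<subseteq> B ==> idx (Lc B S') (Lc B S) = q ^ card (S' - S)"
  using idx_Lc_Un[of "S' - S" S] finite_subset[OF _ finite_B, of "S' - S"] by (simp add: Un_absorb1 subset_iff)

lemma idx_Lc_N: "S \<subseteq> B ==> idx (Lc B S) N = q ^ card S"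
  using idx_Lc[of "{}" S] by (simp add: N_Lc)

lemma almost_abelian_Lc:
  assumes x: "x \<notin> E" "B = insert x E" and E1: "E1 \<subseteq> E" and ab: "\<And>e e'. e \<in> E ==> e' \<in> E ==> br e e' = 0"
    and im: "\<And>e. e \<in> E ==> br x e \<in> Lc B E1" and onto: "\<And>u. u \<in> E1 ==> \<exists>v\<in>Lc B E. br x v = u"
  shows "almost_abelian A M scale br N \<Lambda> (Lc B E) x (card E) (card E - card E1)"
proof unfold_locales
  have EB: "E \<subseteq> B" "E1 \<subseteq> B" "x \<in> B" using x E1 by auto
  show "Lc B E \<in> betw N \<Lambda>" unfolding \<Lambda>_Lc by (rule Lc_betw[OF EB(1)])
  show "x \<notin> Lc B E" by (rule Lc_insert(1)[OF EB(3) x(1)])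
  show "\<Lambda> = adj (Lc B E) x" using Lc_insert(2)[OF EB(3) x(1)] x(2) \<Lambda>_Lc by simp
  have lN: "lat N" using \<Lambda>_facts by simp
  show "br v w \<in> N" if "v \<in> Lc B E" "w \<in> Lc B E" for v w
    by (rule br_Lc_Lc[OF that EB(1,1) lN]) (use ab lat_zero[OF lN] in auto)
  have im': "br x v \<in> Lc B E1" if "v \<in> Lc B E" for v
    by (rule br_Lc_right[OF that basis_\<Lambda>[OF EB(3)] lat_Lc' N_Lc_subset]) (rule im)
  thus "br x v \<in> Lc B E" if "v \<in> Lc B E" for v using that Lc_mono[OF E1] by blast
  show "idx (Lc B E) N = q ^ card E" by (rule idx_Lc_N[OF EB(1)])
  have "Img (br x) N (Lc B E) = Lc B E1"
  proof
    show "Img (br x) N (Lc B E) \<subseteq> Lc B E1"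
    proof
      fix u assume "u \<in> Img (br x) N (Lc B E)"
      then obtain v n where v: "v \<in> Lc B E" "n \<in> N" "u = br x v + n" unfolding Img_def by blast
      have "n \<in> Lc B E1" using v(2) N_Lc_subset by blast
      thus "u \<in> Lc B E1" unfolding v(3) by (rule lat_add[OF lat_Lc' im'[OF v(1)]])
    qed
    have I: "Img (br x) N (Lc B E) \<in> betw N (Lc B E)"
      by (rule Img_betw[OF _ lin_right]) (use quot_Lc[of "{}" E] EB N_Lc subsetD[OF Lc_mono[OF E1] im'] br_N basis_\<Lambda> in auto)
    show "Lc B E1 \<subseteq> Img (br x) N (Lc B E)"
    proof
      fix v assume v: "v \<in> Lc B E1"
      show "v \<in> Img (br x) N (Lc B E)"
      proof (rule Lc_map[OF v, of "\<lambda>v. v"])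
        show "lin (\<lambda>v. v)" by (simp add: lin_def)
        fix u assume "u \<in> E1"
        then obtain w where "w \<in> Lc B E" "br x w = u" using onto by blast
        hence "u = br x w + 0 \<and> w \<in> Lc B E \<and> 0 \<in> N" using lat_zero[OF lN] by simp
        thus "u \<in> Img (br x) N (Lc B E)" unfolding Img_def by blast
      qed (use I basis_\<Lambda> in \<open>auto simp: betw_def\<close>)
    qed
  qed
  moreover have "card (E - E1) = card E - card E1" by (rule card_Diff_subset) (use E1 EB finite_B finite_subset in auto)
  ultimately show "idx (Lc B E) (Img (br x) N (Lc B E)) = q ^ (card E - card E1)" using idx_Lc[OF E1 EB(1)] by simp
qed

lemma plane_pencil_Lc:
  assumes B: "B = {x, y, v, w}" "card B = 4"
    and r: "br v w = 0" "br x v = v" "br x w = w" "br x y = 0" "br y v = w" "br y w \<in> Lc B {v, w}"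
  shows "plane_pencil A M scale br N \<Lambda> (Lc B {x, v, w}) (Lc B {v, w}) x y"
proof unfold_locales
  have d: "x \<noteq> y" "x \<noteq> v" "x \<noteq> w" "y \<noteq> v" "y \<noteq> w" "v \<noteq> w" using B by (auto simp: card_insert_if split: if_splits)
  have mB: "x \<in> B" "y \<in> B" "v \<in> B" "w \<in> B" using B by auto
  have s: "{v, w} \<subseteq> B" "{x, v, w} \<subseteq> B" using mB by auto
  have lN: "lat N" "0 \<in> N" using \<Lambda>_facts lat_zero by auto
  show "Lc B {x, v, w} \<in> betw N \<Lambda>" unfolding \<Lambda>_Lc by (rule Lc_betw[OF s(2)])
  show "Lc B {v, w} \<in> betw N (Lc B {x, v, w})" by (rule Lc_betw) auto
  show "x \<notin> Lc B {v, w}" "Lc B {x, v, w} = adj (Lc B {v, w}) x" using Lc_insert[of x "{v, w}"] mB d by auto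
  have "B = insert y {x, v, w}" using B by auto
  thus "y \<notin> Lc B {x, v, w}" "\<Lambda> = adj (Lc B {x, v, w}) y" using Lc_insert[of y "{x, v, w}"] mB d \<Lambda>_Lc by auto
  have "br w v = 0" using br_anti[of w v] r by simp
  show "br s t \<in> N" if "s \<in> Lc B {v, w}" "t \<in> Lc B {v, w}" for s t
    by (rule br_Lc_Lc[OF that s(1,1) lN(1)]) (use r br_self lN \<open>br w v = 0\<close> in auto)
  show "br x s - s \<in> N" if "s \<in> Lc B {v, w}" for s
    by (rule Lc_map[OF that, of "\<lambda>s. br x s - s"])
      (use r lN br_\<Lambda> basis_\<Lambda> mB lat_diff[OF \<Lambda>_facts(2)] in \<open>auto simp: lin_def scale_right_diff_distrib\<close>)
  show "br y s \<in> Lc B {v, w}" if "s \<in> Lc B {v, w}" for s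
    by (rule br_Lc_right[OF that basis_\<Lambda>[OF mB(2)] lat_Lc' N_Lc_subset]) (use r basis_Lc[of w "{v, w}"] mB in auto)
  show "br x y \<in> N" using r lN by simp
  show "idx (Lc B {v, w}) N = q\<^sup>2" using idx_Lc_N[OF s(1)] d by (simp add: power2_eq_square)
  \<comment> \<open>The vector v works for every a, since [y, v] - a v = w - a v has coordinate 1 at
    w.\<close>
  show "\<exists>s\<in>Lc B {v, w}. br y s - a \<star> s \<notin> N" if "a \<in> A" for a
  proof
    show "v \<in> Lc B {v, w}" using basis_Lc mB by simp
    have sp: "v \<in> span B" "w \<in> span B" using mB span_base by auto
    have "representation B (w - a \<star> v) w = 1"
      using rep_diff[OF sp(2) span_scale[OF sp(1)]] rep_scale[OF sp(1)] rep_basis mB d by simp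
    hence "w - a \<star> v \<notin> N" using one_notin_M mB(4) unfolding N_Lc Lc_def by (metis (no_types, lifting) empty_iff mem_Collect_eq)
    thus "br y v - a \<star> v \<notin> N" using r(5) by simp
  qed
qed

lemma heisenberg_ext_Lc:
  assumes B: "B = {x, a, b, z}" "card B = 4"
    and r: "br a b = z" "br z a = 0" "br z b = 0" "br x a \<in> Lc B {a, b, z}" "br x b \<in> Lc B {a, b, z}" "br x z \<in> Lc B {z}"
    and onto: "\<And>c. c \<in> {a, b} ==> \<exists>k\<in>A. \<exists>l\<in>A. \<exists>m\<in>A. c = k \<star> br x a + l \<star> br x b + m \<star> z"
  shows "heisenberg_ext A M scale br N \<Lambda> (Lc B {a, b, z}) (Lc B {z}) x"
proof unfold_locales
  let ?V = "Lc B {a, b, z}" and ?Z = "Lc B {z}"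
  have d: "x \<noteq> a" "x \<noteq> b" "x \<noteq> z" "a \<noteq> b" "a \<noteq> z" "b \<noteq> z" using B by (auto simp: card_insert_if split: if_splits)
  have mB: "x \<in> B" "a \<in> B" "b \<in> B" "z \<in> B" using B by auto
  have s: "{z} \<subseteq> B" "{a, b, z} \<subseteq> B" using mB by auto
  have lN: "lat N" "0 \<in> N" using \<Lambda>_facts lat_zero by auto
  have ZV: "?Z \<subseteq> ?V" by (rule Lc_mono) auto
  have zZ: "z \<in> ?Z" using basis_Lc mB by simp
  show "?V \<in> betw N \<Lambda>" unfolding \<Lambda>_Lc by (rule Lc_betw[OF s(2)])
  show "x \<notin> ?V" using Lc_insert[of x "{a, b, z}"] mB d by auto
  show "\<Lambda> = adj ?V x" using Lc_insert(2)[of x "{a, b, z}"] mB d \<Lambda>_Lc B by auto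
  show Z: "?Z \<in> betw N ?V" by (rule Lc_betw) auto
  have "{a, b, z} - {z} = {a, b}" using d by auto
  thus "idx ?V ?Z = q\<^sup>2" using idx_Lc[of "{z}" "{a, b, z}"] s d by (simp add: power2_eq_square)
  show "idx ?Z N = q" using idx_Lc_N[OF s(1)] by simp
  have r': "br b a = - z" "br a z = 0" "br b z = 0" using br_anti[of b a] br_anti[of a z] br_anti[of b z] r by auto
  have mz: "- z \<in> ?Z" using lat_minus[OF lat_Lc' zZ] .
  show "br v w \<in> ?Z" if "v \<in> ?V" "w \<in> ?V" for v w
    by (rule br_Lc_Lc[OF that s(2,2)]) (use r r' br_self zZ mz lat_zero[OF lat_Lc'] in auto)
  show VZ: "br v w \<in> N" if "v \<in> ?V" "w \<in> ?Z" for v w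
    by (rule br_Lc_Lc[OF that s(2,1) lN(1)]) (use r' br_self lN in auto)
  show xV: "br x v \<in> ?V" if "v \<in> ?V" for v
    by (rule br_Lc_right[OF that basis_\<Lambda>[OF mB(1)] lat_Lc' N_Lc_subset]) (use r ZV in auto)
  show xZ: "br x w \<in> ?Z" if "w \<in> ?Z" for w
    by (rule br_Lc_right[OF that basis_\<Lambda>[OF mB(1)] lat_Lc' N_Lc_subset]) (use r in auto)
  \<comment> \<open>Modulo N, the brackets of v with b and with a read off its coordinates at a and
    b, up to sign; if both lie in M, then v is in \<open>?Z\<close>.\<close>
  show "\<exists>w\<in>?V. br v w \<notin> N" if v: "v \<in> ?V" "v \<notin> ?Z" for v
  proof (rule ccontr)
    assume *: "\<not> (\<exists>w\<in>?V. br v w \<notin> N)"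
    let ?k = "representation B v a" and ?l = "representation B v b"
    have sp: "v \<in> span B" "a \<in> span B" "b \<in> span B" "z \<in> span B" using v mB span_base by (auto simp: Lc_def)
    have kl: "?k \<in> A" "?l \<in> A" using v mB by (auto simp: Lc_def)
    define u where "u = v - ?k \<star> a - ?l \<star> b"
    have ru: "representation B u c = representation B v c - (if c = a then ?k else 0) - (if c = b then ?l else 0)" for c
      unfolding u_def using sp d mB by (simp add: rep_diff rep_scale rep_basis span_diff span_scale)
    have "u \<in> span B" unfolding u_def using sp by (intro span_diff span_scale)
    hence uZ: "u \<in> ?Z" using v(1) ru d zero_M unfolding Lc_def by (auto split: if_splits)
    have ab: "a \<in> ?V" "b \<in> ?V" using basis_Lc mB by auto
    have "br u b \<in> N" "br u a \<in> N"
      using lat_minus[OF lN(1) VZ[OF ab(2) uZ]] lat_minus[OF lN(1) VZ[OF ab(1) uZ]] br_anti[of u b] br_anti[of u a] by auto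
    moreover have "br v b = br u b + ?k \<star> z" "br v a = br u a + (- ?l) \<star> z" using r r' by (simp_all add: u_def br_self)
    moreover have "br v b \<in> N" "br v a \<in> N" using * ab by auto
    ultimately have "?k \<star> z \<in> N" "(- ?l) \<star> z \<in> N" using lat_add_iff[OF lN(1)] by (metis add.commute)+
    hence "representation B (?k \<star> z) z \<in> M" "representation B ((- ?l) \<star> z) z \<in> M" using mB by (auto simp: N_Lc Lc_def)
    hence "?k \<in> M" "- ?l \<in> M" unfolding rep_scale[OF sp(4)] using rep_basis[OF mB(4)] by auto
    hence "?k \<in> M" "?l \<in> M" using uminus_M[of "- ?l"] by auto
    hence "v \<in> ?Z" using v(1) unfolding Lc_def by (auto split: if_splits)
    thus False using v(2) by simp
  qed
  have I: "Img (br x) ?Z ?V \<in> betw ?Z ?V"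
    by (rule Img_betw[OF _ lin_right]) (use quot_Lc[of "{z}" "{a, b, z}"] s xV xZ in auto)
  show "Img (br x) ?Z ?V = ?V"
  proof
    show "Img (br x) ?Z ?V \<subseteq> ?V" using I by (simp add: betw_def)
    have ab: "a \<in> ?V" "b \<in> ?V" using basis_Lc mB by auto
    have lI: "lat (Img (br x) ?Z ?V)" "?Z \<subseteq> Img (br x) ?Z ?V" using I by (auto simp: betw_def)
    have mem: "c \<in> Img (br x) ?Z ?V" if c: "c \<in> {a, b}" for c
    proof -
      obtain k l m where k: "k \<in> A" "l \<in> A" "m \<in> A" "c = k \<star> br x a + l \<star> br x b + m \<star> z" using onto[OF c] by blast
      have "c = br x (k \<star> a + l \<star> b) + m \<star> z \<and> k \<star> a + l \<star> b \<in> ?V \<and> m \<star> z \<in> ?Z"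
        using k ab zZ lat_add[OF lat_Lc'] lat_scale[OF lat_Lc'] by simp
      thus ?thesis unfolding Img_def by blast
    qed
    show "?V \<subseteq> Img (br x) ?Z ?V"
    proof
      fix v assume v: "v \<in> ?V"
      show "v \<in> Img (br x) ?Z ?V"
      proof (rule Lc_map[OF v, of "\<lambda>v. v"])
        show "lin (\<lambda>v. v)" by (simp add: lin_def)
        show "N \<subseteq> Img (br x) ?Z ?V" using lI(2) N_Lc_subset by blast
        fix c assume "c \<in> {a, b, z}"
        thus "c \<in> Img (br x) ?Z ?V" using mem lI(2) zZ by auto
      qed (use lI basis_\<Lambda> in auto)
    qed
  qed
qed

end

section \<open>Transfer to almost all primes\<close>

context lie_coords
begin

lemma unit_expand: "v \<in> ambient ==> v = (\<Sum>i<n. vscale (v i) (unit i))"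
proof
  fix j assume v: "v \<in> ambient"
  have "(\<Sum>i<n. vscale (v i) (unit i)) j = (\<Sum>i<n. if j = i then v i else 0)"
    unfolding sum_fun_apply by (rule sum.cong) (auto simp: unit_apply)
  also have "\<dots> = v j" using v by (simp add: ambient_def)
  finally show "v j = (\<Sum>i<n. vscale (v i) (unit i)) j" ..
qed

lemma ambient_subspace: "vs.subspace ambient"
  by (auto simp: vs.subspace_def ambient_def)

lemma unit_ambient: "i < n ==> unit i \<in> ambient"
  by (simp add: ambient_def unit_apply)

lemma ambient_basis: "\<exists>B. finite B \<and> vs.independent B \<and> vs.span B = ambient \<and> card B = n"
proof -
  let ?U = "unit ` {..<n}"
  have inj: "inj_on unit {..<n}"
  proof (rule inj_onI)
    fix i j assume "i \<in> {..<n}" "j \<in> {..<n}" "unit i = unit j"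
    thus "i = j" using unit_apply[of i i] unit_apply[of j i] by (metis lessThan_iff zero_neq_one)
  qed
  have "vs.independent ?U"
  proof
    assume "vs.dependent ?U"
    then obtain u v where u: "v \<in> ?U" "u v \<noteq> 0" "(\<Sum>v\<in>?U. vscale (u v) v) = 0"
      using vs.dependent_finite[of ?U] by auto
    then obtain i where i: "i < n" "v = unit i" by blast
    have "0 = (\<Sum>v\<in>?U. vscale (u v) v) i" using u(3) by simp
    also have "\<dots> = (\<Sum>j<n. vscale (u (unit j)) (unit j)) i" using inj by (simp add: sum.reindex)
    also have "\<dots> = (\<Sum>j<n. if i = j then u (unit j) else 0)"
      unfolding sum_fun_apply by (rule sum.cong) (auto simp: unit_apply)
    also have "\<dots> = u v" using i by simp
    finally show False using u(2) by simp
  qed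
  moreover have "vs.span ?U = ambient"
  proof
    show "vs.span ?U \<subseteq> ambient" using unit_ambient by (intro vs.span_minimal ambient_subspace) auto
    show "ambient \<subseteq> vs.span ?U"
    proof
      fix v assume "v \<in> ambient"
      hence "v = (\<Sum>i<n. vscale (v i) (unit i))" by (rule unit_expand)
      moreover have "(\<Sum>i<n. vscale (v i) (unit i)) \<in> vs.span ?U"
        by (intro vs.span_sum vs.span_scale vs.span_base) auto
      ultimately show "v \<in> vs.span ?U" by simp
    qed
  qed
  moreover have "card ?U = n" using inj by (simp add: card_image)
  ultimately show ?thesis by blast
qed

lemma ambient_span: "ambient \<subseteq> vs.span (coord ` carrier L)"
proof
  fix v assume "v \<in> ambient"
  hence "v = (\<Sum>i<n. vscale (v i) (unit i))" by (rule unit_expand)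
  moreover have "(\<Sum>i<n. vscale (v i) (unit i)) \<in> vs.span (coord ` carrier L)"
    by (intro vs.span_sum vs.span_scale vs.span_base) (auto simp: unit_def)
  ultimately show "v \<in> vs.span (coord ` carrier L)" by simp
qed

lemma br_0': "br u 0 = 0" "br 0 u = 0" by (simp_all add: fun_eq_iff br_def)

lemma br_span:
  assumes U: "U \<subseteq> carrier L" "W \<subseteq> carrier L" and Z: "\<And>x y. x \<in> U ==> y \<in> W ==> lie L x y \<in> Z"
    and u: "u \<in> vs.span (coord ` U)" and v: "v \<in> vs.span (coord ` W)"
  shows "br u v \<in> vs.span (coord ` Z)"
proof -
  let ?S = "vs.span (coord ` Z)"
  have 1: "br (coord x) v \<in> ?S" if x: "x \<in> U" for x
  proof -
    have "vs.subspace {v. br (coord x) v \<in> ?S}"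
      by (auto simp: vs.subspace_def br_linear br_0' intro: vs.span_add vs.span_scale vs.span_zero)
    moreover have "coord ` W \<subseteq> {v. br (coord x) v \<in> ?S}"
    proof
      fix v assume "v \<in> coord ` W"
      then obtain y where y: "y \<in> W" "v = coord y" by blast
      have "x \<in> carrier L" "y \<in> carrier L" using U x y by blast+
      hence "br (coord x) v = coord (lie L x y)" using coord_lie y(2) by simp
      moreover have "coord (lie L x y) \<in> ?S" using Z[OF x y(1)] by (intro vs.span_base imageI)
      ultimately show "v \<in> {v. br (coord x) v \<in> ?S}" by simp
    qed
    ultimately have "vs.span (coord ` W) \<subseteq> {v. br (coord x) v \<in> ?S}" by (intro vs.span_minimal)
    thus ?thesis using v by blast
  qed
  have "vs.subspace {u. br u v \<in> ?S}"
    by (auto simp: vs.subspace_def br_linear br_0' intro: vs.span_add vs.span_scale vs.span_zero)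
  moreover have "coord ` U \<subseteq> {u. br u v \<in> ?S}" using 1 by blast
  ultimately have "vs.span (coord ` U) \<subseteq> {u. br u v \<in> ?S}" by (intro vs.span_minimal)
  thus ?thesis using u by blast
qed

lemma lie_span_mem: "x \<in> U ==> y \<in> W ==> lie L x y \<in> lie_span OK L U W"
  unfolding lie_span_def by blast

lemma lie_span_carrier: "U \<subseteq> carrier L ==> W \<subseteq> carrier L ==> lie_span OK L U W \<subseteq> carrier L"
  unfolding lie_span_def using carrier_is_submodule lie_closed by blast

lemma derived_series_carrier: "derived_series OK L k \<subseteq> carrier L"
  by (induction k) (use lie_span_carrier in auto)

lemma lower_central_series_carrier: "lower_central_series OK L k \<subseteq> carrier L"
  by (induction k) (use lie_span_carrier in auto)

lemma span_coord_zero: "vs.span (coord ` {\<zero>\<^bsub>L\<^esub>}) = {0}"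
  by (simp add: coord_zero)

text \<open>A subspace contained in its own derived subspace stays, by induction, in the K-span of
  every term of the derived series of L, and some term is 0.\<close>

lemma solvable_imp:
  assumes solv: "solvable_lie OK L" and S: "vs.subspace S" "S \<subseteq> ambient" "S \<subseteq> vs.span {br u v | u v. u \<in> S \<and> v \<in> S}"
  shows "S = {0}"
proof -
  have "S \<subseteq> vs.span (coord ` derived_series OK L k)" for k
  proof (induction k)
    case 0 show ?case unfolding derived_series.simps using S(2) ambient_span by (rule subset_trans)
  next
    case (Suc k)
    have "{br u v | u v. u \<in> S \<and> v \<in> S} \<subseteq> vs.span (coord ` derived_series OK L (Suc k))"
    proof
      fix s assume "s \<in> {br u v | u v. u \<in> S \<and> v \<in> S}"
      then obtain u v where uv: "u \<in> S" "v \<in> S" "s = br u v" by blast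
      show "s \<in> vs.span (coord ` derived_series OK L (Suc k))" unfolding uv(3) derived_series.simps
        by (rule br_span[OF derived_series_carrier derived_series_carrier lie_span_mem subsetD[OF Suc uv(1)] subsetD[OF Suc uv(2)]])
    qed
    thus ?case using S(3) vs.span_minimal[OF _ vs.subspace_span] by blast
  qed
  moreover obtain m where "derived_series OK L m = {\<zero>\<^bsub>L\<^esub>}" using solv by (auto simp: solvable_lie_def)
  ultimately have "S \<subseteq> {0}" using span_coord_zero by metis
  thus ?thesis using vs.subspace_0[OF S(1)] by blast
qed

text \<open>Applying ad u k times leads into the K-span of the k-th term of the lower central
  series, so one exponent m serves all u.\<close>

lemma nilpotent_imp:
  assumes "nilpotent_lie OK L"
  shows "\<exists>m. \<forall>u\<in>ambient. \<forall>v\<in>ambient. (br u ^^ m) v = 0"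
proof -
  obtain m where m: "lower_central_series OK L m = {\<zero>\<^bsub>L\<^esub>}" using assms by (auto simp: nilpotent_lie_def)
  have "(br u ^^ k) v \<in> vs.span (coord ` lower_central_series OK L k)" if uv: "u \<in> ambient" "v \<in> ambient" for u v k
  proof (induction k)
    case 0 show ?case unfolding lower_central_series.simps funpow_0 using subsetD[OF ambient_span uv(2)] .
  next
    case (Suc k)
    have u: "u \<in> vs.span (coord ` carrier L)" using uv ambient_span by blast
    show ?case unfolding lower_central_series.simps funpow.simps o_apply
      by (rule br_span[OF order_refl lower_central_series_carrier lie_span_mem u Suc])
  qed
  hence "(br u ^^ m) v = 0" if "u \<in> ambient" "v \<in> ambient" for u v using that m span_coord_zero by (metis singletonD)
  thus ?thesis by blast
qed

lemma solvable_bracket: "solvable_lie OK L ==> solvable_bracket vscale br ambient n"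
  by unfold_locales (use ambient_subspace br_linear br_self br_jacobi br_ambient ambient_basis solvable_imp in auto)

end

locale lie_number_ring = lie_coords L n b
  for L :: "('k::field_char_0, 'a) lie_module" and n b +
  assumes number_field: "number_field TYPE('k)"
begin

sublocale NR: number_ring "TYPE('k)"
  by unfold_locales (use number_field R.is_cring in auto)

definition Lam where "Lam I = {v \<in> ambient. \<forall>i. v i \<in> NR.loc I}"
definition LamM where "LamM I = {v \<in> ambient. \<forall>i. v i \<in> NR.locM I}"

abbreviation resq where "resq I \<equiv> local_ring.q (NR.loc I) (NR.locM I)"
abbreviation basis_lattice where "basis_lattice I \<equiv> lattice_space.Lc (NR.loc I) (NR.locM I) (vscale :: 'k => (nat => 'k) => nat => 'k)"
abbreviation adapted where "adapted I B \<equiv> adapted_lattice (NR.loc I) (NR.locM I) vscale br (LamM I) (Lam I) B"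

lemma reduction_coords: "I \<in> NR.P ==> reduction_coords L n b (NR.loc I) (NR.locM I) I"
  by (intro reduction_coords.intro reduction_coords_axioms.intro lie_coords_axioms)
    (rule NR.loc_facts NR.PD(1); assumption)+

lemma
  assumes I: "I \<in> NR.P"
  shows lie_lattice: "lie_lattice (NR.loc I) (NR.locM I) vscale br (LamM I) (Lam I)"
    and idx_Lam: "idx (Lam I) (LamM I) = resq I ^ n"
    and num_codim: "num_codim t (OK Quot I) (reduction OK I L) i = lie_lattice.num (NR.loc I) (NR.locM I) vscale br (LamM I) (Lam I) t i"
    and card_residue: "card (carrier (OK Quot I)) = resq I"
proof -
  interpret R: reduction_coords L n b "NR.loc I" "NR.locM I" I by (rule reduction_coords[OF I])
  have e: "Lam I = R.\<Lambda>" "LamM I = R.\<Lambda>M" by (simp_all add: Lam_def LamM_def R.\<Lambda>_def R.\<Lambda>M_def)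
  show "lie_lattice (NR.loc I) (NR.locM I) vscale br (LamM I) (Lam I)" unfolding e by (rule R.LL.lie_lattice_axioms)
  show "idx (Lam I) (LamM I) = resq I ^ n" unfolding e by (rule R.idx_\<Lambda>)
  show "num_codim t (OK Quot I) (reduction OK I L) i = lie_lattice.num (NR.loc I) (NR.locM I) vscale br (LamM I) (Lam I) t i"
    unfolding e by (rule R.num_codim_eq)
  show "card (carrier (OK Quot I)) = resq I" by (rule R.card_F)
qed

lemma eventually_locs: "finite S ==> \<forall>\<^sub>F I in NR.almost_all. \<forall>x\<in>S. x \<in> NR.loc I"
  using NR.eventually_loc by (intro eventually_ball_finite) auto

text \<open>The matrix from B to the standard basis and its inverse have finitely many entries. At
  every prime whose local ring contains them, both bases span the same lattices.\<close>

lemma eventually_adapted: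
  assumes B: "finite B" "vs.independent B" "vs.span B = ambient"
  shows "\<forall>\<^sub>F I in NR.almost_all. adapted I B"
proof -
  let ?r = "vs.representation B"
  let ?S = "(\<Union>v\<in>B. v ` {..<n}) \<union> (\<Union>i<n. ?r (unit i) ` B)"
  have "finite ?S" using B(1) by auto
  from eventually_locs[OF this] NR.eventually_P show ?thesis
  proof eventually_elim
    case (elim I)
    have I: "I \<in> NR.P" by fact
    have loc: "v i \<in> NR.loc I" if "v \<in> B" "i < n" for v i using elim(1) that by blast
    have loc': "?r (unit i) v \<in> NR.loc I" if "v \<in> B" "i < n" for v i using elim(1) that by blast
    interpret lie_lattice "NR.loc I" "NR.locM I" vscale br "LamM I" "Lam I" by (rule lie_lattice[OF I])
    have sumA: "sum f T \<in> NR.loc I" if "\<And>x. x \<in> T ==> f x \<in> NR.loc I" for T :: "'z set" and f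
      using that by (induction T rule: infinite_finite_induct) (auto simp: zero_A add_A)
    have sumM: "sum f T \<in> NR.locM I" if "\<And>x. x \<in> T ==> f x \<in> NR.locM I" for T :: "'z set" and f
      using that by (induction T rule: infinite_finite_induct) (auto simp: zero_M add_M)
    have rep: "?r v c = (\<Sum>i<n. ?r (unit i) c * v i)" if v: "v \<in> ambient" for v c
    proof -
      have sp: "unit i \<in> vs.span B" if "i < n" for i using unit_ambient[OF that] B(3) by simp
      have "?r v c = ?r (\<Sum>i<n. vscale (v i) (unit i)) c" using unit_expand[OF v] by simp
      also have "?r (\<Sum>i<n. vscale (v i) (unit i)) = (\<lambda>c. \<Sum>i<n. ?r (vscale (v i) (unit i)) c)"
        by (rule vs.representation_sum[OF B(2)]) (use sp in \<open>auto intro: vs.span_scale\<close>)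
      also have "(\<Sum>i<n. ?r (vscale (v i) (unit i)) c) = (\<Sum>i<n. ?r (unit i) c * v i)"
        by (rule sum.cong) (use vs.representation_scale[OF B(2) sp] in auto)
      finally show ?thesis .
    qed
    have coef: "v j = (\<Sum>c\<in>B. c j * ?r v c)" if v: "v \<in> ambient" for v j
    proof -
      have "(\<Sum>c\<in>B. vscale (?r v c) c) = v" using vs.sum_representation_eq[OF B(2) _ B(1) order_refl, of v] v B(3) by simp
      hence "v j = (\<Sum>c\<in>B. vscale (?r v c) c) j" by simp
      thus ?thesis by (simp add: mult.commute)
    qed
    have z: "v i = 0" if "v \<in> ambient" "\<not> i < n" for v i using that by (simp add: ambient_def)
    have locB: "c j \<in> NR.loc I" if "c \<in> B" for c j
      using loc[OF that, of j] z[of c j] vs.span_base[OF that] B(3) zero_A by (cases "j < n") auto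
    show "adapted I B"
    proof
      show "Lam I = Lc B B"
      proof (intro equalityI subsetI)
        fix v assume "v \<in> Lam I"
        hence v: "v \<in> ambient" "\<And>i. v i \<in> NR.loc I" by (auto simp: Lam_def)
        thus "v \<in> Lc B B" using B(3) by (auto simp: Lc_def rep intro!: sumA mult_A loc')
      next
        fix v assume "v \<in> Lc B B"
        hence v: "v \<in> ambient" "\<And>c. c \<in> B ==> ?r v c \<in> NR.loc I" using B(3) by (auto simp: Lc_def)
        have "v j \<in> NR.loc I" for j unfolding coef[OF v(1), of j] by (intro sumA mult_A v(2) locB)
        thus "v \<in> Lam I" using v(1) by (simp add: Lam_def)
      qed
      show "LamM I = Lc B {}"
      proof (intro equalityI subsetI)
        fix v assume "v \<in> LamM I"
        hence v: "v \<in> ambient" "\<And>i. v i \<in> NR.locM I" by (auto simp: LamM_def)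
        thus "v \<in> Lc B {}" using B(3) by (auto simp: Lc_def rep intro!: sumM mult_M loc')
      next
        fix v assume "v \<in> Lc B {}"
        hence v: "v \<in> ambient" "\<And>c. c \<in> B ==> ?r v c \<in> NR.locM I" using B(3) by (auto simp: Lc_def)
        have "v j \<in> NR.locM I" for j unfolding coef[OF v(1), of j] by (intro sumM mult_M v(2) locB)
        thus "v \<in> LamM I" using v(1) by (simp add: LamM_def)
      qed
    qed (use B in auto)
  qed
qed

text \<open>Finitely many coordinates of u have to lie in the local ring; those outside S are
  0.\<close>

lemma eventually_basis_lattice:
  assumes B: "finite B" "vs.independent B" "S \<subseteq> B" and u: "u \<in> vs.span S"
  shows "\<forall>\<^sub>F I in NR.almost_all. u \<in> basis_lattice I B S"
proof -
  let ?r = "vs.representation B"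
  have r0: "?r u c = 0" if "c \<notin> S" for c
    using vs.representation_extend[OF B(2) u B(3)] vs.representation_ne_zero[of S u c] that by auto
  have "finite (?r u ` B)" using B by simp
  from eventually_locs[OF this] NR.eventually_P show ?thesis
  proof eventually_elim
    case (elim I)
    interpret lie_lattice "NR.loc I" "NR.locM I" vscale br "LamM I" "Lam I" by (rule lie_lattice[OF elim(2)])
    have "u \<in> vs.span B" using u vs.span_mono[OF B(3)] by blast
    thus ?case using elim(1) r0 zero_M by (auto simp: Lc_def)
  qed
qed

end

section \<open>The codimension counts as polynomials\<close>

fun gb_poly :: "nat => nat => rat poly" where
  "gb_poly 0 i = (if i = 0 then 1 else 0)"
| "gb_poly (Suc e) i = (if i = 0 then 0 else gb_poly e (i - 1)) + monom 1 i * gb_poly e i"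

lemma poly_gb_poly [simp]: "poly (gb_poly e i) (of_nat q) = of_nat (gb q e i)"
  by (induction e arbitrary: i) (auto simp: poly_monom)

definition eigen_polys :: "nat => rat poly set" where
  "eigen_polys d = (\<lambda>m. \<Sum>j\<in>{1..d}. of_nat (m j) * gb_poly j 1) ` ({1..d} \<rightarrow>\<^sub>E {..d})"

lemma finite_eigen_polys: "finite (eigen_polys d)"
  unfolding eigen_polys_def by (intro finite_imageI finite_PiE) auto

lemma eigen_polys: "c \<in> eigen_counts d q ==> \<exists>f\<in>eigen_polys d. of_nat c = poly f (of_nat q)"
proof -
  assume "c \<in> eigen_counts d q"
  then obtain m where m: "m \<in> {1..d} \<rightarrow>\<^sub>E {..d}" "c = (\<Sum>j\<in>{1..d}. m j * gb q j 1)"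
    unfolding eigen_counts_def by blast
  let ?f = "\<Sum>j\<in>{1..d}. of_nat (m j) * gb_poly j 1"
  have "?f \<in> eigen_polys d" unfolding eigen_polys_def using m(1) by blast
  moreover have "of_nat c = poly ?f (of_nat q)"
    unfolding m(2) poly_sum poly_mult poly_of_nat poly_gb_poly of_nat_sum of_nat_mult ..
  ultimately show ?thesis by blast
qed

text \<open>The number of invariant subspaces of codimension \<open>i\<close> in dimension \<open>d \<le> 3\<close> is
  \<open>inv_const d i + inv_slope d i * \<iota>\<close>, where \<open>\<iota>\<close> is the number of invariant hyperplanes.\<close>

definition inv_const :: "nat => nat => rat poly" where "inv_const d i = (if i = 0 \<or> i = d then 1 else 0)"
definition inv_slope :: "nat => nat => rat poly" where "inv_slope d i = (if 0 < i \<and> i < d then 1 else 0)"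

context lattice_space
begin

lemma of_nat_invs:
  assumes "quot N V" "idx V N = q ^ d" "lin T" "T ` V \<subseteq> V" "T ` N \<subseteq> N" "d \<le> 3"
  shows "of_nat (invs T N V i) = poly (inv_const d i) x + poly (inv_slope d i) x * of_nat (invs T N V 1)"
  unfolding invs_le_3[OF assms, of i] by (auto simp: inv_const_def inv_slope_def)

end

context almost_abelian
begin

lemma T_facts: "br x ` V \<subseteq> V" "br x ` N \<subseteq> N"
  using x_V br_N facts by auto

lemmas inv_facts = facts(7) idx_V lin_right[of x] T_facts

lemmas of_nat_invs' = of_nat_invs[OF inv_facts, where x = "of_nat q"]

lemma of_nat_num:
  assumes "d \<le> 3"
  shows "of_nat (num Subalgebras i) = poly ((if i = 0 then 0 else gb_poly d (i - 1)) + monom 1 i * inv_const d i) (of_nat q)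
      + poly (monom 1 i * inv_slope d i) (of_nat q) * of_nat (invs (br x) N V 1)"
    and "of_nat (num Ideals i) = poly ((if i = 0 then 0 else inv_const d (i - 1)) + monom 1 i * gb_poly e i) (of_nat q)
      + poly (if i = 0 then 0 else inv_slope d (i - 1)) (of_nat q) * of_nat (invs (br x) N V 1)"
  unfolding num_Subalgebras num_Ideals
  using of_nat_invs'[OF assms, of i] of_nat_invs'[OF assms, of "i - 1"]
  by (simp_all add: poly_monom algebra_simps del: One_nat_def)

end

context plane_pencil
begin

lemma of_nat_invs': "of_nat (invs (br y) N V i) =
    poly (inv_const 2 i) (of_nat q) + poly (inv_slope 2 i) (of_nat q) * of_nat (invs (br y) N V 1)"
  by (rule of_nat_invs[OF quots(3) idx_V lin_right T_facts]) simp

lemma of_nat_num: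
  shows "of_nat (num Subalgebras i) = poly ((if i = 0 then 0 else gb_poly 3 (i - 1))
        + monom 1 i * ((if i = 0 then 0 else inv_const 2 (i - 1)) + inv_const 2 i)) (of_nat q)
      + poly (monom 1 i * ((if i = 0 then 0 else inv_slope 2 (i - 1)) + inv_slope 2 i)) (of_nat q) * of_nat (invs (br y) N V 1)" (is ?S)
    and "of_nat (num Ideals i) = poly (if i = 0 then 1 else if i = 1 then [:1, 1:] else if i = 2 then 1 else inv_const 2 (i - 2)) (of_nat q)
      + poly (if i = 0 \<or> i = 1 then 0 else if i = 2 then 1 else inv_slope 2 (i - 2)) (of_nat q) * of_nat (invs (br y) N V 1)" (is ?I)
proof -
  show ?S
    unfolding num_Subalgebras
    using of_nat_invs'[of i] of_nat_invs'[of "i - 1"] by (simp add: poly_monom algebra_simps del: One_nat_def)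
  show ?I
    unfolding num_Ideals using of_nat_invs'[of "i - 2"] by auto
qed

end

context heisenberg_ext
begin

lemma of_nat_num:
  assumes i: "i \<le> 4"
  shows "of_nat (num Subalgebras i) = poly (if i = 2 then gb_poly 2 1 + monom 1 2 else if i = 3 then gb_poly 4 3 else 1) (of_nat q)
      + poly (if i = 1 \<or> i = 2 then monom 1 i else 0) (of_nat q) * of_nat (invs (br x) Z V 1)" (is ?S)
    and "of_nat (num Ideals i) = poly (if i = 2 then 0 else 1) (of_nat q)
      + poly (if i = 2 then 1 else 0) (of_nat q) * of_nat (invs (br x) Z V 1)" (is ?I)
proof -
  have L: "idx \<Lambda> N = q ^ 4"
    using idx_mult[OF quots(1) V] idx_VN complement_facts(8)[OF quots(1) V x \<Lambda>_eq] by (simp add: eval_nat_numeral)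
  have n: "num t 0 = 1" "num t 4 = 1" "num Subalgebras 3 = gb q 4 3" for t
    using num_0 num_top[OF L] num_lines[OF L, of 3] by simp_all
  consider "i = 0" | "i = 1" | "i = 2" | "i = 3" | "i = 4" using i by linarith
  thus ?S
    by cases (simp_all add: n num_Subalgebras_1 num_Subalgebras_2 poly_monom del: One_nat_def gb.simps gb_poly.simps)
  consider "i = 0" | "i = 1" | "i = 2" | "i = 3" | "i = 4" using i by linarith
  thus ?I
    by cases (simp_all add: n num_Ideals_1 num_Ideals_2 num_Ideals_3 del: One_nat_def)
qed

end

context lie_number_ring
begin

abbreviation cnt :: "zeta_type => 'k set => nat => nat" where
  "cnt t I i \<equiv> num_codim t (OK Quot I) (reduction OK I L) i"

text \<open>The common shape of all cases: \<alpha> and \<beta> are the intercept and slope of each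
  count as an affine function of \<iota>, and Fs holds the candidates for \<iota>. The fourth clause
  is the dichotomy behind the equivalence of the two uniformities: \<iota> is harmless, or it is
  visible in both zeta functions.\<close>

definition affine_family :: "(zeta_type => nat => rat poly) => (zeta_type => nat => rat poly) => rat poly set => ('k set => rat) => bool" where
  "affine_family \<alpha> \<beta> Fs \<iota> \<longleftrightarrow> finite Fs \<and>
     (\<forall>\<^sub>F I in NR.almost_all. \<exists>f\<in>Fs. \<iota> I = poly f (of_nat (resq I))) \<and>
     (\<forall>\<^sub>F I in NR.almost_all. \<forall>t. \<forall>i\<le>n. of_nat (cnt t I i) =
        poly (\<alpha> t i) (of_nat (resq I)) + poly (\<beta> t i) (of_nat (resq I)) * \<iota> I) \<and>
     ((\<exists>f. \<forall>\<^sub>F I in NR.almost_all. \<iota> I = poly f (of_nat (resq I))) \<or> (\<forall>t. \<exists>i\<le>n. \<beta> t i \<noteq> 0)) \<and>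
     (nilpotent_lie OK L \<longrightarrow> (\<exists>f. \<forall>\<^sub>F I in NR.almost_all. \<iota> I = poly f (of_nat (resq I))))"

abbreviation fixed_hyperplanes where
  "fixed_hyperplanes I \<equiv> lattice_space.invs (NR.loc I) (NR.locM I) (vscale :: 'k => (nat => 'k) => nat => 'k)"

context
  assumes solvable: "solvable_lie OK L" and n4: "n \<le> 4"
begin

interpretation S: solvable_bracket vscale br ambient n by (rule solvable_bracket[OF solvable])

lemma affine_family_zero:
  assumes "ambient = {0}"
  shows "affine_family (\<lambda>t i. 1) (\<lambda>t i. 0) {0} (\<lambda>I. 0)"
proof -
  have n0: "n = 0"
  proof (rule ccontr)
    assume "n \<noteq> 0"
    hence "unit 0 = 0" using unit_ambient[of 0] assms by simp
    thus False using unit_apply[of 0 0] \<open>n \<noteq> 0\<close> by simp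
  qed
  have "\<forall>\<^sub>F I in NR.almost_all. \<forall>t. \<forall>i\<le>n. of_nat (cnt t I i) = (1 :: rat)"
    using NR.eventually_P
  proof eventually_elim
    case (elim I)
    show ?case unfolding n0 num_codim[OF elim] using lie_lattice.num_0[OF lie_lattice[OF elim]] by (simp add: n0)
  qed
  moreover have "\<exists>f. \<forall>\<^sub>F I in NR.almost_all. (0::rat) = poly f (of_nat (resq I))" by (rule exI[of _ 0]) simp
  ultimately show ?thesis by (simp add: affine_family_def)
qed

lemma affine_family_A:
  assumes A: "S.form_A x E E1"
  shows "\<exists>\<alpha> \<beta> Fs \<iota>. affine_family \<alpha> \<beta> Fs \<iota>"
proof -
  let ?B = "insert x E"
  have B: "x \<notin> E" "finite ?B" "vs.independent ?B" "vs.span ?B = ambient" "E1 \<subseteq> E"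
    and ab: "\<And>u v. u \<in> vs.span E ==> v \<in> vs.span E ==> br u v = 0"
    and im: "\<And>v. v \<in> ambient ==> br x v \<in> vs.span E1" and on: "\<And>u. u \<in> E1 ==> \<exists>v\<in>ambient. u = br x v"
    using A unfolding S.form_A_def by blast+
  define d where "d = card E"
  define e where "e = d - card E1"
  have n: "n = Suc d" using S.basis_card[OF B(3,4)] B(1,2) by (simp add: d_def)
  have d3: "d \<le> 3" using n n4 by simp
  \<comment> \<open>A preimage under ad x may be taken in the span of E, as subtracting a multiple
    of x from v does not change [x, v].\<close>
  have "\<forall>u\<in>E1. \<exists>w\<in>vs.span E. br x w = u"
  proof
    fix u assume "u \<in> E1"
    then obtain v where v: "v \<in> ambient" "u = br x v" using on by blast
    obtain k where k: "v - vscale k x \<in> vs.span E" using v(1) B(4) S.span_ins[of v x E] by blast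
    have "br x (v - vscale k x) = u" using v(2) by (simp only: S.br_simps vs.scale_zero_right diff_0_right)
    thus "\<exists>w\<in>vs.span E. br x w = u" using k by blast
  qed
  then obtain w where w: "\<And>u. u \<in> E1 ==> w u \<in> vs.span E" "\<And>u. u \<in> E1 ==> br x (w u) = u" by metis
  have fE: "finite E" "finite E1" using B finite_subset by auto
  have xE: "E \<subseteq> ambient" using B(4) vs.span_superset by blast
  have E1B: "E1 \<subseteq> ?B" "E \<subseteq> ?B" using B(5) by auto
  have ev1: "\<forall>\<^sub>F I in NR.almost_all. \<forall>c\<in>E. br x c \<in> basis_lattice I ?B E1"
    using fE im xE eventually_basis_lattice[OF B(2,3) E1B(1)] by (intro eventually_ball_finite) blast+
  have ev2: "\<forall>\<^sub>F I in NR.almost_all. \<forall>u\<in>E1. w u \<in> basis_lattice I ?B E"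
    using fE w(1) eventually_basis_lattice[OF B(2,3) E1B(2)] by (intro eventually_ball_finite) blast+
  have AA: "\<forall>\<^sub>F I in NR.almost_all. I \<in> NR.P \<and>
      almost_abelian (NR.loc I) (NR.locM I) vscale br (LamM I) (Lam I) (basis_lattice I ?B E) x d e"
    using ev1 ev2 eventually_adapted[OF B(2-4)] NR.eventually_P
  proof eventually_elim
    case (elim I)
    interpret adapted_lattice "NR.loc I" "NR.locM I" vscale br "LamM I" "Lam I" ?B by (rule elim(3))
    have "almost_abelian (NR.loc I) (NR.locM I) vscale br (LamM I) (Lam I) (basis_lattice I ?B E) x (card E) (card E - card E1)"
    proof (rule almost_abelian_Lc[OF B(1) refl B(5)])
      show "br c c' = 0" if "c \<in> E" "c' \<in> E" for c c' by (rule ab[OF vs.span_base[OF that(1)] vs.span_base[OF that(2)]])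
      show "br x c \<in> Lc ?B E1" if "c \<in> E" for c using elim(1) that by blast
      show "\<exists>v\<in>Lc ?B E. br x v = u" if "u \<in> E1" for u using elim(2) w(2) that by blast
    qed
    thus ?case using elim(4) by (simp add: d_def e_def)
  qed
  define \<iota> where "\<iota> I = (of_nat (fixed_hyperplanes I (br x) (LamM I) (basis_lattice I ?B E) 1) :: rat)" for I
  define \<alpha> :: "zeta_type => nat => rat poly" where "\<alpha> t i = (case t of
      Subalgebras => (if i = 0 then 0 else gb_poly d (i - 1)) + Polynomial.monom 1 i * inv_const d i
    | Ideals => (if i = 0 then 0 else inv_const d (i - 1)) + Polynomial.monom 1 i * gb_poly e i)" for t i
  define \<beta> :: "zeta_type => nat => rat poly" where "\<beta> t i = (case t of Subalgebras => Polynomial.monom 1 i * inv_slope d i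
    | Ideals => (if i = 0 then 0 else inv_slope d (i - 1)))" for t i
  have 1: "\<forall>\<^sub>F I in NR.almost_all. \<exists>f\<in>eigen_polys d. \<iota> I = poly f (of_nat (resq I))"
    using AA
  proof eventually_elim
    case (elim I)
    then interpret AA: almost_abelian "NR.loc I" "NR.locM I" vscale br "LamM I" "Lam I" "basis_lattice I ?B E" x d e by blast
    show ?case unfolding \<iota>_def by (rule eigen_polys[OF AA.invs_eigen_counts[OF AA.inv_facts]])
  qed
  have 2: "\<forall>\<^sub>F I in NR.almost_all. \<forall>t. \<forall>i\<le>n. of_nat (cnt t I i) =
      poly (\<alpha> t i) (of_nat (resq I)) + poly (\<beta> t i) (of_nat (resq I)) * \<iota> I"
    using AA
  proof eventually_elim
    case (elim I)
    then interpret AA: almost_abelian "NR.loc I" "NR.locM I" vscale br "LamM I" "Lam I" "basis_lattice I ?B E" x d e by blast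
    have c: "cnt t I i = AA.num t i" for t i by (rule num_codim) (use elim in blast)
    have "of_nat (cnt t I i) = poly (\<alpha> t i) (of_nat (resq I)) + poly (\<beta> t i) (of_nat (resq I)) * \<iota> I" for t i
      by (cases t) (simp_all only: c \<alpha>_def \<beta>_def \<iota>_def zeta_type.case AA.of_nat_num[OF d3])
    thus ?case by blast
  qed
  have 3: "(\<exists>f. \<forall>\<^sub>F I in NR.almost_all. \<iota> I = poly f (of_nat (resq I))) \<or> (\<forall>t. \<exists>i\<le>n. \<beta> t i \<noteq> 0)"
  \<comment> \<open>For d at least 2, \<iota> occurs in codimension 1 of the subalgebra count and in
    codimension 2 of the ideal count. For d = 1 the only hyperplane is 0, so \<iota> = 1, and for d
    = 0 there is none.\<close>
  proof (cases "d \<ge> 2")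
    case True
    have "\<exists>i\<le>n. \<beta> t i \<noteq> 0" for t
    proof (cases t)
      case Subalgebras thus ?thesis using True n by (intro exI[of _ 1]) (auto simp: \<beta>_def inv_slope_def monom_eq_0_iff)
    next
      case Ideals thus ?thesis using True n by (intro exI[of _ 2]) (auto simp: \<beta>_def inv_slope_def)
    qed
    thus ?thesis by blast
  next
    case False
    have "\<forall>\<^sub>F I in NR.almost_all. \<iota> I = poly (if d = 1 then 1 else 0) (of_nat (resq I))"
      using AA
    proof eventually_elim
      case (elim I)
      then interpret AA: almost_abelian "NR.loc I" "NR.locM I" vscale br "LamM I" "Lam I" "basis_lattice I ?B E" x d e by blast
      have "d = 0 \<or> d = 1" using False by linarith
      thus ?case using AA.invs_le_3[OF AA.inv_facts d3, of 1] unfolding \<iota>_def by (auto simp: One_nat_def[symmetric] simp del: One_nat_def)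
    qed
    thus ?thesis by blast
  qed
  have 4: "\<exists>f. \<forall>\<^sub>F I in NR.almost_all. \<iota> I = poly f (of_nat (resq I))" if nil: "nilpotent_lie OK L"
  proof -
    obtain m where m: "\<forall>u\<in>ambient. \<forall>v\<in>ambient. (br u ^^ m) v = 0" using nilpotent_imp[OF nil] by blast
    have xa: "x \<in> ambient" using B(4) vs.span_base[of x ?B] by blast
    have "\<forall>\<^sub>F I in NR.almost_all. \<iota> I = poly (gb_poly e 1) (of_nat (resq I))"
      using AA
    proof eventually_elim
      case (elim I)
      then interpret AA: almost_abelian "NR.loc I" "NR.locM I" vscale br "LamM I" "Lam I" "basis_lattice I ?B E" x d e by blast
      have "(br x ^^ m) v \<in> LamM I" if v: "v \<in> basis_lattice I ?B E" for v
      proof -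
        have "v \<in> Lam I" using v AA.V by (auto simp: AA.betw_def)
        hence "(br x ^^ m) v = 0" using m xa by (simp add: Lam_def)
        thus ?thesis using AA.lat_zero AA.\<Lambda>_facts(1) by simp
      qed
      from AA.invs_nilpotent[OF AA.inv_facts this AA.idx_im]
      show ?case unfolding \<iota>_def by (simp only: poly_gb_poly)
    qed
    thus ?thesis by blast
  qed
  have "affine_family \<alpha> \<beta> (eigen_polys d) \<iota>"
    unfolding affine_family_def using finite_eigen_polys 1 2 3 4 by blast
  thus ?thesis by blast
qed

lemma affine_family_C:
  assumes C: "S.form_C x y v w"
  shows "\<exists>\<alpha> \<beta> Fs \<iota>. affine_family \<alpha> \<beta> Fs \<iota>"
proof -
  let ?B = "{x, y, v, w}"
  have B: "finite ?B" "vs.independent ?B" "vs.span ?B = ambient" and c4: "card ?B = 4"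
    and r: "br v w = 0" "br x v = v" "br x w = w" "br x y = 0" "br y v = w" "br y w \<in> vs.span {v, w}"
    using C unfolding S.form_C_def by blast+
  have n: "n = 4" using S.basis_card[OF B(2,3)] c4 by simp
  have vwB: "{v, w} \<subseteq> ?B" by blast
  have PP: "\<forall>\<^sub>F I in NR.almost_all. I \<in> NR.P \<and>
      plane_pencil (NR.loc I) (NR.locM I) vscale br (LamM I) (Lam I) (basis_lattice I ?B {x, v, w}) (basis_lattice I ?B {v, w}) x y"
    using eventually_basis_lattice[OF B(1,2) vwB r(6)] eventually_adapted[OF B] NR.eventually_P
  proof eventually_elim
    case (elim I)
    interpret adapted_lattice "NR.loc I" "NR.locM I" vscale br "LamM I" "Lam I" ?B by (rule elim(2))
    show ?case using plane_pencil_Lc[OF refl c4 r(1-5) elim(1)] elim(3) by blast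
  qed
  define \<iota> where "\<iota> I = (of_nat (fixed_hyperplanes I (br y) (LamM I) (basis_lattice I ?B {v, w}) 1) :: rat)" for I
  define \<alpha> :: "zeta_type => nat => rat poly" where "\<alpha> t i = (case t of
      Subalgebras => (if i = 0 then 0 else gb_poly 3 (i - 1))
        + Polynomial.monom 1 i * ((if i = 0 then 0 else inv_const 2 (i - 1)) + inv_const 2 i)
    | Ideals => (if i = 0 then 1 else if i = 1 then [:1, 1:] else if i = 2 then 1 else inv_const 2 (i - 2)))" for t i
  define \<beta> :: "zeta_type => nat => rat poly" where "\<beta> t i = (case t of
      Subalgebras => Polynomial.monom 1 i * ((if i = 0 then 0 else inv_slope 2 (i - 1)) + inv_slope 2 i)
    | Ideals => (if i = 0 \<or> i = 1 then 0 else if i = 2 then 1 else inv_slope 2 (i - 2)))" for t i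
  have 1: "\<forall>\<^sub>F I in NR.almost_all. \<exists>f\<in>eigen_polys 2. \<iota> I = poly f (of_nat (resq I))"
    using PP
  proof eventually_elim
    case (elim I)
    then interpret PP: plane_pencil "NR.loc I" "NR.locM I" vscale br "LamM I" "Lam I" "basis_lattice I ?B {x, v, w}" "basis_lattice I ?B {v, w}" x y by blast
    show ?case unfolding \<iota>_def by (rule eigen_polys[OF PP.invs_eigen_counts[OF PP.quots(3) PP.idx_V PP.lin_right PP.T_facts]])
  qed
  have 2: "\<forall>\<^sub>F I in NR.almost_all. \<forall>t. \<forall>i\<le>n. of_nat (cnt t I i) =
      poly (\<alpha> t i) (of_nat (resq I)) + poly (\<beta> t i) (of_nat (resq I)) * \<iota> I"
    using PP
  proof eventually_elim
    case (elim I)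
    then interpret PP: plane_pencil "NR.loc I" "NR.locM I" vscale br "LamM I" "Lam I" "basis_lattice I ?B {x, v, w}" "basis_lattice I ?B {v, w}" x y by blast
    have c: "cnt t I i = PP.num t i" for t i by (rule num_codim) (use elim in blast)
    have "of_nat (cnt t I i) = poly (\<alpha> t i) (of_nat (resq I)) + poly (\<beta> t i) (of_nat (resq I)) * \<iota> I" for t i
      by (cases t) (simp_all only: c \<alpha>_def \<beta>_def \<iota>_def zeta_type.case PP.of_nat_num)
    thus ?case by blast
  qed
  have 3: "\<exists>i\<le>n. \<beta> t i \<noteq> 0" for t
  proof (cases t)
    case Subalgebras thus ?thesis using n by (intro exI[of _ 1]) (auto simp: \<beta>_def inv_slope_def monom_eq_0_iff)
  next
    case Ideals thus ?thesis using n by (intro exI[of _ 2]) (auto simp: \<beta>_def)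
  qed
  \<comment> \<open>ad x fixes v, so no power of it vanishes.\<close>
  have 4: "\<not> nilpotent_lie OK L"
  proof
    assume "nilpotent_lie OK L"
    then obtain m where m: "\<forall>u\<in>ambient. \<forall>v\<in>ambient. (br u ^^ m) v = 0" using nilpotent_imp by blast
    have "x \<in> ambient" "v \<in> ambient" using B(3) vs.span_superset[of ?B] by auto
    moreover have "(br x ^^ m) v = v" by (induction m) (simp_all add: r(2))
    ultimately have "v = 0" using m by metis
    thus False using B(2) vs.dependent_zero[of ?B] by auto
  qed
  have "affine_family \<alpha> \<beta> (eigen_polys 2) \<iota>"
    unfolding affine_family_def using finite_eigen_polys 1 2 3 4 by blast
  thus ?thesis by blast
qed

lemma affine_family_B:
  assumes F: "S.form_B x a b' z"
  shows "\<exists>\<alpha> \<beta> Fs \<iota>. affine_family \<alpha> \<beta> Fs \<iota>"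
proof -
  let ?B = "{x, a, b', z}"
  have B: "finite ?B" "vs.independent ?B" "vs.span ?B = ambient" and c4: "card ?B = 4"
    and r: "br a b' = z" "br z a = 0" "br z b' = 0" "br x a \<in> vs.span {a, b', z}" "br x b' \<in> vs.span {a, b', z}" "br x z \<in> vs.span {z}"
    and on: "a \<in> vs.span {br x a, br x b', z}" "b' \<in> vs.span {br x a, br x b', z}"
    using F unfolding S.form_B_def by blast+
  have n: "n = 4" using S.basis_card[OF B(2,3)] c4 by simp
  have sub: "{a, b', z} \<subseteq> ?B" "{z} \<subseteq> ?B" by blast+
  obtain k l m where klm: "a = vscale k (br x a) + vscale l (br x b') + vscale m z" using on(1) S.span3 by blast
  obtain k' l' m' where klm': "b' = vscale k' (br x a) + vscale l' (br x b') + vscale m' z" using on(2) S.span3 by blast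
  have "\<forall>\<^sub>F I in NR.almost_all. \<forall>c\<in>{k, l, m, k', l', m'}. c \<in> NR.loc I" by (rule eventually_locs) simp
  hence HE: "\<forall>\<^sub>F I in NR.almost_all. I \<in> NR.P \<and>
      heisenberg_ext (NR.loc I) (NR.locM I) vscale br (LamM I) (Lam I) (basis_lattice I ?B {a, b', z}) (basis_lattice I ?B {z}) x"
    using eventually_basis_lattice[OF B(1,2) sub(1) r(4)] eventually_basis_lattice[OF B(1,2) sub(1) r(5)]
      eventually_basis_lattice[OF B(1,2) sub(2) r(6)] eventually_adapted[OF B] NR.eventually_P
  proof eventually_elim
    case (elim I)
    interpret adapted_lattice "NR.loc I" "NR.locM I" vscale br "LamM I" "Lam I" ?B by (rule elim(5))
    have "\<exists>k\<in>NR.loc I. \<exists>l\<in>NR.loc I. \<exists>m\<in>NR.loc I. c = vscale k (br x a) + vscale l (br x b') + vscale m z" if c: "c \<in> {a, b'}" for c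
    proof (cases "c = a")
      case True thus ?thesis using klm elim(1) by blast
    next
      case False
      hence "c = b'" using c by blast
      thus ?thesis using klm' elim(1) by blast
    qed
    from heisenberg_ext_Lc[OF refl c4 r(1-3) elim(2-4) this] show ?case using elim(6) by blast
  qed
  define \<iota> where "\<iota> I = (of_nat (fixed_hyperplanes I (br x) (basis_lattice I ?B {z}) (basis_lattice I ?B {a, b', z}) 1) :: rat)" for I
  define \<alpha> :: "zeta_type => nat => rat poly" where "\<alpha> t i = (case t of
      Subalgebras => (if i = 2 then gb_poly 2 1 + Polynomial.monom 1 2 else if i = 3 then gb_poly 4 3 else 1)
    | Ideals => (if i = 2 then 0 else 1))" for t and i :: nat
  define \<beta> :: "zeta_type => nat => rat poly" where "\<beta> t i = (case t of Subalgebras => (if i = 1 \<or> i = 2 then Polynomial.monom 1 i else 0)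
    | Ideals => (if i = 2 then 1 else 0))" for t and i :: nat
  have 1: "\<forall>\<^sub>F I in NR.almost_all. \<exists>f\<in>eigen_polys 2. \<iota> I = poly f (of_nat (resq I))"
    using HE
  proof eventually_elim
    case (elim I)
    then interpret HE: heisenberg_ext "NR.loc I" "NR.locM I" vscale br "LamM I" "Lam I" "basis_lattice I ?B {a, b', z}" "basis_lattice I ?B {z}" x by blast
    show ?case unfolding \<iota>_def by (rule eigen_polys[OF HE.invs_eigen_counts[OF HE.quots(3) HE.idx_V HE.lin_right HE.T_facts]])
  qed
  have 2: "\<forall>\<^sub>F I in NR.almost_all. \<forall>t. \<forall>i\<le>n. of_nat (cnt t I i) =
      poly (\<alpha> t i) (of_nat (resq I)) + poly (\<beta> t i) (of_nat (resq I)) * \<iota> I"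
    using HE
  proof eventually_elim
    case (elim I)
    then interpret HE: heisenberg_ext "NR.loc I" "NR.locM I" vscale br "LamM I" "Lam I" "basis_lattice I ?B {a, b', z}" "basis_lattice I ?B {z}" x by blast
    have c: "cnt t I i = HE.num t i" for t i by (rule num_codim) (use elim in blast)
    have "of_nat (cnt t I i) = poly (\<alpha> t i) (of_nat (resq I)) + poly (\<beta> t i) (of_nat (resq I)) * \<iota> I" if "i \<le> 4" for t i
      by (cases t) (simp_all only: c \<alpha>_def \<beta>_def \<iota>_def zeta_type.case HE.of_nat_num[OF that])
    thus ?case using n by blast
  qed
  have 3: "\<exists>i\<le>n. \<beta> t i \<noteq> 0" for t
    using n by (cases t; intro exI[of _ 2]) (auto simp: \<beta>_def monom_eq_0_iff)
  have 4: "\<exists>f. \<forall>\<^sub>F I in NR.almost_all. \<iota> I = poly f (of_nat (resq I))" if nil: "nilpotent_lie OK L"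
  proof -
    obtain m where m: "\<forall>u\<in>ambient. \<forall>v\<in>ambient. (br u ^^ m) v = 0" using nilpotent_imp[OF nil] by blast
    have xa: "x \<in> ambient" using B(3) vs.span_superset[of ?B] by auto
    have "\<forall>\<^sub>F I in NR.almost_all. \<iota> I = poly (gb_poly 0 1) (of_nat (resq I))"
      using HE
    proof eventually_elim
      case (elim I)
      then interpret HE: heisenberg_ext "NR.loc I" "NR.locM I" vscale br "LamM I" "Lam I" "basis_lattice I ?B {a, b', z}" "basis_lattice I ?B {z}" x by blast
      have nilT: "(br x ^^ m) v \<in> basis_lattice I ?B {z}" if v: "v \<in> basis_lattice I ?B {a, b', z}" for v
      proof -
        have "v \<in> Lam I" using v HE.sub(1) by blast
        hence "(br x ^^ m) v = 0" using m xa by (simp add: Lam_def)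
        thus ?thesis using HE.lat_zero[OF HE.quotD(1)[OF HE.quots(3)]] by simp
      qed
      \<comment> \<open>By surjectivity of ad x modulo z the corank is 0, so the polynomial is
        \<open>gb_poly 0 1\<close>.\<close>
      have "idx (basis_lattice I ?B {a, b', z}) (HE.Img (br x) (basis_lattice I ?B {z}) (basis_lattice I ?B {a, b', z})) = resq I ^ 0"
        unfolding HE.onto using HE.idx_self[OF HE.quotD(2)[OF HE.quots(3)]] by simp
      from HE.invs_nilpotent[OF HE.quots(3) HE.idx_V HE.lin_right HE.T_facts nilT this]
      show ?case unfolding \<iota>_def by (simp only: poly_gb_poly)
    qed
    thus ?thesis by blast
  qed
  have "affine_family \<alpha> \<beta> (eigen_polys 2) \<iota>"
    unfolding affine_family_def using finite_eigen_polys 1 2 3 4 by blast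
  thus ?thesis by blast
qed

theorem affine_family: "\<exists>\<alpha> \<beta> Fs \<iota>. affine_family \<alpha> \<beta> Fs \<iota>"
  using S.classification[OF n4]
proof (elim disjE exE)
  assume "ambient = {0}"
  thus ?thesis by (intro exI) (rule affine_family_zero)
qed (erule affine_family_A affine_family_B affine_family_C)+

end

end

section \<open>Zeta functions and their coefficients\<close>

lemma poly_of_rat: "poly (map_poly of_rat c) (of_nat q) = (of_rat (poly c (of_nat q)) :: complex)"
  by (induction c) (simp_all add: map_poly_pCons of_rat_add of_rat_mult)

text \<open>Every nonzero complex number y is a value of q^(-s), at s = - Ln y / Ln q, so the
  polynomials agree at infinitely many points.\<close>

lemma complex_poly_eqI:
  fixes p r :: "complex poly"
  assumes "q \<ge> 2" "\<And>s. poly p (of_nat q powr (- s)) = poly r (of_nat q powr (- s))"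
  shows "p = r"
proof (rule ccontr)
  assume "p \<noteq> r"
  hence "finite {y. poly (p - r) y = 0}" by (intro poly_roots_finite) simp
  moreover have "UNIV - {0} \<subseteq> {y. poly (p - r) y = 0}"
  proof
    fix y :: complex assume y: "y \<in> UNIV - {0}"
    have "Ln (of_nat q) = of_real (ln (real q))" using assms(1) by (intro Ln_of_nat) simp
    moreover have "ln (real q) \<noteq> 0" using assms(1) by simp
    ultimately have "Ln (of_nat q) \<noteq> 0" by (metis of_real_eq_0_iff)
    hence "of_nat q powr (- (- Ln y / Ln (of_nat q))) = exp (Ln y)" using assms(1) by (simp add: powr_def)
    hence "of_nat q powr (- (- Ln y / Ln (of_nat q))) = y" using y by simp
    thus "y \<in> {y. poly (p - r) y = 0}" using assms(2)[of "- Ln y / Ln (of_nat q)"] by simp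
  qed
  ultimately have "finite (UNIV - {0 :: complex})" by (rule finite_subset[rotated])
  thus False by (simp add: infinite_UNIV_char_0)
qed

lemma finite_zeta_eq_iff:
  assumes q: "card (carrier F) = q" "q \<ge> 2" and n: "\<And>i. i > n ==> num_codim t F L i = 0"
  shows "(\<forall>s. finite_zeta t F L s = eval2 P (of_nat q) (of_nat q powr (- s))) \<longleftrightarrow>
    (\<forall>i. of_nat (num_codim t F L i) = poly (coeff P i) (of_nat q))"
proof -
  define N :: "complex poly" where "N = (\<Sum>i\<le>n. monom (of_nat (num_codim t F L i)) i)"
  define E :: "complex poly" where "E = map_poly (\<lambda>c. of_rat (poly c (of_nat q))) P"
  have cN: "coeff N i = of_nat (num_codim t F L i)" for i
    using n[of i] by (simp add: N_def coeff_sum not_le)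
  have cE: "coeff E i = of_rat (poly (coeff P i) (of_nat q))" for i by (simp add: E_def coeff_map_poly)
  have z: "finite_zeta t F L s = poly N (of_nat q powr (- s))" for s
  proof -
    have "finite_zeta t F L s = (\<Sum>i\<le>n. of_nat (num_codim t F L i) * of_nat q powr (- (of_nat i * s)))"
      unfolding finite_zeta_def q(1) by (rule suminf_finite) (auto simp: n not_le)
    also have "\<dots> = poly N (of_nat q powr (- s))"
      unfolding N_def poly_sum poly_monom using q(2)
      by (intro sum.cong) (auto simp: powr_def exp_of_nat_mult[symmetric] mult.assoc)
    finally show ?thesis .
  qed
  have e: "eval2 P (of_nat q) y = poly E y" for y unfolding eval2_def E_def poly_of_rat ..
  have "(\<forall>s. finite_zeta t F L s = eval2 P (of_nat q) (of_nat q powr (- s))) \<longleftrightarrow> N = E"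
    unfolding z e
  proof
    assume "\<forall>s. poly N (of_nat q powr (- s)) = poly E (of_nat q powr (- s))"
    thus "N = E" by (intro complex_poly_eqI[OF q(2)]) (rule spec)
  qed simp
  also have "\<dots> \<longleftrightarrow> (\<forall>i. of_nat (num_codim t F L i) = (of_rat (poly (coeff P i) (of_nat q)) :: complex))"
    by (simp add: poly_eq_iff cN cE)
  also have "\<dots> \<longleftrightarrow> (\<forall>i. of_nat (num_codim t F L i) = poly (coeff P i) (of_nat q))"
  proof -
    have "of_nat k = (of_rat r :: complex) \<longleftrightarrow> of_nat k = r" for k and r :: rat by (metis of_rat_of_nat_eq of_rat_eq_iff)
    thus ?thesis by (simp only:)
  qed
  finally show ?thesis .
qed

definition from_coeffs :: "nat => (nat => rat poly) => rat poly poly" where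
  "from_coeffs n c = (\<Sum>i\<le>n. monom (c i) i)"

lemma coeff_from_coeffs: "coeff (from_coeffs n c) i = (if i \<le> n then c i else 0)"
  by (simp add: from_coeffs_def coeff_sum)

context lie_number_ring
begin

lemma cnt_gt: "I \<in> NR.P ==> i > n ==> cnt t I i = 0"
  unfolding num_codim using lie_lattice.num_gt[OF lie_lattice idx_Lam] by blast

lemma zeta_given_by_iff:
  assumes I: "I \<in> NR.P"
  shows "zeta_given_by t OK L I Q \<longleftrightarrow> (\<forall>i. of_nat (cnt t I i) = poly (Polynomial.coeff Q i) (of_nat (resq I)))"
proof -
  interpret lie_lattice "NR.loc I" "NR.locM I" vscale br "LamM I" "Lam I" by (rule lie_lattice[OF I])
  show ?thesis unfolding zeta_given_by_def Let_def card_residue[OF I]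
    by (rule finite_zeta_eq_iff[OF card_residue[OF I] q_ge_2 cnt_gt[OF I]])
qed

lemma zeta_given_byI:
  assumes I: "I \<in> NR.P" and c: "\<And>i. i \<le> n ==> of_nat (cnt t I i) = poly (c i) (of_nat (resq I))"
  shows "zeta_given_by t OK L I (from_coeffs n c)"
  unfolding zeta_given_by_iff[OF I] coeff_from_coeffs using c cnt_gt[OF I] by (simp add: not_le)

lemma uniform_iff: "uniform t OK L \<longleftrightarrow> (\<exists>Q. \<forall>\<^sub>F I in NR.almost_all. zeta_given_by t OK L I Q)"
  unfolding uniform_def NR.eventually_almost_all NR.P_def ..

text \<open>The natural numbers among the roots are bounded, and only finitely many primes have norm
  below a bound. Thus two polynomials in q that agree at infinitely many primes are equal.\<close>

lemma eventually_nonroot: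
  assumes "p \<noteq> (0 :: rat poly)" shows "\<forall>\<^sub>F I in NR.almost_all. poly p (of_nat (resq I)) \<noteq> 0"
proof -
  have "finite ((of_nat :: nat => rat) -` {x. poly p x = 0})"
    using poly_roots_finite[OF assms] by (rule finite_vimageI) (rule inj_of_nat)
  then obtain N where N: "\<And>k. poly p (of_nat k) = 0 ==> k \<le> N"
    using finite_nat_set_iff_bounded_le[of "(of_nat :: nat => rat) -` {x. poly p x = 0}"] by auto
  have "{I \<in> NR.P. \<not> poly p (of_nat (resq I)) \<noteq> 0} \<subseteq> {I \<in> NR.P. resq I \<le> N}" using N by blast
  thus ?thesis unfolding NR.eventually_almost_all using NR.finite_small_norm finite_subset by blast
qed

lemma affine_family_uniform:
  assumes A: "affine_family \<alpha> \<beta> Fs \<iota>" and f: "\<forall>\<^sub>F I in NR.almost_all. \<iota> I = poly f (of_nat (resq I))"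
  shows "uniform t OK L"
proof -
  have "\<forall>\<^sub>F I in NR.almost_all. \<forall>t. \<forall>i\<le>n. of_nat (cnt t I i) =
      poly (\<alpha> t i) (of_nat (resq I)) + poly (\<beta> t i) (of_nat (resq I)) * \<iota> I"
    using A by (simp only: affine_family_def)
  from this f NR.eventually_P
  have "\<forall>\<^sub>F I in NR.almost_all. zeta_given_by t OK L I (from_coeffs n (\<lambda>i. \<alpha> t i + \<beta> t i * f))"
    by eventually_elim (rule zeta_given_byI, simp_all)
  thus ?thesis unfolding uniform_iff by blast
qed

text \<open>Almost all primes are served by one polynomial for each candidate in Fs. Each
  exceptional prime receives its own polynomial, whose coefficients are the counts
  themselves.\<close>

lemma affine_family_finitely_uniform:
  assumes A: "affine_family \<alpha> \<beta> Fs \<iota>"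
  shows "finitely_uniform t OK L"
proof -
  let ?g = "\<lambda>f. from_coeffs n (\<lambda>i. \<alpha> t i + \<beta> t i * f)"
  let ?h = "\<lambda>I. from_coeffs n (\<lambda>i. [:of_nat (cnt t I i):])"
  have "finite Fs" and A1: "\<forall>\<^sub>F I in NR.almost_all. \<exists>f\<in>Fs. \<iota> I = poly f (of_nat (resq I))"
    and A2: "\<forall>\<^sub>F I in NR.almost_all. \<forall>t. \<forall>i\<le>n. of_nat (cnt t I i) =
      poly (\<alpha> t i) (of_nat (resq I)) + poly (\<beta> t i) (of_nat (resq I)) * \<iota> I"
    using A by (simp_all only: affine_family_def)
  have "\<forall>\<^sub>F I in NR.almost_all. \<exists>Q\<in>?g ` Fs. zeta_given_by t OK L I Q"
    using A1 A2 NR.eventually_P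
  proof eventually_elim
    case (elim I)
    then obtain f where f: "f \<in> Fs" "\<iota> I = poly f (of_nat (resq I))" by blast
    have "zeta_given_by t OK L I (?g f)" by (rule zeta_given_byI[OF elim(3)]) (use elim(2) f(2) in simp)
    thus ?case using f(1) by blast
  qed
  hence fin: "finite {I \<in> NR.P. \<not> (\<exists>Q\<in>?g ` Fs. zeta_given_by t OK L I Q)}" (is "finite ?X")
    by (simp only: NR.eventually_almost_all)
  have "zeta_given_by t OK L I (?h I)" if "I \<in> NR.P" for I by (rule zeta_given_byI[OF that]) simp
  hence "\<forall>I\<in>nonzero_primes OK. \<exists>Q\<in>?g ` Fs \<union> ?h ` ?X. zeta_given_by t OK L I Q"
    unfolding NR.P_def[symmetric] by blast
  moreover have "finite (?g ` Fs \<union> ?h ` ?X)" using \<open>finite Fs\<close> fin by blast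
  ultimately show ?thesis unfolding finitely_uniform_def by blast
qed

text \<open>If the zeta function is uniform, then some coefficient with nonzero slope determines \<open>\<iota>\<close> as
  the solution of a linear equation over \<open>\<rat>(q)\<close>; among the finitely many candidates for \<open>\<iota>\<close>, one
  must solve that equation identically.\<close>

lemma uniform_imp_polynomial:
  assumes A: "affine_family \<alpha> \<beta> Fs \<iota>" and u: "uniform t OK L" and i: "i \<le> n" "\<beta> t i \<noteq> 0"
  shows "\<exists>f. \<forall>\<^sub>F I in NR.almost_all. \<iota> I = poly f (of_nat (resq I))"
proof -
  have "finite Fs" and A1: "\<forall>\<^sub>F I in NR.almost_all. \<exists>f\<in>Fs. \<iota> I = poly f (of_nat (resq I))"
    and A2: "\<forall>\<^sub>F I in NR.almost_all. \<forall>t. \<forall>i\<le>n. of_nat (cnt t I i) =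
      poly (\<alpha> t i) (of_nat (resq I)) + poly (\<beta> t i) (of_nat (resq I)) * \<iota> I"
    using A by (simp_all only: affine_family_def)
  obtain Q where Q: "\<forall>\<^sub>F I in NR.almost_all. zeta_given_by t OK L I Q" using u uniform_iff by blast
  have eq: "\<forall>\<^sub>F I in NR.almost_all. poly (\<alpha> t i) (of_nat (resq I)) + poly (\<beta> t i) (of_nat (resq I)) * \<iota> I
      = poly (Polynomial.coeff Q i) (of_nat (resq I))"
    using A2 Q NR.eventually_P
  proof eventually_elim
    case (elim I)
    have "of_nat (cnt t I i) = poly (Polynomial.coeff Q i) (of_nat (resq I))" using elim(2) zeta_given_by_iff[OF elim(3)] by blast
    thus ?case using elim(1) i(1) by simp
  qed
  define D where "D f = \<alpha> t i + \<beta> t i * f - Polynomial.coeff Q i" for f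
  show ?thesis
  proof (cases "\<exists>f\<in>Fs. D f = 0")
    case True
    then obtain f where f: "\<alpha> t i + \<beta> t i * f = Polynomial.coeff Q i" by (auto simp: D_def)
    have "\<forall>\<^sub>F I in NR.almost_all. \<iota> I = poly f (of_nat (resq I))"
      using eq eventually_nonroot[OF i(2)]
    proof eventually_elim
      case (elim I)
      thus ?case unfolding f[symmetric] by simp
    qed
    thus ?thesis by blast
  next
    case False
    have "\<forall>\<^sub>F I in NR.almost_all. \<forall>f\<in>Fs. poly (D f) (of_nat (resq I)) \<noteq> 0"
    proof (rule eventually_ball_finite[OF \<open>finite Fs\<close>], rule ballI)
      fix f assume "f \<in> Fs"
      hence "D f \<noteq> 0" using False by blast
      thus "\<forall>\<^sub>F I in NR.almost_all. poly (D f) (of_nat (resq I)) \<noteq> 0" by (rule eventually_nonroot)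
    qed
    hence "\<forall>\<^sub>F I in NR.almost_all. \<iota> I = poly 0 (of_nat (resq I))"
      using A1 eq
    proof eventually_elim
      case (elim I)
      then obtain f where f: "f \<in> Fs" "\<iota> I = poly f (of_nat (resq I))" by blast
      \<comment> \<open>This contradicts the case assumption at almost every prime, so the
        polynomial 0 stands for any polynomial.\<close>
      have "poly (D f) (of_nat (resq I)) = 0" using elim(3) f(2) by (simp add: D_def)
      thus ?case using elim(1) f(1) by blast
    qed
    thus ?thesis by blast
  qed
qed

end

theorem corollary1p10:
  fixes L :: "('k::field_char_0, 'a) lie_module"
  assumes "number_field TYPE('k)"
    and "lie_algebra ring_of_integers L"
    and "\<exists>n \<le> 4. free_of_rank ring_of_integers L n"
    and "solvable_lie ring_of_integers L"
  shows "(\<forall>t. finitely_uniform t ring_of_integers L) \<and>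
    (nilpotent_lie ring_of_integers L \<longrightarrow> (\<forall>t. uniform t ring_of_integers L)) \<and>
    (uniform Subalgebras ring_of_integers L \<longleftrightarrow> uniform Ideals ring_of_integers L) \<and>
    (finitely_uniform Subalgebras ring_of_integers L
       \<longleftrightarrow> finitely_uniform Ideals ring_of_integers L)"
proof -
  obtain n where n: "n \<le> 4" and free: "free_of_rank OK L n" using assms(3) by blast
  from free[unfolded free_of_rank_def] obtain b where b': "b \<in> {..<n} \<rightarrow> carrier L \<and>
    (\<forall>x \<in> carrier L. \<exists>!c. c \<in> {..<n} \<rightarrow>\<^sub>E carrier OK \<and> x = (\<Oplus>\<^bsub>L\<^esub> i \<in> {..<n}. c i \<odot>\<^bsub>L\<^esub> b i))"
    by (rule exE)
  note b = conjunct1[OF b'] conjunct2[OF b']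
  interpret lie_algebra OK L by fact
  interpret lie_number_ring L n b
  proof unfold_locales
    show "b \<in> {..<n} \<rightarrow> carrier L" by (rule b(1))
    show "\<exists>!c. c \<in> {..<n} \<rightarrow>\<^sub>E carrier OK \<and> x = (\<Oplus>\<^bsub>L\<^esub> i \<in> {..<n}. c i \<odot>\<^bsub>L\<^esub> b i)" if "x \<in> carrier L" for x
      by (rule bspec[OF b(2) that])
    show "number_field TYPE('k)" by fact
  qed
  obtain \<alpha> \<beta> Fs \<iota> where A: "affine_family \<alpha> \<beta> Fs \<iota>" using affine_family[OF assms(4) n] by blast
  have fin: "finitely_uniform t OK L" for t by (rule affine_family_finitely_uniform[OF A])
  have poly: "uniform t OK L" if "\<exists>f. \<forall>\<^sub>F I in NR.almost_all. \<iota> I = poly f (of_nat (resq I))" for t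
    using that affine_family_uniform[OF A] by blast
  have "(\<exists>f. \<forall>\<^sub>F I in NR.almost_all. \<iota> I = poly f (of_nat (resq I))) \<or> (\<forall>t. \<exists>i\<le>n. \<beta> t i \<noteq> 0)"
    using A by (simp only: affine_family_def)
  \<comment> \<open>By the dichotomy, uniformity of either type makes \<iota> a polynomial, and a
    polynomial \<iota> makes both types uniform.\<close>
  hence "uniform t OK L \<Longrightarrow> uniform t' OK L" for t t'
    using poly uniform_imp_polynomial[OF A] by blast
  moreover have "uniform t OK L" if "nilpotent_lie OK L" for t
    using that A by (intro poly) (simp only: affine_family_def)
  ultimately show ?thesis using fin by blast
qed

end
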